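(* The following optimization problem is NP-hard: given an input subdivision (a rectilinear layout) together with a global target layout for it, find a rectangular layout of the input that respects the global target layout, preserves all internal adjacencies, and preserves as many bottom-level external adjacencies as possible. Here orientations of adjacencies need not be preserved.
   Context: All rectangles and polygons are axis-aligned (rectilinear) in $\mathbb{R}^2$. A rectangle complex is a finite set of rectangles (its cells) with pairwise disjoint interiors such that any two of them are either completely disjoint or share part of an edge (no two meet in a single point only). Its boundary is the boundary of the union of its cells. It is simple if its boundary is a simple polygon (connected, no holes), and rectangular if its boundary is a rectangle. Two cells are adjacent if they share part of an edge. A (rectilinear) layout is a set of simple rectangle complexes with pairwise disjoint interiors such that the boundary of the union of all complexes is a rectangle (the root box) and no point belongs to more than three cells. It is a rectangular layout if all its complexes are rectangular. The global layout of a layout is the subdivision of the root box into (global, top-level) regions, one per complex, bounded by the boundaries of the complexes. The extended dual graph of a global layout is the plane graph with one vertex per region and four additional vertices for the four sides of the root box; two regions are joined if they share part of an edge, a region is joined to a side if it touches that side, and consecutive sides are joined. A global target layout for an input layout is a subdivision of a root box into rectangles, in bijection with the regions of the input, having the same extended dual graph (as a plane graph) as the input's global layout. A rectangular layout of an input layout is a rectangular layout whose complexes and cells are in bijection with those of the input (compatibly with membership of cells in complexes). It respects a global target layout if its global layout is that target layout. An internal adjacency is an adjacency of the input between two cells of the same complex; a bottom-level external adjacency is an adjacency of the input between cells of two different complexes. An adjacency is preserved if the two corresponding cells are adjacent in the output (with any orientation). *)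

theory Defs
  imports "HOL-Analysis.Analysis" "HOL-Computational_Algebra.Polynomial"
begin

section \<open>Turing machines, polynomial time and NP\<close>

datatype move = Move_Left | Stay | Move_Right

text \<open>
  Deterministic machines with finitely many two-way infinite tapes. States and tape symbols are
  initial segments of the natural numbers; state 0 is the start state and state 1 the halting state.
  Symbol 0 is the blank, symbols 1 and 2 stand for the bits \<open>False\<close> and \<open>True\<close>.
\<close>

record tm =
  tapes :: nat
  symbols :: nat
  states :: nat
  delta :: "nat \<Rightarrow> nat list \<Rightarrow> nat \<times> (nat \<times> move) list"

definition wf_tm :: "tm \<Rightarrow> bool" where
  "wf_tm M \<longleftrightarrow> 1 \<le> tapes M \<and> 3 \<le> symbols M \<and> 2 \<le> states M \<and>
     (\<forall>q < states M. \<forall>ss. length ss = tapes M \<and> (\<forall>s \<in> set ss. s < symbols M) \<longrightarrow>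
        (case delta M q ss of (q', as) \<Rightarrow>
           q' < states M \<and> length as = tapes M \<and> (\<forall>(s, m) \<in> set as. s < symbols M)))"

text \<open>A configuration: the state and, for every tape, its contents and the head position.\<close>

type_synonym config = "nat \<times> ((int \<Rightarrow> nat) \<times> int) list"

fun head_move :: "move \<Rightarrow> int \<Rightarrow> int" where
  "head_move Move_Left h = h - 1"
| "head_move Stay h = h"
| "head_move Move_Right h = h + 1"

fun perform :: "nat \<times> move \<Rightarrow> (int \<Rightarrow> nat) \<times> int \<Rightarrow> (int \<Rightarrow> nat) \<times> int" where
  "perform (s, m) (t, h) = (t(h := s), head_move m h)"

fun tm_step :: "tm \<Rightarrow> config \<Rightarrow> config" where
  "tm_step M (q, ts) =
     (if q = 1 then (q, ts)
      else case delta M q (map (\<lambda>(t, h). t h) ts) of (q', as) \<Rightarrow> (q', map2 perform as ts))"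

definition string_tape :: "bool list \<Rightarrow> int \<Rightarrow> nat" where
  "string_tape x i =
     (if 0 \<le> i \<and> i < int (length x) then (if x ! nat i then 2 else 1) else 0)"

definition tm_init :: "tm \<Rightarrow> bool list \<Rightarrow> config" where
  "tm_init M x = (0, (string_tape x, 0) # replicate (tapes M - 1) (\<lambda>_. 0, 0))"

text \<open>The output is read on the first tape, from cell 0 up to the first blank.\<close>

definition halts_with :: "config \<Rightarrow> bool list \<Rightarrow> bool" where
  "halts_with c y \<longleftrightarrow>
     fst c = 1 \<and> (\<forall>i \<in> {0..int (length y)}. fst (hd (snd c)) i = string_tape y i)"

definition polytime :: "(bool list \<Rightarrow> bool list) \<Rightarrow> bool" where
  "polytime f \<longleftrightarrow> (\<exists>M (p :: nat poly). wf_tm M \<and>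
     (\<forall>x. \<exists>n \<le> poly p (length x). halts_with ((tm_step M ^^ n) (tm_init M x)) (f x)))"

definition class_P :: "bool list set set" where
  "class_P = {A. polytime (\<lambda>x. [x \<in> A])}"

text \<open>Self-delimiting binary codes; numbers are written with the least significant bit first.\<close>

definition enc_list :: "('a \<Rightarrow> bool list) \<Rightarrow> 'a list \<Rightarrow> bool list" where
  "enc_list f xs = concat (map (\<lambda>x. True # f x) xs) @ [False]"

definition enc_bits :: "bool list \<Rightarrow> bool list" where
  "enc_bits = enc_list (\<lambda>b. [b])"

definition class_NP :: "bool list set set" where
  "class_NP = {A. \<exists>V \<in> class_P. \<exists>p :: nat poly.
     \<forall>x. x \<in> A \<longleftrightarrow> (\<exists>w. length w \<le> poly p (length x) \<and> enc_bits x @ w \<in> V)}"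

fun bits_of_nat :: "nat \<Rightarrow> bool list" where
  "bits_of_nat n = (if n = 0 then [] else odd n # bits_of_nat (n div 2))"

declare bits_of_nat.simps [simp del]

definition enc_nat :: "nat \<Rightarrow> bool list" where
  "enc_nat n = enc_bits (bits_of_nat n)"

definition enc_int :: "int \<Rightarrow> bool list" where
  "enc_int z = (z < 0) # enc_nat (nat \<bar>z\<bar>)"

definition enc_rat :: "rat \<Rightarrow> bool list" where
  "enc_rat r = (case quotient_of r of (a, b) \<Rightarrow> enc_int a @ enc_int b)"

section \<open>NP-hard problems\<close>

text \<open>
  A decision problem is given by an encoding of its instances, the set \<open>I\<close> of valid instances and
  the set \<open>Y\<close> of yes-instances. Reductions have to produce valid instances only.
\<close>

definition NP_hard :: "('i \<Rightarrow> bool list) \<Rightarrow> 'i set \<Rightarrow> 'i set \<Rightarrow> bool" where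
  "NP_hard enc I Y \<longleftrightarrow>
     (\<forall>A \<in> class_NP. \<exists>f. polytime f \<and> (\<forall>x. \<exists>i \<in> I. f x = enc i \<and> (x \<in> A \<longleftrightarrow> i \<in> Y)))"

text \<open>
  A maximisation problem is NP-hard if its threshold problem is: is there a feasible solution
  of value at least \<open>k\<close>?
\<close>

definition NP_hard_maximisation ::
    "('i \<Rightarrow> bool list) \<Rightarrow> 'i set \<Rightarrow> ('i \<Rightarrow> 's set) \<Rightarrow> ('i \<Rightarrow> 's \<Rightarrow> nat) \<Rightarrow> bool" where
  "NP_hard_maximisation enc I solutions val \<longleftrightarrow>
     NP_hard (\<lambda>(i, k). enc i @ enc_nat k) (I \<times> UNIV)
       {(i, k). \<exists>s \<in> solutions i. k \<le> val i s}"

section \<open>Layouts\<close>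

text \<open>Coordinates are rational in problem instances and real in solutions.\<close>

datatype 'a rect = Rect (x_lo: 'a) (y_lo: 'a) (x_hi: 'a) (y_hi: 'a)

definition proper_rect :: "real rect \<Rightarrow> bool" where
  "proper_rect R \<longleftrightarrow> x_lo R < x_hi R \<and> y_lo R < y_hi R"

definition area :: "real rect \<Rightarrow> (real \<times> real) set" where
  "area R = cbox (x_lo R, y_lo R) (x_hi R, y_hi R)"

definition share_edge :: "(real \<times> real) set \<Rightarrow> (real \<times> real) set \<Rightarrow> bool" where
  "share_edge S T \<longleftrightarrow> (\<exists>p q. p \<noteq> q \<and> closed_segment p q \<subseteq> frontier S \<inter> frontier T)"

definition adjacent :: "real rect \<Rightarrow> real rect \<Rightarrow> bool" where
  "adjacent R S \<longleftrightarrow> share_edge (area R) (area S)"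

definition region :: "real rect list \<Rightarrow> (real \<times> real) set" where
  "region C = (\<Union>R \<in> set C. area R)"

definition rectangle_complex :: "real rect list \<Rightarrow> bool" where
  "rectangle_complex C \<longleftrightarrow> (\<forall>R \<in> set C. proper_rect R) \<and>
     (\<forall>j < length C. \<forall>k < length C. j \<noteq> k \<longrightarrow>
        interior (area (C ! j)) \<inter> interior (area (C ! k)) = {} \<and>
        (area (C ! j) \<inter> area (C ! k) = {} \<or> adjacent (C ! j) (C ! k)))"

text \<open>
  The boundary of a finite union of rectangles is a finite union of line segments, so it is a
  simple polygon as soon as it is a simple closed curve.
\<close>

definition simple_complex :: "real rect list \<Rightarrow> bool" where
  "simple_complex C \<longleftrightarrow> rectangle_complex C \<and>
     (\<exists>g. simple_path g \<and> pathfinish g = pathstart g \<and> path_image g = frontier (region C))"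

definition rectangular_complex :: "real rect list \<Rightarrow> bool" where
  "rectangular_complex C \<longleftrightarrow> rectangle_complex C \<and>
     (\<exists>R. proper_rect R \<and> frontier (region C) = frontier (area R))"

definition root_box :: "real rect \<Rightarrow> (real \<times> real) set list \<Rightarrow> bool" where
  "root_box B rs \<longleftrightarrow> proper_rect B \<and> frontier (\<Union>(set rs)) = frontier (area B)"

text \<open>
  A layout is a list of complexes, a complex is a list of cells: the cell with name \<open>(i, j)\<close> is
  \<open>L ! i ! j\<close>.
\<close>

definition layout :: "real rect list list \<Rightarrow> bool" where
  "layout L \<longleftrightarrow> (\<forall>C \<in> set L. simple_complex C) \<and>
     (\<forall>i < length L. \<forall>k < length L. i \<noteq> k \<longrightarrow>
        interior (region (L ! i)) \<inter> interior (region (L ! k)) = {}) \<and>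
     (\<exists>B. root_box B (map region L)) \<and>
     (\<forall>p. card {(i, j). i < length L \<and> j < length (L ! i) \<and> p \<in> area (L ! i ! j)} \<le> 3)"

definition rectangular_layout :: "real rect list list \<Rightarrow> bool" where
  "rectangular_layout L \<longleftrightarrow> layout L \<and> (\<forall>C \<in> set L. rectangular_complex C)"

section \<open>The extended dual graph\<close>

datatype side = North | West | South | East

datatype node = Region nat | Side side

fun side_segment :: "real rect \<Rightarrow> side \<Rightarrow> (real \<times> real) set" where
  "side_segment B North = {x_lo B..x_hi B} \<times> {y_hi B}"
| "side_segment B West = {x_lo B} \<times> {y_lo B..y_hi B}"
| "side_segment B South = {x_lo B..x_hi B} \<times> {y_lo B}"
| "side_segment B East = {x_hi B} \<times> {y_lo B..y_hi B}"

fun consecutive :: "side \<Rightarrow> side \<Rightarrow> bool" where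
  "consecutive North s = (s = West \<or> s = East)"
| "consecutive South s = (s = West \<or> s = East)"
| "consecutive West s = (s = North \<or> s = South)"
| "consecutive East s = (s = North \<or> s = South)"

fun dual_edge :: "(real \<times> real) set list \<Rightarrow> real rect \<Rightarrow> node \<Rightarrow> node \<Rightarrow> bool" where
  "dual_edge rs B (Region i) (Region k) =
     (i < length rs \<and> k < length rs \<and> i \<noteq> k \<and> share_edge (rs ! i) (rs ! k))"
| "dual_edge rs B (Region i) (Side s) = (i < length rs \<and> rs ! i \<inter> side_segment B s \<noteq> {})"
| "dual_edge rs B (Side s) (Region i) = (i < length rs \<and> rs ! i \<inter> side_segment B s \<noteq> {})"
| "dual_edge rs B (Side s) (Side t) = consecutive s t"

text \<open>
  The plane embedding is recorded by the rotation at each vertex, i.e. by the counterclockwise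
  order of its neighbours. To read it off, every vertex is given a part of the plane: the sides
  of the root box get four unbounded parts that surround the root box like a pinwheel, each
  touching its own side of the box and the parts of the two consecutive sides.
\<close>

fun side_part :: "real rect \<Rightarrow> side \<Rightarrow> (real \<times> real) set" where
  "side_part B North = {..x_hi B} \<times> {y_hi B..}"
| "side_part B West = {..x_lo B} \<times> {..y_hi B}"
| "side_part B South = {x_lo B..} \<times> {..y_lo B}"
| "side_part B East = {x_hi B..} \<times> {y_lo B..}"

fun node_part :: "(real \<times> real) set list \<Rightarrow> real rect \<Rightarrow> node \<Rightarrow> (real \<times> real) set" where
  "node_part rs B (Region i) = (if i < length rs then rs ! i else {})"
| "node_part rs B (Side s) = side_part B s"

text \<open>The set \<open>S\<close> covers the \<open>q\<close>-th quadrant (counterclockwise, modulo 4) near \<open>p\<close>.\<close>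

definition covers_quadrant :: "(real \<times> real) set \<Rightarrow> real \<times> real \<Rightarrow> nat \<Rightarrow> bool" where
  "covers_quadrant S p q \<longleftrightarrow>
     (\<forall>\<^sub>F e in at_right 0. p + e *\<^sub>R ([(1, 1), (-1, 1), (-1, -1), (1, -1)] ! (q mod 4)) \<in> S)"

text \<open>
  Around the vertex \<open>u\<close>, the neighbour \<open>w\<close> follows the neighbour \<open>v\<close> counterclockwise: the parts of
  \<open>u\<close>, \<open>v\<close> and \<open>w\<close> meet in some point \<open>p\<close> (dual to a bounded face of the graph) and, in a
  counterclockwise turn about \<open>p\<close>, one passes from \<open>w\<close> to \<open>u\<close> and then from \<open>u\<close> to \<open>v\<close>. The outer
  face consists of the four sides and is the same for all subdivisions.
\<close>

definition dual_rotation ::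
    "(real \<times> real) set list \<Rightarrow> real rect \<Rightarrow> node \<Rightarrow> node \<Rightarrow> node \<Rightarrow> bool" where
  "dual_rotation rs B u v w \<longleftrightarrow> distinct [u, v, w] \<and>
     (\<exists>p a l. 1 \<le> l \<and> covers_quadrant (node_part rs B w) p a \<and>
        (\<forall>j \<in> {1..l}. covers_quadrant (node_part rs B u) p (a + j)) \<and>
        covers_quadrant (node_part rs B v) p (a + l + 1))"

text \<open>The extended dual graph as a plane graph: vertices, edges, rotation system.\<close>

definition extended_dual ::
    "(real \<times> real) set list \<Rightarrow> real rect \<Rightarrow>
       node set \<times> (node \<Rightarrow> node \<Rightarrow> bool) \<times> (node \<Rightarrow> node \<Rightarrow> node \<Rightarrow> bool)" where
  "extended_dual rs B =
     (Region ` {..<length rs} \<union> range Side, dual_edge rs B, dual_rotation rs B)"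

text \<open>The rectangle \<open>T ! i\<close> of a target layout corresponds to the complex \<open>L ! i\<close>.\<close>

definition global_target :: "real rect list list \<Rightarrow> real rect list \<Rightarrow> bool" where
  "global_target L T \<longleftrightarrow> length T = length L \<and> (\<forall>R \<in> set T. proper_rect R) \<and>
     (\<forall>i < length T. \<forall>k < length T. i \<noteq> k \<longrightarrow>
        interior (area (T ! i)) \<inter> interior (area (T ! k)) = {}) \<and>
     (\<exists>B B'. root_box B (map region L) \<and> root_box B' (map area T) \<and>
        extended_dual (map region L) B = extended_dual (map area T) B')"

section \<open>The optimisation problem\<close>

definition rectangular_layout_of :: "real rect list list \<Rightarrow> real rect list list \<Rightarrow> bool" where
  "rectangular_layout_of L M \<longleftrightarrow> rectangular_layout M \<and> map length M = map length L"

definition respects_target :: "real rect list list \<Rightarrow> real rect list \<Rightarrow> bool" where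
  "respects_target M T \<longleftrightarrow> map region M = map area T"

definition preserves_internal :: "real rect list list \<Rightarrow> real rect list list \<Rightarrow> bool" where
  "preserves_internal L M \<longleftrightarrow>
     (\<forall>i < length L. \<forall>j < length (L ! i). \<forall>k < length (L ! i).
        j \<noteq> k \<and> adjacent (L ! i ! j) (L ! i ! k) \<longrightarrow> adjacent (M ! i ! j) (M ! i ! k))"

text \<open>Each adjacency is counted once: the two complexes are taken in the order of their indices.\<close>

definition preserved_external :: "real rect list list \<Rightarrow> real rect list list \<Rightarrow> nat" where
  "preserved_external L M = card {((i, j), (i', j')).
     i < i' \<and> i' < length L \<and> j < length (L ! i) \<and> j' < length (L ! i') \<and>
     adjacent (L ! i ! j) (L ! i' ! j') \<and> adjacent (M ! i ! j) (M ! i' ! j')}"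

type_synonym inst = "rat rect list list \<times> rat rect list"

definition real_rect :: "rat rect \<Rightarrow> real rect" where
  "real_rect = map_rect real_of_rat"

definition real_layout :: "rat rect list list \<Rightarrow> real rect list list" where
  "real_layout = map (map real_rect)"

definition instances :: "inst set" where
  "instances = {(L, T). layout (real_layout L) \<and> global_target (real_layout L) (map real_rect T)}"

fun solutions :: "inst \<Rightarrow> real rect list list set" where
  "solutions (L, T) = {M. rectangular_layout_of (real_layout L) M \<and>
     respects_target M (map real_rect T) \<and> preserves_internal (real_layout L) M}"

fun objective :: "inst \<Rightarrow> real rect list list \<Rightarrow> nat" where
  "objective (L, T) M = preserved_external (real_layout L) M"

fun enc_rect :: "rat rect \<Rightarrow> bool list" where
  "enc_rect (Rect a b c d) = enc_rat a @ enc_rat b @ enc_rat c @ enc_rat d"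

fun enc_inst :: "inst \<Rightarrow> bool list" where
  "enc_inst (L, T) = enc_list (enc_list enc_rect) L @ enc_list enc_rect T"

section \<open>The encodings are injective\<close>

definition prefix_code :: "('a \<Rightarrow> bool list) \<Rightarrow> bool" where
  "prefix_code f \<longleftrightarrow> (\<forall>x y u v. f x @ u = f y @ v \<longrightarrow> x = y \<and> u = v)"

lemma prefix_codeD: "prefix_code f \<Longrightarrow> f x @ u = f y @ v \<Longrightarrow> x = y \<and> u = v"
  unfolding prefix_code_def by blast

lemma prefix_code_list:
  assumes "prefix_code f"
  shows "prefix_code (enc_list f)"
proof -
  have "enc_list f xs @ u = enc_list f ys @ v \<Longrightarrow> xs = ys \<and> u = v" for xs ys u v
  proof (induction xs arbitrary: ys)
    case Nil
    then show ?case by (cases ys) (auto simp: enc_list_def)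
  next
    case (Cons x xs)
    show ?case
    proof (cases ys)
      case Nil
      with Cons.prems show ?thesis by (auto simp: enc_list_def)
    next
      case (Cons y zs)
      with Cons.prems have "f x @ (enc_list f xs @ u) = f y @ (enc_list f zs @ v)"
        by (simp add: enc_list_def)
      from prefix_codeD[OF assms this] Cons.IH[of zs] Cons show ?thesis by auto
    qed
  qed
  then show ?thesis unfolding prefix_code_def by blast
qed

lemma prefix_code_bits: "prefix_code enc_bits"
  unfolding enc_bits_def by (rule prefix_code_list) (simp add: prefix_code_def)

lemma bits_of_nat_inj: "bits_of_nat m = bits_of_nat n \<Longrightarrow> m = n"
proof (induction m arbitrary: n rule: less_induct)
  case (less m)
  show ?case
  proof (cases "m = 0 \<or> n = 0")
    case True
    with less.prems show ?thesis
      by (auto simp: bits_of_nat.simps[of m] bits_of_nat.simps[of n] split: if_splits)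
  next
    case False
    with less.prems have "odd m = odd n" "bits_of_nat (m div 2) = bits_of_nat (n div 2)"
      by (auto simp: bits_of_nat.simps[of m] bits_of_nat.simps[of n])
    with less.IH[of "m div 2" "n div 2"] False have "m div 2 = n div 2" "odd m = odd n" by auto
    then show ?thesis by presburger
  qed
qed

lemma prefix_code_nat: "prefix_code enc_nat"
  using prefix_codeD[OF prefix_code_bits] bits_of_nat_inj
  unfolding prefix_code_def enc_nat_def by blast

lemma prefix_code_int: "prefix_code enc_int"
  unfolding prefix_code_def enc_int_def
  by (auto dest!: prefix_codeD[OF prefix_code_nat])

lemma prefix_code_rat: "prefix_code enc_rat"
  unfolding prefix_code_def enc_rat_def
  by (auto split: prod.splits dest!: prefix_codeD[OF prefix_code_int] intro: quotient_of_inject)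

lemma prefix_code_rect: "prefix_code enc_rect"
  unfolding prefix_code_def
proof (intro allI impI)
  fix R S :: "rat rect" and u v
  assume "enc_rect R @ u = enc_rect S @ v"
  then show "R = S \<and> u = v"
    by (cases R; cases S) (auto dest!: prefix_codeD[OF prefix_code_rat])
qed

lemma prefix_code_inst: "prefix_code enc_inst"
  unfolding prefix_code_def
  by (auto dest!: prefix_codeD[OF prefix_code_list[OF prefix_code_list[OF prefix_code_rect]]]
      prefix_codeD[OF prefix_code_list[OF prefix_code_rect]])

lemma inj_enc_inst_threshold: "inj (\<lambda>(i, k). enc_inst i @ enc_nat k)"
proof (rule injI)
  fix x y :: "inst \<times> nat"
  assume *: "(case x of (i, k) \<Rightarrow> enc_inst i @ enc_nat k) = (case y of (i, k) \<Rightarrow> enc_inst i @ enc_nat k)"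
  obtain i k i' k' where [simp]: "x = (i, k)" "y = (i', k')" by (cases x; cases y) auto
  from * have "i = i' \<and> enc_nat k = enc_nat k'"
    using prefix_codeD[OF prefix_code_inst] by simp
  then show "x = y" using prefix_codeD[OF prefix_code_nat, of k "[]" k' "[]"] by simp
qed

end

theory Submission
  imports Defs
begin

text \<open>
  A language in NP is reduced to the existence of a tiling, by the tableau of a verifying machine,
  and tilings are reduced to triple systems: every row \<open>i\<close> serves the slot \<open>al i\<close> if it is selected and
  the slots \<open>c1 i\<close> and \<open>c2 i\<close> otherwise, and all slots have to be served.

  The threshold is the number of all external adjacencies, so a solution has to keep every adjacency
  of the input. The input is a grid of cells with slightly broken lines: a row of the triple system
  is a strip of three levels of cells, a slot consists of two columns, and the complexes are blocks
  of one slot and some levels of a row. In the target, the middle line of each slot is moved to the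
  left in the bottom row, but not in the top row. Hence in every slot some crossing inside a complex
  has to be straightened against its sign, which the preserved adjacencies permit only at the
  crossings of \<open>al i\<close>, \<open>c1 i\<close> and \<open>c2 i\<close>. They also bound the heights of the lines of row \<open>i\<close> along
  the row, so that the crossing at \<open>al i\<close> excludes the other two.

  All coordinates are powers of two, so that their binary codes are unary codes of the exponents and
  the instance can be emitted by nested loops.
\<close>

section \<open>Rectangles\<close>

text \<open>A point lies in at most three cells, so two lines cannot cross straight: at each
  crossing one of them is broken, and its sign tells which diagonal pair of cells is in contact.
  Preserved adjacencies fix the signs but not which line is broken, and this choice encodes a
  solution. At a negative crossing the vertical line cannot move right on the way up, nor the
  horizontal one rise on the way right. So a middle line can move right only at a positive crossing
  where the horizontal line does not rise. But horizontal lines have to rise too: the lower line of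
  a row is low before slot \<open>c1\<close> and high at the right rim, so it rises at
  \<open>c1\<close> or at \<open>al\<close>; a rise at \<open>c1\<close> also lifts the upper line,
  which then has to rise at \<open>c2\<close>. Hence the two inner lines of a row, and the choice
  between one slot and two others.

  The target keeps the dual graph because a middle line in the bottom row ends on the side of a
  complex as wide as the slot. The order of abscissas in the bottom and top rows does change, so the
  dual graphs are compared for each triple of regions and not by a single change of
  coordinates.\<close>

lemma mem_area: "p \<in> area R \<longleftrightarrow>
    x_lo R \<le> fst p \<and> fst p \<le> x_hi R \<and> y_lo R \<le> snd p \<and> snd p \<le> y_hi R"
  by (cases p) (auto simp: area_def cbox_Pair_eq)

lemma area_Times: "area R = {x_lo R..x_hi R} \<times> {y_lo R..y_hi R}"
  by (auto simp: mem_area)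

lemma mem_interior_area: "p \<in> interior (area R) \<longleftrightarrow>
    x_lo R < fst p \<and> fst p < x_hi R \<and> y_lo R < snd p \<and> snd p < y_hi R"
  unfolding area_def interior_cbox by (cases p) (auto simp: mem_box Basis_prod_def)

lemma closed_area [simp]: "closed (area R)"
  by (simp add: area_def closed_cbox)

lemma compact_area [simp]: "compact (area R)"
  by (simp add: area_def compact_cbox)

lemma convex_area [simp]: "convex (area R)"
  by (simp add: area_def)

lemma closure_interior_area:
  assumes "proper_rect R"
  shows "closure (interior (area R)) = area R"
proof -
  have "((x_lo R + x_hi R) / 2, (y_lo R + y_hi R) / 2) \<in> interior (area R)"
    using assms by (auto simp: mem_interior_area proper_rect_def)
  then have "box (x_lo R, y_lo R) (x_hi R, y_hi R) \<noteq> {}"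
    by (auto simp: area_def interior_cbox)
  then show ?thesis by (simp add: area_def interior_cbox closure_box)
qed

definition apart :: "real rect \<Rightarrow> real rect \<Rightarrow> bool" where
  "apart R S \<longleftrightarrow> interior (area R) \<inter> interior (area S) = {}"

lemma apart_sym: "apart R S \<longleftrightarrow> apart S R"
  by (auto simp: apart_def)

lemma apart_iff:
  assumes "proper_rect R" "proper_rect S"
  shows "apart R S \<longleftrightarrow>
    x_hi R \<le> x_lo S \<or> x_hi S \<le> x_lo R \<or> y_hi R \<le> y_lo S \<or> y_hi S \<le> y_lo R"
proof
  assume *: "apart R S"
  show "x_hi R \<le> x_lo S \<or> x_hi S \<le> x_lo R \<or> y_hi R \<le> y_lo S \<or> y_hi S \<le> y_lo R"
  proof (rule ccontr)
    assume **: "\<not> ?thesis"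
    define a b where "a = max (x_lo R) (x_lo S)" and "b = min (x_hi R) (x_hi S)"
    define c d where "c = max (y_lo R) (y_lo S)" and "d = min (y_hi R) (y_hi S)"
    have "a < b" "c < d" using ** assms by (auto simp: a_def b_def c_def d_def proper_rect_def)
    then have "a < (a + b) / 2" "(a + b) / 2 < b" "c < (c + d) / 2" "(c + d) / 2 < d" by auto
    then have "((a + b) / 2, (c + d) / 2) \<in> interior (area R) \<inter> interior (area S)"
      unfolding Int_iff mem_interior_area fst_conv snd_conv
      unfolding a_def b_def c_def d_def by linarith
    then show False using * by (auto simp: apart_def)
  qed
next
  assume "x_hi R \<le> x_lo S \<or> x_hi S \<le> x_lo R \<or> y_hi R \<le> y_lo S \<or> y_hi S \<le> y_lo R"
  then show "apart R S" by (auto simp: apart_def mem_interior_area)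
qed

lemma adjacent_sym: "adjacent R S \<longleftrightarrow> adjacent S R"
  by (simp add: adjacent_def share_edge_def Int_commute)

lemma adjacent_common:
  assumes "adjacent R S"
  obtains p q where "p \<noteq> q" "p \<in> area R" "p \<in> area S" "q \<in> area R" "q \<in> area S"
proof -
  from assms obtain p q where "p \<noteq> q" "closed_segment p q \<subseteq> frontier (area R) \<inter> frontier (area S)"
    by (auto simp: adjacent_def share_edge_def)
  moreover from this have "closed_segment p q \<subseteq> area R \<inter> area S"
    using frontier_subset_closed[of "area R"] frontier_subset_closed[of "area S"] by auto
  ultimately show ?thesis using that[of p q] ends_in_segment[of p q] by blast
qed

text \<open>Rectangles with disjoint interiors meet only in their frontiers, and their intersection
  is convex, so two common points already span a common segment. This replaces frontiers by
  membership in the areas.\<close>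

lemma adjacent_iff:
  assumes "proper_rect R" "proper_rect S" "apart R S"
  shows "adjacent R S \<longleftrightarrow> (\<exists>p q. p \<noteq> q \<and> {p, q} \<subseteq> area R \<inter> area S)"
proof
  assume "adjacent R S"
  then obtain p q where "p \<noteq> q" "p \<in> area R" "p \<in> area S" "q \<in> area R" "q \<in> area S"
    by (rule adjacent_common)
  then show "\<exists>p q. p \<noteq> q \<and> {p, q} \<subseteq> area R \<inter> area S" by blast
next
  assume "\<exists>p q. p \<noteq> q \<and> {p, q} \<subseteq> area R \<inter> area S"
  then obtain p q where pq: "p \<noteq> q" "p \<in> area R \<inter> area S" "q \<in> area R \<inter> area S"
    by blast
  have "convex (area R \<inter> area S)" by (simp add: convex_Int)
  then have sub: "closed_segment p q \<subseteq> area R \<inter> area S"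
    using pq by (intro closed_segment_subset) auto
  \<comment> \<open>An open set that misses the interior of \<open>area Q\<close> also misses its
    closure, which is \<open>area Q\<close> for a proper rectangle.\<close>
  have *: "area P \<inter> area Q \<inter> interior (area P) = {}"
    if "proper_rect P" "proper_rect Q" "apart P Q" for P Q
  proof -
    have "interior (area P) \<inter> closure (interior (area Q)) = {}"
      using that(3) open_Int_closure_eq_empty[OF open_interior] by (auto simp: apart_def)
    then show ?thesis using closure_interior_area[OF that(2)] by auto
  qed
  have "area R \<inter> area S \<subseteq> frontier (area R) \<inter> frontier (area S)"
    using *[OF assms] *[OF assms(2,1)] assms(3) by (auto simp: frontier_def apart_sym)
  with sub have "closed_segment p q \<subseteq> frontier (area R) \<inter> frontier (area S)"
    by (rule subset_trans)
  then show "adjacent R S" unfolding adjacent_def share_edge_def using pq(1) by metis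
qed

lemma adjacentI_vertical:
  assumes "proper_rect R" "proper_rect S" "x_hi R = x_lo S" "y_lo R < y_hi S" "y_lo S < y_hi R"
  shows "adjacent R S"
proof -
  have "(x_hi R, max (y_lo R) (y_lo S)) \<noteq> (x_hi R, min (y_hi R) (y_hi S))"
    using assms by (auto simp: proper_rect_def min_def max_def)
  moreover have "{(x_hi R, max (y_lo R) (y_lo S)), (x_hi R, min (y_hi R) (y_hi S))} \<subseteq> area R \<inter> area S"
    using assms by (auto simp: proper_rect_def mem_area)
  moreover have "apart R S" using assms by (simp add: apart_iff)
  ultimately show ?thesis using adjacent_iff[OF assms(1,2)] by blast
qed

lemma adjacentI_horizontal:
  assumes "proper_rect R" "proper_rect S" "y_hi R = y_lo S" "x_lo R < x_hi S" "x_lo S < x_hi R"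
  shows "adjacent R S"
proof -
  have "(max (x_lo R) (x_lo S), y_hi R) \<noteq> (min (x_hi R) (x_hi S), y_hi R)"
    using assms by (auto simp: proper_rect_def min_def max_def)
  moreover have "{(max (x_lo R) (x_lo S), y_hi R), (min (x_hi R) (x_hi S), y_hi R)} \<subseteq> area R \<inter> area S"
    using assms by (auto simp: proper_rect_def mem_area)
  moreover have "apart R S" using assms by (simp add: apart_iff)
  ultimately show ?thesis using adjacent_iff[OF assms(1,2)] by blast
qed

lemma adjacent_imp_le:
  assumes "adjacent R S"
  shows "x_lo R \<le> x_hi S" "x_lo S \<le> x_hi R" "y_lo R \<le> y_hi S" "y_lo S \<le> y_hi R"
  using adjacent_common[OF assms] by (auto simp: mem_area intro: order_trans)

text \<open>The line at \<open>X\<close> separates the rectangles, so two common points both lie on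
  it and differ in their ordinates. In this way a contact across a known line becomes a strict
  inequality.\<close>

lemma adjacent_left_of:
  assumes "adjacent R S" "x_hi R \<le> X" "X \<le> x_lo S"
  shows "x_hi R = X" "x_lo S = X" "y_lo R < y_hi S" "y_lo S < y_hi R"
proof -
  obtain p q where "p \<noteq> q" and pq: "p \<in> area R" "p \<in> area S" "q \<in> area R" "q \<in> area S"
    using adjacent_common[OF assms(1)] .
  then have "fst p = X" "fst q = X" "x_hi R = X \<and> x_lo S = X" using assms by (auto simp: mem_area)
  then have "snd p \<noteq> snd q" using \<open>p \<noteq> q\<close> by (auto simp: prod_eq_iff)
  then show "x_hi R = X" "x_lo S = X" "y_lo R < y_hi S" "y_lo S < y_hi R"
    using pq \<open>x_hi R = X \<and> _\<close> by (auto simp: mem_area)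
qed

lemma adjacent_below:
  assumes "adjacent R S" "y_hi R \<le> Y" "Y \<le> y_lo S"
  shows "y_hi R = Y" "y_lo S = Y" "x_lo R < x_hi S" "x_lo S < x_hi R"
proof -
  obtain p q where "p \<noteq> q" and pq: "p \<in> area R" "p \<in> area S" "q \<in> area R" "q \<in> area S"
    using adjacent_common[OF assms(1)] .
  then have "snd p = Y" "snd q = Y" "y_hi R = Y \<and> y_lo S = Y" using assms by (auto simp: mem_area)
  then have "fst p \<noteq> fst q" using \<open>p \<noteq> q\<close> by (auto simp: prod_eq_iff)
  then show "y_hi R = Y" "y_lo S = Y" "x_lo R < x_hi S" "x_lo S < x_hi R"
    using pq \<open>y_hi R = Y \<and> _\<close> by (auto simp: mem_area)
qed

lemma interior_frontier_area: "interior (frontier (area R)) = {}"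
proof -
  have "interior (frontier (area R)) \<subseteq> interior (area R)"
    by (intro interior_mono frontier_subset_closed closed_area)
  moreover have "interior (frontier (area R)) \<inter> interior (area R) = {}"
    using interior_subset[of "frontier (area R)"] by (auto simp: frontier_def)
  ultimately show ?thesis by auto
qed

text \<open>Frontiers of rectangles are closed with empty interior, so finitely many of them cannot
  cover a nonempty open set.\<close>

lemma open_meets_interior:
  assumes "finite A" "open U" "U \<noteq> {}" "U \<subseteq> (\<Union>R\<in>A. area R)"
  shows "\<exists>R\<in>A. interior (area R) \<inter> U \<noteq> {}"
proof (rule ccontr)
  assume *: "\<not> ?thesis"
  have emp: "closed (\<Union>R\<in>B. frontier (area R)) \<and> interior (\<Union>R\<in>B. frontier (area R)) = {}"
    if "finite B" for B
    using that
  proof induction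
    case (insert R B)
    have "interior (frontier (area R)) = {}"
      by (simp add: interior_frontier_area)
    then show ?case using insert interior_closed_Un_empty_interior[of "\<Union>R\<in>B. frontier (area R)" "frontier (area R)"]
      by (auto simp: Un_commute)
  qed simp
  have "U \<subseteq> (\<Union>R\<in>A. frontier (area R))"
    using * assms(4) by (force simp: frontier_def closure_closed)
  then have "U \<subseteq> interior (\<Union>R\<in>A. frontier (area R))" using assms(2) by (simp add: interior_maximal)
  then show False using emp[OF assms(1)] assms(3) by auto
qed

text \<open>The rectangular path lives in the complex plane; the linear injection \<open>h\<close>
  transports it to pairs.\<close>

lemma simple_closed_frontier:
  assumes "proper_rect R"
  shows "\<exists>g. simple_path g \<and> pathfinish g = pathstart g \<and> path_image g = frontier (area R)"
proof -
  define h where "h = (\<lambda>z. (Re z, Im z))"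
  have lin: "linear h" by (rule linearI) (auto simp: h_def)
  have inj: "inj h" by (auto simp: h_def inj_on_def complex_eq_iff)
  define a b where "a = Complex (x_lo R) (y_lo R)" and "b = Complex (x_hi R) (y_hi R)"
  have eq: "p \<in> h ` A \<longleftrightarrow> Complex (fst p) (snd p) \<in> A" for p A
    by (auto simp: h_def image_iff intro!: bexI[of _ "Complex (fst p) (snd p)"])
  have img: "h ` cbox a b = area R"
    unfolding set_eq_iff eq by (auto simp: mem_area in_cbox_complex_iff a_def b_def)
  have img2: "h ` box a b = interior (area R)"
    unfolding set_eq_iff eq by (auto simp: mem_interior_area in_box_complex_iff a_def b_def)
  have "path_image (h \<circ> rectpath a b) = h ` (cbox a b - box a b)"
    using assms by (simp add: path_image_compose path_image_rectpath_cbox_minus_box a_def b_def proper_rect_def)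
  also have "\<dots> = frontier (area R)"
    using inj by (simp add: image_set_diff img img2 frontier_def closure_closed)
  finally have "path_image (h \<circ> rectpath a b) = frontier (area R)" .
  moreover have "simple_path (h \<circ> rectpath a b)"
    using assms simple_path_linear_image_eq[OF lin inj]
    by (simp add: a_def b_def proper_rect_def simple_path_rectpath)
  moreover have "pathfinish (h \<circ> rectpath a b) = pathstart (h \<circ> rectpath a b)"
    by (simp add: pathfinish_compose pathstart_compose)
  ultimately show ?thesis by blast
qed

section \<open>Grids with displaced lines\<close>

text \<open>The contacts in a grid with broken lines, each in one orientation only.
  \<open>P c r\<close> is the sign of the crossing at the upper right corner of cell
  \<open>(c, r)\<close>; it selects the diagonal pair that touches there.\<close>

definition nbr :: "nat \<Rightarrow> nat \<Rightarrow> (nat \<Rightarrow> nat \<Rightarrow> bool) \<Rightarrow> nat \<times> nat \<Rightarrow> nat \<times> nat \<Rightarrow> bool" where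
  "nbr C R P u v \<longleftrightarrow> (case (u, v) of ((c, r), (c', r')) \<Rightarrow>
     c < C \<and> c' < C \<and> r < R \<and> r' < R \<and>
     (c' = Suc c \<and> r' = r \<or> c' = c \<and> r' = Suc r \<or>
      c' = Suc c \<and> r' = Suc r \<and> \<not> P c r \<or> c' = Suc c \<and> r = Suc r' \<and> P c r'))"

text \<open>
  \<open>xi g r\<close> is the abscissa of the \<open>g\<close>-th vertical line on level \<open>r\<close>, \<open>et r c\<close> the ordinate of the
  \<open>r\<close>-th horizontal line in column \<open>c\<close>. At a crossing at most one of the two lines is broken, so
  that a line end always abuts on the interior of a straight piece of the other line.
\<close>

locale wgrid =
  fixes C R :: nat and xi et :: "nat \<Rightarrow> nat \<Rightarrow> real"
  assumes size: "0 < C" "0 < R"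
    and xi_sep: "\<And>g r r'. g < C \<Longrightarrow> r < R \<Longrightarrow> r' < R \<Longrightarrow> xi g r < xi (Suc g) r'"
    and et_sep: "\<And>r c c'. r < R \<Longrightarrow> c < C \<Longrightarrow> c' < C \<Longrightarrow> c \<le> Suc c' \<Longrightarrow> c' \<le> Suc c \<Longrightarrow>
        et r c < et (Suc r) c'"
    and cross: "\<And>g r. Suc g < C \<Longrightarrow> Suc r < R \<Longrightarrow>
        xi (Suc g) r = xi (Suc g) (Suc r) \<and> et (Suc r) g \<noteq> et (Suc r) (Suc g) \<or>
        et (Suc r) g = et (Suc r) (Suc g) \<and> xi (Suc g) r \<noteq> xi (Suc g) (Suc r)"
    and straight: "\<And>r. r < R \<Longrightarrow> xi 0 r = xi 0 0" "\<And>r. r < R \<Longrightarrow> xi C r = xi C 0"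
      "\<And>c. c < C \<Longrightarrow> et 0 c = et 0 0" "\<And>c. c < C \<Longrightarrow> et R c = et R 0"
begin

definition cell :: "nat \<times> nat \<Rightarrow> real rect" where
  "cell = (\<lambda>(c, r). Rect (xi c r) (et r c) (xi (Suc c) r) (et (Suc r) c))"

lemma cell_sel [simp]:
  "x_lo (cell (c, r)) = xi c r" "x_hi (cell (c, r)) = xi (Suc c) r"
  "y_lo (cell (c, r)) = et r c" "y_hi (cell (c, r)) = et (Suc r) c"
  by (simp_all add: cell_def)

definition box :: "real rect" where
  "box = Rect (xi 0 0) (et 0 0) (xi C 0) (et R 0)"

text \<open>Positive sign: the vertical line moves right on the way up or the horizontal line rises
  on the way right. In both cases the upper left cell touches the lower right one.\<close>

definition plus :: "nat \<Rightarrow> nat \<Rightarrow> bool" where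
  "plus g r \<longleftrightarrow> xi (Suc g) r < xi (Suc g) (Suc r) \<or> et (Suc r) g < et (Suc r) (Suc g)"

lemma proper_cell: "c < C \<Longrightarrow> r < R \<Longrightarrow> proper_rect (cell (c, r))"
  using xi_sep et_sep by (simp add: proper_rect_def)

lemma xi_mono: "g < g' \<Longrightarrow> g' \<le> C \<Longrightarrow> r < R \<Longrightarrow> r' < R \<Longrightarrow> xi g r < xi g' r'"
proof (induction g' arbitrary: r')
  case (Suc g')
  then show ?case using xi_sep[of g' r r'] xi_sep[of g' r' r'] Suc.IH[of r']
    by (cases "g = g'") (auto intro: order.strict_trans)
qed simp

text \<open>Horizontal lines are ordered only between neighbouring columns: a line may climb above
  the height that the next line has far away.\<close>

lemma et_mono: "r < r' \<Longrightarrow> r' \<le> R \<Longrightarrow> c < C \<Longrightarrow> c' < C \<Longrightarrow> c \<le> Suc c' \<Longrightarrow> c' \<le> Suc c \<Longrightarrow>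
    et r c < et r' c'"
proof (induction r' arbitrary: c')
  case (Suc r')
  then show ?case using et_sep[of r' c c'] et_sep[of r' c' c'] Suc.IH[of c']
    by (cases "r = r'") (auto intro: order.strict_trans)
qed simp

lemma box_proper: "proper_rect box"
  using size xi_mono[of 0 C 0 0] et_mono[of 0 R 0 0] by (simp add: box_def proper_rect_def)

lemma cell_subset_box:
  assumes "c < C" "r < R"
  shows "area (cell (c, r)) \<subseteq> area box"
proof -
  have "xi 0 0 \<le> xi c r" "xi (Suc c) r \<le> xi C 0"
    using assms straight(1,2)[of r] xi_mono[of 0 c r r] xi_mono[of "Suc c" C r r]
    by (cases "c = 0"; cases "Suc c = C"; auto)+
  moreover have "et 0 0 \<le> et r c" "et (Suc r) c \<le> et R 0"
    using assms straight(3,4)[of c] et_mono[of 0 r c c] et_mono[of "Suc r" R c c]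
    by (cases "r = 0"; cases "Suc r = R"; auto)+
  ultimately show ?thesis by (auto simp: mem_area box_def)
qed

lemma nbr_adjacent:
  assumes "nbr C R plus u v"
  shows "adjacent (cell u) (cell v)"
proof -
  obtain c r c' r' where [simp]: "u = (c, r)" "v = (c', r')" by (cases u; cases v)
  have lt: "c < C" "c' < C" "r < R" "r' < R" using assms by (auto simp: nbr_def)
  note pr = proper_cell[OF lt(1,3)] proper_cell[OF lt(2,4)]
  from assms consider "c' = Suc c" "r' = r" | "c' = c" "r' = Suc r"
    | "c' = Suc c" "r' = Suc r" "\<not> plus c r" | "c' = Suc c" "r = Suc r'" "plus c r'"
    by (auto simp: nbr_def)
  then show ?thesis
  proof cases
    case 1
    then show ?thesis using pr lt et_sep by (auto intro!: adjacentI_vertical)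
  next
    case 2
    then show ?thesis using pr lt xi_sep by (auto intro!: adjacentI_horizontal)
  next
    case 3
    have e: "et r c < et (Suc (Suc r)) (Suc c)" "xi c r < xi (Suc (Suc c)) (Suc r)"
      using lt 3 et_mono[of r "Suc (Suc r)" c "Suc c"] xi_mono[of c "Suc (Suc c)" r "Suc r"] by auto
    consider "xi (Suc c) r = xi (Suc c) (Suc r)" "et (Suc r) (Suc c) < et (Suc r) c"
      | "et (Suc r) c = et (Suc r) (Suc c)" "xi (Suc c) (Suc r) < xi (Suc c) r"
      using cross[of c r] 3 lt by (auto simp: plus_def)
    then show ?thesis
    proof cases
      case 1
      then show ?thesis using pr e 3 by (auto intro!: adjacentI_vertical)
    next
      case 2
      then show ?thesis using pr e 3 by (auto intro!: adjacentI_horizontal)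
    qed
  next
    case 4
    have e: "et r' (Suc c) < et (Suc r) c" "xi c r < xi (Suc (Suc c)) r'"
      using lt 4 et_mono[of r' "Suc r" "Suc c" c] xi_mono[of c "Suc (Suc c)" r r'] by auto
    consider "xi (Suc c) r' = xi (Suc c) r" "et r c < et r (Suc c)"
      | "et r c = et r (Suc c)" "xi (Suc c) r' < xi (Suc c) r"
      using cross[of c r'] 4 lt by (auto simp: plus_def)
    then show ?thesis
    proof cases
      case 1
      then show ?thesis using pr e 4 by (auto intro!: adjacentI_vertical)
    next
      case 2
      then have "adjacent (cell v) (cell u)" using pr e 4 by (auto intro!: adjacentI_horizontal)
      then show ?thesis by (simp add: adjacent_sym)
    qed
  qed
qed

lemma disjointI:
  assumes "x_hi S < x_lo T \<or> x_hi T < x_lo S \<or> y_hi S < y_lo T \<or> y_hi T < y_lo S"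
  shows "area S \<inter> area T = {}"
  using assms by (auto simp: mem_area)

text \<open>Cells that are further apart are separated by a whole column or level; a diagonal pair
  of the wrong kind is separated by the line that is broken at its crossing.\<close>

lemma not_nbr_disjoint:
  assumes lt: "c < C" "c' < C" "r < R" "r' < R" and ne: "(c, r) \<noteq> (c', r')"
    and n1: "\<not> nbr C R plus (c, r) (c', r')" and n2: "\<not> nbr C R plus (c', r') (c, r)"
  shows "area (cell (c, r)) \<inter> area (cell (c', r')) = {}"
proof -
  have *: "area (cell (c, r)) \<inter> area (cell (c', r')) = {}"
    if lt: "c < C" "c' < C" "r < R" "r' < R" and ne: "(c, r) \<noteq> (c', r')" and le: "c \<le> c'"
      and n1: "\<not> nbr C R plus (c, r) (c', r')" and n2: "\<not> nbr C R plus (c', r') (c, r)"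
    for c c' r r'
  proof -
    have cc: "c' = c \<or> c' = Suc c \<or> Suc c < c'" using le by linarith
    have rr: "r = r' \<or> r' = Suc r \<or> r = Suc r' \<or> Suc r < r' \<or> Suc r' < r" by linarith
    note m = et_mono[of "Suc r" r' c c'] et_mono[of "Suc r'" r c' c]
    from cc show ?thesis
    proof (elim disjE)
      assume "c' = c"
      have "Suc r < r' \<or> Suc r' < r"
        using rr ne n1 n2 lt \<open>c' = c\<close> by (auto simp: nbr_def)
      then show ?thesis using m lt \<open>c' = c\<close> by (intro disjointI) auto
    next
      assume c: "c' = Suc c"
      from rr show ?thesis
      proof (elim disjE)
        assume r: "r' = Suc r"
        then have "plus c r" using n1 c lt by (auto simp: nbr_def)
        then show ?thesis using cross[of c r] lt c r by (intro disjointI) (auto simp: plus_def)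
      next
        assume r: "r = Suc r'"
        then have "\<not> plus c r'" using n1 c lt by (auto simp: nbr_def)
        then show ?thesis using cross[of c r'] lt c r by (intro disjointI) (auto simp: plus_def)
      next
        assume "r = r'"
        then show ?thesis using n1 c lt by (auto simp: nbr_def)
      next
        assume "Suc r < r'"
        then show ?thesis using m(1) c lt by (intro disjointI) simp
      next
        assume "Suc r' < r"
        then show ?thesis using m(2) c lt by (intro disjointI) simp
      qed
    next
      assume "Suc c < c'"
      then show ?thesis using xi_mono[of "Suc c" c' r r'] lt by (intro disjointI) auto
    qed
  qed
  show ?thesis
  proof (cases "c \<le> c'")
    case True
    then show ?thesis using *[OF lt ne] n1 n2 by simp
  next
    case False
    then have "area (cell (c', r')) \<inter> area (cell (c, r)) = {}"
      using *[OF lt(2,1,4,3)] ne n1 n2 by simp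
    then show ?thesis by (subst Int_commute)
  qed
qed

lemma nbr_apart:
  assumes "nbr C R plus u v"
  shows "apart (cell u) (cell v)"
proof -
  obtain c r c' r' where [simp]: "u = (c, r)" "v = (c', r')" by (cases u; cases v)
  have lt: "c < C" "c' < C" "r < R" "r' < R" using assms by (auto simp: nbr_def)
  show ?thesis unfolding \<open>u = _\<close> \<open>v = _\<close> apart_iff[OF proper_cell[OF lt(1,3)] proper_cell[OF lt(2,4)]]
    using assms cross[of c r] cross[of c r'] by (auto simp: nbr_def plus_def)
qed

lemma cells_apart:
  assumes "c < C" "c' < C" "r < R" "r' < R" "(c, r) \<noteq> (c', r')"
  shows "apart (cell (c, r)) (cell (c', r'))"
proof (cases "nbr C R plus (c, r) (c', r') \<or> nbr C R plus (c', r') (c, r)")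
  case True
  then show ?thesis using nbr_apart apart_sym by blast
next
  case False
  then have "area (cell (c, r)) \<inter> area (cell (c', r')) = {}" using not_nbr_disjoint[OF assms] by blast
  then show ?thesis using interior_subset by (fastforce simp: apart_def)
qed

lemma adjacent_cell_iff:
  assumes "c < C" "c' < C" "r < R" "r' < R" "(c, r) \<noteq> (c', r')"
  shows "adjacent (cell (c, r)) (cell (c', r')) \<longleftrightarrow>
    nbr C R plus (c, r) (c', r') \<or> nbr C R plus (c', r') (c, r)"
  using nbr_adjacent[of "(c, r)" "(c', r')"] nbr_adjacent[of "(c', r')" "(c, r)"]
    not_nbr_disjoint[OF assms] adjacent_common[of "cell (c, r)" "cell (c', r')"] adjacent_sym
  by blast

text \<open>For a given point, \<open>lv c\<close> is the level of column \<open>c\<close> at its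
  height, and the column is the last one whose left side on that level does not lie to the right of
  the point.\<close>

lemma cells_cover: "(\<Union>c<C. \<Union>r<R. area (cell (c, r))) = area box"
proof
  show "(\<Union>c<C. \<Union>r<R. area (cell (c, r))) \<subseteq> area box"
    using cell_subset_box by (intro UN_least) simp
  show "area box \<subseteq> (\<Union>c<C. \<Union>r<R. area (cell (c, r)))"
  proof
    fix p assume p: "p \<in> area box"
    define x y where "x = fst p" and "y = snd p"
    have xy: "xi 0 0 \<le> x" "x \<le> xi C 0" "et 0 0 \<le> y" "y \<le> et R 0"
      using p by (auto simp: mem_area box_def x_def y_def)
    define lv where "lv c = (GREATEST r. r < R \<and> et r c \<le> y)" for c
    have lv: "lv c < R \<and> et (lv c) c \<le> y" and lv_max: "r < R \<Longrightarrow> et r c \<le> y \<Longrightarrow> r \<le> lv c"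
      if "c < C" for c r
    proof -
      have "0 < R \<and> et 0 c \<le> y" using size xy straight(3)[OF that] by simp
      then show "lv c < R \<and> et (lv c) c \<le> y" unfolding lv_def
        by (rule GreatestI_nat[of "\<lambda>r. r < R \<and> et r c \<le> y" 0 R]) auto
      show "r \<le> lv c" if "r < R" "et r c \<le> y"
        unfolding lv_def using that by (intro Greatest_le_nat[of _ _ R]) auto
    qed
    have up: "y \<le> et (Suc (lv c)) c" "Suc (lv c) < R \<Longrightarrow> y < et (Suc (lv c)) c" if "c < C" for c
      using lv_max[OF that, of "Suc (lv c)"] lv[OF that] straight(4)[OF that] xy(4)
      by (cases "Suc (lv c) = R"; force)+
    define c where "c = (GREATEST c. c < C \<and> xi c (lv c) \<le> x)"
    have "0 < C \<and> xi 0 (lv 0) \<le> x" using size xy straight(1)[of "lv 0"] lv[of 0] by simp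
    then have c: "c < C \<and> xi c (lv c) \<le> x" unfolding c_def
      by (rule GreatestI_nat[of "\<lambda>c. c < C \<and> xi c (lv c) \<le> x" 0 C]) auto
    have c_max: "c' \<le> c" if "c' < C" "xi c' (lv c') \<le> x" for c'
      unfolding c_def using that by (intro Greatest_le_nat[of _ _ C]) auto
    have "x \<le> xi (Suc c) (lv c)"
    proof (cases "Suc c = C")
      case True
      then show ?thesis using straight(2)[of "lv c"] lv[of c] c xy by simp
    next
      case False
      then have sc: "Suc c < C" using c by simp
      then have lt: "x < xi (Suc c) (lv (Suc c))" using c_max[of "Suc c"] by force
      \<comment> \<open>Otherwise the point falls between two columns whose levels differ by one.
        The vertical line is broken between these levels, so the horizontal line is straight there
        and cannot separate the levels.\<close>
      show ?thesis
      proof (rule ccontr)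
        assume *: "\<not> ?thesis"
        have ne: "lv c \<noteq> lv (Suc c)" using * lt by auto
        have cc: "c < C" using sc by simp
        have 1: "\<not> Suc (lv c) < lv (Suc c)"
          using et_mono[of "Suc (lv c)" "lv (Suc c)" c "Suc c"] up(1)[OF cc] lv[OF sc] sc by force
        have 2: "\<not> Suc (lv (Suc c)) < lv c"
          using et_mono[of "Suc (lv (Suc c))" "lv c" "Suc c" c] up(1)[OF sc] lv[OF cc] sc by force
        from 1 2 ne consider "lv (Suc c) = Suc (lv c)" | "lv c = Suc (lv (Suc c))" by linarith
        then show False
        proof cases
          case 1
          then have "et (Suc (lv c)) c = et (Suc (lv c)) (Suc c)"
            using cross[of c "lv c"] sc lv[OF sc] * lt by auto
          then show False using up(2)[OF cc] lv[OF sc] 1 by auto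
        next
          case 2
          then have "et (lv c) c = et (lv c) (Suc c)"
            using cross[of c "lv (Suc c)"] sc lv[OF cc] * lt by auto
          then show False using up(2)[OF sc] lv[OF cc] 2 by auto
        qed
      qed
    qed
    then have "p \<in> area (cell (c, lv c))"
      using c lv up(1) by (auto simp: mem_area x_def y_def)
    then show "p \<in> (\<Union>c<C. \<Union>r<R. area (cell (c, r)))" using c lv by blast
  qed
qed

text \<open>Cells with a common point are pairwise in contact, hence lie in a square of two columns
  and two levels, and one diagonal pair of that square is not in contact.\<close>

lemma card_cells_le_3:
  "card {(c, r). c < C \<and> r < R \<and> p \<in> area (cell (c, r))} \<le> 3"
proof -
  define A where "A = {(c, r). c < C \<and> r < R \<and> p \<in> area (cell (c, r))}"
  have A: "nbr C R plus u v \<or> nbr C R plus v u" if "u \<in> A" "v \<in> A" "u \<noteq> v" for u v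
    using that not_nbr_disjoint[of "fst u" "fst v" "snd u" "snd v"] by (auto simp: A_def)
  have cl: "fst u \<le> Suc (fst v)" "snd u \<le> Suc (snd v)" if "u \<in> A" "v \<in> A" for u v
    using A[OF that] by (cases u; cases v; cases "u = v"; auto simp: nbr_def)+
  show ?thesis
  proof (cases "A = {}")
    case False
    obtain u where u: "u \<in> A" "\<And>v. v \<in> A \<Longrightarrow> fst u \<le> fst v"
      using ex_has_least_nat[of "\<lambda>u. u \<in> A" _ fst] False by (metis ex_in_conv)
    obtain w where w: "w \<in> A" "\<And>v. v \<in> A \<Longrightarrow> snd w \<le> snd v"
      using ex_has_least_nat[of "\<lambda>u. u \<in> A" _ snd] False by (metis ex_in_conv)
    define c r where "c = fst u" and "r = snd w"
    have sub: "A \<subseteq> {c, Suc c} \<times> {r, Suc r}"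
    proof
      fix v assume "v \<in> A"
      then have "c \<le> fst v" "fst v \<le> Suc c" "r \<le> snd v" "snd v \<le> Suc r"
        using u w cl by (auto simp: c_def r_def)
      then show "v \<in> {c, Suc c} \<times> {r, Suc r}" by (cases v) auto
    qed
    have "\<not> ((c, r) \<in> A \<and> (Suc c, Suc r) \<in> A \<and> (c, Suc r) \<in> A \<and> (Suc c, r) \<in> A)"
      using A[of "(c, r)" "(Suc c, Suc r)"] A[of "(c, Suc r)" "(Suc c, r)"] by (auto simp: nbr_def)
    then obtain v where v: "v \<in> {c, Suc c} \<times> {r, Suc r}" "v \<notin> A" by auto
    have "card A \<le> card ({c, Suc c} \<times> {r, Suc r} - {v})"
      using sub v by (intro card_mono) auto
    also have "\<dots> = 3" using v(1) by (simp add: card_Diff_singleton card_cartesian_product)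
    finally show ?thesis by (simp add: A_def)
  qed (simp add: A_def[symmetric])
qed

end

section \<open>Layouts cut out of grids\<close>

type_synonym block = "nat \<times> nat \<times> nat \<times> nat"

fun block_cells :: "block \<Rightarrow> (nat \<times> nat) list" where
  "block_cells (c, w, r, h) = List.product [c..<c + w] [r..<r + h]"

lemma set_block_cells: "set (block_cells (c, w, r, h)) = {c..<c + w} \<times> {r..<r + h}"
  by auto

lemma distinct_concat_disjoint:
  assumes "distinct (concat xss)" "i < length xss" "k < length xss" "i \<noteq> k"
  shows "set (xss ! i) \<inter> set (xss ! k) = {}"
  using assms
proof (induction xss arbitrary: i k)
  case (Cons xs xss)
  then show ?case
    by (cases i; cases k) (fastforce simp: in_set_conv_nth)+
qed simp

lemma distinct_concat_nth_eq:
  assumes "distinct (concat xss)" "i < length xss" "k < length xss"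
    "j < length (xss ! i)" "l < length (xss ! k)" "xss ! i ! j = xss ! k ! l"
  shows "i = k \<and> j = l"
proof -
  have "i = k" using distinct_concat_disjoint[OF assms(1-3)] assms(4-6) nth_mem by fastforce
  moreover have "distinct (xss ! i)" using assms(1,2) by (simp add: distinct_concat_iff)
  ultimately show ?thesis using assms by (auto simp: nth_eq_iff_index_eq)
qed

locale blocked_grid = wgrid +
  fixes bs :: "block list"
  assumes blocks: "\<And>c w r h. (c, w, r, h) \<in> set bs \<Longrightarrow> 0 < w \<and> 0 < h \<and> c + w \<le> C \<and> r + h \<le> R \<and>
      (\<forall>r'\<in>{r..<r + h}. xi c r' = xi c r \<and> xi (c + w) r' = xi (c + w) r) \<and>
      (\<forall>c'\<in>{c..<c + w}. et r c' = et r c \<and> et (r + h) c' = et (r + h) c)"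
    and distinct_cells: "distinct (concat (map block_cells bs))"
    and all_cells: "set (concat (map block_cells bs)) = {..<C} \<times> {..<R}"
begin

fun bbox :: "block \<Rightarrow> real rect" where
  "bbox (c, w, r, h) = Rect (xi c r) (et r c) (xi (c + w) r) (et (r + h) c)"

definition lay :: "real rect list list" where
  "lay = map (\<lambda>b. map cell (block_cells b)) bs"

text \<open>Lines may be broken inside a block but not along its sides, so a block is itself a grid
  with displaced lines and \<open>cells_cover\<close> applies to it.\<close>

lemma block_region:
  assumes "b \<in> set bs"
  shows "region (map cell (block_cells b)) = area (bbox b)" "proper_rect (bbox b)"
proof -
  obtain c w r h where [simp]: "b = (c, w, r, h)" by (cases b)
  have "(c, w, r, h) \<in> set bs" using assms by simp
  note bl = blocks[OF this]
  note bl2 = conjunct2[OF conjunct2[OF conjunct2[OF conjunct2[OF bl]]]]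
  have b: "0 < w" "0 < h" "c + w \<le> C" "r + h \<le> R"
    by (rule conjunct1[OF bl] conjunct1[OF conjunct2[OF bl]]
        conjunct1[OF conjunct2[OF conjunct2[OF bl]]]
        conjunct1[OF conjunct2[OF conjunct2[OF conjunct2[OF bl]]]])+
  have b5: "xi c r' = xi c r \<and> xi (c + w) r' = xi (c + w) r" if "r \<le> r'" "r' < r + h" for r'
    by (rule bspec[OF conjunct1[OF bl2]]) (use that in simp)
  have b6: "et r c' = et r c \<and> et (r + h) c' = et (r + h) c" if "c \<le> c'" "c' < c + w" for c'
    by (rule bspec[OF conjunct2[OF bl2]]) (use that in simp)
  interpret s: wgrid w h "\<lambda>g r'. xi (c + g) (r + r')" "\<lambda>r' g. et (r + r') (c + g)"
  proof
    show "0 < w" "0 < h" by (fact b)+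
    show "xi (c + g) (r + r') < xi (c + Suc g) (r + r'')" if "g < w" "r' < h" "r'' < h" for g r' r''
      using xi_sep[of "c + g" "r + r'" "r + r''"] that b(3,4) by simp
    show "et (r + r') (c + c') < et (r + Suc r') (c + c'')"
      if "r' < h" "c' < w" "c'' < w" "c' \<le> Suc c''" "c'' \<le> Suc c'" for r' c' c''
      using et_sep[of "r + r'" "c + c'" "c + c''"] that b(3,4) by simp
    show "xi (c + Suc g) (r + r') = xi (c + Suc g) (r + Suc r') \<and>
        et (r + Suc r') (c + g) \<noteq> et (r + Suc r') (c + Suc g) \<or>
        et (r + Suc r') (c + g) = et (r + Suc r') (c + Suc g) \<and>
        xi (c + Suc g) (r + r') \<noteq> xi (c + Suc g) (r + Suc r')"
      if "Suc g < w" "Suc r' < h" for g r'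
      using cross[of "c + g" "r + r'"] that b(3,4) by simp
    show "xi (c + 0) (r + r') = xi (c + 0) (r + 0)" "xi (c + w) (r + r') = xi (c + w) (r + 0)"
      if "r' < h" for r'
      using b5[of "r + r'"] that by simp_all
    show "et (r + 0) (c + c') = et (r + 0) (c + 0)" "et (r + h) (c + c') = et (r + h) (c + 0)"
      if "c' < w" for c'
      using b6[of "c + c'"] that by simp_all
  qed
  have box: "s.box = bbox b" by (simp add: s.box_def)
  then show "proper_rect (bbox b)" using s.box_proper by simp
  have cell: "s.cell (c', r') = cell (c + c', r + r')" for c' r'
    by (simp add: s.cell_def cell_def)
  have "(\<Union>c'<w. \<Union>r'<h. area (cell (c + c', r + r'))) = area (bbox b)"
    using s.cells_cover by (simp add: box cell)
  moreover have "region (map cell (block_cells b)) = (\<Union>c'<w. \<Union>r'<h. area (cell (c + c', r + r')))"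
  proof -
    have "{c..<c + w} = (+) c ` {..<w}" "{r..<r + h} = (+) r ` {..<h}"
      by (simp_all add: lessThan_atLeast0 image_add_atLeastLessThan add.commute)
    then show ?thesis by (auto simp: region_def)
  qed
  ultimately show "region (map cell (block_cells b)) = area (bbox b)" by simp
qed

lemma in_grid:
  assumes "i < length bs" "j < length (block_cells (bs ! i))"
  obtains c r where "block_cells (bs ! i) ! j = (c, r)" "c < C" "r < R"
proof -
  have "block_cells (bs ! i) ! j \<in> set (concat (map block_cells bs))"
    using assms by (auto intro!: bexI[of _ "bs ! i"])
  then show ?thesis using that unfolding all_cells by (cases "block_cells (bs ! i) ! j") auto
qed

lemma cell_index_eq:
  assumes "i < length bs" "k < length bs" "j < length (block_cells (bs ! i))"
    "l < length (block_cells (bs ! k))" "block_cells (bs ! i) ! j = block_cells (bs ! k) ! l"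
  shows "i = k \<and> j = l"
  using distinct_concat_nth_eq[OF distinct_cells, of i k j l] assms by simp

lemma cell_index_ex:
  assumes "c < C" "r < R"
  obtains i j where "i < length bs" "j < length (block_cells (bs ! i))" "block_cells (bs ! i) ! j = (c, r)"
proof -
  have "(c, r) \<in> set (concat (map block_cells bs))" unfolding all_cells using assms by simp
  then obtain b where "b \<in> set bs" "(c, r) \<in> set (block_cells b)" by auto
  then show ?thesis using that by (metis in_set_conv_nth)
qed

lemma lay_nth [simp]:
  "length lay = length bs"
  "i < length bs \<Longrightarrow> lay ! i = map cell (block_cells (bs ! i))"
  by (simp_all add: lay_def)

lemma map_region_lay: "map region lay = map area (map bbox bs)"
  using block_region by (simp add: lay_def)

text \<open>An open overlap of two blocks would meet the interior of a cell of the first one and,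
  within that, the interior of a cell of the second one; but distinct cells are apart.\<close>

lemma blocks_apart:
  assumes "i < length bs" "k < length bs" "i \<noteq> k"
  shows "apart (bbox (bs ! i)) (bbox (bs ! k))"
proof (rule ccontr)
  define U where "U = interior (area (bbox (bs ! i))) \<inter> interior (area (bbox (bs ! k)))"
  assume "\<not> ?thesis"
  then have U: "open U" "U \<noteq> {}" by (auto simp: U_def apart_def)
  have reg: "area (bbox (bs ! l)) = (\<Union>S\<in>cell ` set (block_cells (bs ! l)). area S)"
    if "l < length bs" for l
    using block_region(1)[of "bs ! l"] that by (simp add: region_def)
  have "U \<subseteq> area (bbox (bs ! i))" "U \<subseteq> area (bbox (bs ! k))"
    using interior_subset by (auto simp: U_def)
  then obtain u where u: "u \<in> set (block_cells (bs ! i))" "interior (area (cell u)) \<inter> U \<noteq> {}"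
    using open_meets_interior[OF _ U, of "cell ` set (block_cells (bs ! i))"] reg assms(1) by auto
  define V where "V = interior (area (cell u)) \<inter> U"
  have V: "open V" "V \<noteq> {}" using u U by (auto simp: V_def)
  have "V \<subseteq> area (bbox (bs ! k))" using \<open>U \<subseteq> area (bbox (bs ! k))\<close> by (auto simp: V_def)
  then obtain v where v: "v \<in> set (block_cells (bs ! k))" "interior (area (cell v)) \<inter> V \<noteq> {}"
    using open_meets_interior[OF _ V, of "cell ` set (block_cells (bs ! k))"] reg assms(2) by auto
  have "\<not> apart (cell u) (cell v)" using v(2) by (auto simp: V_def apart_def)
  moreover have "u \<noteq> v"
    using distinct_concat_disjoint[OF distinct_cells, of i k] u(1) v(1) assms by auto
  moreover obtain c r c' r' where "u = (c, r)" "c < C" "r < R" "v = (c', r')" "c' < C" "r' < R"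
    using u(1) v(1) in_grid assms(1,2) by (metis in_set_conv_nth)
  ultimately show False using cells_apart by blast
qed

lemma bbox_apart: "i < length bs \<Longrightarrow> k < length bs \<Longrightarrow> i \<noteq> k \<Longrightarrow>
    interior (area (map bbox bs ! i)) \<inter> interior (area (map bbox bs ! k)) = {}"
  using blocks_apart by (simp add: apart_def)

lemma Union_bbox: "\<Union> (set (map area (map bbox bs))) = area box"
proof -
  have "\<Union> (set (map area (map bbox bs))) = (\<Union>b\<in>set bs. region (map cell (block_cells b)))"
    using block_region by simp
  also have "\<dots> = (\<Union>u\<in>set (concat (map block_cells bs)). area (cell u))"
    by (simp add: region_def)
  also have "\<dots> = area box"
    unfolding all_cells cells_cover[symmetric] by auto
  finally show ?thesis .
qed

lemma root_box: "root_box box (map area (map bbox bs))"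
  unfolding root_box_def Union_bbox using box_proper by simp

lemma rectangle_complex_block:
  assumes "i < length bs"
  shows "rectangle_complex (lay ! i)"
  unfolding rectangle_complex_def
proof (intro conjI ballI allI impI)
  fix S assume "S \<in> set (lay ! i)"
  then obtain j where "j < length (block_cells (bs ! i))" "S = cell (block_cells (bs ! i) ! j)"
    using assms by (auto simp: in_set_conv_nth)
  then show "proper_rect S" using in_grid[OF assms] proper_cell by metis
next
  fix j k assume jk: "j < length (lay ! i)" "k < length (lay ! i)" "j \<noteq> k"
  then have jk': "j < length (block_cells (bs ! i))" "k < length (block_cells (bs ! i))"
    using assms by simp_all
  obtain c r where 1: "block_cells (bs ! i) ! j = (c, r)" "c < C" "r < R" using in_grid[OF assms jk'(1)] .
  obtain c' r' where 2: "block_cells (bs ! i) ! k = (c', r')" "c' < C" "r' < R" using in_grid[OF assms jk'(2)] .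
  have ne: "(c, r) \<noteq> (c', r')" using cell_index_eq[OF assms assms jk'] 1 2 jk(3) by auto
  have eq: "lay ! i ! j = cell (c, r)" "lay ! i ! k = cell (c', r')" using assms jk' 1 2 by simp_all
  show "interior (area (lay ! i ! j)) \<inter> interior (area (lay ! i ! k)) = {}"
    using cells_apart[OF 1(2) 2(2) 1(3) 2(3) ne] by (simp add: eq apart_def)
  show "area (lay ! i ! j) \<inter> area (lay ! i ! k) = {} \<or> adjacent (lay ! i ! j) (lay ! i ! k)"
    unfolding eq adjacent_cell_iff[OF 1(2) 2(2) 1(3) 2(3) ne]
    using not_nbr_disjoint[OF 1(2) 2(2) 1(3) 2(3) ne] by blast
qed

lemma region_lay: "i < length bs \<Longrightarrow> region (lay ! i) = area (bbox (bs ! i))"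
  using block_region(1)[of "bs ! i"] by simp

lemma rectangular_layout_lay: "rectangular_layout lay"
proof -
  have nth: "\<exists>i<length bs. D = lay ! i" if "D \<in> set lay" for D
    using that unfolding in_set_conv_nth lay_nth(1) by auto
  have proper: "i < length bs \<Longrightarrow> proper_rect (bbox (bs ! i))" for i using block_region(2) by simp
  have "rectangular_complex D \<and> simple_complex D" if "D \<in> set lay" for D
  proof -
    obtain i where i: "i < length bs" "D = lay ! i" using nth[OF \<open>D \<in> set lay\<close>] by blast
    then show ?thesis
      using rectangle_complex_block[OF i(1)] region_lay[OF i(1)] proper[OF i(1)]
        simple_closed_frontier[OF proper[OF i(1)]]
      unfolding rectangular_complex_def simple_complex_def by auto
  qed
  moreover have "interior (region (lay ! i)) \<inter> interior (region (lay ! k)) = {}"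
    if "i < length lay" "k < length lay" "i \<noteq> k" for i k
    using blocks_apart[of i k] that region_lay by (simp add: apart_def)
  moreover have "\<exists>B. root_box B (map region lay)"
    unfolding map_region_lay using root_box by blast
  \<comment> \<open>Names of cells correspond injectively to grid positions, so the bound for the
    grid carries over.\<close>
  moreover have "card {(i, j). i < length lay \<and> j < length (lay ! i) \<and> p \<in> area (lay ! i ! j)} \<le> 3" for p
  proof -
    define X where "X = {(i, j). i < length lay \<and> j < length (lay ! i) \<and> p \<in> area (lay ! i ! j)}"
    define Y where "Y = {(c, r). c < C \<and> r < R \<and> p \<in> area (cell (c, r))}"
    define f where "f = (\<lambda>(i, j). block_cells (bs ! i) ! j)"
    have "inj_on f X"
    proof (rule inj_onI)
      fix a b assume "a \<in> X" "b \<in> X" "f a = f b"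
      then show "a = b"
        using cell_index_eq[of "fst a" "fst b" "snd a" "snd b"] by (auto simp: f_def X_def)
    qed
    moreover have "f ` X \<subseteq> Y"
    proof (rule image_subsetI)
      fix a assume "a \<in> X"
      moreover obtain i j where "a = (i, j)" by (cases a)
      ultimately have ij: "i < length bs" "j < length (block_cells (bs ! i))"
        "p \<in> area (cell (block_cells (bs ! i) ! j))" by (auto simp: X_def)
      obtain c r where "block_cells (bs ! i) ! j = (c, r)" "c < C" "r < R" using in_grid[OF ij(1,2)] .
      then show "f a \<in> Y" using ij(3) \<open>a = _\<close> by (simp add: f_def Y_def)
    qed
    moreover have "finite Y"
      by (rule finite_subset[of _ "{..<C} \<times> {..<R}"]) (auto simp: Y_def)
    ultimately have "card X \<le> card Y" by (rule card_inj_on_le)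
    also have "\<dots> \<le> 3" unfolding Y_def by (rule card_cells_le_3)
    finally show ?thesis by (simp add: X_def)
  qed
  ultimately show ?thesis unfolding rectangular_layout_def layout_def by blast
qed

lemma adjacent_lay_iff:
  assumes "i < length bs" "k < length bs" "j < length (block_cells (bs ! i))"
    "l < length (block_cells (bs ! k))" "(i, j) \<noteq> (k, l)"
  shows "adjacent (lay ! i ! j) (lay ! k ! l) \<longleftrightarrow>
    nbr C R plus (block_cells (bs ! i) ! j) (block_cells (bs ! k) ! l) \<or>
    nbr C R plus (block_cells (bs ! k) ! l) (block_cells (bs ! i) ! j)"
proof -
  obtain c r where 1: "block_cells (bs ! i) ! j = (c, r)" "c < C" "r < R" using in_grid[OF assms(1,3)] .
  obtain c' r' where 2: "block_cells (bs ! k) ! l = (c', r')" "c' < C" "r' < R" using in_grid[OF assms(2,4)] .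
  have ne: "(c, r) \<noteq> (c', r')" using cell_index_eq[OF assms(1-4)] 1 2 assms(5) by auto
  show ?thesis using adjacent_cell_iff[OF 1(2) 2(2) 1(3) 2(3) ne] assms 1 2 by simp
qed

end

section \<open>The layouts of a triple system\<close>

text \<open>The bottom level counts as the last level of row 0, the top level as the first one of
  row \<open>m + 1\<close>. As horizontal line \<open>r\<close> is the lower side of level
  \<open>r\<close>, the borders between rows are the lines with \<open>lev r = 0\<close>.\<close>

definition row :: "nat \<Rightarrow> nat" where "row r = (r + 2) div 3"
definition lev :: "nat \<Rightarrow> nat" where "lev r = (r + 2) mod 3"
definition slot :: "nat \<Rightarrow> nat" where "slot c = (c + 1) div 2"

lemma row_lev [simp]: "row 0 = 0" "lev 0 = 2"
  "k < 3 \<Longrightarrow> row (Suc (3 * i + k)) = Suc i" "k < 3 \<Longrightarrow> lev (Suc (3 * i + k)) = k"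
proof -
  assume "k < 3"
  have "(Suc (3 * i + k) + 2) = 3 * Suc i + k" by simp
  then show "row (Suc (3 * i + k)) = Suc i" "lev (Suc (3 * i + k)) = k"
    using \<open>k < 3\<close> by (simp_all add: row_def lev_def del: mult_Suc_right)
qed (simp_all add: row_def lev_def)

lemma slot_simps [simp]: "slot 0 = 0" "slot (2 * j) = j" "slot (Suc (2 * j)) = Suc j"
  by (simp_all add: slot_def)

lemma slot_pred [simp]: "0 < j \<Longrightarrow> slot (2 * j - Suc 0) = j"
  by (simp add: slot_def)

lemma level_cases:
  obtains "r = 0" | i k where "r = Suc (3 * i + k)" "k < 3"
proof (cases "r = 0")
  case False
  have "r = Suc (3 * ((r - 1) div 3) + (r - 1) mod 3)" using False by simp
  then show ?thesis using that(2)[of "(r - 1) div 3" "(r - 1) mod 3"] by simp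
qed (use that in simp)

text \<open>
  Row \<open>i\<close> of the layout consists of three levels of cells; its inner horizontal lines are numbered
  0 and 1. Slot \<open>j\<close> consists of two columns of cells. The crossing of the slot with line \<open>k\<close> lies
  inside a complex unless \<open>bord\<close> holds.
\<close>

locale triples =
  fixes m n :: nat and c2 c1 al :: "nat \<Rightarrow> nat"
begin

text \<open>The positive crossings on middle lines, the only ones where a middle line may move to
  the right.\<close>

definition act :: "nat \<Rightarrow> nat \<Rightarrow> nat \<Rightarrow> bool" where
  "act i k j \<longleftrightarrow> k = 1 \<and> j = c2 i \<or> k = 0 \<and> (j = c1 i \<or> j = al i)"

text \<open>Complexes are cut along the lower line left of slot \<open>c1\<close> and along the
  upper line right of it. So the line that runs free inside the complexes is the upper one on the
  left and the lower one on the right, and in slot \<open>c1\<close> both are free.\<close>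

definition bord :: "nat \<Rightarrow> nat \<Rightarrow> nat \<Rightarrow> bool" where
  "bord i k j \<longleftrightarrow> k = 0 \<and> j < c1 i \<or> k = 1 \<and> c1 i < j"

text \<open>
  \<open>xe\<close> and \<open>ye\<close> are the exponents of the coordinates. Each vertical line has a band of width \<open>D\<close>,
  each row of the system one of height \<open>F\<close>, divided into five bands of height \<open>G\<close>. The parameters:
  \<open>hi j r\<close> holds if the middle line of slot \<open>j\<close> is in its right position on level \<open>r\<close>, \<open>sel\<close> are the
  selected rows, and \<open>hs i k j\<close> holds if horizontal line \<open>k\<close> of row \<open>i\<close> is straight at slot \<open>j\<close>, where
  the middle line may then be broken.
\<close>

definition D :: nat where "D = 6 * (m + 3)"
text \<open>A line falls by two per slot, which makes its crossings between slots negative;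
  \<open>2 * n + 4\<close> exceeds the total of this fall and of \<open>del\<close>.\<close>

definition G :: nat where "G = 2 * n + 4"
definition F :: nat where "F = 5 * G + 1"

text \<open>One unit to the right below the border of two complexes in the row, so that the middle
  line steps left at the border and the crossing is negative.\<close>

definition extra :: "nat \<Rightarrow> nat \<Rightarrow> nat \<Rightarrow> nat" where
  "extra i k j = (if 1 \<le> i \<and> i \<le> m \<and> (j < c1 i \<and> k = 0 \<or> c1 i < j \<and> k \<le> 1) then 1 else 0)"

text \<open>Lines between slots move right by one per row, so they cross row borders positively.
  Middle lines move left by two per row, more than \<open>extra\<close> can undo, so they cross row
  borders negatively. The offset \<open>2 * (m + 3)\<close> of the right position exceeds their
  whole drift \<open>2 * (m + 1)\<close>.\<close>

definition xe :: "(nat \<Rightarrow> nat \<Rightarrow> bool) \<Rightarrow> nat \<Rightarrow> nat \<Rightarrow> nat" where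
  "xe hi g r = g * D + (if g = 0 \<or> g = 2 * n + 2 then 0 else if odd g then row r
     else (if hi (g div 2) r then 2 * (m + 3) else 0) + 2 * (m + 1 - row r) + extra (row r) (lev r) (g div 2))"

text \<open>Produces the sign inside a slot where the middle line is straight: a fall by one, or a
  rise by one at \<open>act\<close> crossings.\<close>

definition del :: "(nat \<Rightarrow> nat \<Rightarrow> nat \<Rightarrow> bool) \<Rightarrow> nat \<Rightarrow> nat \<Rightarrow> nat \<Rightarrow> nat" where
  "del hs i k c = (if slot c = 0 \<or> slot c = n + 1 \<or> bord i k (slot c) \<or> hs i k (slot c) then 0
     else if act i k (slot c) then of_bool (even c) else of_bool (odd c))"

text \<open>The lower line rises to band 2 at \<open>al\<close>, or already at \<open>c1\<close> in
  a selected row; there the upper line rises to band 3 at \<open>c2\<close> in order to stay above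
  it. These rises take place in the middle of slots, exactly at the positive crossings that the row
  does not serve. After slot \<open>c1\<close> the upper line is a border and has band 4 in any
  case.\<close>

definition band :: "(nat \<Rightarrow> bool) \<Rightarrow> nat \<Rightarrow> nat \<Rightarrow> nat \<Rightarrow> nat" where
  "band sel i k c = (if k = 0 then (if (if sel i then 2 * c1 i else 2 * al i) \<le> c then 2 else 0)
     else if 2 * c1 i < c then 4 else if sel i \<and> 2 * c2 i \<le> c then 3 else 1)"

definition ye :: "(nat \<Rightarrow> bool) \<Rightarrow> (nat \<Rightarrow> nat \<Rightarrow> nat \<Rightarrow> bool) \<Rightarrow> nat \<Rightarrow> nat \<Rightarrow> nat" where
  "ye sel hs r c = (if r = 3 * m + 2 then (m + 2) * F else if lev r = 0 then row r * F
     else if r = 0 then 0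
     else row r * F + 1 + band sel (row r) (lev r - 1) c * G + 2 * (n + 1 - slot c)
       + del hs (row r) (lev r - 1) c)"

definition xi :: "(nat \<Rightarrow> nat \<Rightarrow> bool) \<Rightarrow> nat \<Rightarrow> nat \<Rightarrow> real" where
  "xi hi g r = 2 ^ xe hi g r"

definition et :: "(nat \<Rightarrow> bool) \<Rightarrow> (nat \<Rightarrow> nat \<Rightarrow> nat \<Rightarrow> bool) \<Rightarrow> nat \<Rightarrow> nat \<Rightarrow> real" where
  "et sel hs r c = 2 ^ ye sel hs r c"

definition blk :: "nat \<Rightarrow> nat \<Rightarrow> block list" where
  "blk i j = (if j < c1 i then [(2 * j - 1, 2, 3 * i - 2, 1), (2 * j - 1, 2, 3 * i - 1, 2)]
     else if j = c1 i then [(2 * j - 1, 2, 3 * i - 2, 3)]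
     else [(2 * j - 1, 2, 3 * i - 2, 2), (2 * j - 1, 2, 3 * i, 1)])"

definition rowblocks :: "nat \<Rightarrow> block list" where
  "rowblocks i = map (\<lambda>k. (0, 1, 3 * i - 2 + k, 1)) [0..<3] @ concat (map (blk i) [1..<Suc n]) @
     map (\<lambda>k. (2 * n + 1, 1, 3 * i - 2 + k, 1)) [0..<3]"

definition bs :: "block list" where
  "bs = map (\<lambda>c. (c, 1, 0, 1)) [0..<2 * n + 2] @ concat (map rowblocks [1..<Suc m]) @
     map (\<lambda>c. (c, 1, 3 * m + 1, 1)) [0..<2 * n + 2]"

text \<open>The sign of the crossing of vertical line \<open>g + 1\<close> and horizontal line \<open>r + 1\<close>.\<close>

definition sgn :: "nat \<Rightarrow> nat \<Rightarrow> bool" where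
  "sgn g r \<longleftrightarrow> (if odd g then lev (Suc r) \<noteq> 0 \<and> act (row (Suc r)) (lev (Suc r) - 1) (Suc g div 2)
     else lev (Suc r) = 0 \<or> lev (Suc r) = 2 \<and> g = 2 * c1 (row (Suc r)))"

text \<open>Ensures that exactly one line is broken at each crossing with a middle line. On a border
  of complexes the vertical line is broken anyway by \<open>extra\<close>, so \<open>hi\<close> may
  change there.\<close>

definition jumps_ok :: "(nat \<Rightarrow> nat \<Rightarrow> bool) \<Rightarrow> (nat \<Rightarrow> bool) \<Rightarrow> (nat \<Rightarrow> nat \<Rightarrow> nat \<Rightarrow> bool) \<Rightarrow> bool" where
  "jumps_ok hi sel hs \<longleftrightarrow> (\<forall>i k j. 1 \<le> i \<and> i \<le> m \<and> k < 2 \<and> 1 \<le> j \<and> j \<le> n \<longrightarrow>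
     (if hs i k j then act i k j \<and> band sel i k (2 * j - 1) = band sel i k (2 * j) \<and>
        \<not> hi j (3 * i - 2 + k) \<and> hi j (3 * i - 1 + k)
      else bord i k j \<or> hi j (3 * i - 2 + k) = hi j (3 * i - 1 + k)))"

text \<open>Fixes the signs on the borders of rows and complexes. The target is not smooth: its
  middle lines jump at the lowest row border. Only its blocks matter, not the signs.\<close>

definition smooth :: "(nat \<Rightarrow> nat \<Rightarrow> bool) \<Rightarrow> (nat \<Rightarrow> nat \<Rightarrow> nat \<Rightarrow> bool) \<Rightarrow> bool" where
  "smooth hi hs \<longleftrightarrow> (\<forall>i k j. 1 \<le> j \<and> j \<le> n \<longrightarrow>
     (i \<le> m \<longrightarrow> hi j (3 * i) = hi j (3 * i + 1)) \<and>
     (1 \<le> i \<and> i \<le> m \<and> k < 2 \<and> bord i k j \<longrightarrow> hi j (3 * i - 2 + k) = hi j (3 * i - 1 + k)))"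

end

locale good_triples = triples +
  assumes m_pos: "0 < m"
    and ord: "\<And>i. 1 \<le> i \<Longrightarrow> i \<le> m \<Longrightarrow> 1 \<le> c2 i \<and> c2 i < c1 i \<and> c1 i < al i \<and> al i \<le> n"
begin

lemma row_le: "r < 3 * m + 2 \<Longrightarrow> row r \<le> m + 1"
  by (auto simp: row_def)

lemma xe_bounds:
  assumes "r < 3 * m + 2"
  shows "g * D \<le> xe hi g r" "xe hi g r < Suc g * D"
proof -
  have "2 * (m + 3) + (2 * (m + 1) + 1) < D" "m + 1 < D" by (simp_all add: D_def)
  moreover have "extra (row r) (lev r) (g div 2) \<le> 1" by (simp add: extra_def)
  ultimately show "g * D \<le> xe hi g r" "xe hi g r < Suc g * D"
    using row_le[OF assms] by (auto simp: xe_def)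
qed

lemma xe_sep: "r < 3 * m + 2 \<Longrightarrow> r' < 3 * m + 2 \<Longrightarrow> xe hi g r < xe hi (Suc g) r'"
  using xe_bounds(2)[of r hi g] xe_bounds(1)[of r' "Suc g" hi] by linarith

lemma band_le: "band sel i k c \<le> 4"
  by (simp add: band_def)

lemma del_le: "del hs i k c \<le> 1"
  by (simp add: del_def of_bool_def)

lemma band_lt:
  assumes "1 \<le> i" "i \<le> m" "c \<le> Suc c'"
  shows "band sel i 0 c < band sel i 1 c'"
  using ord[OF assms(1,2)] assms(3) by (auto simp: band_def)

lemma mult_G_less: "a < b \<Longrightarrow> a * G + 2 * (n + 1 - s) + d < b * G" if "d \<le> 1" for a b d s
proof -
  assume "a < b"
  then have "Suc a * G \<le> b * G" by (intro mult_right_mono) auto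
  moreover have "2 * (n + 1 - s) + d < G" using that by (simp add: G_def)
  ultimately show ?thesis by simp
qed

lemma line_bounds:
  "row r * F < row r * F + 1 + band sel i k c * G + 2 * (n + 1 - slot c) + del hs i k c"
  "row r * F + 1 + band sel i k c * G + 2 * (n + 1 - slot c) + del hs i k c < Suc (row r) * F"
proof -
  have "band sel i k c * G + 2 * (n + 1 - slot c) + del hs i k c < 5 * G"
    using mult_G_less[OF del_le, of "band sel i k c" 5] band_le[of sel i k c] by simp
  then show "row r * F + 1 + band sel i k c * G + 2 * (n + 1 - slot c) + del hs i k c < Suc (row r) * F"
    by (simp add: F_def)
qed simp

lemma ye_simps:
  "ye sel hs 0 c = 0" "i \<le> m \<Longrightarrow> ye sel hs (Suc (3 * i)) c = Suc i * F"
  "i < m \<Longrightarrow> k < 2 \<Longrightarrow> ye sel hs (Suc (3 * i + Suc k)) c =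
     Suc i * F + 1 + band sel (Suc i) k c * G + 2 * (n + 1 - slot c) + del hs (Suc i) k c"
  "ye sel hs (3 * m + 2) c = (m + 2) * F"
proof -
  show "ye sel hs 0 c = 0" by (simp add: ye_def)
  show "i \<le> m \<Longrightarrow> ye sel hs (Suc (3 * i)) c = Suc i * F"
    using row_lev(3,4)[of 0 i] by (simp add: ye_def)
  show "i < m \<Longrightarrow> k < 2 \<Longrightarrow> ye sel hs (Suc (3 * i + Suc k)) c =
     Suc i * F + 1 + band sel (Suc i) k c * G + 2 * (n + 1 - slot c) + del hs (Suc i) k c"
    using row_lev(3,4)[of "Suc k" i] by (simp add: ye_def del: mult_Suc)
  show "ye sel hs (3 * m + 2) c = (m + 2) * F" by (simp add: ye_def)
qed

lemma line_cases:
  assumes "r < 3 * m + 2"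
  obtains "r = 0" | i where "i \<le> m" "r = Suc (3 * i)" | i k where "i < m" "k < 2" "r = Suc (3 * i + Suc k)"
proof (cases r rule: level_cases)
  case (2 i k)
  show ?thesis
  proof (cases k)
    case 0
    then show ?thesis using that(2)[of i] 2 assms by simp
  next
    case (Suc k')
    then show ?thesis using that(3)[of i k'] 2 assms by simp
  qed
qed (use that in simp)

lemma ye_sep:
  assumes "r < 3 * m + 2" "c \<le> Suc c'"
  shows "ye sel hs r c < ye sel hs (Suc r) c'"
  using assms(1)
proof (cases r rule: line_cases)
  case 1
  then show ?thesis using ye_simps(1) ye_simps(2)[of 0 sel hs c'] by (simp add: F_def)
next
  case (2 i)
  show ?thesis
  proof (cases "i = m")
    case True
    then show ?thesis using 2 ye_simps(2)[of i sel hs c] ye_simps(4)[of sel hs c'] by (simp add: F_def)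
  next
    case False
    then show ?thesis using 2 ye_simps(2)[of i sel hs c] ye_simps(3)[of i 0 sel hs c'] by simp
  qed
next
  case (3 i k)
  show ?thesis
  proof (cases "k = 0")
    case True
    have "band sel (Suc i) 0 c * G + 2 * (n + 1 - slot c) + del hs (Suc i) 0 c < band sel (Suc i) 1 c' * G"
      using band_lt[of "Suc i" c c' sel] 3 assms(2) by (intro mult_G_less[OF del_le]) simp
    then show ?thesis
      using True 3 ye_simps(3)[of i 0 sel hs c] ye_simps(3)[of i 1 sel hs c'] by simp
  next
    case False
    then have k: "k = 1" using 3 by simp
    have r: "Suc r = Suc (3 * Suc i)" using 3 k by simp
    have "row (Suc (3 * i)) = Suc i" using row_lev(3)[of 0 i] by simp
    then show ?thesis
      using ye_simps(3)[of i k sel hs c] ye_simps(2)[of "Suc i" sel hs c'] 3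
        line_bounds(2)[of "Suc (3 * i)" sel "Suc i" k c hs] unfolding r by simp
  qed
qed

lemma act_not_bord: "1 \<le> i \<Longrightarrow> i \<le> m \<Longrightarrow> act i k j \<Longrightarrow> \<not> bord i k j"
  using ord[of i] by (auto simp: act_def bord_def)

lemma band_even:
  assumes "1 \<le> i" "i \<le> m" "k < 2"
  shows "band sel i k (Suc (2 * j)) = (if k = 1 \<and> j = c1 i then 4 else band sel i k (2 * j))"
    "k = 1 \<Longrightarrow> j = c1 i \<Longrightarrow> band sel i k (2 * j) < 4"
proof -
  have "2 * x \<le> Suc (2 * j) \<longleftrightarrow> 2 * x \<le> 2 * j" for x by presburger
  moreover have "2 * x < Suc (2 * j) \<longleftrightarrow> 2 * x < 2 * j \<or> x = j" for x by presburger
  ultimately show "band sel i k (Suc (2 * j)) = (if k = 1 \<and> j = c1 i then 4 else band sel i k (2 * j))"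
    using assms by (auto simp: band_def)
qed (auto simp: band_def)

lemma band_odd:
  assumes "1 \<le> i" "i \<le> m" "k < 2" "1 \<le> j"
  shows "band sel i k (2 * j - 1) \<le> band sel i k (2 * j)"
    "\<not> act i k j \<Longrightarrow> band sel i k (2 * j - 1) = band sel i k (2 * j)"
proof -
  have 1: "2 * x \<le> 2 * j - 1 \<longleftrightarrow> 2 * x \<le> 2 * j \<and> x \<noteq> j" for x using assms(4) by presburger
  have 2: "2 * x < 2 * j - 1 \<longleftrightarrow> 2 * x < 2 * j" for x using assms(4) by presburger
  show "band sel i k (2 * j - 1) \<le> band sel i k (2 * j)"
    unfolding band_def 1 2 by auto
  show "\<not> act i k j \<Longrightarrow> band sel i k (2 * j - 1) = band sel i k (2 * j)"
    using assms unfolding band_def 1 2 by (auto simp: act_def)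
qed

text \<open>At row borders the horizontal line is straight and the row number moves the vertical
  one. On inner lines the vertical lines between slots are straight, and the fall per slot or a
  change of band moves the horizontal one. Middle lines are broken at \<open>hs\<close> crossings
  and complex borders; elsewhere the horizontal line is.\<close>

lemma crossing:
  fixes hi sel hs
  assumes ok: "jumps_ok hi sel hs" and g: "Suc g < 2 * n + 2" and r: "Suc r < 3 * m + 2"
  defines "X1 \<equiv> xe hi (Suc g) r" and "X2 \<equiv> xe hi (Suc g) (Suc r)"
    and "Y1 \<equiv> ye sel hs (Suc r) g" and "Y2 \<equiv> ye sel hs (Suc r) (Suc g)"
  shows "(X1 = X2 \<and> Y1 \<noteq> Y2 \<or> Y1 = Y2 \<and> X1 \<noteq> X2) \<and>
    (smooth hi hs \<longrightarrow> (sgn g r \<longleftrightarrow> X1 < X2 \<or> Y1 < Y2))"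
proof (cases "even g")
  case True
  then obtain j where j: "g = 2 * j" by (elim evenE)
  have jn: "j \<le> n" using g j by simp
  have X: "X1 = Suc g * D + row r" "X2 = Suc g * D + row (Suc r)"
    using g j by (auto simp: X1_def X2_def xe_def)
  show ?thesis
  proof (cases rule: line_cases[OF r])
    case (2 i)
    then have i: "i \<le> m" "r = 3 * i" by auto
    have "row (Suc r) = Suc i" "lev (Suc r) = 0" using row_lev(3,4)[of 0 i] i by simp_all
    moreover have "row r = i" using i by (simp add: row_def)
    moreover have "Y1 = Y2" using ye_simps(2)[OF i(1)] by (simp add: Y1_def Y2_def i)
    ultimately show ?thesis using X True by (simp add: sgn_def)
  next
    case (3 i k)
    have rr: "row (Suc r) = Suc i" "lev (Suc r) = Suc k" using row_lev(3,4)[of "Suc k" i] 3 by simp_all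
    have "row r = Suc i" using row_lev(3)[of k i] 3 by simp
    then have XX: "X1 = X2" using X rr by simp
    have Y: "Y1 = Suc i * F + 1 + band sel (Suc i) k (2 * j) * G + 2 * (n + 1 - j) + del hs (Suc i) k (2 * j)"
      "Y2 = Suc i * F + 1 + band sel (Suc i) k (Suc (2 * j)) * G + 2 * (n + 1 - Suc j) + del hs (Suc i) k (Suc (2 * j))"
      using ye_simps(3)[OF 3(1,2), of sel hs] by (simp_all add: Y1_def Y2_def 3(3) j)
    note b = band_even[where i = "Suc i" and k = k and sel = sel and j = j]
    show ?thesis
    proof (cases "k = 1 \<and> j = c1 (Suc i)")
      \<comment> \<open>The climb of the upper line to band 4 after slot \<open>c1\<close> is the
        only rise between slots.\<close>
      case True
      then have "band sel (Suc i) k (2 * j) * G + 2 * (n + 1 - j) + del hs (Suc i) k (2 * j) < 4 * G"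
        using 3 b(2) by (intro mult_G_less[OF del_le]) auto
      moreover have "band sel (Suc i) k (Suc (2 * j)) = 4" using True b(1) 3 by simp
      ultimately have "Y1 < Y2" unfolding Y by simp
      then show ?thesis using XX True rr j \<open>even g\<close> by (simp add: sgn_def)
    next
      case False
      then have "band sel (Suc i) k (Suc (2 * j)) = band sel (Suc i) k (2 * j)"
        using b(1) 3 by (simp only: if_False)
      then have "Y2 < Y1" unfolding Y using jn del_le[of hs "Suc i" k "Suc (2 * j)"] by simp
      moreover have "\<not> sgn g r" using False rr j \<open>even g\<close> 3 by (auto simp: sgn_def)
      ultimately show ?thesis using XX by simp
    qed
  qed simp
next
  case False
  then obtain j' where j': "g = Suc (2 * j')" by (elim oddE) simp
  define j where "j = Suc j'"
  have j: "Suc g = 2 * j" "g = 2 * j - 1" "1 \<le> j" "j \<le> n" "slot g = j" "slot (Suc g) = j" "Suc g div 2 = j"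
    using g j' by (simp_all add: j_def slot_def)
  have X: "X1 = Suc g * D + ((if hi j r then 2 * (m + 3) else 0) + 2 * (m + 1 - row r) + extra (row r) (lev r) j)"
    "X2 = Suc g * D + ((if hi j (Suc r) then 2 * (m + 3) else 0) + 2 * (m + 1 - row (Suc r)) + extra (row (Suc r)) (lev (Suc r)) j)"
    using j by (auto simp: X1_def X2_def xe_def)
  have e1: "extra i k j \<le> 1" for i k by (simp add: extra_def)
  show ?thesis
  proof (cases rule: line_cases[OF r])
    case (2 i)
    then have i: "i \<le> m" "r = 3 * i" by auto
    have rr: "row (Suc r) = Suc i" "lev (Suc r) = 0" "row r = i"
      using row_lev(3,4)[of 0 i] i by (simp_all add: row_def)
    have Y: "Y1 = Y2" using ye_simps(2)[OF i(1)] by (simp add: Y1_def Y2_def i)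
    have s: "\<not> sgn g r" using False rr by (simp add: sgn_def)
    have lt: "X2 < X1" if "hi j r = hi j (Suc r)"
      using that i(1) e1[of "Suc i" 0] unfolding X rr by auto
    \<comment> \<open>A change of \<open>hi\<close> contributes \<open>2 * (m + 3)\<close>, which
      outweighs the other terms; this occurs in the target.\<close>
    have "X1 \<noteq> X2"
    proof (cases "hi j r = hi j (Suc r)")
      case False
      then show ?thesis unfolding X rr using i(1) e1[of "Suc i" 0] e1[of i "lev r"] by auto
    qed (use lt in simp)
    moreover have "smooth hi hs \<Longrightarrow> X2 < X1" using lt i j(3,4) by (simp add: smooth_def)
    ultimately show ?thesis using Y s by auto
  next
    case (3 i k)
    have rr: "row (Suc r) = Suc i" "lev (Suc r) = Suc k" "row r = Suc i" "lev r = k"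
      using row_lev(3,4)[of "Suc k" i] row_lev(3,4)[of k i] 3 by simp_all
    have I: "1 \<le> Suc i" "Suc i \<le> m" using 3 by auto
    have r': "3 * Suc i - 2 + k = r" "3 * Suc i - 1 + k = Suc r" using 3 by auto
    have Y: "Y1 = Suc i * F + 1 + band sel (Suc i) k (2 * j - 1) * G + 2 * (n + 1 - j) + del hs (Suc i) k (2 * j - 1)"
      "Y2 = Suc i * F + 1 + band sel (Suc i) k (2 * j) * G + 2 * (n + 1 - j) + del hs (Suc i) k (2 * j)"
      using ye_simps(3)[OF 3(1,2), of sel hs] j by (simp_all add: Y1_def Y2_def 3(3))
    have sg: "sgn g r \<longleftrightarrow> act (Suc i) k j" using False rr j(7) by (simp add: sgn_def)
    have okj: "if hs (Suc i) k j then act (Suc i) k j \<and> band sel (Suc i) k (2 * j - 1) = band sel (Suc i) k (2 * j) \<and>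
        \<not> hi j r \<and> hi j (Suc r) else bord (Suc i) k j \<or> hi j r = hi j (Suc r)"
      by (rule mp[OF ok[unfolded jumps_ok_def, THEN spec[of _ "Suc i"], THEN spec[of _ k],
            THEN spec[of _ j], unfolded r']]) (use I 3(2) j(3,4) in simp)
    have j0: "0 < j" using j(3) by simp
    show ?thesis
    proof (cases "hs (Suc i) k j")
      case True
      then have "Y1 = Y2" unfolding Y using okj j0 by (simp add: del_def)
      moreover have "X1 < X2" unfolding X rr using True okj e1[of "Suc i" k] 3 by auto
      ultimately show ?thesis using sg okj True by simp
    next
      case nh: False
      show ?thesis
      proof (cases "bord (Suc i) k j")
        case True
        then have na: "\<not> act (Suc i) k j" using act_not_bord[OF I] by blast
        have "Y1 = Y2" unfolding Y using True band_odd(2)[OF I 3(2) j(3) na] j0 by (simp add: del_def)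
        moreover have ex: "extra (Suc i) k j = 1" "extra (Suc i) (Suc k) j = 0"
          using True 3 ord[OF I] by (auto simp: extra_def bord_def)
        have "X1 \<noteq> X2" unfolding X rr ex using 3 by auto
        moreover have "X2 < X1" if "smooth hi hs"
        proof -
          have "hi j r = hi j (Suc r)"
            using mp[OF that[unfolded smooth_def, THEN spec[of _ "Suc i"], THEN spec[of _ k],
              THEN spec[of _ j], unfolded r']] True I 3(2) j(3,4) by simp
          then show ?thesis unfolding X rr ex by simp
        qed
        ultimately show ?thesis using sg na by auto
      next
        case nb: False
        then have "extra (Suc i) k j = extra (Suc i) (Suc k) j"
          using 3(2) by (auto simp: extra_def bord_def)
        then have XX: "X1 = X2" unfolding X rr using okj nh nb by simp
        show ?thesis
        proof (cases "act (Suc i) k j")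
          case True
          then have "del hs (Suc i) k (2 * j - 1) = 0" "del hs (Suc i) k (2 * j) = 1"
            using nh nb j0 j(4) True by (simp_all add: del_def)
          moreover have "band sel (Suc i) k (2 * j - 1) * G \<le> band sel (Suc i) k (2 * j) * G"
            using band_odd(1)[OF I 3(2) j(3)] by (intro mult_right_mono) auto
          ultimately have "Y1 < Y2" unfolding Y by linarith
          then show ?thesis using XX sg True by simp
        next
          case False
          then have "del hs (Suc i) k (2 * j - 1) = 1" "del hs (Suc i) k (2 * j) = 0"
            using nh nb j0 j(4) False by (simp_all add: del_def)
          then have "Y2 < Y1" unfolding Y using band_odd(2)[OF I 3(2) j(3) False] by simp
          then show ?thesis using XX sg False by simp
        qed
      qed
    qed
  qed simp
qed

lemma grid:
  assumes "jumps_ok hi sel hs"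
  shows "wgrid (2 * n + 2) (3 * m + 2) (xi hi) (et sel hs)"
proof
  show "0 < 2 * n + 2" "0 < 3 * m + 2" by simp_all
  show "xi hi g r < xi hi (Suc g) r'"
    if "g < 2 * n + 2" "r < 3 * m + 2" "r' < 3 * m + 2" for g r r'
    using xe_sep[OF that(2,3)] by (simp add: xi_def)
  show "et sel hs r c < et sel hs (Suc r) c'"
    if "r < 3 * m + 2" "c < 2 * n + 2" "c' < 2 * n + 2" "c \<le> Suc c'" "c' \<le> Suc c" for r c c'
    using ye_sep[OF that(1,4)] by (simp add: et_def)
  show "xi hi 0 r = xi hi 0 0" "xi hi (2 * n + 2) r = xi hi (2 * n + 2) 0" for r
    by (simp_all add: xi_def xe_def)
  show "et sel hs 0 c = et sel hs 0 0" "et sel hs (3 * m + 2) c = et sel hs (3 * m + 2) 0" for c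
    using ye_simps(1,4)[of sel hs] by (simp_all only: et_def)
  fix g r assume g: "Suc g < 2 * n + 2" and r: "Suc r < 3 * m + 2"
  have "xe hi (Suc g) r = xe hi (Suc g) (Suc r) \<and> ye sel hs (Suc r) g \<noteq> ye sel hs (Suc r) (Suc g) \<or>
      ye sel hs (Suc r) g = ye sel hs (Suc r) (Suc g) \<and> xe hi (Suc g) r \<noteq> xe hi (Suc g) (Suc r)"
    using crossing[OF assms g r] by blast
  then show "xi hi (Suc g) r = xi hi (Suc g) (Suc r) \<and> et sel hs (Suc r) g \<noteq> et sel hs (Suc r) (Suc g) \<or>
      et sel hs (Suc r) g = et sel hs (Suc r) (Suc g) \<and> xi hi (Suc g) r \<noteq> xi hi (Suc g) (Suc r)"
    by (simp add: xi_def et_def)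
qed

lemma plus_iff:
  assumes ok: "jumps_ok hi sel hs" and sm: "smooth hi hs"
    and g: "Suc g < 2 * n + 2" and r: "Suc r < 3 * m + 2"
  shows "wgrid.plus (xi hi) (et sel hs) g r \<longleftrightarrow> sgn g r"
  unfolding wgrid.plus_def[OF grid[OF ok]]
  using crossing[OF ok g r] sm by (simp add: xi_def et_def)

lemma nbr_cong:
  assumes "\<And>g r. Suc g < C \<Longrightarrow> Suc r < R \<Longrightarrow> P g r = Q g r"
  shows "nbr C R P = nbr C R Q"
  using assms by (intro ext) (auto simp: nbr_def split: prod.splits)

lemma nbr_plus:
  assumes "jumps_ok hi sel hs" "smooth hi hs"
  shows "nbr (2 * n + 2) (3 * m + 2) (wgrid.plus (xi hi) (et sel hs)) = nbr (2 * n + 2) (3 * m + 2) sgn"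
  using plus_iff[OF assms] by (rule nbr_cong)

end

section \<open>The blocks partition the grid\<close>

context good_triples
begin

lemma bs_cases:
  assumes "(c, w, r, h) \<in> set bs"
  obtains "w = 1" "h = 1" "c < 2 * n + 2" "r < 3 * m + 2" "r = 0 \<or> r = 3 * m + 1 \<or> c = 0 \<or> c = 2 * n + 1"
  | i j k where "i < m" "1 \<le> j" "j \<le> n" "c = 2 * j - 1" "w = 2" "r = Suc (3 * i + k)" "0 < h" "k + h \<le> 3"
      "k = 0 \<or> bord (Suc i) (k - 1) j" "k + h = 3 \<or> bord (Suc i) (k + h - 1) j"
proof -
  have "w = 1 \<and> h = 1 \<and> c < 2 * n + 2 \<and> r < 3 * m + 2 \<and> (r = 0 \<or> r = 3 * m + 1 \<or> c = 0 \<or> c = 2 * n + 1) \<or>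
      (\<exists>i. 1 \<le> i \<and> i \<le> m \<and> (c, w, r, h) \<in> set (rowblocks i))"
    using assms unfolding bs_def by (auto simp: less_Suc_eq_le simp del: upt_Suc)
  then consider "w = 1" "h = 1" "c < 2 * n + 2" "r < 3 * m + 2" "r = 0 \<or> r = 3 * m + 1 \<or> c = 0 \<or> c = 2 * n + 1"
    | i where "1 \<le> i" "i \<le> m" "(c, w, r, h) \<in> set (rowblocks i)"
    by blast
  then show ?thesis
  proof cases
    case (2 i)
    then have "w = 1 \<and> h = 1 \<and> c < 2 * n + 2 \<and> r < 3 * m + 2 \<and> (r = 0 \<or> r = 3 * m + 1 \<or> c = 0 \<or> c = 2 * n + 1) \<or>
        (\<exists>j. 1 \<le> j \<and> j \<le> n \<and> (c, w, r, h) \<in> set (blk i j))"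
      unfolding rowblocks_def by (auto simp: less_Suc_eq_le simp del: upt_Suc)
    then consider "w = 1" "h = 1" "c < 2 * n + 2" "r < 3 * m + 2" "r = 0 \<or> r = 3 * m + 1 \<or> c = 0 \<or> c = 2 * n + 1"
      | j where "1 \<le> j" "j \<le> n" "(c, w, r, h) \<in> set (blk i j)"
      by blast
    then show ?thesis
    proof cases
      case (2 j)
      obtain i' where i: "i = Suc i'" "i' < m" using \<open>1 \<le> i\<close> \<open>i \<le> m\<close> by (cases i) auto
      have "j < c1 i \<and> r = Suc (3 * i' + 0) \<and> h = 1 \<or> j < c1 i \<and> r = Suc (3 * i' + 1) \<and> h = 2 \<or>
          j = c1 i \<and> r = Suc (3 * i' + 0) \<and> h = 3 \<or>
          c1 i < j \<and> r = Suc (3 * i' + 0) \<and> h = 2 \<or> c1 i < j \<and> r = Suc (3 * i' + 2) \<and> h = 1"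
        using 2(3) unfolding blk_def i(1)
        by (cases "j < c1 (Suc i')"; cases "j = c1 (Suc i')") (simp_all, auto)
      then consider "j < c1 i" "r = Suc (3 * i' + 0)" "h = 1" | "j < c1 i" "r = Suc (3 * i' + 1)" "h = 2"
        | "j = c1 i" "r = Suc (3 * i' + 0)" "h = 3"
        | "c1 i < j" "r = Suc (3 * i' + 0)" "h = 2" | "c1 i < j" "r = Suc (3 * i' + 2)" "h = 1"
        by argo
      moreover have cw: "c = 2 * j - 1" "w = 2" using 2(3) by (auto simp: blk_def split: if_splits)
      ultimately show ?thesis
      proof cases
        case 1
        show ?thesis by (rule that(2)[OF i(2) 2(1,2) cw 1(2)]) (use 1 in \<open>simp_all add: bord_def i(1)\<close>)
      next
        case 22: 2
        show ?thesis by (rule that(2)[OF i(2) 2(1,2) cw 22(2)]) (use 22 in \<open>simp_all add: bord_def i(1)\<close>)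
      next
        case 3
        show ?thesis by (rule that(2)[OF i(2) 2(1,2) cw 3(2)]) (use 3 in \<open>simp_all add: bord_def i(1)\<close>)
      next
        case 4
        show ?thesis by (rule that(2)[OF i(2) 2(1,2) cw 4(2)]) (use 4 in \<open>simp_all add: bord_def i(1)\<close>)
      next
        case 5
        show ?thesis by (rule that(2)[OF i(2) 2(1,2) cw 5(2)]) (use 5 in \<open>simp_all add: bord_def i(1)\<close>)
      qed
    next
      case 1
      then show ?thesis by (rule that(1))
    qed
  next
    case 1
    then show ?thesis by (rule that(1))
  qed
qed

lemma ye_border:
  assumes "i < m" "k < 2" "bord (Suc i) k j" "1 \<le> j" "j \<le> n"
  shows "ye sel hs (Suc (3 * i + Suc k)) (2 * j - 1) = ye sel hs (Suc (3 * i + Suc k)) (2 * j)"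
proof -
  have "\<not> act (Suc i) k j" using assms act_not_bord[of "Suc i" k j] by auto
  then have "band sel (Suc i) k (2 * j - 1) = band sel (Suc i) k (2 * j)"
    using assms band_odd(2)[of "Suc i" k j sel] by simp
  moreover have "slot (2 * j - 1) = j" using assms(4) by (simp add: slot_def)
  ultimately show ?thesis
    using assms(3,4) unfolding ye_simps(3)[OF assms(1,2)] by (simp add: del_def)
qed

lemma length_blk: "length (concat (map block_cells (blk i j))) = 6"
  by (simp add: blk_def del: upt_Suc)

lemma set_blk:
  assumes "1 \<le> i" "1 \<le> j"
  shows "set (concat (map block_cells (blk i j))) = {2 * j - 1..2 * j} \<times> {3 * i - 2..3 * i}"
proof -
  have j: "{2 * j - 1..<2 * j - 1 + 2} = {2 * j - 1..2 * j}" using assms by auto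
  have l1: "{3 * i - 2..<3 * i - 2 + 1} \<union> {3 * i - 1..<3 * i - 1 + 2} = {3 * i - 2..3 * i}"
    and l2: "{3 * i - 2..<3 * i - 2 + 3} = {3 * i - 2..3 * i}"
    and l3: "{3 * i - 2..<3 * i - 2 + 2} \<union> {3 * i..<3 * i + 1} = {3 * i - 2..3 * i}" using assms by auto
  have e: "set (concat (map block_cells [b])) = set (block_cells b)"
    "set (concat (map block_cells [b, b'])) = set (block_cells b) \<union> set (block_cells b')" for b b'
    by simp_all
  consider "j < c1 i" | "j = c1 i" | "c1 i < j" by linarith
  then show ?thesis
  proof cases
    case 1
    then have "blk i j = [(2 * j - 1, 2, 3 * i - 2, 1), (2 * j - 1, 2, 3 * i - 1, 2)]" by (simp add: blk_def)
    then show ?thesis by (simp only: e set_block_cells j Sigma_Un_distrib2[symmetric] l1)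
  next
    case 2
    then have "blk i j = [(2 * j - 1, 2, 3 * i - 2, 3)]" by (simp add: blk_def)
    then show ?thesis by (simp only: e set_block_cells j l2)
  next
    case 3
    then have "blk i j = [(2 * j - 1, 2, 3 * i - 2, 2), (2 * j - 1, 2, 3 * i, 1)]" by (simp add: blk_def)
    then show ?thesis by (simp only: e set_block_cells j Sigma_Un_distrib2[symmetric] l3)
  qed
qed

lemma length_rowblocks: "length (concat (map block_cells (rowblocks i))) = 6 * n + 6"
proof -
  have "length (concat (map block_cells (concat (map (blk i) js)))) = 6 * length js" for js
    by (induction js) (use length_blk[of i] in \<open>auto simp: map_concat\<close>)
  then show ?thesis by (simp add: rowblocks_def numeral_3_eq_3)
qed

lemma set_rowblocks: "1 \<le> i \<Longrightarrow>
    set (concat (map block_cells (rowblocks i))) = {..<2 * n + 2} \<times> {3 * i - 2..3 * i}"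
proof -
  assume i: "1 \<le> i"
  have "set (concat (map block_cells (concat (map (blk i) js)))) = (\<Union>j\<in>set js. {2 * j - 1..2 * j}) \<times> {3 * i - 2..3 * i}"
    if "\<forall>j\<in>set js. 1 \<le> j" for js
    using that set_blk[OF i] by (induction js) (auto simp: map_concat)
  from this[of "[1..<Suc n]"] have bset: "set (concat (map block_cells (concat (map (blk i) [1..<Suc n])))) =
      (\<Union>j\<in>{1..n}. {2 * j - 1..2 * j}) \<times> {3 * i - 2..3 * i}" by (simp add: atLeastLessThanSuc_atLeastAtMost del: upt_Suc)
  have un: "(\<Union>j\<in>{1..n}. {2 * j - 1..2 * j}) = {1..2 * n}"
  proof
    show "{1..2 * n} \<subseteq> (\<Union>j\<in>{1..n}. {2 * j - 1..2 * j})"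
    proof
      fix c assume "c \<in> {1..2 * n}"
      moreover define q where "q = (c + 1) div 2"
      have "2 * q \<le> c + 1" "c + 1 < 2 * q + 2" unfolding q_def by presburger+
      ultimately have "c \<in> {2 * q - 1..2 * q}" "q \<in> {1..n}" by auto
      then show "c \<in> (\<Union>j\<in>{1..n}. {2 * j - 1..2 * j})" by (intro UN_I[of q])
    qed
    show "(\<Union>j\<in>{1..n}. {2 * j - 1..2 * j}) \<subseteq> {1..2 * n}"
      by (rule UN_least) auto
  qed
  have cols: "{..<2 * n + 2} = {0} \<union> ({1..2 * n} \<union> {2 * n + 1})" by auto
  have lev: "{3 * i - 2..3 * i} = {3 * i - 2, 3 * i - 1, 3 * i}" using i by auto
  have single: "set (concat (map block_cells (map (\<lambda>k. (c, 1, 3 * i - 2 + k, 1)) [0..<3]))) =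
      {c} \<times> {3 * i - 2..3 * i}" for c
    unfolding lev using i by (auto simp: numeral_3_eq_3)
  have "set (concat (map block_cells (rowblocks i))) = {0} \<times> {3 * i - 2..3 * i} \<union>
      ({1..2 * n} \<times> {3 * i - 2..3 * i} \<union> {2 * n + 1} \<times> {3 * i - 2..3 * i})"
    unfolding rowblocks_def map_append concat_append set_append single bset un ..
  then show ?thesis unfolding cols Sigma_Un_distrib1 .
qed

text \<open>Distinctness follows by counting: the list is as long as its set of elements is
  large.\<close>

lemma bs_cells:
  "set (concat (map block_cells bs)) = {..<2 * n + 2} \<times> {..<3 * m + 2}"
  "distinct (concat (map block_cells bs))"
proof -
  let ?top = "\<lambda>r. concat (map block_cells (map (\<lambda>c. (c, 1, r, 1)) [0..<2 * n + 2]))"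
  let ?rows = "\<lambda>is. concat (map block_cells (concat (map rowblocks is)))"
  have "set (concat (map block_cells (map (\<lambda>c. (c, 1, r, 1)) cs))) = set cs \<times> {r}"
    "length (concat (map block_cells (map (\<lambda>c. (c, 1, r, 1)) cs))) = length cs" for r cs
    by (induction cs) auto
  from this[where cs = "[0..<2 * n + 2]"]
  have top: "set (?top r) = {..<2 * n + 2} \<times> {r}" "length (?top r) = 2 * n + 2" for r
    by (simp_all add: atLeast0LessThan del: upt_Suc)
  have rows: "length (?rows is) = (6 * n + 6) * length is" for "is"
    by (induction "is") (use length_rowblocks in auto)
  have "set (?rows is) = {..<2 * n + 2} \<times> (\<Union>i\<in>set is. {3 * i - 2..3 * i})"
    if "\<forall>i\<in>set is. 1 \<le> i" for "is"
    using that set_rowblocks by (induction "is") auto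
  from this[of "[1..<Suc m]"] have rset: "set (?rows [1..<Suc m]) = {..<2 * n + 2} \<times> (\<Union>i\<in>{1..m}. {3 * i - 2..3 * i})"
    by (simp add: atLeastLessThanSuc_atLeastAtMost del: upt_Suc)
  have un: "(\<Union>i\<in>{1..m}. {3 * i - 2..3 * i}) = {1..3 * m}"
  proof
    show "{1..3 * m} \<subseteq> (\<Union>i\<in>{1..m}. {3 * i - 2..3 * i})"
    proof
      fix c assume "c \<in> {1..3 * m}"
      moreover define q where "q = (c + 2) div 3"
      have "3 * q \<le> c + 2" "c + 2 < 3 * q + 3" unfolding q_def by presburger+
      ultimately have "c \<in> {3 * q - 2..3 * q}" "q \<in> {1..m}" by auto
      then show "c \<in> (\<Union>i\<in>{1..m}. {3 * i - 2..3 * i})" by (intro UN_I[of q])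
    qed
    show "(\<Union>i\<in>{1..m}. {3 * i - 2..3 * i}) \<subseteq> {1..3 * m}"
      by (rule UN_least) auto
  qed
  have lv: "{..<3 * m + 2} = {0} \<union> ({1..3 * m} \<union> {3 * m + 1})" by auto
  have bs: "concat (map block_cells bs) = ?top 0 @ ?rows [1..<Suc m] @ ?top (3 * m + 1)"
    by (simp add: bs_def del: upt_Suc)
  show s: "set (concat (map block_cells bs)) = {..<2 * n + 2} \<times> {..<3 * m + 2}"
    unfolding bs set_append top rset un lv Sigma_Un_distrib2 ..
  have "length (concat (map block_cells bs)) = (2 * n + 2) * (3 * m + 2)"
    unfolding bs length_append top rows by (simp add: algebra_simps)
  then have "card (set (concat (map block_cells bs))) = length (concat (map block_cells bs))"
    unfolding s by (simp add: card_cartesian_product)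
  then show "distinct (concat (map block_cells bs))" by (rule card_distinct)
qed

lemma blocked:
  assumes "jumps_ok hi sel hs"
  shows "blocked_grid (2 * n + 2) (3 * m + 2) (xi hi) (et sel hs) bs"
proof -
  interpret wgrid "2 * n + 2" "3 * m + 2" "xi hi" "et sel hs" by (rule grid[OF assms])
  show ?thesis
  proof
    fix c w r h assume "(c, w, r, h) \<in> set bs"
    then show "0 < w \<and> 0 < h \<and> c + w \<le> 2 * n + 2 \<and> r + h \<le> 3 * m + 2 \<and>
      (\<forall>r'\<in>{r..<r + h}. xi hi c r' = xi hi c r \<and> xi hi (c + w) r' = xi hi (c + w) r) \<and>
      (\<forall>c'\<in>{c..<c + w}. et sel hs r c' = et sel hs r c \<and> et sel hs (r + h) c' = et sel hs (r + h) c)"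
    proof (cases rule: bs_cases)
      case (2 i j k)
      have row: "row r' = Suc i" if "r' \<in> {r..<r + h}" for r'
      proof -
        have "r' = Suc (3 * i + (r' - Suc (3 * i)))" "r' - Suc (3 * i) < 3" using that 2 by auto
        then show ?thesis using row_lev(3)[of "r' - Suc (3 * i)" i] by simp
      qed
      have x: "xi hi c r' = xi hi c r \<and> xi hi (c + w) r' = xi hi (c + w) r" if "r' \<in> {r..<r + h}" for r'
        using row[OF that] row[of r] 2 by (simp add: xi_def xe_def)
      have y0: "ye sel hs (Suc (3 * i + l)) (2 * j - 1) = ye sel hs (Suc (3 * i + l)) (2 * j)"
        if "l = 0 \<or> l = 3 \<or> l < 3 \<and> bord (Suc i) (l - 1) j" for l
      proof (cases "l = 0 \<or> l = 3")
        case True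
        then show ?thesis using ye_simps(2)[of i] ye_simps(2)[of "Suc i"] 2(1) by auto
      next
        case False
        then have "l = Suc (l - 1)" "l - 1 < 2" "bord (Suc i) (l - 1) j" using that by auto
        then show ?thesis using ye_border[OF 2(1), of "l - 1" j sel hs] 2(2,3) by simp
      qed
      have c: "c' = c \<or> c' = 2 * j" if "c' \<in> {c..<c + w}" for c' using that 2 by auto
      have y1: "et sel hs r (2 * j) = et sel hs r c" using y0[of k] 2 by (auto simp: et_def)
      have rh: "r + h = Suc (3 * i + (k + h))" using 2 by simp
      have y2: "et sel hs (r + h) (2 * j) = et sel hs (r + h) c"
      proof -
        have "k + h = 0 \<or> k + h = 3 \<or> k + h < 3 \<and> bord (Suc i) (k + h - 1) j"
          using 2(8,10) by (cases "k + h = 3") auto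
        then show ?thesis unfolding rh using y0[of "k + h"] 2(4) by (simp add: et_def)
      qed
      have y: "et sel hs r c' = et sel hs r c \<and> et sel hs (r + h) c' = et sel hs (r + h) c"
        if "c' \<in> {c..<c + w}" for c'
        using c[OF that] y1 y2 by (elim disjE) simp_all
      have "0 < w" "0 < h" "c + w \<le> 2 * n + 2" "r + h \<le> 3 * m + 2" using 2 by auto
      then show ?thesis using x y by (intro conjI ballI) (simp_all only:)
    qed simp
  qed (use bs_cells in auto)
qed

end

section \<open>Extended dual graphs and monotone coordinate changes\<close>

text \<open>Empty sets of bounds give unbounded intervals, so that rectangles and the unbounded
  parts of the sides have the same form.\<close>

definition ivl :: "real set \<Rightarrow> real set \<Rightarrow> real set" where
  "ivl lo hi = {x. (\<forall>a\<in>lo. a \<le> x) \<and> (\<forall>b\<in>hi. x \<le> b)}"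

lemma eventually_at_right_0_le:
  "(\<forall>\<^sub>F e in at_right (0::real). a \<le> t + e) \<longleftrightarrow> a \<le> t"
  "(\<forall>\<^sub>F e in at_right (0::real). t + e \<le> a) \<longleftrightarrow> t < a"
  "(\<forall>\<^sub>F e in at_right (0::real). a \<le> t - e) \<longleftrightarrow> a < t"
  "(\<forall>\<^sub>F e in at_right (0::real). t - e \<le> a) \<longleftrightarrow> t \<le> a"
proof -
  have *: "(\<forall>\<^sub>F e in at_right (0::real). c \<le> e) \<longleftrightarrow> c \<le> 0" for c :: real
  proof
    assume "\<forall>\<^sub>F e in at_right (0::real). c \<le> e"
    then obtain b where b: "0 < b" "\<And>e. 0 < e \<Longrightarrow> e < b \<Longrightarrow> c \<le> e"
      by (auto simp: eventually_at_right_field)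
    show "c \<le> 0"
    proof (rule ccontr)
      assume "\<not> c \<le> 0"
      then show False using b(1) b(2)[of "min b c / 2"] by (cases "b \<le> c") auto
    qed
  next
    assume "c \<le> 0"
    then show "\<forall>\<^sub>F e in at_right (0::real). c \<le> e"
      by (auto simp: eventually_at_right_field intro!: exI[of _ 1])
  qed
  have **: "(\<forall>\<^sub>F e in at_right (0::real). e \<le> c) \<longleftrightarrow> 0 < c" for c :: real
  proof
    assume "\<forall>\<^sub>F e in at_right (0::real). e \<le> c"
    then obtain b where b: "0 < b" "\<And>e. 0 < e \<Longrightarrow> e < b \<Longrightarrow> e \<le> c"
      by (auto simp: eventually_at_right_field)
    then show "0 < c" using b(2)[of "b / 2"] by auto
  next
    assume "0 < c"
    then show "\<forall>\<^sub>F e in at_right (0::real). e \<le> c"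
      by (auto simp: eventually_at_right_field intro!: exI[of _ c])
  qed
  show "(\<forall>\<^sub>F e in at_right (0::real). a \<le> t + e) \<longleftrightarrow> a \<le> t"
    using *[of "a - t"] by (simp add: algebra_simps)
  show "(\<forall>\<^sub>F e in at_right (0::real). t + e \<le> a) \<longleftrightarrow> t < a"
    using **[of "a - t"] by (simp add: algebra_simps)
  show "(\<forall>\<^sub>F e in at_right (0::real). a \<le> t - e) \<longleftrightarrow> a < t"
    using **[of "t - a"] by (simp add: algebra_simps)
  show "(\<forall>\<^sub>F e in at_right (0::real). t - e \<le> a) \<longleftrightarrow> t \<le> a"
    using *[of "t - a"] by (simp add: algebra_simps)
qed

lemma eventually_ivl:
  assumes "finite lo" "finite hi"
  shows "(\<forall>\<^sub>F e in at_right 0. t + e \<in> ivl lo hi) \<longleftrightarrow> (\<forall>a\<in>lo. a \<le> t) \<and> (\<forall>b\<in>hi. t < b)"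
    "(\<forall>\<^sub>F e in at_right 0. t - e \<in> ivl lo hi) \<longleftrightarrow> (\<forall>a\<in>lo. a < t) \<and> (\<forall>b\<in>hi. t \<le> b)"
  using assms
  by (simp_all add: ivl_def eventually_conj_iff eventually_ball_finite_distrib eventually_at_right_0_le)

lemma covers_quadrant_Times:
  "covers_quadrant (A \<times> B) p q \<longleftrightarrow>
    (if q mod 4 = 0 \<or> q mod 4 = 3 then \<forall>\<^sub>F e in at_right 0. fst p + e \<in> A
     else \<forall>\<^sub>F e in at_right 0. fst p - e \<in> A) \<and>
    (if q mod 4 = 0 \<or> q mod 4 = 1 then \<forall>\<^sub>F e in at_right 0. snd p + e \<in> B
     else \<forall>\<^sub>F e in at_right 0. snd p - e \<in> B)"
proof -
  have "q mod 4 < 4" by simp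
  then consider "q mod 4 = 0" | "q mod 4 = 1" | "q mod 4 = 2" | "q mod 4 = 3" by linarith
  then show ?thesis
    by cases (simp_all add: covers_quadrant_def mem_Times_iff eventually_conj_iff numeral_3_eq_3 numeral_2_eq_2)
qed

text \<open>Expressed by bounds and not as an image under \<open>f\<close>: whether a product covers
  a quadrant at a point depends only on comparisons with the bounds, and these are preserved by
  \<open>f\<close>.\<close>

definition shifted :: "(real \<Rightarrow> real) \<Rightarrow> (real \<times> real) set \<Rightarrow> (real \<times> real) set \<Rightarrow> bool" where
  "shifted f S T \<longleftrightarrow> (\<exists>lo hi lo' hi'. finite lo \<and> finite hi \<and> finite lo' \<and> finite hi' \<and>
     S = ivl lo hi \<times> ivl lo' hi' \<and> T = ivl (f ` lo) (f ` hi) \<times> ivl lo' hi')"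

lemma shifted_mem:
  assumes "strict_mono f" "shifted f S T"
  shows "(f x, y) \<in> T \<longleftrightarrow> (x, y) \<in> S"
  using assms by (auto simp: shifted_def ivl_def strict_mono_less_eq)

lemma shifted_covers:
  assumes "strict_mono f" "shifted f S T"
  shows "covers_quadrant T (f x, y) q \<longleftrightarrow> covers_quadrant S (x, y) q"
proof -
  obtain lo hi lo' hi' where *: "finite lo" "finite hi" "finite lo'" "finite hi'"
    "S = ivl lo hi \<times> ivl lo' hi'" "T = ivl (f ` lo) (f ` hi) \<times> ivl lo' hi'"
    using assms(2) unfolding shifted_def by blast
  show ?thesis unfolding *(5,6) covers_quadrant_Times
    using *(1-4) assms(1) by (simp add: eventually_ivl strict_mono_less_eq strict_mono_less)
qed

lemma shifted_area:
  assumes "f (x_lo R) = x_lo S" "f (x_hi R) = x_hi S" "y_lo R = y_lo S" "y_hi R = y_hi S"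
  shows "shifted f (area R) (area S)"
proof -
  have "area Q = ivl {x_lo Q} {x_hi Q} \<times> ivl {y_lo Q} {y_hi Q}" for Q
    by (auto simp: area_Times ivl_def)
  then show ?thesis unfolding shifted_def using assms
    by (intro exI[of _ "{x_lo R}"] exI[of _ "{x_hi R}"] exI[of _ "{y_lo R}"] exI[of _ "{y_hi R}"]) simp
qed

lemma shifted_empty:
  assumes "strict_mono f"
  shows "shifted f {} {}"
proof -
  have "f 0 < f 1" using assms by (simp add: strict_mono_less)
  then have "ivl {1} {0} = {}" "ivl {f 1} {f 0} = {}" by (auto simp: ivl_def)
  then show ?thesis unfolding shifted_def
    by (intro exI[of _ "{1}"] exI[of _ "{0}"] exI[of _ "{}"] exI[of _ "{}"]) simp
qed

lemma shifted_side_part: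
  assumes "f (x_lo B) = x_lo B" "f (x_hi B) = x_hi B"
  shows "shifted f (side_part B s) (side_part B s)"
proof (cases s)
  case North
  then show ?thesis unfolding shifted_def using assms
    by (intro exI[of _ "{}"] exI[of _ "{x_hi B}"] exI[of _ "{y_hi B}"] exI[of _ "{}"]) (auto simp: ivl_def)
next
  case South
  then show ?thesis unfolding shifted_def using assms
    by (intro exI[of _ "{x_lo B}"] exI[of _ "{}"] exI[of _ "{}"] exI[of _ "{y_lo B}"]) (auto simp: ivl_def)
next
  case West
  then show ?thesis unfolding shifted_def using assms
    by (intro exI[of _ "{}"] exI[of _ "{x_lo B}"] exI[of _ "{}"] exI[of _ "{y_hi B}"]) (auto simp: ivl_def)
next
  case East
  then show ?thesis unfolding shifted_def using assms
    by (intro exI[of _ "{x_hi B}"] exI[of _ "{}"] exI[of _ "{y_lo B}"] exI[of _ "{}"]) (auto simp: ivl_def)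
qed

text \<open>Only the parts of \<open>u\<close>, \<open>v\<close> and \<open>w\<close> have to be
  related by \<open>f\<close>, which leaves room for a different \<open>f\<close> for every triple.
  Surjectivity pulls the meeting point back.\<close>

lemma dual_rotation_shifted:
  assumes f: "strict_mono f" "surj f"
    and sh: "\<And>z. z \<in> {u, v, w} \<Longrightarrow> shifted f (node_part rs B z) (node_part rs' B' z)"
  shows "dual_rotation rs B u v w \<longleftrightarrow> dual_rotation rs' B' u v w"
proof -
  have cov: "covers_quadrant (node_part rs B z) p q \<longleftrightarrow> covers_quadrant (node_part rs' B' z) (f (fst p), snd p) q"
    if "z \<in> {u, v, w}" for z p q
    using shifted_covers[OF f(1) sh[OF that], of "fst p" "snd p" q] by simp
  show ?thesis
  proof
    assume "dual_rotation rs B u v w"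
    then show "dual_rotation rs' B' u v w" unfolding dual_rotation_def by (auto simp: cov)
  next
    assume "dual_rotation rs' B' u v w"
    then obtain p a l where d: "distinct [u, v, w]" and p: "1 \<le> l"
      "covers_quadrant (node_part rs' B' w) p a"
      "\<And>j. j \<in> {1..l} \<Longrightarrow> covers_quadrant (node_part rs' B' u) p (a + j)"
      "covers_quadrant (node_part rs' B' v) p (a + l + 1)"
      unfolding dual_rotation_def by blast
    obtain x where x: "fst p = f x" using f(2) by (metis surjD)
    have "covers_quadrant (node_part rs B w) (x, snd p) a"
      "\<And>j. j \<in> {1..l} \<Longrightarrow> covers_quadrant (node_part rs B u) (x, snd p) (a + j)"
      "covers_quadrant (node_part rs B v) (x, snd p) (a + l + 1)"
      using p x by (simp_all add: cov flip: x)
    then show "dual_rotation rs B u v w" unfolding dual_rotation_def using d p(1) by blast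
  qed
qed

lemma covers_quadrant_closed:
  assumes "closed S" "covers_quadrant S p q"
  shows "p \<in> S"
proof -
  define d :: "real \<times> real" where "d = [(1, 1), (-1, 1), (-1, -1), (1, -1)] ! (q mod 4)"
  have "((\<lambda>e. p + e *\<^sub>R d) \<longlongrightarrow> p + 0 *\<^sub>R d) (at_right 0)"
    by (intro tendsto_intros)
  then show ?thesis
    using assms Lim_in_closed_set[OF assms(1), of "\<lambda>e. p + e *\<^sub>R d" "at_right 0" "p + 0 *\<^sub>R d"]
    by (simp add: covers_quadrant_def d_def trivial_limit_at_right_real)
qed

text \<open>Induction on the largest point: beyond the previous maximum the map continues linearly,
  with the slope \<open>k\<close> that reaches the new value.\<close>

lemma extend_strict_mono:
  fixes h :: "real \<Rightarrow> real"
  assumes "finite A" "\<And>a b. a \<in> A \<Longrightarrow> b \<in> A \<Longrightarrow> a < b \<Longrightarrow> h a < h b"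
  shows "\<exists>f. strict_mono f \<and> surj f \<and> (\<forall>a\<in>A. f a = h a)"
  using assms
proof (induction A rule: finite_linorder_max_induct)
  case empty
  show ?case by (intro exI[of _ id]) (simp add: strict_mono_def)
next
  case (insert b A)
  then obtain f where f: "strict_mono f" "surj f" "\<And>a. a \<in> A \<Longrightarrow> f a = h a" by auto
  show ?case
  proof (cases "A = {}")
    case True
    have "surj (\<lambda>x. x + (h b - b))" unfolding surj_def
      by (rule allI, rule_tac x = "y - (h b - b)" in exI) simp
    moreover have "strict_mono (\<lambda>x. x + (h b - b))" by (simp add: strict_mono_def)
    ultimately show ?thesis using True by (intro exI[of _ "\<lambda>x. x + (h b - b)"]) simp
  next
    case False
    define a where "a = Max A"
    have a: "a \<in> A" "\<And>x. x \<in> A \<Longrightarrow> x \<le> a" using insert.hyps(1) False by (auto simp: a_def)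
    have ab: "a < b" "f a < h b" using a insert.hyps(2) insert.prems[of a b] f(3) by auto
    define k where "k = (h b - f a) / (b - a)"
    have k: "0 < k" using ab by (simp add: k_def)
    define g where "g x = (if x \<le> a then f x else f a + (x - a) * k)" for x
    have lt: "g x < g y" if "x < y" for x y
    proof (cases "y \<le> a")
      case True
      then show ?thesis using that f(1) by (simp add: g_def strict_mono_less)
    next
      case False
      show ?thesis
      proof (cases "x \<le> a")
        case True
        then have "f x \<le> f a" "0 < (y - a) * k" using f(1) False k by (simp_all add: strict_mono_less_eq)
        then show ?thesis using True False by (simp add: g_def)
      next
        case False
        then show ?thesis using that k by (simp add: g_def)
      qed
    qed
    have "\<exists>x. y = g x" for y
    proof (cases "y \<le> f a")
      case True
      obtain x where x: "y = f x" using f(2) by (metis surjD)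
      then have "x \<le> a" using True f(1) by (simp add: strict_mono_less_eq)
      then show ?thesis using x by (auto simp: g_def)
    next
      case False
      then have "a < a + (y - f a) / k" using k by simp
      then show ?thesis using k by (intro exI[of _ "a + (y - f a) / k"]) (simp add: g_def)
    qed
    moreover have "g b = h b" using ab by (simp add: g_def k_def)
    moreover have "g x = h x" if "x \<in> A" for x using a(2)[OF that] f(3)[OF that] by (simp add: g_def)
    ultimately show ?thesis using lt by (intro exI[of _ g]) (auto simp: strict_mono_def surj_def)
  qed
qed

lemma extend_strict_mono_family:
  fixes p q :: "'i \<Rightarrow> real"
  assumes "finite I" "\<And>i j. i \<in> I \<Longrightarrow> j \<in> I \<Longrightarrow> p i < p j \<Longrightarrow> q i < q j"
    "\<And>i j. i \<in> I \<Longrightarrow> j \<in> I \<Longrightarrow> p i = p j \<Longrightarrow> q i = q j"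
  shows "\<exists>f. strict_mono f \<and> surj f \<and> (\<forall>i\<in>I. f (p i) = q i)"
proof -
  define h where "h x = q (SOME i. i \<in> I \<and> p i = x)" for x
  have h: "h (p i) = q i" if "i \<in> I" for i
  proof -
    have "(SOME j. j \<in> I \<and> p j = p i) \<in> I \<and> p (SOME j. j \<in> I \<and> p j = p i) = p i"
      by (rule someI[of "\<lambda>j. j \<in> I \<and> p j = p i" i]) (use that in simp)
    then show ?thesis using assms(3)[OF _ that] unfolding h_def by blast
  qed
  have "\<exists>f. strict_mono f \<and> surj f \<and> (\<forall>a\<in>p ` I. f a = h a)"
    by (rule extend_strict_mono) (use assms(1,2) h in auto)
  then show ?thesis using h by auto
qed

lemma share_edge_shifted:
  assumes f: "strict_mono f" "surj f"
    and sh: "shifted f (area R) (area R')" "shifted f (area S) (area S')"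
    and R: "proper_rect R" "proper_rect S" "apart R S" "proper_rect R'" "proper_rect S'" "apart R' S'"
  shows "share_edge (area R) (area S) \<longleftrightarrow> share_edge (area R') (area S')"
proof -
  have m: "(f x, y) \<in> area R' \<inter> area S' \<longleftrightarrow> (x, y) \<in> area R \<inter> area S" for x y
    using shifted_mem[OF f(1) sh(1)] shifted_mem[OF f(1) sh(2)] by auto
  define g where "g = (\<lambda>(x, y). (f x, y :: real))"
  have "inj f" using f(1) by (rule strict_mono_imp_inj_on)
  then have g: "inj g" "surj g" "\<And>p. g p \<in> area R' \<inter> area S' \<longleftrightarrow> p \<in> area R \<inter> area S"
    using f(2) m by (auto simp: g_def inj_on_def surj_def split: prod.splits)
  have "(\<exists>p q. p \<noteq> q \<and> {p, q} \<subseteq> area R \<inter> area S) \<longleftrightarrow> (\<exists>p q. p \<noteq> q \<and> {p, q} \<subseteq> area R' \<inter> area S')"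
  proof
    assume "\<exists>p q. p \<noteq> q \<and> {p, q} \<subseteq> area R \<inter> area S"
    then obtain p q where "p \<noteq> q" "p \<in> area R \<inter> area S" "q \<in> area R \<inter> area S" by blast
    then have "g p \<noteq> g q" "g p \<in> area R' \<inter> area S'" "g q \<in> area R' \<inter> area S'"
      using inj_eq[OF g(1)] g(3)[of p] g(3)[of q] by simp_all
    then show "\<exists>p q. p \<noteq> q \<and> {p, q} \<subseteq> area R' \<inter> area S'" by blast
  next
    assume "\<exists>p q. p \<noteq> q \<and> {p, q} \<subseteq> area R' \<inter> area S'"
    then obtain p q where pq: "p \<noteq> q" "p \<in> area R' \<inter> area S'" "q \<in> area R' \<inter> area S'" by blast
    obtain p' q' where "p = g p'" "q = g q'" using g(2) by (metis surjD)
    then have "p' \<noteq> q'" "p' \<in> area R \<inter> area S" "q' \<in> area R \<inter> area S"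
      using pq g(3)[of p'] g(3)[of q'] by auto
    then show "\<exists>p q. p \<noteq> q \<and> {p, q} \<subseteq> area R \<inter> area S" by blast
  qed
  then show ?thesis using adjacent_iff[OF R(1-3)] adjacent_iff[OF R(4-6)] by (simp add: adjacent_def)
qed

lemma side_segment_shifted:
  assumes f: "strict_mono f" "surj f" "f (x_lo B) = x_lo B" "f (x_hi B) = x_hi B"
    and sh: "shifted f S T"
  shows "S \<inter> side_segment B s \<noteq> {} \<longleftrightarrow> T \<inter> side_segment B s \<noteq> {}"
proof -
  have le: "f x \<le> x_hi B \<longleftrightarrow> x \<le> x_hi B" "x_lo B \<le> f x \<longleftrightarrow> x_lo B \<le> x"
    "f x = x_hi B \<longleftrightarrow> x = x_hi B" "f x = x_lo B \<longleftrightarrow> x = x_lo B" for x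
    using strict_mono_less_eq[OF f(1), of x "x_hi B"] strict_mono_less_eq[OF f(1), of "x_lo B" x]
      strict_mono_eq[OF f(1), of x "x_hi B"] strict_mono_eq[OF f(1), of x "x_lo B"] f(3,4) by simp_all
  have seg: "(f x, y) \<in> side_segment B s \<longleftrightarrow> (x, y) \<in> side_segment B s" for x y
    by (cases s) (auto simp: le)
  show ?thesis
  proof
    assume "S \<inter> side_segment B s \<noteq> {}"
    then obtain x y where "(x, y) \<in> S" "(x, y) \<in> side_segment B s" by auto
    then have "(f x, y) \<in> T \<inter> side_segment B s" using shifted_mem[OF f(1) sh] seg by simp
    then show "T \<inter> side_segment B s \<noteq> {}" by blast
  next
    assume "T \<inter> side_segment B s \<noteq> {}"
    then obtain x' y where xy: "(x', y) \<in> T" "(x', y) \<in> side_segment B s" by auto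
    obtain x where "x' = f x" using f(2) by (metis surjD)
    then have "(x, y) \<in> S \<inter> side_segment B s" using xy shifted_mem[OF f(1) sh] seg by simp
    then show "S \<inter> side_segment B s \<noteq> {}" by blast
  qed
qed

section \<open>Input and target have the same extended dual graph\<close>

context good_triples
begin

definition hiL :: "nat \<Rightarrow> nat \<Rightarrow> bool" where "hiL j r = True"
definition hiT :: "nat \<Rightarrow> nat \<Rightarrow> bool" where "hiT j r = (r \<noteq> 0)"
definition sel0 :: "nat \<Rightarrow> bool" where "sel0 i = False"
definition hs0 :: "nat \<Rightarrow> nat \<Rightarrow> nat \<Rightarrow> bool" where "hs0 i k j = False"

lemma ok_L: "jumps_ok hiL sel0 hs0" "smooth hiL hs0"
  by (simp_all add: jumps_ok_def smooth_def hiL_def hs0_def)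

lemma ok_T: "jumps_ok hiT sel0 hs0"
  by (auto simp: jumps_ok_def hiT_def hs0_def)

sublocale L: blocked_grid "2 * n + 2" "3 * m + 2" "xi hiL" "et sel0 hs0" bs
  by (rule blocked[OF ok_L(1)])

sublocale T: blocked_grid "2 * n + 2" "3 * m + 2" "xi hiT" "et sel0 hs0" bs
  by (rule blocked[OF ok_T])

lemma boxes_eq: "T.box = L.box"
  unfolding T.box_def L.box_def by (simp add: xi_def xe_def)

definition rsL :: "(real \<times> real) set list" where "rsL = map area (map L.bbox bs)"
definition rsT :: "(real \<times> real) set list" where "rsT = map area (map T.bbox bs)"

definition bot :: "nat \<Rightarrow> bool" where
  "bot i \<longleftrightarrow> i < length bs \<and> (case bs ! i of (c, w, r, h) \<Rightarrow> r = 0)"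
definition top :: "nat \<Rightarrow> bool" where
  "top i \<longleftrightarrow> i < length bs \<and> (case bs ! i of (c, w, r, h) \<Rightarrow> r = 3 * m + 1)"

lemma xi_T_L: "r \<noteq> 0 \<Longrightarrow> xi hiT c r = xi hiL c r"
  by (simp add: xi_def xe_def hiT_def hiL_def)

lemma bbox_T_L: "\<not> bot i \<Longrightarrow> i < length bs \<Longrightarrow> T.bbox (bs ! i) = L.bbox (bs ! i)"
  by (cases "bs ! i") (simp add: bot_def xi_T_L)

lemma bot_top_disjoint:
  assumes "bot i" "top k"
  shows "area (L.bbox (bs ! i)) \<inter> area (L.bbox (bs ! k)) = {}"
    "area (T.bbox (bs ! i)) \<inter> area (T.bbox (bs ! k)) = {}"
proof -
  obtain c w h c' w' h' where i: "bs ! i = (c, w, 0, h)" and k: "bs ! k = (c', w', 3 * m + 1, h')"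
    and mem: "(c, w, 0, h) \<in> set bs"
    using assms nth_mem[of i bs] unfolding bot_def top_def by (cases "bs ! i"; cases "bs ! k") auto
  have "h = 1" using mem by (cases rule: bs_cases) auto
  moreover have "et sel0 hs0 1 c < et sel0 hs0 (3 * m + 1) c'"
    using ye_simps(2)[of 0 sel0 hs0 c] ye_simps(2)[of m sel0 hs0 c'] m_pos
    by (simp add: et_def F_def)
  ultimately show "area (L.bbox (bs ! i)) \<inter> area (L.bbox (bs ! k)) = {}"
    "area (T.bbox (bs ! i)) \<inter> area (T.bbox (bs ! k)) = {}"
    by (auto simp: i k mem_area)
qed

text \<open>Apart from the top row, middle lines bound blocks in the bottom row only. Moving them
  left within their slots keeps the order of all abscissas in use, which \<open>I\<close>
  collects.\<close>

lemma shift_exists: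
  "\<exists>f. strict_mono f \<and> surj f \<and> f (x_lo L.box) = x_lo L.box \<and> f (x_hi L.box) = x_hi L.box \<and>
    (\<forall>i<length bs. \<not> top i \<longrightarrow> shifted f (area (L.bbox (bs ! i))) (area (T.bbox (bs ! i))))"
proof -
  define I where "I = {(c, r). c \<le> 2 * n + 2 \<and> r < 3 * m + 2 \<and> (r = 0 \<or> odd c \<or> c = 0 \<or> c = 2 * n + 2)}"
  define p q where "p = (\<lambda>(c, r). xi hiL c r)" and "q = (\<lambda>(c, r). xi hiT c r)"
  have "finite I" by (rule finite_subset[of _ "{..2 * n + 2} \<times> {..<3 * m + 2}"]) (auto simp: I_def)
  moreover have "(p i < p j \<longrightarrow> q i < q j) \<and> (p i = p j \<longrightarrow> q i = q j)" if "i \<in> I" "j \<in> I" for i j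
  proof -
    obtain c r c' r' where [simp]: "i = (c, r)" "j = (c', r')" by (cases i; cases j)
    have lt: "xe hi c r < xe hi c' r'" if "c < c'" "r < 3 * m + 2" "r' < 3 * m + 2" for hi c r c' r'
    proof -
      have "Suc c * D \<le> c' * D" using that(1) by (intro mult_right_mono) auto
      then show ?thesis using xe_bounds(2)[OF that(2), of hi c] xe_bounds(1)[OF that(3), of c' hi] by linarith
    qed
    have r: "r < 3 * m + 2" "r' < 3 * m + 2" using that by (auto simp: I_def)
    consider "c < c'" | "c' < c" | "c = c'" by linarith
    then show ?thesis
    proof cases
      case 1
      then show ?thesis using lt[OF 1 r, of hiL] lt[OF 1 r, of hiT] by (simp add: p_def q_def xi_def)
    next
      case 2
      then show ?thesis using lt[OF 2 r(2,1), of hiL] by (simp add: p_def q_def xi_def)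
    next
      case 3
      then have "odd c \<or> c = 0 \<or> c = 2 * n + 2 \<or> even c \<and> r = 0 \<and> r' = 0"
        using that by (auto simp: I_def)
      then consider "odd c \<or> c = 0 \<or> c = 2 * n + 2" | "even c" "r = 0" "r' = 0" by blast
      then show ?thesis
        using 3 by cases (auto simp: p_def q_def xi_def xe_def)
    qed
  qed
  ultimately obtain f where f: "strict_mono f" "surj f" "\<And>i. i \<in> I \<Longrightarrow> f (p i) = q i"
    using extend_strict_mono_family[of I p q] by blast
  have x: "f (xi hiL c r) = xi hiT c r" if "(c, r) \<in> I" for c r
    using f(3)[OF that] by (simp add: p_def q_def)
  show ?thesis
  proof (intro exI conjI allI impI)
    show "strict_mono f" "surj f" by fact+
    show "f (x_lo L.box) = x_lo L.box" "f (x_hi L.box) = x_hi L.box"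
      using x[of 0 0] x[of "2 * n + 2" 0] unfolding L.box_def
      by (simp_all add: I_def) (simp_all add: xi_def xe_def)
    fix i assume i: "i < length bs" "\<not> top i"
    obtain c w r h where b: "bs ! i = (c, w, r, h)" by (cases "bs ! i")
    have "(c, w, r, h) \<in> set bs" using i b by (metis nth_mem)
    moreover have "r \<noteq> 3 * m + 1" using i b by (simp add: top_def)
    ultimately have "(c, r) \<in> I \<and> (c + w, r) \<in> I"
      by (cases rule: bs_cases) (auto simp: I_def)
    then show "shifted f (area (L.bbox (bs ! i))) (area (T.bbox (bs ! i)))"
      by (intro shifted_area) (auto simp: b x)
  qed
qed

fun ntop :: "node \<Rightarrow> bool" where "ntop (Region i) = top i" | "ntop (Side s) = False"
fun nbot :: "node \<Rightarrow> bool" where "nbot (Region i) = bot i" | "nbot (Side s) = False"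

text \<open>If a top block is involved, no bottom block is, and the identity will do. No single map
  serves both rows: a middle line at the bottom is right of the one at the top in the input and left
  of it in the target.\<close>

lemma shift_nodes:
  assumes "\<not> ((\<exists>z\<in>Z. ntop z) \<and> (\<exists>z\<in>Z. nbot z))"
  obtains f where "strict_mono f" "surj f" "f (x_lo L.box) = x_lo L.box" "f (x_hi L.box) = x_hi L.box"
    "\<And>z. z \<in> Z \<Longrightarrow> shifted f (node_part rsL L.box z) (node_part rsT L.box z)"
proof (cases "\<exists>z\<in>Z. ntop z")
  case True
  then have nb: "\<not> nbot z" if "z \<in> Z" for z using assms that by blast
  have id: "strict_mono (id :: real \<Rightarrow> real)" "surj (id :: real \<Rightarrow> real)" by (auto simp: strict_mono_def)
  show ?thesis
  proof (rule that[OF id])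
    fix z assume "z \<in> Z"
    then show "shifted id (node_part rsL L.box z) (node_part rsT L.box z)"
      using nb[of z] shifted_empty[OF id(1)] bbox_T_L
      by (cases z) (auto simp: rsL_def rsT_def shifted_side_part intro!: shifted_area)
  qed simp_all
next
  case False
  obtain f where f: "strict_mono f" "surj f" "f (x_lo L.box) = x_lo L.box" "f (x_hi L.box) = x_hi L.box"
    "\<And>i. i < length bs \<Longrightarrow> \<not> top i \<Longrightarrow> shifted f (area (L.bbox (bs ! i))) (area (T.bbox (bs ! i)))"
    using shift_exists by blast
  show ?thesis
  proof (rule that[OF f(1-4)])
    fix z assume "z \<in> Z"
    then have "\<not> ntop z" using False by blast
    then show "shifted f (node_part rsL L.box z) (node_part rsT L.box z)"
      using f shifted_empty[OF f(1)]
      by (cases z) (auto simp: rsL_def rsT_def intro!: shifted_side_part)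
  qed
qed

lemma closed_node_part: "closed (node_part rsL L.box z)" "closed (node_part rsT L.box z)"
proof -
  have "closed (side_part B s)" for B s by (cases s) (auto intro!: closed_Times)
  then show "closed (node_part rsL L.box z)" "closed (node_part rsT L.box z)"
    by (cases z; simp add: rsL_def rsT_def)+
qed

lemma conflict_disjoint:
  assumes "ntop z" "nbot z'"
  shows "node_part rsL L.box z \<inter> node_part rsL L.box z' = {}"
    "node_part rsT L.box z \<inter> node_part rsT L.box z' = {}"
proof -
  obtain k i where [simp]: "z = Region k" "z' = Region i" and ki: "top k" "bot i"
    using assms by (cases z; cases z') auto
  then show "node_part rsL L.box z \<inter> node_part rsL L.box z' = {}"
    "node_part rsT L.box z \<inter> node_part rsT L.box z' = {}"
    using bot_top_disjoint[OF ki(2,1)]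
    by (simp_all add: rsL_def rsT_def bot_def top_def Int_commute)
qed

lemma rotation_meet:
  assumes "dual_rotation rs B u v w" "\<And>z. closed (node_part rs B z)" "z \<in> {u, v, w}" "z' \<in> {u, v, w}"
  shows "node_part rs B z \<inter> node_part rs B z' \<noteq> {}"
proof -
  obtain p a l where "1 \<le> l" "covers_quadrant (node_part rs B w) p a"
    "\<And>j. j \<in> {1..l} \<Longrightarrow> covers_quadrant (node_part rs B u) p (a + j)"
    "covers_quadrant (node_part rs B v) p (a + l + 1)"
    using assms(1) unfolding dual_rotation_def by blast
  then have "p \<in> node_part rs B w" "p \<in> node_part rs B u" "p \<in> node_part rs B v"
    using covers_quadrant_closed[OF assms(2)] by (metis atLeastAtMost_iff order_refl)+
  then show ?thesis using assms(3,4) by auto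
qed

text \<open>A bottom block and a top block never meet, so a triple that contains both has no common
  point in either layout.\<close>

lemma rotation_eq: "dual_rotation rsL L.box u v w \<longleftrightarrow> dual_rotation rsT L.box u v w"
proof (cases "(\<exists>z\<in>{u, v, w}. ntop z) \<and> (\<exists>z\<in>{u, v, w}. nbot z)")
  case True
  then obtain z z' where "z \<in> {u, v, w}" "z' \<in> {u, v, w}" "ntop z" "nbot z'" by blast
  then show ?thesis
    using rotation_meet[of rsL L.box u v w z z'] rotation_meet[of rsT L.box u v w z z']
      closed_node_part conflict_disjoint by blast
next
  case False
  obtain f where "strict_mono f" "surj f" "\<And>z. z \<in> {u, v, w} \<Longrightarrow> shifted f (node_part rsL L.box z) (node_part rsT L.box z)"
    using shift_nodes[OF False] by metis
  then show ?thesis by (rule dual_rotation_shifted)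
qed

lemma region_edge_eq:
  assumes "i < length bs" "k < length bs" "i \<noteq> k"
  shows "share_edge (rsL ! i) (rsL ! k) \<longleftrightarrow> share_edge (rsT ! i) (rsT ! k)"
proof (cases "(\<exists>z\<in>{Region i, Region k}. ntop z) \<and> (\<exists>z\<in>{Region i, Region k}. nbot z)")
  case True
  have dis: "\<not> share_edge (area R) (area S)" if "area R \<inter> area S = {}" for R S
    using that adjacent_common[of R S] unfolding adjacent_def by blast
  from True obtain z z' where zz: "z \<in> {Region i, Region k}" "z' \<in> {Region i, Region k}" "ntop z" "nbot z'" by blast
  have "z \<noteq> z'" using zz(3,4) m_pos by (cases z) (auto simp: top_def bot_def)
  then have "{z, z'} = {Region i, Region k}" using zz(1,2) by auto
  then have "area (L.bbox (bs ! i)) \<inter> area (L.bbox (bs ! k)) = {}"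
    "area (T.bbox (bs ! i)) \<inter> area (T.bbox (bs ! k)) = {}"
    using conflict_disjoint[OF zz(3,4)] assms
    by (auto simp: doubleton_eq_iff rsL_def rsT_def Int_commute)
  then show ?thesis using dis assms by (simp add: rsL_def rsT_def)
next
  case False
  obtain f where f: "strict_mono f" "surj f"
    "\<And>z. z \<in> {Region i, Region k} \<Longrightarrow> shifted f (node_part rsL L.box z) (node_part rsT L.box z)"
    using shift_nodes[OF False] by metis
  have "shifted f (area (L.bbox (bs ! i))) (area (T.bbox (bs ! i)))"
    "shifted f (area (L.bbox (bs ! k))) (area (T.bbox (bs ! k)))"
    using f(3)[of "Region i"] f(3)[of "Region k"] assms by (simp_all add: rsL_def rsT_def)
  from share_edge_shifted[OF f(1,2) this] show ?thesis
    using L.block_region(2) T.block_region(2) L.blocks_apart T.blocks_apart assms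
    by (simp add: rsL_def rsT_def)
qed

lemma side_edge_eq:
  assumes "i < length bs"
  shows "rsL ! i \<inter> side_segment L.box s \<noteq> {} \<longleftrightarrow> rsT ! i \<inter> side_segment L.box s \<noteq> {}"
proof -
  have nc: "\<not> ((\<exists>z\<in>{Region i}. ntop z) \<and> (\<exists>z\<in>{Region i}. nbot z))"
    using m_pos by (auto simp: top_def bot_def)
  obtain f where f: "strict_mono f" "surj f" "f (x_lo L.box) = x_lo L.box" "f (x_hi L.box) = x_hi L.box"
    "\<And>z. z \<in> {Region i} \<Longrightarrow> shifted f (node_part rsL L.box z) (node_part rsT L.box z)"
    using shift_nodes[OF nc] by metis
  show ?thesis
    using side_segment_shifted[OF f(1-4) f(5)[of "Region i"]] assms by (simp add: rsL_def rsT_def)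
qed

lemma extended_dual_eq: "extended_dual rsL L.box = extended_dual rsT T.box"
proof -
  have len: "length rsL = length bs" "length rsT = length bs" by (simp_all add: rsL_def rsT_def)
  have "dual_edge rsL L.box u v = dual_edge rsT L.box u v" for u v
    using region_edge_eq side_edge_eq by (cases u; cases v) (auto simp: len)
  then show ?thesis
    unfolding extended_dual_def boxes_eq using rotation_eq by (simp add: len fun_eq_iff)
qed

theorem global_target_T: "global_target L.lay (map T.bbox bs)"
  unfolding global_target_def
proof (intro conjI allI impI exI)
  show "length (map T.bbox bs) = length L.lay" by simp
  show "\<forall>R\<in>set (map T.bbox bs). proper_rect R" using T.block_region(2) by simp
  show "interior (area (map T.bbox bs ! i)) \<inter> interior (area (map T.bbox bs ! k)) = {}"
    if "i < length (map T.bbox bs)" "k < length (map T.bbox bs)" "i \<noteq> k" for i k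
    using T.bbox_apart that by simp
  show "root_box L.box (map region L.lay)" using L.root_box by (simp add: L.map_region_lay)
  show "root_box T.box (map area (map T.bbox bs))" by (rule T.root_box)
  show "extended_dual (map region L.lay) L.box = extended_dual (map area (map T.bbox bs)) T.box"
    using extended_dual_eq unfolding rsL_def rsT_def L.map_region_lay .
qed

end

section \<open>Counting external adjacencies\<close>

text \<open>Contacts without reference to the size of the grid, so that they can also be counted
  inside a block.\<close>

definition nb :: "(nat \<Rightarrow> nat \<Rightarrow> bool) \<Rightarrow> nat \<times> nat \<Rightarrow> nat \<times> nat \<Rightarrow> bool" where
  "nb P u v \<longleftrightarrow> (case (u, v) of ((c, r), (c', r')) \<Rightarrow>
     c' = Suc c \<and> r' = r \<or> c' = c \<and> r' = Suc r \<or>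
     c' = Suc c \<and> r' = Suc r \<and> \<not> P c r \<or> c' = Suc c \<and> r = Suc r' \<and> P c r')"

lemma nbr_nb: "nbr C R P u v \<longleftrightarrow> u \<in> {..<C} \<times> {..<R} \<and> v \<in> {..<C} \<times> {..<R} \<and> nb P u v"
  by (auto simp: nbr_def nb_def split: prod.splits)

lemma nb_asym: "nb P u v \<Longrightarrow> \<not> nb P v u"
  by (auto simp: nb_def split: prod.splits)

text \<open>Each crossing contributes exactly one diagonal contact whatever its sign, so the count
  does not depend on \<open>P\<close>.\<close>

lemma card_nb_rectangle:
  assumes "0 < w" "0 < h"
  shows "card {(u, v). u \<in> {c..<c + w} \<times> {r..<r + h} \<and> v \<in> {c..<c + w} \<times> {r..<r + h} \<and> nb P u v} =
    (w - 1) * h + w * (h - 1) + (w - 1) * (h - 1)"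
proof -
  define A where "A = {c..<c + w} \<times> {r..<r + h}"
  define H V where "H = {c..<c + w - 1} \<times> {r..<r + h}" and "V = {c..<c + w} \<times> {r..<r + h - 1}"
  define Q where "Q = {c..<c + w - 1} \<times> {r..<r + h - 1}"
  define fH fV fQ where "fH = (\<lambda>(c, r). ((c, r), (Suc c, r :: nat)))"
    and "fV = (\<lambda>(c, r). ((c :: nat, r), (c, Suc r)))"
    and "fQ = (\<lambda>(c, r). if P c r then ((c, Suc r), (Suc c, r)) else ((c, r), (Suc c, Suc r)))"
  have "{(u, v). u \<in> A \<and> v \<in> A \<and> nb P u v} = fH ` H \<union> fV ` V \<union> fQ ` Q" (is "?l = ?r")
  proof (rule set_eqI)
    fix x :: "(nat \<times> nat) \<times> nat \<times> nat"
    obtain c1 r1 c2 r2 where x: "x = ((c1, r1), (c2, r2))" by (metis prod.exhaust)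
    have h1: "x \<in> fH ` H \<longleftrightarrow> x \<in> ?l \<and> c2 = Suc c1 \<and> r2 = r1"
      by (auto simp: x fH_def H_def A_def nb_def)
    have h2: "x \<in> fV ` V \<longleftrightarrow> x \<in> ?l \<and> c2 = c1 \<and> r2 = Suc r1"
      by (auto simp: x fV_def V_def A_def nb_def)
    have h3: "x \<in> fQ ` Q \<longleftrightarrow> x \<in> ?l \<and> c2 = Suc c1 \<and> (r2 = Suc r1 \<or> r1 = Suc r2)"
    proof
      assume "x \<in> fQ ` Q"
      then show "x \<in> ?l \<and> c2 = Suc c1 \<and> (r2 = Suc r1 \<or> r1 = Suc r2)"
        by (auto simp: x fQ_def Q_def A_def nb_def split: if_splits)
    next
      assume *: "x \<in> ?l \<and> c2 = Suc c1 \<and> (r2 = Suc r1 \<or> r1 = Suc r2)"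
      then consider "r2 = Suc r1" "\<not> P c1 r1" | "r1 = Suc r2" "P c1 r2"
        by (auto simp: x nb_def)
      then show "x \<in> fQ ` Q"
      proof cases
        case 1
        then have "x = fQ (c1, r1)" "(c1, r1) \<in> Q" using * by (auto simp: x fQ_def Q_def A_def)
        then show ?thesis by blast
      next
        case 2
        then have "x = fQ (c1, r2)" "(c1, r2) \<in> Q" using * by (auto simp: x fQ_def Q_def A_def)
        then show ?thesis by blast
      qed
    qed
    have h4: "x \<in> ?l \<Longrightarrow> c2 = Suc c1 \<and> r2 = r1 \<or> c2 = c1 \<and> r2 = Suc r1 \<or>
        c2 = Suc c1 \<and> (r2 = Suc r1 \<or> r1 = Suc r2)"
      by (auto simp: x nb_def)
    show "x \<in> ?l \<longleftrightarrow> x \<in> ?r" unfolding Un_iff h1 h2 h3 using h4 by argo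
  qed
  moreover have "card (fH ` H \<union> fV ` V \<union> fQ ` Q) = card H + card V + card Q"
  proof -
    have "inj_on fH H" "inj_on fV V" by (auto simp: inj_on_def fH_def fV_def)
    moreover have "inj_on fQ Q"
    proof (rule inj_onI)
      fix a b assume "fQ a = fQ b"
      then show "a = b" by (cases a; cases b) (simp add: fQ_def split: if_splits)
    qed
    ultimately have "card (fH ` H) = card H" "card (fV ` V) = card V" "card (fQ ` Q) = card Q"
      by (simp_all add: card_image)
    moreover have "fH ` H \<inter> fV ` V = {}" by (auto simp: fH_def fV_def)
    moreover have "(fH ` H \<union> fV ` V) \<inter> fQ ` Q = {}"
    proof -
      have "fst (fst x) = fst (snd x) \<or> snd (fst x) = snd (snd x)" if "x \<in> fH ` H \<union> fV ` V" for x
        using that by (auto simp: fH_def fV_def)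
      moreover have "fst (fst x) \<noteq> fst (snd x) \<and> snd (fst x) \<noteq> snd (snd x)" if "x \<in> fQ ` Q" for x
        using that by (auto simp: fQ_def split: if_splits)
      ultimately show ?thesis by blast
    qed
    moreover have "finite H" "finite V" "finite Q" by (simp_all add: H_def V_def Q_def)
    ultimately show ?thesis by (simp add: card_Un_disjoint)
  qed
  moreover have "card H = (w - 1) * h" "card V = w * (h - 1)" "card Q = (w - 1) * (h - 1)"
    using assms by (simp_all add: H_def V_def Q_def card_cartesian_product)
  ultimately show ?thesis by (simp add: A_def)
qed

fun inner_pairs :: "block \<Rightarrow> nat" where
  "inner_pairs (c, w, r, h) = (w - 1) * h + w * (h - 1) + (w - 1) * (h - 1)"

context blocked_grid
begin

definition ext_pairs :: "(nat \<Rightarrow> nat \<Rightarrow> bool) \<Rightarrow> ((nat \<times> nat) \<times> nat \<times> nat) set" where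
  "ext_pairs P = {((i, j), (i', j')). i < i' \<and> i' < length bs \<and> j < length (block_cells (bs ! i)) \<and>
     j' < length (block_cells (bs ! i')) \<and>
     (nbr C R P (block_cells (bs ! i) ! j) (block_cells (bs ! i') ! j') \<or>
      nbr C R P (block_cells (bs ! i') ! j') (block_cells (bs ! i) ! j))}"

lemma block_in_grid: "i < length bs \<Longrightarrow> u \<in> set (block_cells (bs ! i)) \<Longrightarrow> u \<in> {..<C} \<times> {..<R}"
  unfolding all_cells[symmetric] by auto

text \<open>External contacts are those of the whole grid without those inside a block, and both
  numbers are independent of the signs.\<close>

lemma card_ext_pairs:
  "card (ext_pairs P) + sum_list (map inner_pairs bs) = (C - 1) * R + C * (R - 1) + (C - 1) * (R - 1)"
proof -
  define nm where "nm = (\<lambda>(i, j). block_cells (bs ! i) ! j)"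
  define all where "all = {(u, v). u \<in> {..<C} \<times> {..<R} \<and> v \<in> {..<C} \<times> {..<R} \<and> nb P u v}"
  define inn where "inn i = {(u, v). u \<in> set (block_cells (bs ! i)) \<and> v \<in> set (block_cells (bs ! i)) \<and> nb P u v}" for i
  define ext where "ext = all - (\<Union>i<length bs. inn i)"
  have call: "card all = (C - 1) * R + C * (R - 1) + (C - 1) * (R - 1)"
    using card_nb_rectangle[of C R 0 0 P] size by (simp add: all_def lessThan_atLeast0)
  have fin: "finite all"
    by (rule finite_subset[of _ "({..<C} \<times> {..<R}) \<times> ({..<C} \<times> {..<R})"]) (auto simp: all_def)
  have sub: "inn i \<subseteq> all" if "i < length bs" for i
    using block_in_grid[OF that] by (auto simp: inn_def all_def)
  have "card (inn i) = inner_pairs (bs ! i)" if "i < length bs" for i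
  proof -
    obtain c w r h where b: "bs ! i = (c, w, r, h)" by (cases "bs ! i")
    have "(c, w, r, h) \<in> set bs" using that b by (metis nth_mem)
    then show ?thesis using blocks[of c w r h] card_nb_rectangle[of w h c r P]
      by (simp add: inn_def b set_block_cells del: block_cells.simps)
  qed
  moreover have "inn i \<inter> inn k = {}" if "i < length bs" "k < length bs" "i \<noteq> k" for i k
    using distinct_concat_disjoint[OF distinct_cells, of i k] that by (auto simp: inn_def)
  moreover have "finite (inn i)" if "i < length bs" for i using sub[OF that] fin by (rule finite_subset)
  ultimately have "card (\<Union>i<length bs. inn i) = (\<Sum>i<length bs. inner_pairs (bs ! i))"
    by (subst card_UN_disjoint) auto
  also have "\<dots> = sum_list (map inner_pairs bs)"
    by (simp add: sum_list_sum_nth atLeast0LessThan)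
  finally have "card ext + sum_list (map inner_pairs bs) = card all"
  proof -
    assume *: "card (\<Union>i<length bs. inn i) = sum_list (map inner_pairs bs)"
    have sub': "(\<Union>i<length bs. inn i) \<subseteq> all" using sub by (intro UN_least) simp
    then show ?thesis
      using card_mono[OF fin sub'] finite_subset[OF sub' fin] *
      unfolding ext_def by (simp add: card_Diff_subset)
  qed
  moreover have "card (ext_pairs P) = card ext"
  proof -
    \<comment> \<open>An external pair is ordered by the indices of its blocks, a contact by its
      direction in the grid; \<open>f\<close> translates between the two.\<close>
    define f where "f = (\<lambda>(x, y). if nb P (nm x) (nm y) then (nm x, nm y) else (nm y, nm x))"
    have idx: "fst x < length bs \<and> snd x < length (block_cells (bs ! fst x)) \<and>
        fst y < length bs \<and> snd y < length (block_cells (bs ! fst y)) \<and> fst x < fst y \<and>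
        (nbr C R P (nm x) (nm y) \<or> nbr C R P (nm y) (nm x))"
      if "(x, y) \<in> ext_pairs P" for x y
      using that by (auto simp: ext_pairs_def nm_def)
    have eq: "x = y" if "nm x = nm y" "fst x < length bs" "snd x < length (block_cells (bs ! fst x))"
      "fst y < length bs" "snd y < length (block_cells (bs ! fst y))" for x y
      using cell_index_eq[of "fst x" "fst y" "snd x" "snd y"] that by (auto simp: nm_def split: prod.splits)
    have "inj_on f (ext_pairs P)"
    proof (rule inj_onI)
      fix a b assume a: "a \<in> ext_pairs P" and b: "b \<in> ext_pairs P" and fab: "f a = f b"
      obtain x y x' y' where [simp]: "a = (x, y)" "b = (x', y')" by (cases a; cases b)
      have "nm x = nm x' \<and> nm y = nm y' \<or> nm x = nm y' \<and> nm y = nm x'"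
        using fab by (auto simp: f_def split: if_splits)
      then have "x = x' \<and> y = y' \<or> x = y' \<and> y = x'"
        using idx[of x y] idx[of x' y'] a b eq[of x x'] eq[of y y'] eq[of x y'] eq[of y x'] by simp blast
      then show "a = b" using idx[of x y] idx[of x' y'] a b by (elim disjE) simp_all
    qed
    moreover have "f ` ext_pairs P = ext"
    proof
      show "f ` ext_pairs P \<subseteq> ext"
      proof (rule image_subsetI)
        fix a assume a: "a \<in> ext_pairs P"
        obtain x y where [simp]: "a = (x, y)" by (cases a)
        note i = idx[of x y] a
        have "f a \<in> all" using i by (auto simp: f_def all_def nbr_nb)
        moreover have "f a \<notin> inn k" if k: "k < length bs" for k
        proof
          assume "f a \<in> inn k"
          then have "nm x \<in> set (block_cells (bs ! k))" "nm y \<in> set (block_cells (bs ! k))"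
            by (auto simp: f_def inn_def split: if_splits)
          moreover have "nm x \<in> set (block_cells (bs ! fst x))" "nm y \<in> set (block_cells (bs ! fst y))"
            using i by (auto simp: nm_def split: prod.splits)
          ultimately have "k = fst x" "k = fst y"
            using distinct_concat_disjoint[OF distinct_cells, of k "fst x"]
              distinct_concat_disjoint[OF distinct_cells, of k "fst y"] i k by auto
          then show False using i by auto
        qed
        ultimately show "f a \<in> ext" by (auto simp: ext_def)
      qed
      show "ext \<subseteq> f ` ext_pairs P"
      proof
        fix e assume e: "e \<in> ext"
        obtain u v where uv: "e = (u, v)" by (cases e)
        have n: "nbr C R P u v" "nb P u v" using e by (auto simp: uv ext_def all_def nbr_nb)
        obtain i j where i: "i < length bs" "j < length (block_cells (bs ! i))" "block_cells (bs ! i) ! j = u"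
          using cell_index_ex[of "fst u" "snd u" thesis] n(1) by (cases u) (simp add: nbr_nb)
        obtain k l where k: "k < length bs" "l < length (block_cells (bs ! k))" "block_cells (bs ! k) ! l = v"
          using cell_index_ex[of "fst v" "snd v" thesis] n(1) by (cases v) (simp add: nbr_nb)
        have "i \<noteq> k"
        proof
          assume "i = k"
          then have "e \<in> inn i" using i k n(2) nth_mem by (auto simp: inn_def uv)
          then show False using e i(1) by (auto simp: ext_def)
        qed
        show "e \<in> f ` ext_pairs P"
        proof (cases "i < k")
          case True
          then have "((i, j), (k, l)) \<in> ext_pairs P" using i k n(1) by (simp add: ext_pairs_def)
          moreover have "f ((i, j), (k, l)) = e" using i k n(2) by (simp add: f_def nm_def uv)
          ultimately show ?thesis by (metis image_eqI)
        next
          case False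
          then have "((k, l), (i, j)) \<in> ext_pairs P" using i k n(1) \<open>i \<noteq> k\<close> by (simp add: ext_pairs_def)
          moreover have "f ((k, l), (i, j)) = e" using i k n(2) nb_asym[OF n(2)] by (simp add: f_def nm_def uv)
          ultimately show ?thesis by (metis image_eqI)
        qed
      qed
    qed
    ultimately show ?thesis by (metis card_image)
  qed
  ultimately show ?thesis using call by simp
qed

lemma finite_ext_pairs: "finite (ext_pairs P)"
proof -
  define N where "N = (SIGMA i:{..<length bs}. {..<length (block_cells (bs ! i))})"
  have "ext_pairs P \<subseteq> N \<times> N" by (auto simp: ext_pairs_def N_def)
  moreover have "finite (N \<times> N)" by (simp add: N_def)
  ultimately show ?thesis by (rule finite_subset)
qed

lemma preserved_external_lay:
  "preserved_external lay M = card {((i, j), (i', j')). ((i, j), (i', j')) \<in> ext_pairs plus \<and>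
     adjacent (M ! i ! j) (M ! i' ! j')}"
proof -
  have len: "length (lay ! i) = length (block_cells (bs ! i))" if "i < length bs" for i
    using that by simp
  have "i < i' \<and> i' < length lay \<and> j < length (lay ! i) \<and> j' < length (lay ! i') \<and>
      adjacent (lay ! i ! j) (lay ! i' ! j') \<longleftrightarrow> ((i, j), (i', j')) \<in> ext_pairs plus" for i j i' j'
    using adjacent_lay_iff[of i i' j j'] len[of i] len[of i']
    unfolding ext_pairs_def lay_nth(1) by auto
  then show ?thesis unfolding preserved_external_def
    by (intro arg_cong[where f = card]) auto
qed

end

section \<open>The number of external adjacencies of the input\<close>

context good_triples
begin

definition threshold :: nat where
  "threshold = (2 * n + 1) * (3 * m + 2) + (2 * n + 2) * (3 * m + 1) + (2 * n + 1) * (3 * m + 1) - m * (6 * n + 3)"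

text \<open>A slot cut into blocks of heights 1 and 2 has 1 + 5 inner contacts, the uncut slot
  \<open>c1\<close> has 9; blocks of one cell have none.\<close>

lemma inner_pairs_bs: "sum_list (map inner_pairs bs) = m * (6 * n + 3)"
proof -
  have blk: "sum_list (map inner_pairs (blk i j)) = 6 + (if j = c1 i then 3 else 0)" for i j
    by (simp add: blk_def)
  have "sum_list (map inner_pairs (concat (map (blk i) js))) = (\<Sum>j\<leftarrow>js. 6 + (if j = c1 i then 3 else 0))" for i js
    by (induction js) (simp_all add: blk)
  moreover have "(\<Sum>j\<leftarrow>[1..<Suc n]. 6 + (if j = c1 i then 3 else 0 :: nat)) = 6 * n + 3" if "1 \<le> i" "i \<le> m" for i
  proof -
    have "(\<Sum>j\<leftarrow>[1..<Suc n]. 6 + (if j = c1 i then 3 else 0 :: nat)) = (\<Sum>j\<in>{1..n}. 6 + (if j = c1 i then 3 else 0))"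
      by (subst sum_list_distinct_conv_sum_set) (simp_all add: atLeastLessThanSuc_atLeastAtMost del: upt_Suc)
    also have "\<dots> = 6 * n + 3" using ord[OF that] by (simp add: sum.distrib)
    finally show ?thesis .
  qed
  moreover have single: "sum_list (map inner_pairs (map (\<lambda>k. (g k, 1, f k, 1)) ks)) = 0" for f g :: "nat \<Rightarrow> nat" and ks
    by (induction ks) simp_all
  ultimately have row: "sum_list (map inner_pairs (rowblocks i)) = 6 * n + 3" if "1 \<le> i" "i \<le> m" for i
    using that single[of "\<lambda>_. 0"] single[of "\<lambda>_. 2 * n + 1"]
    by (simp add: rowblocks_def del: upt_Suc)
  have "sum_list (map inner_pairs (concat (map rowblocks is))) = length is * (6 * n + 3)"
    if "\<forall>i\<in>set is. 1 \<le> i \<and> i \<le> m" for "is"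
    using that by (induction "is") (simp_all add: row)
  then have "sum_list (map inner_pairs (concat (map rowblocks [1..<Suc m]))) = m * (6 * n + 3)"
    by (simp add: less_Suc_eq_le del: upt_Suc)
  then show ?thesis using single[of "\<lambda>c. c"] unfolding bs_def by (simp del: upt_Suc)
qed

lemma L_plus: "nbr (2 * n + 2) (3 * m + 2) L.plus = nbr (2 * n + 2) (3 * m + 2) sgn"
  using nbr_plus[OF ok_L] .

lemma card_ext_pairs_L: "card (L.ext_pairs sgn) = threshold"
  using L.card_ext_pairs[of sgn] by (simp add: inner_pairs_bs threshold_def)

lemma ext_pairs_L: "L.ext_pairs L.plus = L.ext_pairs sgn"
  unfolding L.ext_pairs_def L_plus ..

lemma preserved_L: "preserved_external L.lay M =
    card {((i, j), (i', j')). ((i, j), (i', j')) \<in> L.ext_pairs sgn \<and> adjacent (M ! i ! j) (M ! i' ! j')}"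
  unfolding L.preserved_external_lay ext_pairs_L ..

end

section \<open>Reading off a solution from a layout\<close>

lemma area_subset_bounds:
  assumes "area R \<subseteq> area B" "proper_rect R"
  shows "x_lo B \<le> x_lo R \<and> x_hi R \<le> x_hi B \<and> y_lo B \<le> y_lo R \<and> y_hi R \<le> y_hi B"
proof -
  have "(x_lo R, y_lo R) \<in> area R" "(x_hi R, y_hi R) \<in> area R"
    using assms(2) by (auto simp: mem_area proper_rect_def)
  then have "(x_lo R, y_lo R) \<in> area B" "(x_hi R, y_hi R) \<in> area B" using assms(1) by auto
  then show ?thesis by (simp add: mem_area)
qed

text \<open>
  The two columns of cells of a slot inside one complex. The left cells touch the left side of the
  complex, the right cells the right side, and the extreme cells touch bottom and top.
\<close>

locale box_cells =
  fixes B :: "real rect" and a b :: "nat \<Rightarrow> real rect" and lo hi :: nat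
  assumes lohi: "lo \<le> hi"
    and proper: "\<And>k. lo \<le> k \<Longrightarrow> k \<le> hi \<Longrightarrow> proper_rect (a k) \<and> proper_rect (b k)"
    and sub: "\<And>k. lo \<le> k \<Longrightarrow> k \<le> hi \<Longrightarrow> area (a k) \<subseteq> area B \<and> area (b k) \<subseteq> area B"
    and apart: "\<And>k l. lo \<le> k \<Longrightarrow> k \<le> hi \<Longrightarrow> lo \<le> l \<Longrightarrow> l \<le> hi \<Longrightarrow> apart (a k) (b l)"
      "\<And>k l. lo \<le> k \<Longrightarrow> k \<le> hi \<Longrightarrow> lo \<le> l \<Longrightarrow> l \<le> hi \<Longrightarrow> k \<noteq> l \<Longrightarrow> apart (a k) (a l) \<and> apart (b k) (b l)"
    and left: "\<And>k. lo \<le> k \<Longrightarrow> k \<le> hi \<Longrightarrow> x_lo (a k) = x_lo B"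
    and right: "\<And>k. lo \<le> k \<Longrightarrow> k \<le> hi \<Longrightarrow> x_hi (b k) = x_hi B"
    and bottom: "y_lo (a lo) = y_lo B" "y_lo (b lo) = y_lo B"
    and top: "y_hi (a hi) = y_hi B" "y_hi (b hi) = y_hi B"
begin

lemma in_B: "lo \<le> k \<Longrightarrow> k \<le> hi \<Longrightarrow> y_lo B \<le> y_lo (a k) \<and> y_hi (a k) \<le> y_hi B \<and>
    y_lo B \<le> y_lo (b k) \<and> y_hi (b k) \<le> y_hi B \<and> x_hi (a k) \<le> x_hi B \<and> x_lo B \<le> x_lo (b k) \<and>
    x_lo (a k) < x_hi (a k) \<and> x_lo (b k) < x_hi (b k) \<and> y_lo (a k) < y_hi (a k) \<and> y_lo (b k) < y_hi (b k)"
  using area_subset_bounds[of "a k" B] area_subset_bounds[of "b k" B] sub[of k] proper[of k] by (simp add: proper_rect_def)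

text \<open>Of two apart rectangles with overlapping heights one lies left of the other, and the
  sides of the complex that they touch decide which.\<close>

lemma beside:
  assumes "lo \<le> k" "k \<le> hi" "lo \<le> l" "l \<le> hi" "y_lo (a k) < y_hi (b l)" "y_lo (b l) < y_hi (a k)"
  shows "x_hi (a k) \<le> x_lo (b l)"
  using apart(1)[OF assms(1-4)] proper[OF assms(1,2)] proper[OF assms(3,4)] assms in_B[of k] in_B[of l]
    left[OF assms(1,2)] right[OF assms(3,4)] by (auto simp: apart_iff)

lemma same_column_a:
  assumes "lo \<le> k" "k \<le> hi" "lo \<le> l" "l \<le> hi" "k \<noteq> l"
  shows "y_hi (a k) \<le> y_lo (a l) \<or> y_hi (a l) \<le> y_lo (a k)"
  using apart(2)[OF assms] proper[OF assms(1,2)] proper[OF assms(3,4)] in_B[of k] in_B[of l] assms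
    left[OF assms(1,2)] left[OF assms(3,4)] by (auto simp: apart_iff)

lemma same_column_b:
  assumes "lo \<le> k" "k \<le> hi" "lo \<le> l" "l \<le> hi" "k \<noteq> l"
  shows "y_hi (b k) \<le> y_lo (b l) \<or> y_hi (b l) \<le> y_lo (b k)"
  using apart(2)[OF assms] proper[OF assms(1,2)] proper[OF assms(3,4)] in_B[of k] in_B[of l] assms
    right[OF assms(1,2)] right[OF assms(3,4)] by (auto simp: apart_iff)

text \<open>The side condition stems from what is known about a column: only its lowest and its
  highest cell are placed.\<close>

lemma stacked:
  assumes "lo \<le> k" "k < hi" "k = lo \<or> Suc k = hi"
  shows "y_hi (a k) \<le> y_lo (a (Suc k))" "y_hi (b k) \<le> y_lo (b (Suc k))"
  using same_column_a[of k "Suc k"] same_column_b[of k "Suc k"] in_B[of k] in_B[of "Suc k"] assms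
    bottom top by auto

text \<open>The contact puts the lower side of the upper right cell at most at the upper side of the
  lower left one, and stacking in both columns does the rest. So the horizontal line does not rise
  to the right.\<close>

lemma pass:
  assumes "lo \<le> k" "k < hi" "k = lo \<or> Suc k = hi" "adjacent (a k) (b (Suc k))"
  shows "y_hi (b k) \<le> y_lo (a (Suc k))"
  using stacked[OF assms(1-3)] adjacent_imp_le[OF assms(4)] by linarith

lemma column_1:
  assumes "hi = lo"
  shows "x_hi (a hi) \<le> x_lo (b lo)"
  using beside[of lo lo] in_B[of lo] bottom assms by simp

text \<open>With a negative contact, the cells beside each other at the bottom and at the top are
  linked by the diagonal pair. Otherwise the upper left and the lower right cell overlap in height
  and are themselves beside each other. Either way the middle line does not move right on the way
  up.\<close>

lemma column_2:
  assumes "hi = Suc lo" "adjacent (a lo) (b hi) \<or> y_lo (a hi) < y_hi (b lo)"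
  shows "x_hi (a hi) \<le> x_lo (b lo)"
  using assms(2)
proof
  assume "adjacent (a lo) (b hi)"
  then show ?thesis
    using beside[of lo lo] beside[of hi hi] in_B[of lo] in_B[of hi] bottom top assms(1) adjacent_imp_le
    by fastforce
next
  assume "y_lo (a hi) < y_hi (b lo)"
  then show ?thesis using beside[of hi lo] in_B[of lo] in_B[of hi] bottom top assms(1) by simp
qed

text \<open>The situation of slot \<open>c1\<close>, the only complex of three levels: its lower
  crossing is positive and its upper one negative.\<close>

lemma column_3:
  assumes "hi = Suc (Suc lo)" "y_lo (a (Suc lo)) < y_hi (b lo)" "adjacent (a (Suc lo)) (b hi)"
  shows "x_hi (a hi) \<le> x_lo (b lo)"
proof -
  have "x_hi (a (Suc lo)) \<le> x_lo (b lo)"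
    using beside[of "Suc lo" lo] in_B[of lo] in_B[of "Suc lo"] assms(1,2) bottom by simp
  moreover have "x_hi (a hi) \<le> x_lo (b hi)"
    using beside[of hi hi] in_B[of hi] top assms(1) by simp
  moreover have "x_lo (b hi) \<le> x_hi (a (Suc lo))" using adjacent_imp_le(2)[OF assms(3)] .
  ultimately show ?thesis by linarith
qed

end

context triples
begin

definition solves :: "nat set \<Rightarrow> bool" where
  "solves S \<longleftrightarrow> (\<forall>j\<in>{1..n}. \<exists>i\<in>{1..m}.
     al i = j \<and> i \<in> S \<or> c1 i = j \<and> i \<notin> S \<or> c2 i = j \<and> i \<notin> S)"

end

text \<open>
  A solution is a function \<open>mc\<close> that assigns a rectangle to every cell name; the block of a name is
  the complex that contains it.
\<close>

locale solved_grid = good_triples +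
  fixes mc :: "nat \<times> nat \<Rightarrow> real rect"
  assumes mc_proper: "\<And>b u. b \<in> set bs \<Longrightarrow> u \<in> set (block_cells b) \<Longrightarrow> proper_rect (mc u)"
    and mc_sub: "\<And>b u. b \<in> set bs \<Longrightarrow> u \<in> set (block_cells b) \<Longrightarrow> area (mc u) \<subseteq> area (T.bbox b)"
    and mc_apart: "\<And>b u v. b \<in> set bs \<Longrightarrow> u \<in> set (block_cells b) \<Longrightarrow> v \<in> set (block_cells b) \<Longrightarrow>
        u \<noteq> v \<Longrightarrow> apart (mc u) (mc v)"
    and mc_adj: "\<And>u v. nbr (2 * n + 2) (3 * m + 2) sgn u v \<Longrightarrow> adjacent (mc u) (mc v)"
begin

lemma block_unique:
  assumes "b \<in> set bs" "b' \<in> set bs" "u \<in> set (block_cells b)" "u \<in> set (block_cells b')"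
  shows "b = b'"
proof -
  obtain i k where "i < length bs" "bs ! i = b" "k < length bs" "bs ! k = b'"
    using assms(1,2) by (metis in_set_conv_nth)
  then show ?thesis
    using distinct_concat_disjoint[OF bs_cells(2), of i k] assms(3,4) by (cases "i = k") auto
qed

lemma block_ex:
  assumes "c < 2 * n + 2" "r < 3 * m + 2"
  obtains b where "b \<in> set bs" "(c, r) \<in> set (block_cells b)"
proof -
  have "(c, r) \<in> set (concat (map block_cells bs))" unfolding bs_cells(1) using assms by simp
  then show ?thesis using that by auto
qed

definition same :: "nat \<times> nat \<Rightarrow> nat \<times> nat \<Rightarrow> bool" where
  "same u v \<longleftrightarrow> (\<exists>b\<in>set bs. u \<in> set (block_cells b) \<and> v \<in> set (block_cells b))"

lemma bounds:
  assumes "(c, w, r, h) \<in> set bs" "u \<in> {c..<c + w} \<times> {r..<r + h}"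
  shows "xi hiT c r \<le> x_lo (mc u)" "x_hi (mc u) \<le> xi hiT (c + w) r"
    "et sel0 hs0 r c \<le> y_lo (mc u)" "y_hi (mc u) \<le> et sel0 hs0 (r + h) c"
  using area_subset_bounds[OF mc_sub[OF assms(1)] mc_proper[OF assms(1)], of u] assms(2)
  by (simp_all add: set_block_cells del: block_cells.simps)

lemma block_data:
  assumes "(c, w, r, h) \<in> set bs" "r' \<in> {r..<r + h}" "c' \<in> {c..<c + w}"
  shows "xi hiT c r' = xi hiT c r" "xi hiT (c + w) r' = xi hiT (c + w) r"
    "et sel0 hs0 r c' = et sel0 hs0 r c" "et sel0 hs0 (r + h) c' = et sel0 hs0 (r + h) c"
  using T.blocks[OF assms(1)] assms(2,3) by blast+

text \<open>Cells of different complexes stay on the two sides of the line of the target between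
  them, and their contact forces both to reach it.\<close>

lemma sep_x:
  assumes "Suc c < 2 * n + 2" "r < 3 * m + 2" "\<not> same (c, r) (Suc c, r)"
  shows "x_hi (mc (c, r)) = xi hiT (Suc c) r" "x_lo (mc (Suc c, r)) = xi hiT (Suc c) r"
proof -
  obtain b where b: "b \<in> set bs" "(c, r) \<in> set (block_cells b)" using block_ex assms by (metis Suc_lessD)
  obtain b' where b': "b' \<in> set bs" "(Suc c, r) \<in> set (block_cells b')" using block_ex assms by metis
  obtain c0 w r0 h where [simp]: "b = (c0, w, r0, h)" by (cases b)
  obtain c0' w' r0' h' where [simp]: "b' = (c0', w', r0', h')" by (cases b')
  have i: "(c, r) \<in> {c0..<c0 + w} \<times> {r0..<r0 + h}" "(Suc c, r) \<in> {c0'..<c0' + w'} \<times> {r0'..<r0' + h'}"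
    using b b' by (simp_all add: set_block_cells del: block_cells.simps)
  have "(Suc c, r) \<notin> {c0..<c0 + w} \<times> {r0..<r0 + h}" "(c, r) \<notin> {c0'..<c0' + w'} \<times> {r0'..<r0' + h'}"
    using assms(3) b b' unfolding same_def by (auto simp: set_block_cells simp del: block_cells.simps)
  then have e: "c0 + w = Suc c" "c0' = Suc c" using i by auto
  have "x_hi (mc (c, r)) \<le> xi hiT (Suc c) r" "xi hiT (Suc c) r \<le> x_lo (mc (Suc c, r))"
    using bounds(2)[of c0 w r0 h "(c, r)"] bounds(1)[of c0' w' r0' h' "(Suc c, r)"] i b b' e
      block_data(2)[of c0 w r0 h r c] block_data(1)[of c0' w' r0' h' r "Suc c"] by auto
  moreover have "adjacent (mc (c, r)) (mc (Suc c, r))"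
    by (rule mc_adj) (use assms in \<open>simp add: nbr_def\<close>)
  ultimately show "x_hi (mc (c, r)) = xi hiT (Suc c) r" "x_lo (mc (Suc c, r)) = xi hiT (Suc c) r"
    using adjacent_left_of by blast+
qed

lemma sep_y:
  assumes "c < 2 * n + 2" "Suc r < 3 * m + 2" "\<not> same (c, r) (c, Suc r)"
  shows "y_hi (mc (c, r)) = et sel0 hs0 (Suc r) c" "y_lo (mc (c, Suc r)) = et sel0 hs0 (Suc r) c"
proof -
  obtain b where b: "b \<in> set bs" "(c, r) \<in> set (block_cells b)" using block_ex assms by (metis Suc_lessD)
  obtain b' where b': "b' \<in> set bs" "(c, Suc r) \<in> set (block_cells b')" using block_ex assms by metis
  obtain c0 w r0 h where [simp]: "b = (c0, w, r0, h)" by (cases b)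
  obtain c0' w' r0' h' where [simp]: "b' = (c0', w', r0', h')" by (cases b')
  have i: "(c, r) \<in> {c0..<c0 + w} \<times> {r0..<r0 + h}" "(c, Suc r) \<in> {c0'..<c0' + w'} \<times> {r0'..<r0' + h'}"
    using b b' by (simp_all add: set_block_cells del: block_cells.simps)
  have "(c, Suc r) \<notin> {c0..<c0 + w} \<times> {r0..<r0 + h}" "(c, r) \<notin> {c0'..<c0' + w'} \<times> {r0'..<r0' + h'}"
    using assms(3) b b' unfolding same_def by (auto simp: set_block_cells simp del: block_cells.simps)
  then have e: "r0 + h = Suc r" "r0' = Suc r" using i by auto
  have "y_hi (mc (c, r)) \<le> et sel0 hs0 (Suc r) c" "et sel0 hs0 (Suc r) c \<le> y_lo (mc (c, Suc r))"
    using bounds(4)[of c0 w r0 h "(c, r)"] bounds(3)[of c0' w' r0' h' "(c, Suc r)"] i b b' e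
      block_data(4)[of c0 w r0 h r c] block_data(3)[of c0' w' r0' h' "Suc r" c] by auto
  moreover have "adjacent (mc (c, r)) (mc (c, Suc r))"
    by (rule mc_adj) (use assms in \<open>simp add: nbr_def\<close>)
  ultimately show "y_hi (mc (c, r)) = et sel0 hs0 (Suc r) c" "y_lo (mc (c, Suc r)) = et sel0 hs0 (Suc r) c"
    using adjacent_below by blast+
qed

lemma not_same_slots:
  assumes "even c"
  shows "\<not> same (c, r) (Suc c, r')"
proof
  assume "same (c, r) (Suc c, r')"
  then obtain c0 w r0 h where b: "(c0, w, r0, h) \<in> set bs" "(c, r) \<in> set (block_cells (c0, w, r0, h))"
    "(Suc c, r') \<in> set (block_cells (c0, w, r0, h))" unfolding same_def by (metis prod.exhaust)
  have i: "c \<in> {c0..<c0 + w}" "Suc c \<in> {c0..<c0 + w}"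
    using b(2,3) by (simp_all add: set_block_cells del: block_cells.simps)
  from b(1) show False
  proof (cases rule: bs_cases)
    case 1
    then show ?thesis using i by auto
  next
    case (2 i j k)
    then have "c = 2 * j - 1" using i by auto
    then show ?thesis using assms 2(2) by auto
  qed
qed

text \<open>The sign pattern turns contacts across complexes into strict inequalities.\<close>

lemma step_left:
  assumes "even c" "Suc c < 2 * n + 2" "Suc r < 3 * m + 2" "\<not> sgn c r" "xi hiT (Suc c) r = xi hiT (Suc c) (Suc r)"
  shows "y_lo (mc (Suc c, Suc r)) < y_hi (mc (c, r))"
proof -
  have "adjacent (mc (c, r)) (mc (Suc c, Suc r))"
    by (rule mc_adj) (use assms in \<open>simp add: nbr_def\<close>)
  moreover have "x_hi (mc (c, r)) = xi hiT (Suc c) r" "x_lo (mc (Suc c, Suc r)) = xi hiT (Suc c) r"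
    using sep_x[of c r] sep_x[of c "Suc r"] not_same_slots[OF assms(1)] assms by auto
  ultimately show ?thesis using adjacent_left_of(4)[of "mc (c, r)" "mc (Suc c, Suc r)" "xi hiT (Suc c) r"] by simp
qed

lemma step_down:
  assumes "odd c" "Suc c < 2 * n + 2" "Suc r < 3 * m + 2" "\<not> sgn c r"
    "\<not> same (c, r) (c, Suc r)" "\<not> same (Suc c, r) (Suc c, Suc r)"
    "et sel0 hs0 (Suc r) c = et sel0 hs0 (Suc r) (Suc c)"
  shows "x_lo (mc (Suc c, Suc r)) < x_hi (mc (c, r))"
proof -
  have "adjacent (mc (c, r)) (mc (Suc c, Suc r))"
    by (rule mc_adj) (use assms in \<open>simp add: nbr_def\<close>)
  moreover have "y_hi (mc (c, r)) = et sel0 hs0 (Suc r) c" "y_lo (mc (Suc c, Suc r)) = et sel0 hs0 (Suc r) c"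
    using sep_y[of c r] sep_y[of "Suc c" r] assms by auto
  ultimately show ?thesis
    using adjacent_below(4)[of "mc (c, r)" "mc (Suc c, Suc r)" "et sel0 hs0 (Suc r) c"] by simp
qed

end

context good_triples
begin

lemma blk_in_bs:
  assumes "i < m" "1 \<le> j" "j \<le> n" "b \<in> set (blk (Suc i) j)"
  shows "b \<in> set bs"
proof -
  have "b \<in> set (concat (map (blk (Suc i)) [1..<Suc n]))"
    using assms by (auto simp: less_Suc_eq_le simp del: upt_Suc)
  then have "b \<in> set (rowblocks (Suc i))" unfolding rowblocks_def set_append by blast
  then have "b \<in> set (concat (map rowblocks [1..<Suc m]))"
    using assms(1) by (auto simp: less_Suc_eq_le simp del: upt_Suc)
  then show ?thesis unfolding bs_def set_append by blast
qed

text \<open>Heights have the form \<open>Suc hi - lo\<close> so as to match the locale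
  \<open>box_cells\<close>.\<close>

lemma groups:
  assumes "i < m" "1 \<le> j" "j \<le> n"
  shows "j < c1 (Suc i) \<Longrightarrow> (2 * j - 1, 2, Suc (3 * i + 0), Suc 0 - 0) \<in> set bs"
    "j < c1 (Suc i) \<Longrightarrow> (2 * j - 1, 2, Suc (3 * i + 1), Suc 2 - 1) \<in> set bs"
    "j = c1 (Suc i) \<Longrightarrow> (2 * j - 1, 2, Suc (3 * i + 0), Suc 2 - 0) \<in> set bs"
    "c1 (Suc i) < j \<Longrightarrow> (2 * j - 1, 2, Suc (3 * i + 0), Suc 1 - 0) \<in> set bs"
    "c1 (Suc i) < j \<Longrightarrow> (2 * j - 1, 2, Suc (3 * i + 2), Suc 2 - 2) \<in> set bs"
  by (rule blk_in_bs[OF assms], simp add: blk_def)+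

lemma sgn_simps:
  assumes "k < 2"
  shows "1 \<le> j \<Longrightarrow> sgn (2 * j - 1) (Suc (3 * i + k)) \<longleftrightarrow> act (Suc i) k j"
    "sgn (2 * j) (Suc (3 * i + k)) \<longleftrightarrow> k = 1 \<and> j = c1 (Suc i)"
    "1 \<le> j \<Longrightarrow> \<not> sgn (2 * j - 1) (3 * i)"
proof -
  have *: "row (Suc (Suc (3 * i + k))) = Suc i" "lev (Suc (Suc (3 * i + k))) = Suc k"
    using row_lev(3,4)[of "Suc k" i] assms by simp_all
  have **: "lev (Suc (3 * i)) = 0" using row_lev(4)[of 0 i] by simp
  show "1 \<le> j \<Longrightarrow> sgn (2 * j - 1) (Suc (3 * i + k)) \<longleftrightarrow> act (Suc i) k j"
    by (simp add: sgn_def *)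
  show "sgn (2 * j) (Suc (3 * i + k)) \<longleftrightarrow> k = 1 \<and> j = c1 (Suc i)"
    by (auto simp: sgn_def *)
  show "1 \<le> j \<Longrightarrow> \<not> sgn (2 * j - 1) (3 * i)" by (simp add: sgn_def **)
qed

end

section \<open>How the lines can run in a solution\<close>

context solved_grid
begin

lemma not_same_below:
  assumes "(c0, w, Suc r, h) \<in> set bs" "c \<in> {c0..<c0 + w}"
  shows "\<not> same (c, r) (c, Suc r)"
proof
  assume "same (c, r) (c, Suc r)"
  then obtain b where b: "b \<in> set bs" "(c, r) \<in> set (block_cells b)" "(c, Suc r) \<in> set (block_cells b)"
    unfolding same_def by blast
  have "(c, Suc r) \<in> set (block_cells (c0, w, Suc r, h))"
    using T.blocks[OF assms(1)] assms(2) by (simp add: set_block_cells del: block_cells.simps)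
  then have "b = (c0, w, Suc r, h)" using block_unique[OF b(1) assms(1) b(3)] by blast
  then show False using b(2) by (simp add: set_block_cells del: block_cells.simps)
qed

lemma not_same_above:
  assumes "(c0, w, r0, h) \<in> set bs" "c \<in> {c0..<c0 + w}" "r0 + h = Suc r"
  shows "\<not> same (c, r) (c, Suc r)"
proof
  assume "same (c, r) (c, Suc r)"
  then obtain b where b: "b \<in> set bs" "(c, r) \<in> set (block_cells b)" "(c, Suc r) \<in> set (block_cells b)"
    unfolding same_def by blast
  have "0 < h" using T.blocks[OF assms(1)] by blast
  then have "(c, r) \<in> set (block_cells (c0, w, r0, h))"
    using assms(2,3) by (simp add: set_block_cells del: block_cells.simps)
  then have "b = (c0, w, r0, h)" using block_unique[OF b(1) assms(1) b(2)] by blast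
  then show False using b(3) assms(3) by (simp add: set_block_cells del: block_cells.simps)
qed

definition A :: "nat \<Rightarrow> nat \<Rightarrow> nat \<Rightarrow> real rect" where "A i j k = mc (2 * j - 1, Suc (3 * i + k))"
definition Bc :: "nat \<Rightarrow> nat \<Rightarrow> nat \<Rightarrow> real rect" where "Bc i j k = mc (2 * j, Suc (3 * i + k))"

lemma box_cells:
  assumes ij: "i < m" "1 \<le> j" "j \<le> n" and lh: "lo \<le> hi" "hi \<le> 2"
    and b: "(2 * j - 1, 2, Suc (3 * i + lo), Suc hi - lo) \<in> set bs"
  shows "box_cells (T.bbox (2 * j - 1, 2, Suc (3 * i + lo), Suc hi - lo)) (A i j) (Bc i j) lo hi"
proof -
  define R where "R = Suc (3 * i + lo)"
  have mem: "(c, Suc (3 * i + k)) \<in> set (block_cells (2 * j - 1, 2, R, Suc hi - lo))"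
    if "lo \<le> k" "k \<le> hi" "c = 2 * j - 1 \<or> c = 2 * j" for c k
    using that ij(2) by (auto simp: set_block_cells R_def simp del: block_cells.simps)
  have b': "(2 * j - 1, 2, R, Suc hi - lo) \<in> set bs" using b by (simp add: R_def)
  have lv: "Suc (3 * i + k) < 3 * m + 1" if "k \<le> 2" for k using that ij(1) by linarith
  have end_lev: "R + (Suc hi - lo) = Suc (Suc (3 * i + hi))" using lh by (simp add: R_def)
  have j1: "2 * j - 1 + 2 = Suc (2 * j)" "Suc (2 * j - 2) = 2 * j - 1" "even (2 * j - 2)" using ij(2) by auto
  show ?thesis unfolding R_def[symmetric]
  proof
    show "lo \<le> hi" by fact
    fix k assume k: "lo \<le> k" "k \<le> hi"
    show "proper_rect (A i j k) \<and> proper_rect (Bc i j k)"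
      "area (A i j k) \<subseteq> area (T.bbox (2 * j - 1, 2, R, Suc hi - lo)) \<and>
       area (Bc i j k) \<subseteq> area (T.bbox (2 * j - 1, 2, R, Suc hi - lo))"
      using mc_proper[OF b' mem[OF k]] mc_sub[OF b' mem[OF k]] by (auto simp: A_def Bc_def)
    have kR: "Suc (3 * i + k) \<in> {R..<R + (Suc hi - lo)}" using k by (simp add: R_def)
    note l = lv[OF order_trans[OF k(2) lh(2)]]
    have "x_lo (mc (Suc (2 * j - 2), Suc (3 * i + k))) = xi hiT (Suc (2 * j - 2)) (Suc (3 * i + k))"
      using not_same_slots[OF j1(3)] ij(3) l by (intro sep_x(2)) auto
    then show "x_lo (A i j k) = x_lo (T.bbox (2 * j - 1, 2, R, Suc hi - lo))"
      using block_data(1)[OF b' kR, of "2 * j - 1"] unfolding j1(2) by (simp add: A_def)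
    have "x_hi (mc (2 * j, Suc (3 * i + k))) = xi hiT (Suc (2 * j)) (Suc (3 * i + k))"
      using not_same_slots[of "2 * j"] ij(3) l by (intro sep_x(1)) auto
    then show "x_hi (Bc i j k) = x_hi (T.bbox (2 * j - 1, 2, R, Suc hi - lo))"
      using block_data(2)[OF b' kR, of "2 * j - 1"] j1(1) by (simp add: Bc_def)
  next
    fix k l assume kl: "lo \<le> k" "k \<le> hi" "lo \<le> l" "l \<le> hi"
    show "apart (A i j k) (Bc i j l)"
      unfolding A_def Bc_def
    proof (rule mc_apart[OF b' mem[OF kl(1,2)] mem[OF kl(3,4)]])
      have "2 * j - 1 \<noteq> 2 * j" using ij(2) by linarith
      then show "(2 * j - 1, Suc (3 * i + k)) \<noteq> (2 * j, Suc (3 * i + l))" by simp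
    qed simp_all
    show "apart (A i j k) (A i j l) \<and> apart (Bc i j k) (Bc i j l)" if "k \<noteq> l"
      using mc_apart[OF b' mem[OF kl(1,2)] mem[OF kl(3,4)], of "2 * j - 1" "2 * j - 1"]
        mc_apart[OF b' mem[OF kl(1,2)] mem[OF kl(3,4)], of "2 * j" "2 * j"] that
      by (simp add: A_def Bc_def)
  next
    have y: "y_lo (mc (c, R)) = et sel0 hs0 R (2 * j - 1)"
      "y_hi (mc (c, Suc (3 * i + hi))) = et sel0 hs0 (R + (Suc hi - lo)) (2 * j - 1)"
      if "c = 2 * j - 1 \<or> c = 2 * j" for c
    proof -
      have c: "c \<in> {2 * j - 1..<2 * j - 1 + 2}" "c < 2 * n + 2" using that ij by auto
      have R0: "R \<in> {R..<R + (Suc hi - lo)}" using lh by simp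
      have "R = Suc (3 * i + lo)" by (simp add: R_def)
      moreover have "y_lo (mc (c, Suc (3 * i + lo))) = et sel0 hs0 (Suc (3 * i + lo)) c"
        using not_same_below[of "2 * j - 1" 2 "3 * i + lo" "Suc hi - lo" c] b c lv[of lo] lh
        by (intro sep_y(2)) auto
      ultimately show "y_lo (mc (c, R)) = et sel0 hs0 R (2 * j - 1)"
        using block_data(3)[OF b' R0 c(1)] lh by simp
      have "y_hi (mc (c, Suc (3 * i + hi))) = et sel0 hs0 (Suc (Suc (3 * i + hi))) c"
        using not_same_above[OF b' c(1) end_lev] c lv[of hi] lh by (intro sep_y(1)) auto
      then show "y_hi (mc (c, Suc (3 * i + hi))) = et sel0 hs0 (R + (Suc hi - lo)) (2 * j - 1)"
        using block_data(4)[OF b' R0 c(1)] lh unfolding end_lev by simp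
    qed
    show "y_lo (A i j lo) = y_lo (T.bbox (2 * j - 1, 2, R, Suc hi - lo))"
      "y_lo (Bc i j lo) = y_lo (T.bbox (2 * j - 1, 2, R, Suc hi - lo))"
      using y(1) by (simp_all add: A_def Bc_def R_def)
    show "y_hi (A i j hi) = y_hi (T.bbox (2 * j - 1, 2, R, Suc hi - lo))"
      "y_hi (Bc i j hi) = y_hi (T.bbox (2 * j - 1, 2, R, Suc hi - lo))"
      using y(2) by (simp_all add: A_def Bc_def)
  qed
qed

lemma minus_adj:
  assumes "i < m" "1 \<le> j" "j \<le> n" "k < 2" "\<not> act (Suc i) k j"
  shows "adjacent (A i j k) (Bc i j (Suc k))"
proof -
  have "nbr (2 * n + 2) (3 * m + 2) sgn (2 * j - 1, Suc (3 * i + k)) (Suc (2 * j - 1), Suc (Suc (3 * i + k)))"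
    using assms sgn_simps(1)[OF assms(4,2), of i] by (simp add: nbr_def)
  then show ?thesis using mc_adj assms(2) by (fastforce simp: A_def Bc_def)
qed

text \<open>At a positive crossing where the horizontal line does not rise, the sign has to come
  from a middle line that moves right.\<close>

definition served :: "nat \<Rightarrow> nat \<Rightarrow> bool" where
  "served i j \<longleftrightarrow> (\<exists>k<2. act (Suc i) k j \<and> y_hi (Bc i j k) \<le> y_lo (A i j (Suc k)))"

lemma step_inside:
  assumes "i < m" "1 \<le> j" "j \<le> n" "k < 2" "bord (Suc i) k j"
  shows "x_lo (Bc i j (Suc k)) < x_hi (A i j k)"
proof -
  have na: "\<not> act (Suc i) k j" using act_not_bord[of "Suc i" k j] assms by auto
  have "\<exists>h. (2 * j - 1, 2, Suc (Suc (3 * i + k)), h) \<in> set bs"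
  proof (cases "k = 0")
    case True
    then show ?thesis using groups(2)[OF assms(1-3)] assms(5) by (auto simp: bord_def)
  next
    case False
    then have "k = 1" using assms(4) by simp
    then show ?thesis using groups(5)[OF assms(1-3)] assms(5) by (auto simp: bord_def numeral_2_eq_2)
  qed
  then obtain h where "(2 * j - 1, 2, Suc (Suc (3 * i + k)), h) \<in> set bs" ..
  from not_same_below[OF this] have ns: "\<not> same (c, Suc (3 * i + k)) (c, Suc (Suc (3 * i + k)))"
    if "c = 2 * j - 1 \<or> c = 2 * j" for c using that assms(2) by auto
  have "x_lo (mc (Suc (2 * j - 1), Suc (Suc (3 * i + k)))) < x_hi (mc (2 * j - 1, Suc (3 * i + k)))"
  proof (rule step_down)
    show "odd (2 * j - 1)" "Suc (2 * j - 1) < 2 * n + 2" "Suc (Suc (3 * i + k)) < 3 * m + 2"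
      using assms by auto
    show "\<not> sgn (2 * j - 1) (Suc (3 * i + k))" using sgn_simps(1)[OF assms(4,2)] na by simp
    show "et sel0 hs0 (Suc (Suc (3 * i + k))) (2 * j - 1) = et sel0 hs0 (Suc (Suc (3 * i + k))) (Suc (2 * j - 1))"
      using ye_border[OF assms(1,4,5,2,3), of sel0 hs0] assms(2) by (simp add: et_def)
  qed (use ns assms(2) in simp_all)
  then show ?thesis using assms(2) by (simp add: A_def Bc_def)
qed

text \<open>Negative crossings do not let the middle line move right, nor do positive ones at which
  the horizontal line rises; a border of complexes in the row even forces it to the left. So without
  service the middle line is not further right at the top of the row than at its bottom.\<close>

lemma row_step:
  assumes ij: "i < m" "1 \<le> j" "j \<le> n" and ns: "\<not> served i j"
  shows "x_hi (A i j 2) \<le> x_lo (Bc i j 0)"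
proof -
  have V: "act (Suc i) k j \<Longrightarrow> y_lo (A i j (Suc k)) < y_hi (Bc i j k)" if "k < 2" for k
    using ns that unfolding served_def by force
  consider "j < c1 (Suc i)" | "j = c1 (Suc i)" | "c1 (Suc i) < j" by linarith
  then show ?thesis
  proof cases
    case 1
    interpret u: box_cells "T.bbox (2 * j - 1, 2, Suc (3 * i + 1), Suc 2 - 1)" "A i j" "Bc i j" 1 2
      by (rule box_cells[OF ij _ _ groups(2)[OF ij 1]]) simp_all
    interpret l: box_cells "T.bbox (2 * j - 1, 2, Suc (3 * i + 0), Suc 0 - 0)" "A i j" "Bc i j" 0 0
      by (rule box_cells[OF ij _ _ groups(1)[OF ij 1]]) simp_all
    have "x_hi (A i j 2) \<le> x_lo (Bc i j 1)"
      using u.column_2 V[of 1] minus_adj[OF ij, of 1] by (cases "act (Suc i) 1 j") (auto simp: numeral_2_eq_2)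
    also have "x_lo (Bc i j 1) < x_hi (A i j 0)" using step_inside[OF ij, of 0] 1 by (simp add: bord_def)
    also have "\<dots> \<le> x_lo (Bc i j 0)" using l.column_1 by simp
    finally show ?thesis by simp
  next
    case 2
    interpret u: box_cells "T.bbox (2 * j - 1, 2, Suc (3 * i + 0), Suc 2 - 0)" "A i j" "Bc i j" 0 2
      by (rule box_cells[OF ij _ _ groups(3)[OF ij 2]]) simp_all
    have "act (Suc i) 0 j" "\<not> act (Suc i) 1 j" using 2 ord[of "Suc i"] ij(1) by (auto simp: act_def)
    then show ?thesis using u.column_3 V[of 0] minus_adj[OF ij, of 1] by (simp add: numeral_2_eq_2)
  next
    case 3
    interpret u: box_cells "T.bbox (2 * j - 1, 2, Suc (3 * i + 2), Suc 2 - 2)" "A i j" "Bc i j" 2 2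
      by (rule box_cells[OF ij _ _ groups(5)[OF ij 3]]) simp_all
    interpret l: box_cells "T.bbox (2 * j - 1, 2, Suc (3 * i + 0), Suc 1 - 0)" "A i j" "Bc i j" 0 1
      by (rule box_cells[OF ij _ _ groups(4)[OF ij 3]]) simp_all
    have "x_hi (A i j 2) \<le> x_lo (Bc i j 2)" using u.column_1 by simp
    also have "x_lo (Bc i j 2) < x_hi (A i j 1)"
      using step_inside[OF ij, of 1] 3 by (simp add: bord_def numeral_2_eq_2)
    also have "\<dots> \<le> x_lo (Bc i j 0)"
      using l.column_2 V[of 0] minus_adj[OF ij, of 0] by (cases "act (Suc i) 0 j") auto
    finally show ?thesis by simp
  qed
qed

lemma row_boundary:
  assumes "i \<le> m" "1 \<le> j" "j \<le> n"
  shows "x_lo (mc (2 * j, Suc (3 * i))) < x_hi (mc (2 * j - 1, 3 * i))"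
proof -
  have ns: "\<not> same (c, 3 * i) (c, Suc (3 * i))" if "c = 2 * j - 1 \<or> c = 2 * j" for c
  proof (cases "i = m")
    case True
    have "(c, 1, Suc (3 * m), 1) \<in> set bs" using that assms by (auto simp: bs_def simp del: upt_Suc)
    then show ?thesis using not_same_below[of c 1 "3 * i" 1 c] True by simp
  next
    case False
    then have i: "i < m" using assms(1) by simp
    obtain h where "(2 * j - 1, 2, Suc (3 * i), h) \<in> set bs"
      using groups[OF i assms(2,3)] by (metis add_0_right nat_neq_iff)
    then show ?thesis using not_same_below that assms(2) by fastforce
  qed
  have "x_lo (mc (Suc (2 * j - 1), Suc (3 * i))) < x_hi (mc (2 * j - 1, 3 * i))"
  proof (rule step_down)
    show "odd (2 * j - 1)" "Suc (2 * j - 1) < 2 * n + 2" "Suc (3 * i) < 3 * m + 2" using assms by auto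
    show "\<not> sgn (2 * j - 1) (3 * i)" using sgn_simps(3)[of 0] assms(2) by simp
    show "et sel0 hs0 (Suc (3 * i)) (2 * j - 1) = et sel0 hs0 (Suc (3 * i)) (Suc (2 * j - 1))"
      using ye_simps(2)[OF assms(1)] by (simp add: et_def)
  qed (use ns assms(2) in simp_all)
  then show ?thesis using assms(2) by simp
qed

text \<open>Without service in any row, the middle line would never move right on the way up,
  although the target has it on the left in the bottom row and on the right in the top row.\<close>

lemma column_served:
  assumes j: "1 \<le> j" "j \<le> n"
  shows "\<exists>i<m. served i j"
proof (rule ccontr)
  assume *: "\<not> ?thesis"
  have "x_hi (mc (2 * j - 1, 3 * i)) \<le> xi hiT (2 * j) 0" if "i \<le> m" for i
    using that
  proof (induction i)
    case 0
    have "(2 * j - 1, 1, 0, 1) \<in> set bs" using j by (auto simp: bs_def simp del: upt_Suc)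
    from bounds(2)[OF this, of "(2 * j - 1, 0)"] show ?case using j by simp
  next
    case (Suc i)
    have "x_hi (A i j 2) \<le> x_lo (Bc i j 0)" using row_step j * Suc.prems by simp
    also have "\<dots> < x_hi (mc (2 * j - 1, 3 * i))" using row_boundary[of i j] j Suc.prems by (simp add: Bc_def)
    also have "\<dots> \<le> xi hiT (2 * j) 0" using Suc by simp
    finally have "x_hi (mc (2 * j - 1, Suc (3 * i + 2))) < xi hiT (2 * j) 0" by (simp only: A_def)
    moreover have "Suc (3 * i + 2) = 3 * Suc i" by simp
    ultimately show ?case by (simp only: less_imp_le)
  qed
  from this[of m] have "x_lo (mc (2 * j, Suc (3 * m))) < xi hiT (2 * j) 0"
    using row_boundary[of m j] j by simp
  moreover have "(2 * j, 1, Suc (3 * m), 1) \<in> set bs" using j by (auto simp: bs_def simp del: upt_Suc)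
  from bounds(1)[OF this, of "(2 * j, Suc (3 * m))"] have "xi hiT (2 * j) (Suc (3 * m)) \<le> x_lo (mc (2 * j, Suc (3 * m)))"
    by simp
  \<comment> \<open>The right position outweighs the drift to the left over all rows, as
    \<open>2 * (m + 1) < 2 * (m + 3)\<close>.\<close>
  moreover have "xe hiT (2 * j) 0 < xe hiT (2 * j) (Suc (3 * m))"
    using j row_lev(3)[of 0 m] by (simp add: xe_def hiT_def extra_def)
  then have "xi hiT (2 * j) 0 < xi hiT (2 * j) (Suc (3 * m))" by (simp add: xi_def)
  ultimately show False by linarith
qed

text \<open>The vertical line between two slots is straight within a row and the crossing is
  negative, so the horizontal line falls strictly to the right. The exception is the climb of the
  upper line after \<open>c1\<close>.\<close>

lemma step_slot:
  assumes "i < m" "j \<le> n" "k < 2" "\<not> (k = 1 \<and> j = c1 (Suc i))"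
  shows "y_lo (A i (Suc j) (Suc k)) < y_hi (Bc i j k)"
proof -
  have r: "row (Suc (3 * i + k)) = Suc i" "row (Suc (Suc (3 * i + k))) = Suc i"
    using row_lev(3)[of k i] row_lev(3)[of "Suc k" i] assms(3) by simp_all
  have "y_lo (mc (Suc (2 * j), Suc (Suc (3 * i + k)))) < y_hi (mc (2 * j, Suc (3 * i + k)))"
    using assms sgn_simps(2)[OF assms(3), of j i] by (intro step_left) (auto simp: xi_def xe_def r)
  then show ?thesis by (simp add: A_def Bc_def)
qed

text \<open>At a negative crossing the contact prevents a rise of the line, at a positive one the
  service does.\<close>

lemma pass_or_served:
  assumes ij: "i < m" "1 \<le> j" "j \<le> n" and k: "k < 2" "\<not> bord (Suc i) k j"
    and s: "act (Suc i) k j \<Longrightarrow> served i j"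
  shows "y_hi (Bc i j k) \<le> y_lo (A i j (Suc k))"
proof (cases "act (Suc i) k j")
  case True
  then obtain k' where "k' < 2" "act (Suc i) k' j" "y_hi (Bc i j k') \<le> y_lo (A i j (Suc k'))"
    using s unfolding served_def by blast
  \<comment> \<open>A slot has at most one positive crossing in a row, since \<open>c2\<close>,
    \<open>c1\<close> and \<open>al\<close> differ.\<close>
  moreover have "k' = k" using calculation True ord[of "Suc i"] ij(1) k by (auto simp: act_def)
  ultimately show ?thesis by simp
next
  case False
  note adj = minus_adj[OF ij k(1) False]
  consider "j < c1 (Suc i)" | "j = c1 (Suc i)" | "c1 (Suc i) < j" by linarith
  then show ?thesis
  proof cases
    case 1
    interpret u: box_cells "T.bbox (2 * j - 1, 2, Suc (3 * i + 1), Suc 2 - 1)" "A i j" "Bc i j" 1 2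
      by (rule box_cells[OF ij _ _ groups(2)[OF ij 1]]) simp_all
    have "k = 1" using k 1 by (auto simp: bord_def)
    then show ?thesis using u.pass[of 1] adj by (simp add: numeral_2_eq_2)
  next
    case 2
    interpret u: box_cells "T.bbox (2 * j - 1, 2, Suc (3 * i + 0), Suc 2 - 0)" "A i j" "Bc i j" 0 2
      by (rule box_cells[OF ij _ _ groups(3)[OF ij 2]]) simp_all
    show ?thesis using u.pass[of k] adj k(1) by (auto simp: numeral_2_eq_2 less_Suc_eq)
  next
    case 3
    interpret l: box_cells "T.bbox (2 * j - 1, 2, Suc (3 * i + 0), Suc 1 - 0)" "A i j" "Bc i j" 0 1
      by (rule box_cells[OF ij _ _ groups(4)[OF ij 3]]) simp_all
    have "k = 0" using k 3 by (auto simp: bord_def)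
    then show ?thesis using l.pass[of 0] adj by simp
  qed
qed

text \<open>
  If a row serves its positive slot, its lower line is high up to \<open>c1\<close>; so the row does not serve
  \<open>c1\<close>, its upper line is high there, and therefore the row does not serve \<open>c2\<close>.
\<close>

lemma served_exclusive:
  assumes i: "i < m" and s: "served i (al (Suc i))"
  shows "\<not> served i (c1 (Suc i))" "\<not> served i (c2 (Suc i))"
proof -
  define p q s' where "p = c2 (Suc i)" and "q = c1 (Suc i)" and "s' = al (Suc i)"
  have o: "1 \<le> p" "p < q" "q < s'" "s' \<le> n" using ord[of "Suc i"] i by (auto simp: p_def q_def s'_def)
  \<comment> \<open>At the right rim the lower line lies exactly at the base of band 2, because the
    fall per slot is used up there. Everything in bands 0 and 1 is below \<open>E\<close>.\<close>
  define E where "E = et sel0 hs0 (Suc (Suc (3 * i))) (2 * n + 1)"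
  have E: "E = 2 ^ (Suc i * F + 1 + 2 * G)"
    using ye_simps(3)[of i 0 sel0 hs0 "2 * n + 1"] i o
    by (simp add: E_def et_def band_def sel0_def del_def s'_def)
  have low: "ye sel0 hs0 (Suc (3 * i + Suc k)) c < Suc i * F + 1 + 2 * G" if "k < 2" "band sel0 (Suc i) k c < 2" for k c
    using mult_G_less[OF del_le, of "band sel0 (Suc i) k c" 2 "slot c" hs0 "Suc i" k c] that
    unfolding ye_simps(3)[OF i that(1)] by simp
  have lo: "et sel0 hs0 (Suc (3 * i + Suc k)) c < E" if "k < 2" "band sel0 (Suc i) k c < 2" for k c
    using low[OF that] unfolding E et_def by (intro power_strict_increasing) auto
  \<comment> \<open>Leftwards the lower line only gets higher, as far as it runs inside complexes,
    that is down to slot \<open>c1\<close>.\<close>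
  have B0: "E < y_hi (Bc i j 0)" if "q \<le> j" "j \<le> n" for j
    using that(2,1)
  proof (induction j rule: inc_induct)
    case base
    have "(2 * n + 1, 1, Suc (Suc (3 * i)), 1) \<in> set bs"
      unfolding bs_def rowblocks_def using i
      by (auto simp: numeral_3_eq_3 less_Suc_eq_le simp del: upt_Suc intro!: bexI[of _ "Suc i"])
    from bounds(3)[OF this, of "(2 * n + 1, Suc (Suc (3 * i)))"] have "E \<le> y_lo (A i (Suc n) 1)"
      by (simp add: E_def A_def)
    then show ?case using step_slot[OF i, of n 0] by simp
  next
    case (step j)
    have "E < y_hi (Bc i (Suc j) 0)" using step by simp
    also have "\<dots> \<le> y_lo (A i (Suc j) (Suc 0))"
      using step o s i by (intro pass_or_served) (auto simp: bord_def act_def q_def s'_def p_def)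
    also have "\<dots> < y_hi (Bc i j 0)" using step_slot[OF i, of j 0] step by simp
    finally show ?case .
  qed
  have q: "1 \<le> q" "q \<le> n" using o by auto
  show nq: "\<not> served i (c1 (Suc i))"
  proof
    assume sq: "served i (c1 (Suc i))"
    have "E < y_hi (Bc i q 0)" using B0 q by simp
    also have "\<dots> \<le> y_lo (A i q (Suc 0))"
      using q i sq by (intro pass_or_served) (auto simp: bord_def q_def)
    also have "\<dots> < y_hi (Bc i (q - 1) 0)" using step_slot[OF i, of "q - 1" 0] q by simp
    finally have "E < y_hi (Bc i (q - 1) 0)" .
    also have "\<dots> \<le> et sel0 hs0 (Suc (3 * i + Suc 0)) (2 * (q - 1) - 1)"
    proof -
      have "(2 * (q - 1) - 1, 2, Suc (3 * i + 0), Suc 0 - 0) \<in> set bs"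
        using o by (intro groups(1)[OF i]) (auto simp: q_def)
      from bounds(4)[OF this, of "(2 * (q - 1), Suc (3 * i))"] show ?thesis
        using o by (simp add: Bc_def)
    qed
    finally have "E < et sel0 hs0 (Suc (3 * i + Suc 0)) (2 * (q - 1) - 1)" .
    moreover have "et sel0 hs0 (Suc (3 * i + Suc 0)) (2 * (q - 1) - 1) < E"
      using o by (intro lo) (auto simp: band_def sel0_def s'_def q_def)
    ultimately show False by simp
  qed
  interpret u: box_cells "T.bbox (2 * q - 1, 2, Suc (3 * i + 0), Suc 2 - 0)" "A i q" "Bc i q" 0 2
    by (rule box_cells[OF i q _ _ groups(3)[OF i q]]) (simp_all add: q_def)
  show "\<not> served i (c2 (Suc i))"
  proof
    assume sp: "served i (c2 (Suc i))"
    \<comment> \<open>In slot \<open>c1\<close> both lines run inside one complex, so the upper line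
      inherits the height of the lower one.\<close>
    have top: "E < y_lo (A i q 2)"
    proof -
      have "E < y_hi (Bc i q 0)" using B0 q by simp
      also have "\<dots> \<le> y_lo (Bc i q 1)" using u.stacked(2)[of 0] by simp
      also have "\<dots> < y_hi (Bc i q 1)" using u.in_B[of 1] by simp
      also have "\<dots> \<le> y_lo (A i q (Suc 1))"
        using q i o by (intro pass_or_served) (auto simp: bord_def act_def q_def p_def)
      finally show ?thesis by (simp add: numeral_2_eq_2)
    qed
    have B1: "E < y_hi (Bc i j 1)" if "j \<le> q - 1" for j
      using that
    proof (induction j rule: inc_induct)
      case base
      have "y_lo (A i (Suc (q - 1)) (Suc 1)) < y_hi (Bc i (q - 1) 1)"
        using q by (intro step_slot[OF i]) (auto simp: q_def)
      then show ?case using top q by (simp add: numeral_2_eq_2)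
    next
      case (step j)
      have "E < y_hi (Bc i (Suc j) 1)" using step by simp
      also have "\<dots> \<le> y_lo (A i (Suc j) (Suc 1))"
        using step o sp i by (intro pass_or_served) (auto simp: bord_def act_def q_def s'_def p_def)
      also have "\<dots> < y_hi (Bc i j 1)" using step o by (intro step_slot[OF i]) (auto simp: q_def)
      finally show ?case .
    qed
    have "(0, 1, Suc (Suc (3 * i)), 1) \<in> set bs"
      unfolding bs_def rowblocks_def using i
      by (auto simp: numeral_3_eq_3 less_Suc_eq_le simp del: upt_Suc intro!: bexI[of _ "Suc i"])
    from bounds(4)[OF this, of "(0, Suc (Suc (3 * i)))"]
    have "y_hi (Bc i 0 1) \<le> et sel0 hs0 (Suc (3 * i + Suc 1)) 0" by (simp add: Bc_def)
    also have "\<dots> < E" using o by (intro lo) (auto simp: band_def sel0_def)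
    finally show False using B1[of 0] by simp
  qed
qed

theorem solves_served: "solves {i. 1 \<le> i \<and> i \<le> m \<and> served (i - 1) (al i)}"
  unfolding solves_def
proof
  fix j assume "j \<in> {1..n}"
  then obtain i where i: "i < m" "served i j" using column_served[of j] by auto
  then have "j = al (Suc i) \<or> j = c1 (Suc i) \<or> j = c2 (Suc i)" by (auto simp: served_def act_def)
  then show "\<exists>i\<in>{1..m}. al i = j \<and> i \<in> {i. 1 \<le> i \<and> i \<le> m \<and> served (i - 1) (al i)} \<or>
      c1 i = j \<and> i \<notin> {i. 1 \<le> i \<and> i \<le> m \<and> served (i - 1) (al i)} \<or>
      c2 i = j \<and> i \<notin> {i. 1 \<le> i \<and> i \<le> m \<and> served (i - 1) (al i)}"
    using i served_exclusive[OF i(1)] by (intro bexI[of _ "Suc i"]) auto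
qed

end

section \<open>Solutions of the triple system yield layouts\<close>

context good_triples
begin

text \<open>The parameters only move pieces of lines inside complexes. The ends of middle lines in
  the bottom and top rows are fixed by assumption, and \<open>band\<close> does not depend on
  \<open>sel\<close> at the rims and on the borders of complexes.\<close>

lemma bbox_eq_T:
  assumes ok: "jumps_ok hi sel hs"
    and h: "\<And>j. 1 \<le> j \<Longrightarrow> j \<le> n \<Longrightarrow> \<not> hi j 0" "\<And>j. 1 \<le> j \<Longrightarrow> j \<le> n \<Longrightarrow> hi j (3 * m + 1)"
    and b: "b \<in> set bs"
  shows "blocked_grid.bbox (xi hi) (et sel hs) b = T.bbox b"
proof -
  interpret M: blocked_grid "2 * n + 2" "3 * m + 2" "xi hi" "et sel hs" bs by (rule blocked[OF ok])
  obtain c w r h where [simp]: "b = (c, w, r, h)" by (cases b)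
  have mem: "(c, w, r, h) \<in> set bs" using b by simp
  have xodd: "xe hi c' r' = xe hiT c' r'" if "odd c' \<or> c' = 0 \<or> c' = 2 * n + 2" for c' r'
    using that by (auto simp: xe_def)
  have xend: "xe hi c' r' = xe hiT c' r'" if "r' = 0 \<or> r' = 3 * m + 1" "c' \<le> 2 * n + 2" for c' r'
  proof (cases "odd c' \<or> c' = 0 \<or> c' = 2 * n + 2")
    case False
    then have "1 \<le> c' div 2" "c' div 2 \<le> n" using that(2) by auto
    then have "hi (c' div 2) r' = hiT (c' div 2) r'" using h that(1) by (auto simp: hiT_def)
    then show ?thesis by (simp add: xe_def)
  qed (rule xodd)
  have ystr: "ye sel hs r' c' = ye sel0 hs0 r' c'" if "r' = 0 \<or> r' = 3 * m + 2 \<or> lev r' = 0" for r' c'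
    using that by (auto simp: ye_def)
  have lev1: "lev 1 = 0" "lev (Suc (3 * i)) = 0" for i using row_lev(4)[of 0 0] row_lev(4)[of 0 i] by simp_all
  have yline: "ye sel hs (Suc (3 * i + Suc k)) c' = ye sel0 hs0 (Suc (3 * i + Suc k)) c'"
    if "i < m" "k < 2" "c' = 0 \<or> c' = 2 * n + 1 \<or> (\<exists>j. 1 \<le> j \<and> j \<le> n \<and> c' = 2 * j - 1 \<and> bord (Suc i) k j)" for i k c'
  proof -
    have o: "1 \<le> c2 (Suc i)" "c2 (Suc i) < c1 (Suc i)" "c1 (Suc i) < al (Suc i)" "al (Suc i) \<le> n"
      using ord[of "Suc i"] that(1) by auto
    have "slot c' = 0 \<or> slot c' = n + 1 \<or> bord (Suc i) k (slot c')"
      using that(3) by auto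
    then have "del hs (Suc i) k c' = del hs0 (Suc i) k c'" by (auto simp: del_def)
    moreover have "band sel (Suc i) k c' = band sel0 (Suc i) k c'"
      using that(2,3) o by (auto simp: band_def bord_def sel0_def)
    ultimately show ?thesis by (simp only: ye_simps(3)[OF that(1,2)])
  qed
  have yall: "ye sel hs r' c' = ye sel0 hs0 r' c'" if "c' = 0 \<or> c' = 2 * n + 1" "r' \<le> 3 * m + 2" for r' c'
  proof (cases "r' = 3 * m + 2")
    case False
    then have "r' < 3 * m + 2" using that(2) by simp
    then show ?thesis
    proof (cases rule: line_cases)
      case (2 i)
      then show ?thesis using ystr lev1 by blast
    next
      case (3 i k)
      have "c' = 0 \<or> c' = 2 * n + 1 \<or> (\<exists>j. 1 \<le> j \<and> j \<le> n \<and> c' = 2 * j - 1 \<and> bord (Suc i) k j)"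
        using that(1) by blast
      from yline[OF 3(1,2) this] show ?thesis unfolding 3(3) .
    qed (use ystr in simp)
  qed (use ystr in simp)
  from mem have "xe hi c r = xe hiT c r \<and> xe hi (c + w) r = xe hiT (c + w) r \<and>
      ye sel hs r c = ye sel0 hs0 r c \<and> ye sel hs (r + h) c = ye sel0 hs0 (r + h) c"
  proof (cases rule: bs_cases)
    case 1
    from 1(5) show ?thesis
    proof (elim disjE)
      assume "r = 0"
      then show ?thesis using 1 xend[of 0] ystr[of 0] ystr[of 1] lev1 by simp
    next
      assume "r = 3 * m + 1"
      then show ?thesis using 1 xend[of "3 * m + 1"] ystr[of "Suc (3 * m)"] ystr[of "3 * m + 2"] lev1(2)[of m] by simp
    next
      assume "c = 0"
      then show ?thesis using 1 xodd yall by simp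
    next
      assume "c = 2 * n + 1"
      then show ?thesis using 1 xodd yall by simp
    qed
  next
    case (2 i j k)
    have "odd c" "odd (c + w)" using 2 by auto
    moreover have *: "ye sel hs (Suc (3 * i + l)) c = ye sel0 hs0 (Suc (3 * i + l)) c"
      if "l = 0 \<or> l = 3 \<or> l < 3 \<and> bord (Suc i) (l - 1) j" for l
    proof (cases "l = 0 \<or> l = 3")
      case True
      have "Suc (3 * i + 3) = Suc (3 * Suc i)" by simp
      then show ?thesis using True ystr lev1(2)[of i] lev1(2)[of "Suc i"] by auto
    next
      case False
      then have l: "l = Suc (l - 1)" "l - 1 < 2" "bord (Suc i) (l - 1) j" using that by auto
      then have "ye sel hs (Suc (3 * i + Suc (l - 1))) c = ye sel0 hs0 (Suc (3 * i + Suc (l - 1))) c"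
        using 2 by (intro yline) auto
      then show ?thesis using l(1) by simp
    qed
    have "ye sel hs r c = ye sel0 hs0 r c"
    proof -
      have "k = 0 \<or> k = 3 \<or> k < 3 \<and> bord (Suc i) (k - 1) j" using 2(7-9) by auto
      then show ?thesis using *[of k] 2(6) by simp
    qed
    moreover have "ye sel hs (r + h) c = ye sel0 hs0 (r + h) c"
    proof -
      have "k + h = 0 \<or> k + h = 3 \<or> k + h < 3 \<and> bord (Suc i) (k + h - 1) j"
        using 2(8,10) by (cases "k + h = 3") auto
      moreover have "r + h = Suc (3 * i + (k + h))" using 2(6) by simp
      ultimately show ?thesis using *[of "k + h"] by metis
    qed
    ultimately show ?thesis using xodd by simp
  qed
  then show ?thesis by (simp add: xi_def et_def)
qed

end

text \<open>Inner line \<open>k\<close> of row \<open>i\<close> lies just above level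
  \<open>3 * i - 2 + k\<close>. The residue modulo 3 recovers \<open>k\<close> and tells these
  levels from \<open>3 * i\<close>, which lies below a row border.\<close>

lemma line_index_inj: "i = s \<and> k = l" if "1 \<le> s" "l < 2" "1 \<le> i" "k < 2" "3 * s - 2 + l = 3 * i - 2 + k" for s l i k :: nat
proof -
  have "3 * s + l = 3 * i + k" using that by linarith
  then have "(3 * s + l) mod 3 = (3 * i + k) mod 3" by simp
  then have "l = k" using that by simp
  then show ?thesis using that by simp
qed
lemma line_index_ne: "3 * s - 2 + l \<noteq> 3 * i" if "1 \<le> s" "l < 2" for s l i:: nat
proof
  assume "3 * s - 2 + l = 3 * i"
  then have "3 * s + l = 3 * i + 2" using that by linarith
  then have "(3 * s + l) mod 3 = (2 + 3 * i) mod 3" by (simp add: add.commute)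
  then show False using that by (simp only: mod_mult_self4 mod_mult_self2) simp
qed
lemma line_index_step: "(x < 3 * i - 2 + k) = (x < 3 * i - 1 + k)" if "x \<noteq> 3 * i - 2 + k" "1 \<le> i" for x i k :: nat
  using that by auto
lemma less_add_one_iff: "(x < 3 * i) = (x < 3 * i + 1)" if "x \<noteq> 3 * i"  for x i k :: nat
  using that by auto

section \<open>A layout from a selection of rows\<close>

context good_triples
begin

context
  fixes S :: "nat set"
  assumes S: "solves S"
begin

text \<open>Several rows may be able to serve a slot; the middle line moves in one of them, and the
  positive crossings of the others are produced by \<open>del\<close>.\<close>

definition srv :: "nat \<Rightarrow> nat" where
  "srv j = (SOME i. i \<in> {1..m} \<and> (al i = j \<and> i \<in> S \<or> c1 i = j \<and> i \<notin> S \<or> c2 i = j \<and> i \<notin> S))"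

definition ln :: "nat \<Rightarrow> nat" where "ln j = (if c2 (srv j) = j then 1 else 0)"
text \<open>The middle line stays on the left up to the level below the chosen crossing.\<close>

definition hiM :: "nat \<Rightarrow> nat \<Rightarrow> bool" where "hiM j r \<longleftrightarrow> 3 * srv j - 2 + ln j < r"
definition hsM :: "nat \<Rightarrow> nat \<Rightarrow> nat \<Rightarrow> bool" where "hsM i k j \<longleftrightarrow> i = srv j \<and> k = ln j"
definition selM :: "nat \<Rightarrow> bool" where "selM i \<longleftrightarrow> i \<in> S"

lemma srv:
  assumes "1 \<le> j" "j \<le> n"
  shows "1 \<le> srv j" "srv j \<le> m"
    "al (srv j) = j \<and> srv j \<in> S \<or> c1 (srv j) = j \<and> srv j \<notin> S \<or> c2 (srv j) = j \<and> srv j \<notin> S"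
proof -
  have "\<exists>i. i \<in> {1..m} \<and> (al i = j \<and> i \<in> S \<or> c1 i = j \<and> i \<notin> S \<or> c2 i = j \<and> i \<notin> S)"
    using S assms unfolding solves_def Bex_def by simp
  from someI_ex[OF this] show "1 \<le> srv j" "srv j \<le> m"
    "al (srv j) = j \<and> srv j \<in> S \<or> c1 (srv j) = j \<and> srv j \<notin> S \<or> c2 (srv j) = j \<and> srv j \<notin> S"
    unfolding srv_def[symmetric] by auto
qed

lemma ln_less: "ln j < 2"
  by (simp add: ln_def)

text \<open>A row rises only at slots that it does not serve: at \<open>al\<close> if unselected, at
  \<open>c1\<close> and \<open>c2\<close> if selected. So its line is straight at the slot that it
  serves.\<close>

lemma hs_act:
  assumes "1 \<le> j" "j \<le> n"
  shows "act (srv j) (ln j) j"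
    "band selM (srv j) (ln j) (2 * j - 1) = band selM (srv j) (ln j) (2 * j)"
proof -
  have *: "al (srv j) = j \<and> srv j \<in> S \<or> c1 (srv j) = j \<and> srv j \<notin> S \<or> c2 (srv j) = j \<and> srv j \<notin> S"
    by (rule srv(3)[OF assms])
  have o: "1 \<le> c2 (srv j) \<and> c2 (srv j) < c1 (srv j) \<and> c1 (srv j) < al (srv j) \<and> al (srv j) \<le> n"
    by (rule ord) (use srv(1,2)[OF assms] in simp_all)
  have gen: "act s l j \<and> band selM s l (2 * j - 1) = band selM s l (2 * j)"
    if "al s = j \<and> s \<in> S \<or> c1 s = j \<and> s \<notin> S \<or> c2 s = j \<and> s \<notin> S"
      "c2 s < c1 s \<and> c1 s < al s" "1 \<le> c2 s" "l = (if c2 s = j then 1 else 0)" for s l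
    using that by (elim disjE conjE; hypsubst; auto simp: act_def band_def selM_def)
  have "act (srv j) (ln j) j \<and> band selM (srv j) (ln j) (2 * j - 1) = band selM (srv j) (ln j) (2 * j)"
    by (rule gen[OF * _ _ ln_def]) (rule o[THEN conjunct1] conjI o[THEN conjunct2, THEN conjunct1]
      o[THEN conjunct2, THEN conjunct2, THEN conjunct1])+
  note h = this
  show "act (srv j) (ln j) j" by (rule h[THEN conjunct1])
  show "band selM (srv j) (ln j) (2 * j - 1) = band selM (srv j) (ln j) (2 * j)" by (rule h[THEN conjunct2])
qed

lemma hiM_eq:
  assumes "1 \<le> i" "k < 2" "1 \<le> j" "j \<le> n" "\<not> hsM i k j"
  shows "hiM j (3 * i - 2 + k) = hiM j (3 * i - 1 + k)"
proof -
  have "3 * srv j - 2 + ln j \<noteq> 3 * i - 2 + k"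
    using line_index_inj[OF srv(1)[OF assms(3,4)] ln_less[of j] assms(1,2)] assms(5) unfolding hsM_def by blast
  then show ?thesis unfolding hiM_def by (rule line_index_step[OF _ assms(1)])
qed

lemma ok_M: "jumps_ok hiM selM hsM"
  unfolding jumps_ok_def
proof (intro allI impI)
  fix i k j :: nat assume *: "1 \<le> i \<and> i \<le> m \<and> k < 2 \<and> 1 \<le> j \<and> j \<le> n"
  show "if hsM i k j then act i k j \<and> band selM i k (2 * j - 1) = band selM i k (2 * j) \<and>
      \<not> hiM j (3 * i - 2 + k) \<and> hiM j (3 * i - 1 + k)
    else bord i k j \<or> hiM j (3 * i - 2 + k) = hiM j (3 * i - 1 + k)"
  proof (cases "hsM i k j")
    case True
    then have "i = srv j" "k = ln j" by (auto simp: hsM_def)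
    then show ?thesis using True hs_act[of j] * srv(1)[of j] by (simp add: hiM_def) linarith
  next
    case False
    then show ?thesis using hiM_eq[of i k j] * by simp
  qed
qed

lemma smooth_M: "smooth hiM hsM"
  unfolding smooth_def
proof (intro allI impI)
  fix i k j :: nat assume j: "1 \<le> j \<and> j \<le> n"
  have "3 * srv j - 2 + ln j \<noteq> 3 * i" by (rule line_index_ne[OF srv(1) ln_less]) (use j in simp_all)
  then have "hiM j (3 * i) = hiM j (3 * i + 1)" unfolding hiM_def by (rule less_add_one_iff)
  moreover have "hiM j (3 * i - 2 + k) = hiM j (3 * i - 1 + k)"
    if "1 \<le> i \<and> i \<le> m \<and> k < 2 \<and> bord i k j"
  proof -
    have "\<not> hsM i k j"
      using that hs_act(1)[of j] j act_not_bord[of i k j] by (auto simp: hsM_def)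
    then show ?thesis using hiM_eq that j by simp
  qed
  ultimately show "(i \<le> m \<longrightarrow> hiM j (3 * i) = hiM j (3 * i + 1)) \<and>
     (1 \<le> i \<and> i \<le> m \<and> k < 2 \<and> bord i k j \<longrightarrow> hiM j (3 * i - 2 + k) = hiM j (3 * i - 1 + k))"
    by blast
qed

text \<open>The layout built from \<open>S\<close> has the sign pattern of the input, hence the same
  contacts, inside complexes and between them.\<close>

lemma solution_exists:
  "\<exists>M. rectangular_layout_of L.lay M \<and> respects_target M (map T.bbox bs) \<and>
    preserves_internal L.lay M \<and> threshold \<le> preserved_external L.lay M"
proof -
  interpret M: blocked_grid "2 * n + 2" "3 * m + 2" "xi hiM" "et selM hsM" bs by (rule blocked[OF ok_M])
  have nbrM: "nbr (2 * n + 2) (3 * m + 2) M.plus = nbr (2 * n + 2) (3 * m + 2) sgn"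
    by (rule nbr_plus[OF ok_M smooth_M])
  have "M.bbox b = T.bbox b" if "b \<in> set bs" for b
  proof (rule bbox_eq_T[OF ok_M _ _ that])
    fix j assume j: "1 \<le> j" "j \<le> n"
    show "\<not> hiM j 0" by (simp add: hiM_def)
    show "hiM j (3 * m + 1)" using srv[OF j] ln_less[of j] unfolding hiM_def by linarith
  qed
  then have resp: "respects_target M.lay (map T.bbox bs)"
    unfolding respects_target_def M.map_region_lay by simp
  have adj: "adjacent (L.lay ! i ! j) (L.lay ! k ! l) \<longleftrightarrow> adjacent (M.lay ! i ! j) (M.lay ! k ! l)"
    if "i < length bs" "k < length bs" "j < length (block_cells (bs ! i))"
      "l < length (block_cells (bs ! k))" "(i, j) \<noteq> (k, l)" for i j k l
    unfolding L.adjacent_lay_iff[OF that] M.adjacent_lay_iff[OF that] L_plus nbrM ..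
  have "rectangular_layout_of L.lay M.lay"
    unfolding rectangular_layout_of_def using M.rectangular_layout_lay
    by (simp add: L.lay_def M.lay_def del: block_cells.simps)
  moreover have "preserves_internal L.lay M.lay"
    unfolding preserves_internal_def L.lay_nth(1)
  proof (intro allI impI, elim conjE)
    fix i j k assume "i < length bs" "j < length (L.lay ! i)" "k < length (L.lay ! i)" "j \<noteq> k"
      "adjacent (L.lay ! i ! j) (L.lay ! i ! k)"
    then show "adjacent (M.lay ! i ! j) (M.lay ! i ! k)"
      using adj[of i i j k] L.lay_nth(2)[of i] by (metis length_map prod.inject)
  qed
  moreover have "preserved_external L.lay M.lay = threshold"
  proof -
    have "{((i, j), (i', j')). ((i, j), (i', j')) \<in> L.ext_pairs sgn \<and> adjacent (M.lay ! i ! j) (M.lay ! i' ! j')} =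
        L.ext_pairs sgn" (is "?X = _")
    proof
      show "L.ext_pairs sgn \<subseteq> ?X"
      proof
        fix x assume x: "x \<in> L.ext_pairs sgn"
        obtain i j i' j' where [simp]: "x = ((i, j), (i', j'))" by (metis prod.exhaust)
        have *: "i < length bs" "i' < length bs" "j < length (block_cells (bs ! i))"
          "j' < length (block_cells (bs ! i'))" "(i, j) \<noteq> (i', j')"
          using x unfolding L.ext_pairs_def by auto
        have "adjacent (M.lay ! i ! j) (M.lay ! i' ! j')"
          unfolding M.adjacent_lay_iff[OF *] nbrM using x unfolding L.ext_pairs_def by auto
        then show "x \<in> ?X" using x by auto
      qed
    qed auto
    then show ?thesis unfolding preserved_L using card_ext_pairs_L by argo
  qed
  ultimately show ?thesis using resp by (intro exI[of _ M.lay]) simp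
qed

end

text \<open>The threshold is the size of the set of all external contacts, so none is lost; with the
  internal ones this is \<open>mc_adj\<close>.\<close>

lemma solution_solves:
  assumes M: "rectangular_layout_of L.lay M" "respects_target M (map T.bbox bs)"
    "preserves_internal L.lay M" "threshold \<le> preserved_external L.lay M"
  shows "\<exists>S. solves S"
proof -
  have len: "map length M = map length L.lay" and rl: "rectangular_layout M"
    using M(1) by (auto simp: rectangular_layout_of_def)
  have lenM: "length M = length bs" using len by (metis length_map L.lay_nth(1))
  have lenMi: "length (M ! i) = length (block_cells (bs ! i))" if "i < length bs" for i
    using arg_cong[OF len, of "\<lambda>x. x ! i"] that lenM by simp
  have reg: "region (M ! i) = area (T.bbox (bs ! i))" if "i < length bs" for i
    using arg_cong[OF M(2)[unfolded respects_target_def], of "\<lambda>x. x ! i"] that lenM by simp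
  have rc: "rectangle_complex (M ! i)" if "i < length bs" for i
    using rl that lenM by (auto simp: rectangular_layout_def rectangular_complex_def)
  define X where "X = {((i, j), (i', j')). ((i, j), (i', j')) \<in> L.ext_pairs sgn \<and> adjacent (M ! i ! j) (M ! i' ! j')}"
  have "X \<subseteq> L.ext_pairs sgn" by (auto simp: X_def)
  moreover have "card (L.ext_pairs sgn) \<le> card X"
    using M(4) unfolding preserved_L X_def card_ext_pairs_L .
  ultimately have X: "X = L.ext_pairs sgn"
    using card_subset_eq[OF L.finite_ext_pairs] card_mono[OF L.finite_ext_pairs] by (metis le_antisym)
  define pos where "pos u = (SOME x. fst x < length bs \<and> snd x < length (block_cells (bs ! fst x)) \<and>
      block_cells (bs ! fst x) ! snd x = u)" for u
  define mc where "mc u = M ! fst (pos u) ! snd (pos u)" for u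
  have mc: "mc (block_cells (bs ! i) ! j) = M ! i ! j"
    if ij: "i < length bs" "j < length (block_cells (bs ! i))" for i j
  proof -
    let ?u = "block_cells (bs ! i) ! j"
    have "fst (pos ?u) < length bs \<and> snd (pos ?u) < length (block_cells (bs ! fst (pos ?u))) \<and>
      block_cells (bs ! fst (pos ?u)) ! snd (pos ?u) = ?u"
      unfolding pos_def by (rule someI[of _ "(i, j)"]) (use ij in simp)
    then have "fst (pos ?u) = i \<and> snd (pos ?u) = j"
      using L.cell_index_eq[of "fst (pos ?u)" i "snd (pos ?u)" j] ij by blast
    then show ?thesis by (simp add: mc_def)
  qed
  have ex: "\<exists>i j. i < length bs \<and> bs ! i = b \<and> j < length (block_cells b) \<and> block_cells b ! j = u"
    if "b \<in> set bs" "u \<in> set (block_cells b)" for b u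
    using that by (metis in_set_conv_nth)
  have "solved_grid m n c2 c1 al mc"
  proof
    fix b u assume b: "b \<in> set bs" "u \<in> set (block_cells b)"
    then obtain i j where i: "i < length bs" "bs ! i = b" "j < length (block_cells b)" "block_cells b ! j = u"
      using ex by blast
    have mem: "mc u \<in> set (M ! i)" using mc[of i j] i lenMi[of i] by auto
    then show "proper_rect (mc u)" using rc[OF i(1)] by (auto simp: rectangle_complex_def)
    have "area (mc u) \<subseteq> region (M ! i)" using mem by (auto simp: region_def)
    then show "area (mc u) \<subseteq> area (T.bbox b)" using reg[OF i(1)] i(2) by simp
  next
    fix b u v assume b: "b \<in> set bs" "u \<in> set (block_cells b)" "v \<in> set (block_cells b)" "u \<noteq> v"
    obtain i j where i: "i < length bs" "bs ! i = b" "j < length (block_cells b)" "block_cells b ! j = u"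
      using ex b by blast
    obtain l where l: "l < length (block_cells b)" "block_cells b ! l = v" using b(3) by (metis in_set_conv_nth)
    have "j \<noteq> l" using i l b(4) by auto
    then have "interior (area (M ! i ! j)) \<inter> interior (area (M ! i ! l)) = {}"
      using rc[OF i(1)] i l lenMi[OF i(1)] unfolding rectangle_complex_def by simp
    then show "apart (mc u) (mc v)" using mc[of i j] mc[of i l] i l by (simp add: apart_def)
  next
    fix u v assume uv: "nbr (2 * n + 2) (3 * m + 2) sgn u v"
    obtain c r c' r' where [simp]: "u = (c, r)" "v = (c', r')" by (cases u; cases v)
    have lt: "c < 2 * n + 2" "r < 3 * m + 2" "c' < 2 * n + 2" "r' < 3 * m + 2"
      using uv by (auto simp: nbr_def)
    obtain i j where i: "i < length bs" "j < length (block_cells (bs ! i))" "block_cells (bs ! i) ! j = u"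
      using L.cell_index_ex[OF lt(1,2)] by auto
    obtain k l where k: "k < length bs" "l < length (block_cells (bs ! k))" "block_cells (bs ! k) ! l = v"
      using L.cell_index_ex[OF lt(3,4)] by auto
    have e: "mc u = M ! i ! j" "mc v = M ! k ! l" using mc[OF i(1,2)] mc[OF k(1,2)] i k by simp_all
    have "i < k \<or> k < i \<or> i = k" by linarith
    then show "adjacent (mc u) (mc v)"
    proof (elim disjE)
      assume "i < k"
      then have "((i, j), (k, l)) \<in> X" unfolding X L.ext_pairs_def using i k uv by auto
      then show ?thesis unfolding X_def e by blast
    next
      assume "k < i"
      then have "((k, l), (i, j)) \<in> X" unfolding X L.ext_pairs_def using i k uv by auto
      then show ?thesis unfolding X_def e using adjacent_sym by blast
    next
      assume ik [simp]: "i = k"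
      have "u \<noteq> v" using uv by (auto simp: nbr_def)
      then have jl: "j \<noteq> l" using i k by auto
      have "adjacent (L.lay ! i ! j) (L.lay ! i ! l)"
        using L.adjacent_lay_iff[of i i j l] i k jl uv unfolding L_plus by simp
      then have "adjacent (M ! i ! j) (M ! i ! l)"
        using M(3) i k jl unfolding preserves_internal_def by (simp add: L.lay_nth)
      then show ?thesis unfolding e ik[symmetric] .
    qed
  qed
  then interpret solved_grid m n c2 c1 al mc .
  show ?thesis using solves_served by blast
qed

theorem threshold_iff:
  "(\<exists>M. rectangular_layout_of L.lay M \<and> respects_target M (map T.bbox bs) \<and>
    preserves_internal L.lay M \<and> threshold \<le> preserved_external L.lay M) \<longleftrightarrow> (\<exists>S. solves S)"
  using solution_exists solution_solves by blast

end

section \<open>The instance with rational coordinates\<close>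

context triples
begin

definition rcell :: "nat \<times> nat \<Rightarrow> rat rect" where
  "rcell = (\<lambda>(c, r). Rect (2 ^ xe (\<lambda>_ _. True) c r) (2 ^ ye (\<lambda>_. False) (\<lambda>_ _ _. False) r c)
     (2 ^ xe (\<lambda>_ _. True) (Suc c) r) (2 ^ ye (\<lambda>_. False) (\<lambda>_ _ _. False) (Suc r) c))"

fun rbox :: "block \<Rightarrow> rat rect" where
  "rbox (c, w, r, h) = Rect (2 ^ xe (\<lambda>j r. r \<noteq> 0) c r) (2 ^ ye (\<lambda>_. False) (\<lambda>_ _ _. False) r c)
     (2 ^ xe (\<lambda>j r. r \<noteq> 0) (c + w) r) (2 ^ ye (\<lambda>_. False) (\<lambda>_ _ _. False) (r + h) c)"

definition instance_of :: inst where
  "instance_of = (map (\<lambda>b. map (rcell) (block_cells b)) bs, map rbox bs)"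

definition limit :: nat where
  "limit = (2 * n + 1) * (3 * m + 2) + (2 * n + 2) * (3 * m + 1) + (2 * n + 1) * (3 * m + 1) - m * (6 * n + 3)"

end

context good_triples
begin

lemma real_instance:
  "real_layout (fst instance_of) = L.lay" "map real_rect (snd instance_of) = map T.bbox bs"
proof -
  have f: "hiL = (\<lambda>_ _. True)" "hiT = (\<lambda>j r. r \<noteq> 0)" "sel0 = (\<lambda>_. False)" "hs0 = (\<lambda>_ _ _. False)"
    by (auto simp: hiL_def hiT_def sel0_def hs0_def fun_eq_iff)
  have "real_rect (rcell u) = L.cell u" for u
  proof -
    obtain c r where u: "u = (c, r)" by (cases u)
    show ?thesis unfolding u rcell_def L.cell_def prod.case unfolding xi_def et_def f by (simp add: real_rect_def of_rat_power)
  qed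
  then show "real_layout (fst instance_of) = L.lay"
    by (simp add: instance_of_def L.lay_def real_layout_def del: block_cells.simps)
  have "real_rect (rbox b) = T.bbox b" for b
  proof -
    obtain c w r h where b: "b = (c, w, r, h)" by (cases b)
    show ?thesis unfolding b T.bbox.simps rbox.simps unfolding xi_def et_def f by (simp add: real_rect_def of_rat_power)
  qed
  then show "map real_rect (snd instance_of) = map T.bbox bs"
    by (simp add: instance_of_def)
qed

theorem instance_of_valid: "instance_of \<in> instances"
proof -
  have "instance_of = (fst instance_of, snd instance_of)" by simp
  moreover have "layout L.lay" using L.rectangular_layout_lay by (simp add: rectangular_layout_def)
  ultimately show ?thesis
    unfolding instances_def using global_target_T real_instance by (metis (mono_tags, lifting) case_prodI mem_Collect_eq)
qed

theorem instance_of_iff: "(\<exists>s\<in>solutions instance_of. limit \<le> objective instance_of s) \<longleftrightarrow> (\<exists>S. solves S)"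
proof -
  obtain L' T' where e: "instance_of = (L', T')" by (cases instance_of)
  then have "real_layout L' = L.lay" "map real_rect T' = map T.bbox bs" using real_instance by simp_all
  moreover have "limit = threshold" by (simp add: limit_def threshold_def)
  ultimately show ?thesis unfolding e threshold_iff[symmetric] by (auto simp: respects_target_def)
qed

end

section \<open>A structured language for Turing machines\<close>

text \<open>\<open>Act t w m\<close> writes \<open>w\<close> on tape \<open>t\<close>, or keeps the
  symbol for \<open>None\<close>, and moves the head; \<open>Cond t s\<close> tests whether
  \<open>s\<close> is read on tape \<open>t\<close>; \<open>Loop t\<close> repeats until tape
  \<open>t\<close> reads a blank.\<close>

datatype prog =
    Skip
  | Act nat "nat option" move
  | Seq prog prog  (infixr ";;" 60)
  | Cond nat nat prog prog
  | Loop nat prog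

type_synonym tape = "(int \<Rightarrow> nat) \<times> int"

definition rd :: "tape \<Rightarrow> nat" where "rd T = fst T (snd T)"

text \<open>The program that remains to be run plays the part of the state. Dropping a finished
  first component of a sequence takes a step of its own, whence the summand 1 in
  \<open>runs_Seq\<close>.\<close>

fun next_prog :: "prog \<Rightarrow> (nat \<Rightarrow> nat) \<Rightarrow> prog" where
  "next_prog Skip ss = Skip"
| "next_prog (Act t w m) ss = Skip"
| "next_prog (Seq p q) ss = (if p = Skip then q else Seq (next_prog p ss) q)"
| "next_prog (Cond t s p q) ss = (if ss t = s then p else q)"
| "next_prog (Loop t p) ss = (if ss t = 0 then Skip else Seq p (Loop t p))"

fun next_act :: "prog \<Rightarrow> (nat \<Rightarrow> nat) \<Rightarrow> nat \<Rightarrow> nat \<times> move" where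
  "next_act (Act t w m) ss = (\<lambda>i. (ss i, Stay))(t := (case w of None \<Rightarrow> ss t | Some s \<Rightarrow> s, m))"
| "next_act (Seq p q) ss = next_act p ss"
| "next_act p ss = (\<lambda>i. (ss i, Stay))"

definition pstep :: "prog \<times> (nat \<Rightarrow> tape) \<Rightarrow> prog \<times> (nat \<Rightarrow> tape)" where
  "pstep = (\<lambda>(p, \<sigma>). (next_prog p (\<lambda>t. rd (\<sigma> t)), \<lambda>t. perform (next_act p (\<lambda>t. rd (\<sigma> t)) t) (\<sigma> t)))"

fun prog_ok :: "nat \<Rightarrow> prog \<Rightarrow> bool" where
  "prog_ok T Skip = True"
| "prog_ok T (Act t w m) = (t < T \<and> (\<forall>s. w = Some s \<longrightarrow> s < 3))"
| "prog_ok T (Seq p q) = (prog_ok T p \<and> prog_ok T q)"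
| "prog_ok T (Cond t s p q) = (t < T \<and> prog_ok T p \<and> prog_ok T q)"
| "prog_ok T (Loop t p) = (t < T \<and> prog_ok T p)"

lemma prog_ok_mono: "prog_ok T p \<Longrightarrow> T \<le> T' \<Longrightarrow> prog_ok T' p"
  by (induction p) auto

text \<open>A finite set that contains the program and is closed under \<open>next_prog\<close>: the
  states of the machine.\<close>

fun residuals :: "prog \<Rightarrow> prog set" where
  "residuals Skip = {Skip}"
| "residuals (Act t w m) = {Act t w m, Skip}"
| "residuals (Seq p q) = (\<lambda>p'. Seq p' q) ` residuals p \<union> residuals q"
| "residuals (Cond t s p q) = insert (Cond t s p q) (residuals p \<union> residuals q)"
| "residuals (Loop t p) = {Loop t p, Skip} \<union> (\<lambda>p'. Seq p' (Loop t p)) ` residuals p"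

lemma finite_residuals: "finite (residuals p)"
  by (induction p) auto

lemma self_residual: "p \<in> residuals p"
  by (induction p) auto

lemma Skip_residual: "Skip \<in> residuals p"
  by (induction p) auto

lemma residuals_closed: "p' \<in> residuals p \<Longrightarrow> next_prog p' ss \<in> residuals p"
  by (induction p arbitrary: p') (auto simp: self_residual split: if_splits)

lemma residuals_ok: "p' \<in> residuals p \<Longrightarrow> prog_ok T p \<Longrightarrow> prog_ok T p'"
  by (induction p arbitrary: p') auto

lemma next_act_symbol: "prog_ok T p \<Longrightarrow> ss t < 3 \<Longrightarrow> fst (next_act p ss t) < 3"
  by (induction p) (auto split: option.splits)

lemma perform_read: "perform (rd T, Stay) T = T"
  by (cases T) (simp add: rd_def)

definition runs :: "prog \<Rightarrow> (nat \<Rightarrow> tape) \<Rightarrow> (nat \<Rightarrow> tape) \<Rightarrow> nat \<Rightarrow> bool" where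
  "runs p \<sigma> \<tau> K \<longleftrightarrow> (\<exists>k \<le> K. (pstep ^^ k) (p, \<sigma>) = (Skip, \<tau>))"

lemma runs_mono: "runs p \<sigma> \<tau> K \<Longrightarrow> K \<le> K' \<Longrightarrow> runs p \<sigma> \<tau> K'"
  unfolding runs_def by (meson le_trans)

lemma runs_Suc: "pstep (p, \<sigma>) = (p', \<sigma>') \<Longrightarrow> runs p' \<sigma>' \<tau> K \<Longrightarrow> runs p \<sigma> \<tau> (Suc K)"
  unfolding runs_def by (metis Suc_le_mono comp_apply funpow_Suc_right)

lemma runs_Skip: "runs Skip \<sigma> \<sigma> K"
  unfolding runs_def by (rule exI[of _ 0]) simp

lemma pstep_Skip: "pstep (Skip, \<sigma>) = (Skip, \<sigma>)"
  by (simp add: pstep_def perform_read)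

lemma pstep_Skip_funpow: "(pstep ^^ k) (Skip, \<sigma>) = (Skip, \<sigma>)"
  by (induction k) (simp_all add: pstep_Skip)

lemma runs_Act:
  "runs (Act t w m) \<sigma> (\<sigma>(t := perform (case w of None \<Rightarrow> rd (\<sigma> t) | Some s \<Rightarrow> s, m) (\<sigma> t))) (Suc 0)"
  by (rule runs_Suc[OF _ runs_Skip]) (auto simp: pstep_def fun_eq_iff perform_read)

lemma runs_Seq:
  assumes "runs p \<sigma> \<tau> K" "runs q \<tau> \<rho> K'"
  shows "runs (p ;; q) \<sigma> \<rho> (K + K' + 1)"
proof -
  obtain k where "k \<le> K" "(pstep ^^ k) (p, \<sigma>) = (Skip, \<tau>)"
    using assms(1) by (auto simp: runs_def)
  then show ?thesis
  proof (induction k arbitrary: K p \<sigma>)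
    case 0
    then have [simp]: "p = Skip" "\<sigma> = \<tau>" by auto
    have "runs (Skip ;; q) \<tau> \<rho> (Suc K')"
      by (rule runs_Suc[OF _ assms(2)]) (simp add: pstep_def perform_read)
    then show ?case by (auto elim: runs_mono)
  next
    case (Suc k)
    obtain p' \<sigma>' where s: "pstep (p, \<sigma>) = (p', \<sigma>')" by (cases "pstep (p, \<sigma>)")
    show ?case
    proof (cases "p = Skip")
      case True
      then have [simp]: "\<sigma> = \<tau>" using Suc.prems(2) pstep_Skip_funpow[of "Suc k" \<sigma>] by simp
      have "runs (Skip ;; q) \<tau> \<rho> (Suc K')"
        by (rule runs_Suc[OF _ assms(2)]) (simp add: pstep_def perform_read)
      then show ?thesis using True by (auto elim: runs_mono)
    next
      case False
      have "runs (p' ;; q) \<sigma>' \<rho> (K - 1 + K' + 1)"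
        by (rule Suc.IH) (use Suc.prems s in \<open>auto simp: funpow_swap1\<close>)
      moreover have "pstep (p ;; q, \<sigma>) = (p' ;; q, \<sigma>')"
        using s False by (simp add: pstep_def)
      ultimately have "runs (p ;; q) \<sigma> \<rho> (Suc (K - 1 + K' + 1))" by (rule runs_Suc[rotated])
      then show ?thesis using Suc.prems(1) by simp
    qed
  qed
qed

lemma runs_Cond:
  assumes "runs (if rd (\<sigma> t) = s then p else q) \<sigma> \<tau> K"
  shows "runs (Cond t s p q) \<sigma> \<tau> (Suc K)"
  by (rule runs_Suc[OF _ assms]) (simp add: pstep_def perform_read)

lemma runs_Loop_end: "rd (\<sigma> t) = 0 \<Longrightarrow> runs (Loop t p) \<sigma> \<sigma> (Suc 0)"
  by (rule runs_Suc[OF _ runs_Skip]) (simp add: pstep_def perform_read)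

lemma runs_Loop_iterate:
  assumes "rd (\<sigma> t) \<noteq> 0" "runs p \<sigma> \<tau> K" "runs (Loop t p) \<tau> \<rho> K'"
  shows "runs (Loop t p) \<sigma> \<rho> (K + 2 + K')"
proof -
  have "runs (Loop t p) \<sigma> \<rho> (Suc (K + K' + 1))"
    by (rule runs_Suc[OF _ runs_Seq[OF assms(2,3)]]) (use assms(1) in \<open>simp add: pstep_def perform_read\<close>)
  then show ?thesis by simp
qed

lemma runs_Loop:
  assumes "\<And>i. i < L \<Longrightarrow> rd (\<sigma> i t) \<noteq> 0" "rd (\<sigma> L t) = 0"
    "\<And>i. i < L \<Longrightarrow> runs p (\<sigma> i) (\<sigma> (Suc i)) K"
  shows "runs (Loop t p) (\<sigma> 0) (\<sigma> L) (L * (K + 2) + 1)"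
  using assms
proof (induction L arbitrary: \<sigma>)
  case 0
  then show ?case using runs_Loop_end by simp
next
  case (Suc L)
  have "runs (Loop t p) (\<sigma> (Suc 0)) (\<sigma> (Suc L)) (L * (K + 2) + 1)"
    by (rule Suc.IH[of "\<lambda>i. \<sigma> (Suc i)"]) (use Suc.prems in auto)
  from runs_Loop_iterate[OF _ Suc.prems(3) this] Suc.prems(1)[of 0]
  show ?case by (simp add: algebra_simps)
qed

text \<open>The states are positions in a list of the residuals that begins with \<open>p\<close>
  and \<open>Skip\<close>, since state 0 starts and state 1 halts. This requires that
  \<open>p\<close> is not \<open>Skip\<close>.\<close>

theorem prog_polytime:
  assumes ok: "prog_ok T p" and T: "0 < T" and start: "p \<noteq> Skip"
    and run: "\<And>x. \<exists>\<tau>. runs p ((\<lambda>_. (\<lambda>_. 0, 0))(0 := (string_tape x, 0))) \<tau> (poly P (length x)) \<and>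
      (\<forall>i \<in> {0..int (length (f x))}. fst (\<tau> 0) i = string_tape (f x) i)"
  shows "polytime f"
proof -
  let ?R = "residuals p"
  obtain rest where rest: "set rest = ?R - {p, Skip}" "distinct rest"
    using finite_distinct_list[of "?R - {p, Skip}"] finite_residuals by auto
  define rs where "rs = p # Skip # rest"
  have rs: "set rs = ?R" "distinct rs" "rs ! 0 = p" "rs ! 1 = Skip" "2 \<le> length rs"
    using rest start self_residual[of p] Skip_residual[of p] by (auto simp: rs_def)
  define idx where "idx q = (THE i. i < length rs \<and> rs ! i = q)" for q
  have idx: "idx (rs ! i) = i" if "i < length rs" for i
    unfolding idx_def by (rule the_equality) (use that nth_eq_iff_index_eq[OF rs(2)] in auto)
  have idx': "idx q < length rs \<and> rs ! idx q = q" if "q \<in> ?R" for q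
  proof -
    have "q \<in> set rs" unfolding rs(1) by (rule that)
    then obtain i where i: "i < length rs" "rs ! i = q" unfolding in_set_conv_nth by (elim exE conjE)
    show ?thesis unfolding i(2)[symmetric] idx[OF i(1)] using i(1) by (rule conjI[OF _ refl])
  qed
  define M where "M = \<lparr>tapes = T, symbols = 3, states = length rs,
    delta = (\<lambda>q ss. (idx (next_prog (rs ! q) ((!) ss)), map (next_act (rs ! q) ((!) ss)) [0..<T]))\<rparr>"
  have wf: "wf_tm M"
    unfolding wf_tm_def
  proof (intro conjI allI impI)
    fix q ss assume q: "q < states M" and ss: "length ss = tapes M \<and> (\<forall>s\<in>set ss. s < symbols M)"
    have "q < length rs" using q by (simp add: M_def)
    then have mem: "rs ! q \<in> ?R" unfolding rs(1)[symmetric] by (rule nth_mem)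
    have 1: "idx (next_prog (rs ! q) ((!) ss)) < length rs"
      by (rule idx'[OF residuals_closed[OF mem], THEN conjunct1])
    have 2: "prog_ok T (rs ! q)" by (rule residuals_ok[OF mem ok])
    have 3: "ss ! t < 3" if "t < T" for t using ss that by (simp add: M_def)
    have "fst (next_act (rs ! q) ((!) ss) t) < 3" if "t < T" for t
      by (rule next_act_symbol[where ss = "(!) ss", OF 2 3[OF that]])
    then show "case delta M q ss of (q', as) \<Rightarrow>
        q' < states M \<and> length as = tapes M \<and> (\<forall>(s, m)\<in>set as. s < symbols M)"
      using 1 by (simp add: M_def case_prod_unfold)
  qed (use T rs in \<open>simp_all add: M_def\<close>)
  define conf where "conf = (\<lambda>(q, \<sigma>). (idx q, map \<sigma> [0..<T]) :: config)"
  have sim: "tm_step M (conf c) = conf (pstep c)" if "fst c \<in> ?R" for c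
  proof -
    obtain q \<sigma> where c: "c = (q, \<sigma>)" by (cases c)
    have q: "q \<in> ?R" using that c by simp
    show ?thesis
    proof (cases "q = Skip")
      case True
      then show ?thesis using idx[of 1] rs(4,5) by (simp add: c conf_def pstep_Skip)
    next
      case False
      have "idx q \<noteq> 1" using idx'[OF q] rs(4) False by auto
      \<comment> \<open>A residual program refers to tapes below \<open>T\<close> only, so the list
        of read symbols determines its step.\<close>
      moreover have "next_prog q ((!) (map (\<lambda>t. rd (\<sigma> t)) [0..<T])) = next_prog q (\<lambda>t. rd (\<sigma> t))"
        using residuals_ok[OF q ok] by (induction q) auto
      moreover have "next_act q ((!) (map (\<lambda>t. rd (\<sigma> t)) [0..<T])) t = next_act q (\<lambda>t. rd (\<sigma> t)) t"
        if "t < T" for t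
        using residuals_ok[OF q ok] that by (induction q) (auto split: option.splits)
      moreover have "map (\<lambda>(t, h). t h) (map \<sigma> [0..<T]) = map (\<lambda>t. rd (\<sigma> t)) [0..<T]"
        by (simp add: rd_def case_prod_unfold)
      moreover have "map2 perform (map a [0..<T]) (map \<sigma> [0..<T]) = map (\<lambda>t. perform (a t) (\<sigma> t)) [0..<T]" for a
        by (simp add: list_eq_iff_nth_eq)
      ultimately show ?thesis
        using idx'[OF q] by (simp add: c conf_def pstep_def M_def del: map_map)
    qed
  qed
  have sims: "(tm_step M ^^ k) (conf c) = conf ((pstep ^^ k) c) \<and> fst ((pstep ^^ k) c) \<in> ?R"
    if "fst c \<in> ?R" for c k
  proof (induction k)
    case (Suc k)
    have "fst (pstep d) \<in> ?R" if "fst d \<in> ?R" for d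
      using residuals_closed[OF that] by (simp add: pstep_def case_prod_unfold)
    then show ?case using Suc sim by simp
  qed (use that in simp)
  show ?thesis unfolding polytime_def
  proof (rule exI[of _ M], rule exI[of _ P], intro conjI allI)
    fix x
    let ?\<sigma> = "(\<lambda>_. (\<lambda>_. 0, 0))(0 := (string_tape x, 0))"
    obtain \<tau> where \<tau>: "runs p ?\<sigma> \<tau> (poly P (length x))"
      "\<forall>i \<in> {0..int (length (f x))}. fst (\<tau> 0) i = string_tape (f x) i" using run by blast
    then obtain k where k: "k \<le> poly P (length x)" "(pstep ^^ k) (p, ?\<sigma>) = (Skip, \<tau>)"
      by (auto simp: runs_def)
    have init: "tm_init M x = conf (p, ?\<sigma>)"
    proof -
      have "0 < length rs" using rs(5) by linarith
      from idx[OF this] have "idx p = 0" unfolding rs(3) .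
      then show ?thesis using T
        by (auto simp: tm_init_def conf_def M_def list_eq_iff_nth_eq nth_Cons split: nat.splits)
    qed
    have "(tm_step M ^^ k) (tm_init M x) = conf (Skip, \<tau>)"
      using sims[of "(p, ?\<sigma>)" k] self_residual k(2) init by simp
    moreover have "halts_with (conf (Skip, \<tau>)) (f x)"
      using \<tau>(2) idx[of 1] rs(4,5) T by (simp add: halts_with_def conf_def upt_conv_Cons)
    ultimately show "\<exists>n\<le>poly P (length x). halts_with ((tm_step M ^^ n) (tm_init M x)) (f x)"
      using k(1) by metis
  qed (rule wf)
qed

section \<open>Tapes as stacks\<close>

text \<open>The head is on the last symbol; strings start at cell 0 on tape 0, where the output is read, and at cell 1 on the others.\<close>

definition stack :: "int \<Rightarrow> bool list \<Rightarrow> tape" where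
  "stack a w = (\<lambda>i. string_tape w (i - a), int (length w) - 1 + a)"

definition stacks :: "(nat \<Rightarrow> bool list) \<Rightarrow> nat \<Rightarrow> tape" where
  "stacks s t = stack (if t = 0 then 0 else 1) (s t)"

definition push :: "nat \<Rightarrow> bool \<Rightarrow> prog" where
  "push t b = Act t None Move_Right ;; Act t (Some (if b then 2 else 1)) Stay"

definition pop :: "nat \<Rightarrow> prog" where "pop t = Act t (Some 0) Move_Left"

text \<open>The bit in transit is remembered by the branch that is taken.\<close>

definition shift :: "nat \<Rightarrow> nat \<Rightarrow> prog" where
  "shift a b = Cond a 2 (pop a ;; push b True) (pop a ;; push b False)"

lemma rd_stack: "rd (stack a w) = (if w = [] then 0 else if last w then 2 else 1)"
  by (cases w rule: rev_cases) (auto simp: rd_def stack_def string_tape_def nat_diff_distrib)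

lemma pop_stack: "w \<noteq> [] \<Longrightarrow> perform (0, Move_Left) (stack a w) = stack a (butlast w)"
  by (cases w rule: rev_cases) (auto simp: stack_def string_tape_def fun_eq_iff nth_append)

lemma push_stack:
  "perform (if b then 2 else 1, Stay) (perform (rd (stack a w), Move_Right) (stack a w)) = stack a (w @ [b])"
proof -
  have *: "perform (rd T, Move_Right) T = (fst T, snd T + 1)" for T
    by (cases T) (simp add: rd_def)
  have "(if i = int (length w) + a then if b then 2 else 1 else string_tape w (i - a)) = string_tape (w @ [b]) (i - a)" for i
  proof -
    consider "i - a < int (length w)" | "i - a = int (length w)" | "i - a > int (length w)" by linarith
    then show ?thesis by cases (auto simp: string_tape_def nth_append)
  qed
  then show ?thesis unfolding * stack_def by (simp add: fun_eq_iff)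
qed

definition does :: "prog \<Rightarrow> (nat \<Rightarrow> bool list) \<Rightarrow> (nat \<Rightarrow> bool list) \<Rightarrow> nat \<Rightarrow> bool" where
  "does p s s' K \<longleftrightarrow> runs p (stacks s) (stacks s') K"

lemma does_le: "does p s s' K \<Longrightarrow> s' = s'' \<Longrightarrow> K \<le> K' \<Longrightarrow> does p s s'' K'"
  unfolding does_def by hypsubst (rule runs_mono)

lemma does_cong: "does p s s' K \<Longrightarrow> s = r \<Longrightarrow> s' = r' \<Longrightarrow> K \<le> K' \<Longrightarrow> does p r r' K'"
  using does_le by blast

lemma does_Skip: "does Skip s s K"
  unfolding does_def by (rule runs_Skip)

lemma does_Seq: "does p s s' K \<Longrightarrow> does q s' s'' K' \<Longrightarrow> does (p ;; q) s s'' (K + K' + 1)"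
  unfolding does_def by (rule runs_Seq)

lemma stacks_upd: "stacks (s(t := w)) = (stacks s)(t := stack (if t = 0 then 0 else 1) w)"
  by (auto simp: stacks_def fun_eq_iff)

lemma does_push: "does (push t b) s (s(t := s t @ [b])) 3"
proof -
  let ?a = "if t = 0 then 0 else 1 :: int"
  let ?\<tau> = "(stacks s)(t := perform (rd (stack ?a (s t)), Move_Right) (stack ?a (s t)))"
  have 1: "runs (Act t None Move_Right) (stacks s) ?\<tau> (Suc 0)"
    using runs_Act[of t None Move_Right "stacks s"] by (simp add: stacks_def)
  have 2: "runs (Act t (Some (if b then 2 else 1)) Stay) ?\<tau> (stacks (s(t := s t @ [b]))) (Suc 0)"
    using runs_Act[of t "Some (if b then 2 else 1)" Stay ?\<tau>]
    unfolding option.case fun_upd_same push_stack fun_upd_upd stacks_upd .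
  show ?thesis unfolding does_def push_def using runs_Seq[OF 1 2] by (simp add: numeral_3_eq_3)
qed

lemma does_pop: "s t \<noteq> [] \<Longrightarrow> does (pop t) s (s(t := butlast (s t))) 1"
  unfolding does_def pop_def using runs_Act[of t "Some 0" Move_Left "stacks s"]
  unfolding option.case stacks_upd stacks_def[of s t] by (simp add: pop_stack)

lemma does_Cond_blank:
  "does (if s t = [] then p else q) s s' K \<Longrightarrow> does (Cond t 0 p q) s s' (Suc K)"
  unfolding does_def by (rule runs_Cond) (simp add: stacks_def rd_stack split: if_splits)

lemma does_Cond_True:
  "does (if s t \<noteq> [] \<and> last (s t) then p else q) s s' K \<Longrightarrow> does (Cond t 2 p q) s s' (Suc K)"
  unfolding does_def by (rule runs_Cond) (auto simp: stacks_def rd_stack)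

lemma does_CondI:
  "s t = [] \<Longrightarrow> does p s s' K \<Longrightarrow> Suc K \<le> K' \<Longrightarrow> does (Cond t 0 p q) s s' K'"
  "s t \<noteq> [] \<Longrightarrow> does q s s' K \<Longrightarrow> Suc K \<le> K' \<Longrightarrow> does (Cond t 0 p q) s s' K'"
  "s t \<noteq> [] \<and> last (s t) \<Longrightarrow> does p s s' K \<Longrightarrow> Suc K \<le> K' \<Longrightarrow> does (Cond t 2 p q) s s' K'"
  "\<not> (s t \<noteq> [] \<and> last (s t)) \<Longrightarrow> does q s s' K \<Longrightarrow> Suc K \<le> K' \<Longrightarrow> does (Cond t 2 p q) s s' K'"
  using does_le[OF does_Cond_blank refl] does_le[OF does_Cond_True refl] by presburger+

lemma does_Loop:
  assumes "\<And>i. i < L \<Longrightarrow> s i t \<noteq> []" "s L t = []" "\<And>i. i < L \<Longrightarrow> does p (s i) (s (Suc i)) K"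
  shows "does (Loop t p) (s 0) (s L) (L * (K + 2) + 1)"
  unfolding does_def
  by (rule runs_Loop[of L "\<lambda>i. stacks (s i)"]) (use assms in \<open>simp_all add: stacks_def rd_stack does_def\<close>)

lemma does_shift:
  assumes "s a \<noteq> []" "a \<noteq> b"
  shows "does (shift a b) s (s(a := butlast (s a), b := s b @ [last (s a)])) 6"
proof -
  have *: "does (pop a ;; push b c) s (s(a := butlast (s a), b := s b @ [c])) 5" for c
    by (rule does_le[OF does_Seq[OF does_pop[of s a, OF assms(1)] does_push]]) (use assms in auto)
  show ?thesis unfolding shift_def
    by (rule does_le[OF does_Cond_True[where K = 5]]) (use assms *[of True] *[of False] in auto)
qed

lemma butlast_take_diff: "i < length w \<Longrightarrow> butlast (take (length w - i) w) = take (length w - Suc i) w"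
  by (simp add: butlast_take)

lemma take_diff_snoc:
  "i < length w \<Longrightarrow> take (length w - i) w = take (length w - Suc i) w @ [rev w ! i]"
  by (metis Suc_diff_Suc diff_Suc_less length_greater_0_conv list.size(3) not_less_zero rev_nth take_Suc_conv_app_nth)

lemma does_clear: "does (Loop t (pop t)) s (s(t := [])) (length (s t) * 3 + 1)"
proof -
  let ?s = "\<lambda>i. s(t := take (length (s t) - i) (s t))"
  have "does (Loop t (pop t)) (?s 0) (?s (length (s t))) (length (s t) * (1 + 2) + 1)"
  proof (rule does_Loop)
    fix i assume "i < length (s t)"
    then show "does (pop t) (?s i) (?s (Suc i)) 1"
      by (intro does_le[OF does_pop]) (auto simp: butlast_take_diff)
  qed auto
  then show ?thesis by (rule does_cong) auto
qed

lemma does_transfer: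
  assumes "a \<noteq> b"
  shows "does (Loop a (shift a b)) s (s(a := [], b := s b @ rev (s a))) (length (s a) * 8 + 1)"
proof -
  let ?s = "\<lambda>i. s(a := take (length (s a) - i) (s a), b := s b @ take i (rev (s a)))"
  have "does (Loop a (shift a b)) (?s 0) (?s (length (s a))) (length (s a) * (6 + 2) + 1)"
  proof (rule does_Loop)
    fix i assume i: "i < length (s a)"
    then have *: "?s i a = take (length (s a) - Suc i) (s a) @ [rev (s a) ! i]"
      using assms take_diff_snoc by simp
    show "does (shift a b) (?s i) (?s (Suc i)) 6"
      by (rule does_le[OF does_shift]) (use * i assms in \<open>auto simp: take_Suc_conv_app_nth fun_eq_iff\<close>)
  qed (use assms in auto)
  then show ?thesis by (rule does_cong) (use assms in auto)
qed

section \<open>Nested loops that emit strings\<close>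

text \<open>
  Numbers are lengths of strings. In \<open>For a b\<close>, the counter is pushed to the front of the
  environment of \<open>b\<close>.
\<close>

datatype wexp =
    Emp
  | Bit bool
  | Var nat
  | Len
  | App wexp wexp
  | For wexp wexp
  | IfLess wexp wexp wexp wexp
  | IfBit wexp wexp wexp

fun eval :: "wexp \<Rightarrow> bool list \<Rightarrow> nat list \<Rightarrow> bool list" where
  "eval Emp x env = []"
| "eval (Bit b) x env = [b]"
| "eval (Var k) x env = (if k < length env then replicate (env ! k) True else [])"
| "eval Len x env = replicate (length x) True"
| "eval (App a b) x env = eval a x env @ eval b x env"
| "eval (For a b) x env = concat (map (\<lambda>i. eval b x (i # env)) [0..<length (eval a x env)])"
| "eval (IfLess a b p q) x env =
     (if length (eval a x env) < length (eval b x env) then eval p x env else eval q x env)"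
| "eval (IfBit a p q) x env =
     (if length (eval a x env) < length x \<and> x ! length (eval a x env) then eval p x env else eval q x env)"

text \<open>
  The input is kept reversed on tape 1, the number \<open>env ! k\<close> in unary on tape \<open>rs ! k\<close>. The
  result is appended to tape \<open>t\<close>; the tapes from \<open>d\<close> on are scratch space.
\<close>

fun compile :: "wexp \<Rightarrow> nat list \<Rightarrow> nat \<Rightarrow> nat \<Rightarrow> prog" where
  "compile Emp rs t d = Skip"
| "compile (Bit b) rs t d = push t b"
| "compile (Var k) rs t d = (if k < length rs
     then Loop (rs ! k) (pop (rs ! k) ;; push t True ;; push d True) ;; Loop d (shift d (rs ! k))
     else Skip)"
| "compile Len rs t d = Loop 1 (shift 1 d ;; push t True) ;; Loop d (shift d 1)"
| "compile (App a b) rs t d = compile a rs t d ;; compile b rs t d"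
| "compile (For a b) rs t d = compile a rs d (d + 1) ;;
     Loop d (compile b ((d + 1) # rs) t (d + 2) ;; push (d + 1) True ;; pop d) ;; Loop (d + 1) (pop (d + 1))"
| "compile (IfLess a b p q) rs t d = compile a rs d (d + 1) ;; compile b rs (d + 1) (d + 2) ;;
     Loop d (pop d ;; Cond (d + 1) 0 Skip (pop (d + 1))) ;;
     Cond (d + 1) 0 (compile q rs t d) (Loop (d + 1) (pop (d + 1)) ;; compile p rs t d)"
| "compile (IfBit a p q) rs t d = compile a rs d (d + 1) ;;
     Loop d (pop d ;; Cond 1 0 Skip (shift 1 (d + 1))) ;;
     Cond 1 2 (Loop (d + 1) (shift (d + 1) 1) ;; compile p rs t d)
       (Loop (d + 1) (shift (d + 1) 1) ;; compile q rs t d)"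

text \<open>A generous bound: both branches of a test are charged, and each pass through a loop is
  charged with the sum over all passes, because \<open>does_Loop\<close> asks for a uniform
  bound.\<close>

fun cost :: "wexp \<Rightarrow> bool list \<Rightarrow> nat list \<Rightarrow> nat" where
  "cost Emp x env = 0"
| "cost (Bit b) x env = 3"
| "cost (Var k) x env = 20 * (if k < length env then env ! k else 0) + 3"
| "cost Len x env = 20 * length x + 3"
| "cost (App a b) x env = cost a x env + cost b x env + 1"
| "cost (For a b) x env = cost a x env + length (eval a x env) *
     ((\<Sum>i<length (eval a x env). cost b x (i # env)) + 20) + 10"
| "cost (IfLess a b p q) x env = cost a x env + cost b x env + 10 * length (eval a x env) +
     10 * length (eval b x env) + cost p x env + cost q x env + 20"
| "cost (IfBit a p q) x env = cost a x env + 20 * length (eval a x env) + 20 * length x +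
     cost p x env + cost q x env + 20"

definition ready :: "bool list \<Rightarrow> nat list \<Rightarrow> nat list \<Rightarrow> nat \<Rightarrow> nat \<Rightarrow> (nat \<Rightarrow> bool list) \<Rightarrow> bool" where
  "ready x env rs t d s \<longleftrightarrow> s 1 = rev x \<and> length rs = length env \<and>
     (\<forall>k < length rs. s (rs ! k) = replicate (env ! k) True \<and> rs ! k < d \<and> rs ! k \<noteq> t) \<and>
     t \<noteq> 1 \<and> t < d \<and> 1 < d \<and> (\<forall>j \<ge> d. s j = [])"

lemma compile_correct:
  "ready x env rs t d s \<Longrightarrow> does (compile e rs t d) s (s(t := s t @ eval e x env)) (cost e x env)"
proof (induction e arbitrary: env rs t d s)
  case Emp
  show ?case by (simp add: does_Skip)
next
  case (Bit b)
  show ?case unfolding compile.simps eval.simps cost.simps by (rule does_push)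
next
  case (Var k)
  show ?case
  proof (cases "k < length rs")
    case True
    let ?r = "rs ! k" and ?n = "env ! k"
    have r: "s ?r = replicate ?n True" "?r < d" "?r \<noteq> t" "t < d" "s d = []" "k < length env"
      using Var True by (auto simp: ready_def)
    let ?s = "\<lambda>i. s(?r := replicate (?n - i) True, t := s t @ replicate i True, d := replicate i True)"
    have 1: "does (Loop ?r (pop ?r ;; push t True ;; push d True)) (?s 0) (?s ?n) (?n * (9 + 2) + 1)"
    proof (rule does_Loop)
      fix i assume i: "i < ?n"
      then have b: "butlast (replicate (?n - i) True) = replicate (?n - Suc i) True"
        by (metis Suc_diff_Suc butlast_snoc replicate_Suc replicate_append_same)
      show "does (pop ?r ;; push t True ;; push d True) (?s i) (?s (Suc i)) 9"
        by (rule does_le[OF does_Seq[OF does_pop does_Seq[OF does_push does_push]]])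
          (use r i b in \<open>auto simp: fun_eq_iff replicate_append_same\<close>)
    qed (use r in auto)
    have 2: "does (Loop d (shift d ?r)) (?s ?n) (s(t := s t @ replicate ?n True)) (?n * 8 + 1)"
      by (rule does_le[OF does_transfer]) (use r in \<open>auto simp: fun_eq_iff\<close>)
    have 3: "?s 0 = s" using r by (auto simp: fun_eq_iff)
    have "does (compile (Var k) rs t d) s (s(t := s t @ replicate ?n True))
        (?n * (9 + 2) + 1 + (?n * 8 + 1) + 1)"
      unfolding compile.simps if_P[OF True] by (rule does_cong[OF does_Seq[OF 1 2] 3 refl le_refl])
    then show ?thesis by (rule does_le) (use r in auto)
  next
    case False
    then show ?thesis using Var by (auto simp: ready_def fun_upd_idem intro: does_Skip)
  qed
next
  case Len
  have r: "s 1 = rev x" "1 < d" "t \<noteq> 1" "t < d" "s d = []" using Len by (auto simp: ready_def)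
  let ?n = "length x"
  let ?s = "\<lambda>i. s(1 := take (?n - i) (rev x), t := s t @ replicate i True, d := take i x)"
  have 1: "does (Loop 1 (shift 1 d ;; push t True)) (?s 0) (?s ?n) (?n * (10 + 2) + 1)"
  proof (rule does_Loop)
    fix i assume i: "i < ?n"
    then have *: "take (?n - i) (rev x) = take (?n - Suc i) (rev x) @ [x ! i]"
      using take_diff_snoc[of i "rev x"] by simp
    show "does (shift 1 d ;; push t True) (?s i) (?s (Suc i)) 10"
      by (rule does_le[OF does_Seq[OF does_shift does_push]])
        (use r i * in \<open>auto simp: fun_eq_iff replicate_append_same take_Suc_conv_app_nth\<close>)
  qed (use r in auto)
  have 2: "does (Loop d (shift d 1)) (?s ?n) (s(t := s t @ replicate ?n True)) (?n * 8 + 1)"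
    by (rule does_le[OF does_transfer]) (use r in \<open>auto simp: fun_eq_iff\<close>)
  have 3: "?s 0 = s" using r by (auto simp: fun_eq_iff)
  have "does (compile Len rs t d) s (s(t := s t @ replicate ?n True))
      (?n * (10 + 2) + 1 + (?n * 8 + 1) + 1)"
    unfolding compile.simps by (rule does_cong[OF does_Seq[OF 1 2] 3 refl le_refl])
  then show ?case by (rule does_le) auto
next
  case (App a b)
  have "ready x env rs t d (s(t := s t @ eval a x env))" using App.prems by (auto simp: ready_def)
  from does_Seq[OF App.IH(1)[OF App.prems] App.IH(2)[OF this]] show ?case
    unfolding compile.simps by (rule does_le) (auto simp: fun_eq_iff)
next
  case (For a b)
  have r: "s 1 = rev x" "1 < d" "t \<noteq> 1" "t < d" "s d = []" "s (d + 1) = []"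
    using For.prems by (auto simp: ready_def)
  let ?v = "eval a x env" and ?w = "\<lambda>i. concat (map (\<lambda>i. eval b x (i # env)) [0..<i])"
  let ?n = "length ?v" and ?C = "\<Sum>i<length (eval a x env). cost b x (i # env)"
  let ?s = "\<lambda>i. s(d := take (?n - i) ?v, t := s t @ ?w i, d + 1 := replicate i True)"
  have rdy: "ready x env rs d (d + 1) s" using For.prems by (auto simp: ready_def)
  have "does (compile a rs d (d + 1)) s (?s 0) (cost a x env)"
    by (rule does_le[OF For.IH(1)[OF rdy]]) (use r in \<open>auto simp: fun_eq_iff\<close>)
  moreover have "does (Loop d (compile b ((d + 1) # rs) t (d + 2) ;; push (d + 1) True ;; pop d))
     (?s 0) (?s ?n) (?n * ((?C + 6) + 2) + 1)"
  proof (rule does_Loop)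
    fix i assume i: "i < ?n"
    have le: "cost b x (i # env) \<le> ?C" using i by (intro member_le_sum) auto
    have rdy: "ready x (i # env) ((d + 1) # rs) t (d + 2) (?s i)"
      using For.prems by (auto simp: ready_def nth_Cons split: nat.splits)
    show "does (compile b ((d + 1) # rs) t (d + 2) ;; push (d + 1) True ;; pop d) (?s i) (?s (Suc i)) (?C + 6)"
      by (rule does_le[OF does_Seq[OF For.IH(2)[OF rdy] does_Seq[OF does_push does_pop]]])
        (use r i le in \<open>auto simp: fun_eq_iff replicate_append_same butlast_take_diff\<close>)
  qed (use r in auto)
  moreover have "does (Loop (d + 1) (pop (d + 1))) (?s ?n) (s(t := s t @ ?w ?n)) (?n * 3 + 1)"
    by (rule does_le[OF does_clear]) (use r in \<open>auto simp: fun_eq_iff\<close>)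
  ultimately have "does (compile (For a b) rs t d) s (s(t := s t @ ?w ?n))
      (cost a x env + ((?n * ((?C + 6) + 2) + 1) + (?n * 3 + 1) + 1) + 1)"
    unfolding compile.simps by (intro does_Seq)
  then show ?case by (rule does_le) (auto simp: algebra_simps)
next
  case (IfLess a b p q)
  have r: "s 1 = rev x" "1 < d" "t \<noteq> 1" "t < d" "s d = []" "s (d + 1) = []"
    using IfLess.prems by (auto simp: ready_def)
  let ?v = "eval a x env" and ?w = "eval b x env"
  let ?n = "length ?v" and ?m = "length ?w"
  let ?s = "\<lambda>i. s(d := take (?n - i) ?v, d + 1 := take (?m - i) ?w)"
  have rdy: "ready x env rs d (d + 1) s" using IfLess.prems by (auto simp: ready_def)
  have 1: "does (compile a rs d (d + 1)) s (s(d := ?v)) (cost a x env)"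
    by (rule does_le[OF IfLess.IH(1)[OF rdy]]) (use r in \<open>auto simp: fun_eq_iff\<close>)
  have rdy: "ready x env rs (d + 1) (d + 2) (s(d := ?v))" using IfLess.prems by (auto simp: ready_def)
  have 2: "does (compile b rs (d + 1) (d + 2)) (s(d := ?v)) (?s 0) (cost b x env)"
    by (rule does_le[OF IfLess.IH(2)[OF rdy]]) (use r in \<open>auto simp: fun_eq_iff\<close>)
  \<comment> \<open>Both strings are shortened in parallel; something of the second one is left
    exactly if it is longer.\<close>
  have 3: "does (Loop d (pop d ;; Cond (d + 1) 0 Skip (pop (d + 1)))) (?s 0) (?s ?n) (?n * (4 + 2) + 1)"
  proof (rule does_Loop)
    fix i assume i: "i < ?n"
    have *: "does (pop d) (?s i) ((?s i)(d := take (?n - Suc i) ?v)) 1"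
      by (rule does_le[OF does_pop]) (use i in \<open>auto simp: fun_eq_iff butlast_take_diff\<close>)
    have "does (Cond (d + 1) 0 Skip (pop (d + 1))) ((?s i)(d := take (?n - Suc i) ?v)) (?s (Suc i)) 2"
    proof (cases "i < ?m")
      case True
      have "does (pop (d + 1)) ((?s i)(d := take (?n - Suc i) ?v)) (?s (Suc i)) 1"
        by (rule does_le[OF does_pop]) (use True in \<open>auto simp: fun_eq_iff butlast_take_diff\<close>)
      then show ?thesis using True by (intro does_le[OF does_Cond_blank[where K = 1]]) auto
    next
      case False
      then show ?thesis by (intro does_le[OF does_Cond_blank[where K = 1]]) (auto simp: fun_eq_iff intro: does_le[OF does_Skip])
    qed
    from does_Seq[OF * this]
    show "does (pop d ;; Cond (d + 1) 0 Skip (pop (d + 1))) (?s i) (?s (Suc i)) 4" by (rule does_le) auto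
  qed auto
  have ready: "ready x env rs t d s" by (rule IfLess.prems)
  have 4: "does (Cond (d + 1) 0 (compile q rs t d) (Loop (d + 1) (pop (d + 1)) ;; compile p rs t d)) (?s ?n)
     (s(t := s t @ eval (IfLess a b p q) x env)) (?m * 3 + cost p x env + cost q x env + 3)"
  proof (cases "?n < ?m")
    case True
    have "does (Loop (d + 1) (pop (d + 1))) (?s ?n) s (?m * 3 + 1)"
      by (rule does_le[OF does_clear]) (use r in \<open>auto simp: fun_eq_iff\<close>)
    then have "does (Loop (d + 1) (pop (d + 1)) ;; compile p rs t d) (?s ?n)
        (s(t := s t @ eval (IfLess a b p q) x env)) (?m * 3 + 1 + cost p x env + 1)"
      by (rule does_le[OF does_Seq[OF _ IfLess.IH(3)[OF ready]]]) (use True in auto)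
    then show ?thesis by (rule does_CondI(2)[rotated]) (use True in auto)
  next
    case False
    then have e: "?s ?n = s" using r by (auto simp: fun_eq_iff)
    have "does (compile q rs t d) (?s ?n) (s(t := s t @ eval (IfLess a b p q) x env)) (cost q x env)"
      unfolding e by (rule does_le[OF IfLess.IH(4)[OF ready]]) (use False in auto)
    then show ?thesis by (rule does_CondI(1)[rotated]) (use False in auto)
  qed
  have "does (compile (IfLess a b p q) rs t d) s (s(t := s t @ eval (IfLess a b p q) x env))
      (cost a x env + (cost b x env + ((?n * (4 + 2) + 1) +
        (?m * 3 + cost p x env + cost q x env + 3) + 1) + 1) + 1)"
    unfolding compile.simps by (intro does_Seq) (rule 1 2 3 4)+
  then show ?case by (rule does_le) (auto simp: algebra_simps)
next
  case (IfBit a p q)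
  have r: "s 1 = rev x" "1 < d" "t \<noteq> 1" "t < d" "s d = []" "s (d + 1) = []"
    using IfBit.prems by (auto simp: ready_def)
  let ?v = "eval a x env"
  let ?n = "length ?v" and ?m = "length x"
  let ?s = "\<lambda>i. s(d := take (?n - i) ?v, 1 := take (?m - i) (rev x), d + 1 := take i x)"
  have rdy: "ready x env rs d (d + 1) s" using IfBit.prems by (auto simp: ready_def)
  have 1: "does (compile a rs d (d + 1)) s (?s 0) (cost a x env)"
    by (rule does_le[OF IfBit.IH(1)[OF rdy]]) (use r in \<open>auto simp: fun_eq_iff\<close>)
  \<comment> \<open>The input is stored in reverse, so moving its first \<open>?n\<close> bits to
    tape \<open>d + 1\<close> brings bit \<open>?n\<close> to the top of tape 1. The transfer
    \<open>undo\<close> restores the input.\<close>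
  have 2: "does (Loop d (pop d ;; Cond 1 0 Skip (shift 1 (d + 1)))) (?s 0) (?s ?n) (?n * (9 + 2) + 1)"
  proof (rule does_Loop)
    fix i assume i: "i < ?n"
    have *: "does (pop d) (?s i) ((?s i)(d := take (?n - Suc i) ?v)) 1"
      by (rule does_le[OF does_pop]) (use i r in \<open>auto simp: fun_eq_iff butlast_take_diff\<close>)
    have "does (Cond 1 0 Skip (shift 1 (d + 1))) ((?s i)(d := take (?n - Suc i) ?v)) (?s (Suc i)) 7"
    proof (cases "i < ?m")
      case True
      then have e: "take (?m - i) (rev x) = take (?m - Suc i) (rev x) @ [x ! i]"
        using take_diff_snoc[of i "rev x"] by simp
      have "does (shift 1 (d + 1)) ((?s i)(d := take (?n - Suc i) ?v)) (?s (Suc i)) 6"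
        by (rule does_le[OF does_shift])
          (use True r e in \<open>auto simp: fun_eq_iff take_Suc_conv_app_nth\<close>)
      then show ?thesis using True r by (intro does_le[OF does_Cond_blank[where K = 6]]) auto
    next
      case False
      then show ?thesis using r
        by (intro does_le[OF does_Cond_blank[where K = 6]]) (auto simp: fun_eq_iff intro: does_le[OF does_Skip])
    qed
    from does_Seq[OF * this]
    show "does (pop d ;; Cond 1 0 Skip (shift 1 (d + 1))) (?s i) (?s (Suc i)) 9" by (rule does_le) auto
  qed (use r in auto)
  have ready: "ready x env rs t d s" by (rule IfBit.prems)
  have undo: "does (Loop (d + 1) (shift (d + 1) 1)) (?s ?n) s (?m * 8 + 1)"
  proof (rule does_le[OF does_transfer])
    have "take (?m - ?n) (rev x) @ rev (take ?n x) = rev x"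
      by (metis append_take_drop_id rev_append rev_drop rev_take rev_rev_ident take_rev)
    then show "(?s ?n)(d + 1 := [], 1 := ?s ?n 1 @ rev (?s ?n (d + 1))) = s"
      using r by (auto simp: fun_eq_iff)
  qed (use r in auto)
  have lst: "(take (?m - ?n) (rev x) \<noteq> [] \<and> last (take (?m - ?n) (rev x))) = (?n < ?m \<and> x ! ?n)"
    using take_diff_snoc[of ?n "rev x"] by (cases "?n < ?m") auto
  have 4: "does (Cond 1 2 (Loop (d + 1) (shift (d + 1) 1) ;; compile p rs t d)
       (Loop (d + 1) (shift (d + 1) 1) ;; compile q rs t d)) (?s ?n)
     (s(t := s t @ eval (IfBit a p q) x env)) (?m * 8 + 1 + (cost p x env + cost q x env) + 2)"
  proof (cases "?n < ?m \<and> x ! ?n")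
    case True
    have "does (Loop (d + 1) (shift (d + 1) 1) ;; compile p rs t d) (?s ?n)
        (s(t := s t @ eval (IfBit a p q) x env)) (?m * 8 + 1 + cost p x env + 1)"
      by (rule does_le[OF does_Seq[OF undo IfBit.IH(2)[OF ready]]]) (use True in auto)
    then show ?thesis by (rule does_CondI(3)[rotated]) (use True lst r in auto)
  next
    case False
    have "does (Loop (d + 1) (shift (d + 1) 1) ;; compile q rs t d) (?s ?n)
        (s(t := s t @ eval (IfBit a p q) x env)) (?m * 8 + 1 + cost q x env + 1)"
      by (rule does_le[OF does_Seq[OF undo IfBit.IH(3)[OF ready]]]) (use False in auto)
    then show ?thesis by (rule does_CondI(4)[rotated]) (use False lst r in auto)
  qed
  have "does (compile (IfBit a p q) rs t d) s (s(t := s t @ eval (IfBit a p q) x env))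
      (cost a x env + ((?n * (9 + 2) + 1) +
        (?m * 8 + 1 + (cost p x env + cost q x env) + 2) + 1) + 1)"
    unfolding compile.simps by (intro does_Seq) (rule 1 2 4)+
  then show ?case by (rule does_le) (auto simp: algebra_simps)
qed

section \<open>Polynomial bounds on results and running times\<close>

definition pbounded :: "(bool list \<Rightarrow> nat list \<Rightarrow> nat) \<Rightarrow> bool" where
  "pbounded f \<longleftrightarrow> (\<exists>k. \<forall>x env. f x env \<le> (length x + sum_list env + 2) ^ k)"

lemma pbounded_le: "pbounded g \<Longrightarrow> (\<And>x env. f x env \<le> g x env) \<Longrightarrow> pbounded f"
  unfolding pbounded_def by (meson le_trans)

lemma pbounded_const: "pbounded (\<lambda>x env. c)"
proof -
  have "c \<le> (n + 2) ^ c" for n :: nat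
    using less_exp[of c] power_mono[of 2 "n + 2" c] by (meson le_add2 less_imp_le order_trans zero_le)
  then show ?thesis unfolding pbounded_def by blast
qed

lemma pbounded_size: "pbounded (\<lambda>x env. length x + sum_list env)"
  unfolding pbounded_def by (rule exI[of _ 1]) simp

lemma pbounded_length: "pbounded (\<lambda>x env. length x)"
  by (rule pbounded_le[OF pbounded_size]) simp

text \<open>The base of the powers is at least 2, so a factor 2 is absorbed by one more
  exponent.\<close>

lemma pbounded_add:
  assumes "pbounded f" "pbounded g"
  shows "pbounded (\<lambda>x env. f x env + g x env)"
proof -
  obtain k l where k: "\<And>x env. f x env \<le> (length x + sum_list env + 2) ^ k"
    and l: "\<And>x env. g x env \<le> (length x + sum_list env + 2) ^ l"
    using assms unfolding pbounded_def by blast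
  have "f x env + g x env \<le> (length x + sum_list env + 2) ^ (k + l + 1)" for x env
  proof -
    let ?B = "length x + sum_list env + 2"
    have "?B ^ k \<le> ?B ^ (k + l)" "?B ^ l \<le> ?B ^ (k + l)" by (rule power_increasing; simp)+
    then have "f x env + g x env \<le> 2 * ?B ^ (k + l)" using k[of x env] l[of x env] by linarith
    also have "\<dots> \<le> ?B * ?B ^ (k + l)" by (rule mult_right_mono) simp_all
    finally show ?thesis by simp
  qed
  then show ?thesis unfolding pbounded_def by blast
qed

lemma pbounded_mult:
  assumes "pbounded f" "pbounded g"
  shows "pbounded (\<lambda>x env. f x env * g x env)"
proof -
  obtain k l where k: "\<And>x env. f x env \<le> (length x + sum_list env + 2) ^ k"
    and l: "\<And>x env. g x env \<le> (length x + sum_list env + 2) ^ l"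
    using assms unfolding pbounded_def by blast
  have "f x env * g x env \<le> (length x + sum_list env + 2) ^ (k + l)" for x env
    unfolding power_add by (rule mult_mono[OF k l]) simp_all
  then show ?thesis unfolding pbounded_def by blast
qed

text \<open>The counter stays below \<open>f x env\<close>, so the extended environment is still
  polynomial in size; the exponents multiply.\<close>

lemma pbounded_sum:
  assumes "pbounded f" "pbounded g"
  shows "pbounded (\<lambda>x env. \<Sum>i<f x env. g x (i # env))"
proof -
  obtain k l where k: "\<And>x env. f x env \<le> (length x + sum_list env + 2) ^ k"
    and l: "\<And>x env. g x env \<le> (length x + sum_list env + 2) ^ l"
    using assms unfolding pbounded_def by blast
  have "g x (i # env) \<le> (length x + sum_list env + 2) ^ ((k + 2) * l)" if "i < f x env" for x i env
  proof -
    let ?B = "length x + sum_list env + 2"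
    have "?B ^ 1 \<le> ?B ^ (k + 1)" "?B ^ k \<le> ?B ^ (k + 1)" by (rule power_increasing; simp)+
    then have "length x + sum_list (i # env) + 2 \<le> 2 * ?B ^ (k + 1)"
      using k[of x env] that by simp
    also have "\<dots> \<le> ?B * ?B ^ (k + 1)" by (rule mult_right_mono) simp_all
    finally have "length x + sum_list (i # env) + 2 \<le> ?B ^ (k + 2)" by simp
    then have "(length x + sum_list (i # env) + 2) ^ l \<le> (?B ^ (k + 2)) ^ l" by (rule power_mono) simp
    with l[of x "i # env"] show ?thesis unfolding power_mult by (rule order_trans)
  qed
  then have "(\<Sum>i<f x env. g x (i # env)) \<le> f x env * (length x + sum_list env + 2) ^ ((k + 2) * l)" for x env
    using sum_bounded_above[of "{..<f x env}" "\<lambda>i. g x (i # env)"] by simp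
  moreover have "pbounded (\<lambda>x env. f x env * (length x + sum_list env + 2) ^ ((k + 2) * l))"
    by (rule pbounded_mult[OF assms(1)]) (auto simp: pbounded_def)
  ultimately show ?thesis by (rule pbounded_le[rotated])
qed

lemma nth_le_sum_list: "k < length env \<Longrightarrow> env ! k \<le> (sum_list env :: nat)"
  by (rule elem_le_sum_list)

lemma length_eval_For:
  "length (eval (For a b) x env) = (\<Sum>i<length (eval a x env). length (eval b x (i # env)))"
  by (simp add: length_concat o_def interv_sum_list_conv_sum_set_nat atLeast0LessThan)

lemma pbounded_eval: "pbounded (\<lambda>x env. length (eval e x env))"
proof (induction e)
  case (Var k)
  show ?case by (rule pbounded_le[OF pbounded_size]) (auto simp: nth_le_sum_list trans_le_add2)
next
  case (App a b)
  then show ?case by (simp add: pbounded_add)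
next
  case (For a b)
  then show ?case unfolding length_eval_For by (rule pbounded_sum)
next
  case (IfLess a b p q)
  from pbounded_add[OF this(3,4)] show ?case by (rule pbounded_le) auto
next
  case (IfBit a p q)
  from pbounded_add[OF this(2,3)] show ?case by (rule pbounded_le) auto
qed (simp_all add: pbounded_const pbounded_length)

lemma pbounded_cost: "pbounded (cost e)"
proof (induction e)
  case (App a b)
  then show ?case unfolding cost.simps by (intro pbounded_add pbounded_const)
next
  case (Var k)
  have "pbounded (\<lambda>x env. 20 * (length x + sum_list env) + 3)"
    by (intro pbounded_add pbounded_mult pbounded_const pbounded_size pbounded_length)
  then show ?case by (rule pbounded_le) (auto simp: nth_le_sum_list trans_le_add2)
next
  case (For a b)
  then show ?case unfolding cost.simps
    by (intro pbounded_add pbounded_mult pbounded_sum pbounded_const pbounded_eval)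
next
  case (IfLess a b p q)
  then show ?case unfolding cost.simps
    by (intro pbounded_add pbounded_mult pbounded_const pbounded_eval)
next
  case (IfBit a p q)
  then show ?case unfolding cost.simps
    by (intro pbounded_add pbounded_mult pbounded_const pbounded_eval pbounded_length)
qed (simp_all add: pbounded_add pbounded_mult pbounded_const pbounded_length)

text \<open>The part of \<open>prog_ok\<close> that does not mention the number of tapes, which
  becomes known only once the program is compiled.\<close>

fun writes_ok :: "prog \<Rightarrow> bool" where
  "writes_ok (Act t w m) = (\<forall>s. w = Some s \<longrightarrow> s < 3)"
| "writes_ok (Seq p q) = (writes_ok p \<and> writes_ok q)"
| "writes_ok (Cond t s p q) = (writes_ok p \<and> writes_ok q)"
| "writes_ok (Loop t p) = writes_ok p"
| "writes_ok Skip = True"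

lemma prog_ok_exists: "writes_ok p \<Longrightarrow> \<exists>T. prog_ok T p"
proof (induction p)
  case (Act t w m)
  then show ?case by (auto intro!: exI[of _ "Suc t"])
next
  case (Seq p q)
  then obtain S T where "prog_ok S p" "prog_ok T q" by auto
  then show ?case using prog_ok_mono[of _ _ "max S T"] by (auto intro!: exI[of _ "max S T"])
next
  case (Cond t s p q)
  then obtain S T where "prog_ok S p" "prog_ok T q" by auto
  then show ?case using prog_ok_mono[of _ _ "max (Suc t) (max S T)"]
    by (auto intro!: exI[of _ "max (Suc t) (max S T)"])
next
  case (Loop t p)
  then obtain S where "prog_ok S p" by auto
  then show ?case using prog_ok_mono[of _ _ "max (Suc t) S"]
    by (auto intro!: exI[of _ "max (Suc t) S"])
qed simp

lemma writes_ok_basic: "writes_ok (push t b)" "writes_ok (pop t)" "writes_ok (shift t u)"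
  by (simp_all add: push_def pop_def shift_def)

lemma writes_ok_compile: "writes_ok (compile e rs t d)"
  by (induction e arbitrary: rs t d) (simp_all add: writes_ok_basic)

theorem eval_polytime: "polytime (\<lambda>x. eval e x [])"
proof -
  \<comment> \<open>Running right to the first blank and one cell back turns tape 0 into a stack.
    Transferring it reverses the input onto tape 1 and frees tape 0 for the output.\<close>
  define p where "p = Loop 0 (Act 0 None Move_Right) ;; Act 0 None Move_Left ;; Loop 0 (shift 0 1) ;; compile e [] 0 2"
  have "writes_ok p" by (simp add: p_def writes_ok_compile writes_ok_basic)
  then obtain T where T: "prog_ok (Suc T) p" using prog_ok_exists prog_ok_mono by (metis le_SucI order_refl)
  have "pbounded (\<lambda>x env. (length x + sum_list env) * 3 + 1 + (1 + ((length x + sum_list env) * 8 + 1 + cost e x env + 1) + 1) + 1)"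
    by (intro pbounded_add pbounded_mult pbounded_const pbounded_size pbounded_cost)
  then obtain k where k: "length x * 3 + 1 + (1 + (length x * 8 + 1 + cost e x [] + 1) + 1) + 1 \<le> (length x + 2) ^ k" for x
    unfolding pbounded_def by (metis add.right_neutral sum_list.Nil)
  show ?thesis
  proof (rule prog_polytime[OF T, where P = "[:2, 1:] ^ k"])
    show "p \<noteq> Skip" by (simp add: p_def)
    fix x :: "bool list"
    let ?n = "length x" and ?i = "(\<lambda>_. (\<lambda>_. 0, 0)) :: nat \<Rightarrow> tape"
    let ?s = "\<lambda>t. if t = 0 then x else []"
    have 1: "runs (Loop 0 (Act 0 None Move_Right)) (?i(0 := (string_tape x, 0)))
      (?i(0 := (string_tape x, int ?n))) (?n * (Suc 0 + 2) + 1)"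
    proof -
      have step: "runs (Act 0 None Move_Right) (?i(0 := (string_tape x, h))) (?i(0 := (string_tape x, 1 + h))) (Suc 0)" for h
        using runs_Act[of 0 None Move_Right "?i(0 := (string_tape x, h))"] by (simp add: rd_def add.commute)
      have "runs (Loop 0 (Act 0 None Move_Right)) (?i(0 := (string_tape x, int 0)))
        (?i(0 := (string_tape x, int ?n))) (?n * (Suc 0 + 2) + 1)"
        by (rule runs_Loop[of ?n "\<lambda>i. ?i(0 := (string_tape x, int i))"])
          (use step in \<open>auto simp: rd_def string_tape_def\<close>)
      then show ?thesis by simp
    qed
    have e: "stacks ?s = ?i(0 := (string_tape x, int ?n - 1))"
      by (auto simp: stacks_def stack_def string_tape_def fun_eq_iff)
    have 2: "runs (Act 0 None Move_Left) (?i(0 := (string_tape x, int ?n))) (stacks ?s) (Suc 0)"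
      using runs_Act[of 0 None Move_Left "?i(0 := (string_tape x, int ?n))"] unfolding e by (simp add: rd_def)
    have 3: "does (Loop 0 (shift 0 1)) ?s (?s(0 := [], 1 := rev x)) (?n * 8 + 1)"
      by (rule does_cong[OF does_transfer[of 0 1 ?s]]) auto
    have "ready x [] [] 0 2 (?s(0 := [], 1 := rev x))" by (auto simp: ready_def)
    from does_Seq[OF 3 compile_correct[OF this, of e]]
    have 4: "runs (Loop 0 (shift 0 1) ;; compile e [] 0 2) (stacks ?s)
      (stacks (?s(0 := eval e x [], 1 := rev x))) (?n * 8 + 1 + cost e x [] + 1)"
      unfolding does_def by (simp add: fun_upd_twist)
    let ?\<tau> = "stacks (?s(0 := eval e x [], 1 := rev x))"
    have "runs p (?i(0 := (string_tape x, 0))) ?\<tau> (poly ([:2, 1:] ^ k) ?n)"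
      unfolding p_def by (rule runs_mono[OF runs_Seq[OF 1 runs_Seq[OF 2 4]]]) (use k[of x] in \<open>simp add: add.commute\<close>)
    moreover have "\<forall>i\<in>{0..int (length (eval e x []))}. fst (?\<tau> 0) i = string_tape (eval e x []) i"
      by (simp add: stacks_def stack_def)
    ultimately show "\<exists>\<tau>. runs p (?i(0 := (string_tape x, 0))) \<tau> (poly ([:2, 1:] ^ k) ?n) \<and>
      (\<forall>i \<in> {0..int (length (eval e x []))}. fst (\<tau> 0) i = string_tape (eval e x []) i)" by blast
  qed simp
qed

section \<open>Emittable strings\<close>

text \<open>Strings, numbers and tests that some expression computes in every environment. Their
  closure properties make it possible to certify a function from its definition, without writing
  down an expression.\<close>

definition emits :: "(bool list \<Rightarrow> nat list \<Rightarrow> bool list) \<Rightarrow> bool" where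
  "emits G \<longleftrightarrow> (\<exists>e. \<forall>x env. eval e x env = G x env)"

definition numf :: "(bool list \<Rightarrow> nat list \<Rightarrow> nat) \<Rightarrow> bool" where
  "numf F \<longleftrightarrow> (\<exists>e. \<forall>x env. length (eval e x env) = F x env)"

definition testf :: "(bool list \<Rightarrow> nat list \<Rightarrow> bool) \<Rightarrow> bool" where
  "testf P \<longleftrightarrow> numf (\<lambda>x env. if P x env then 1 else 0)"

text \<open>The innermost counter. The value for the empty environment agrees with the evaluation of
  \<open>Var 0\<close>, which makes the rules free of side conditions.\<close>

fun top :: "nat list \<Rightarrow> nat" where
  "top [] = 0"
| "top (a # env) = a"

text \<open>Renames variables when an expression is moved under a further loop; the first
  \<open>n\<close> variables are bound inside and stay.\<close>

fun lift :: "nat \<Rightarrow> wexp \<Rightarrow> wexp" where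
  "lift n (Var k) = Var (if k < n then k else Suc k)"
| "lift n (App a b) = App (lift n a) (lift n b)"
| "lift n (For a b) = For (lift n a) (lift (Suc n) b)"
| "lift n (IfLess a b p q) = IfLess (lift n a) (lift n b) (lift n p) (lift n q)"
| "lift n (IfBit a p q) = IfBit (lift n a) (lift n p) (lift n q)"
| "lift n e = e"

lemma eval_lift: "eval (lift (length ys) e) x (ys @ env) = eval e x (ys @ tl env)"
proof (induction e arbitrary: ys)
  case (Var k)
  show ?case by (cases env) (auto simp: nth_append Suc_diff_le)
next
  case (For a b)
  have "eval (lift (Suc (length ys)) b) x (i # ys @ env) = eval b x (i # ys @ tl env)" for i
    using For.IH(2)[of "i # ys"] by simp
  then show ?case using For.IH(1) by simp
qed simp_all

lemma polytime_emits: "emits G \<Longrightarrow> polytime (\<lambda>x. G x [])"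
  unfolding emits_def using eval_polytime by (metis (no_types, lifting) ext)

lemma numf_shift: "numf F \<Longrightarrow> numf (\<lambda>x env. F x (tl env))"
  unfolding numf_def using eval_lift[of "[]"] by (metis append_Nil list.size(3))

lemma numf_top: "numf (\<lambda>x env. top env)"
proof -
  have "length (eval (Var 0) x env) = top env" for x env by (cases env) simp_all
  then show ?thesis unfolding numf_def by blast
qed

lemma numf_length_emits: "emits G \<Longrightarrow> numf (\<lambda>x env. length (G x env))"
  unfolding emits_def numf_def by metis

lemma emits_Nil: "emits (\<lambda>x env. [])"
  unfolding emits_def using eval.simps(1) by metis

lemma emits_append: "emits F \<Longrightarrow> emits G \<Longrightarrow> emits (\<lambda>x env. F x env @ G x env)"
  unfolding emits_def using eval.simps(5) by metis

lemma emits_Cons: "emits G \<Longrightarrow> emits (\<lambda>x env. b # G x env)"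
  using emits_append[of "\<lambda>x env. [b]" G] unfolding emits_def using eval.simps(2) by (metis append_Cons append_Nil)

lemma emits_concat:
  assumes "numf A" "emits (\<lambda>x env. G x (top env) (tl env))"
  shows "emits (\<lambda>x env. concat (map (\<lambda>i. G x i env) [0..<A x env]))"
proof -
  obtain a where a: "\<And>x env. length (eval a x env) = A x env" using assms(1) by (auto simp: numf_def)
  obtain g where g: "\<And>x env. eval g x env = G x (top env) (tl env)" using assms(2) by (auto simp: emits_def)
  have "eval (For a g) x env = concat (map (\<lambda>i. G x i env) [0..<A x env])" for x env
    by (simp add: a g)
  then show ?thesis unfolding emits_def by blast
qed

lemma numf_const: "numf (\<lambda>x env. c)"
proof -
  have "emits (\<lambda>x env. replicate c True)"
    by (induction c) (simp_all add: emits_Nil emits_Cons)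
  from numf_length_emits[OF this] show ?thesis by simp
qed

lemma emits_replicate: "numf A \<Longrightarrow> emits (\<lambda>x env. replicate (A x env) True)"
proof -
  assume "numf A"
  then have "emits (\<lambda>x env. concat (map (\<lambda>i. [True]) [0..<A x env]))"
    by (rule emits_concat) (intro emits_Cons emits_Nil)
  moreover have "concat (map (\<lambda>i. [True]) [0..<n]) = replicate n True" for n
    by (induction n) (simp_all add: replicate_append_same)
  ultimately show ?thesis by simp
qed

lemma emits_numf: "emits (\<lambda>x env. replicate (A x env) True) \<Longrightarrow> numf A"
  using numf_length_emits by force

lemma numf_sum:
  assumes "numf A" "numf (\<lambda>x env. F x (top env) (tl env))"
  shows "numf (\<lambda>x env. \<Sum>i<A x env. F x i env)"
  using numf_length_emits[OF emits_concat[OF assms(1) emits_replicate[OF assms(2)]]]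
  by (simp add: length_concat o_def interv_sum_list_conv_sum_set_nat atLeast0LessThan)

lemma numf_Len: "numf (\<lambda>x env. length x)"
proof -
  have "length (eval Len x env) = length x" for x env by simp
  then show ?thesis unfolding numf_def by blast
qed

lemma numf_add: "numf A \<Longrightarrow> numf B \<Longrightarrow> numf (\<lambda>x env. A x env + B x env)"
  by (rule emits_numf) (simp add: replicate_add emits_append emits_replicate)

lemma numf_mult: "numf A \<Longrightarrow> numf B \<Longrightarrow> numf (\<lambda>x env. A x env * B x env)"
  using numf_sum[of A "\<lambda>x i env. B x env"] numf_shift[of B] by simp

lemma emits_if_less:
  assumes "numf A" "numf B" "emits F" "emits G"
  shows "emits (\<lambda>x env. if A x env < B x env then F x env else G x env)"
proof -
  obtain a b f g where "\<And>x env. length (eval a x env) = A x env" "\<And>x env. length (eval b x env) = B x env"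
    "\<And>x env. eval f x env = F x env" "\<And>x env. eval g x env = G x env"
    using assms unfolding numf_def emits_def by metis
  then have "eval (IfLess a b f g) x env = (if A x env < B x env then F x env else G x env)" for x env
    by simp
  then show ?thesis unfolding emits_def by blast
qed

lemma emits_if:
  assumes "testf P" "emits F" "emits G"
  shows "emits (\<lambda>x env. if P x env then F x env else G x env)"
  by (rule back_subst[of emits, OF emits_if_less[OF numf_const[of 0] assms(1)[unfolded testf_def] assms(2,3)]])
    (auto simp: fun_eq_iff)

lemma numf_if:
  assumes "testf P" "numf A" "numf B"
  shows "numf (\<lambda>x env. if P x env then A x env else B x env)"
  by (rule back_subst[of numf, OF numf_length_emits[OF emits_if[OF assms(1) emits_replicate[OF assms(2)] emits_replicate[OF assms(3)]]]])
    (auto simp: fun_eq_iff)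

lemma testf_less:
  assumes "numf A" "numf B"
  shows "testf (\<lambda>x env. A x env < B x env)"
  unfolding testf_def
  by (rule back_subst[of numf, OF numf_length_emits[OF emits_if_less[OF assms emits_Cons[OF emits_Nil] emits_Nil]]])
    (auto simp: fun_eq_iff)

lemma testf_bit:
  assumes "numf A"
  shows "testf (\<lambda>x env. A x env < length x \<and> x ! A x env)"
proof -
  obtain a where a: "\<And>x env. length (eval a x env) = A x env" using assms by (auto simp: numf_def)
  have "length (eval (IfBit a (Bit True) Emp) x env) = (if A x env < length x \<and> x ! A x env then 1 else 0)" for x env
    by (simp add: a)
  then show ?thesis unfolding testf_def numf_def by blast
qed

lemma testf_const: "testf (\<lambda>x env. b)"
  unfolding testf_def by (cases b) (simp_all add: numf_const)

lemma testf_not: "testf P \<Longrightarrow> testf (\<lambda>x env. \<not> P x env)"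
  unfolding testf_def[of "\<lambda>x env. \<not> P x env"]
  by (rule back_subst[of numf, OF numf_if[OF _ numf_const numf_const]]) (auto simp: fun_eq_iff)

lemma testf_conj:
  assumes "testf P" "testf Q"
  shows "testf (\<lambda>x env. P x env \<and> Q x env)"
  unfolding testf_def
  by (rule back_subst[of numf, OF numf_if[OF assms(1) assms(2)[unfolded testf_def] numf_const[of 0]]]) (auto simp: fun_eq_iff)

lemma testf_disj: "testf P \<Longrightarrow> testf Q \<Longrightarrow> testf (\<lambda>x env. P x env \<or> Q x env)"
  using testf_not[OF testf_conj[OF testf_not testf_not], of P Q] by simp

lemma testf_le: "numf A \<Longrightarrow> numf B \<Longrightarrow> testf (\<lambda>x env. A x env \<le> B x env)"
  using testf_not[OF testf_less[of B A]] by (simp add: not_less)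

lemma testf_eq: "numf A \<Longrightarrow> numf B \<Longrightarrow> testf (\<lambda>x env. A x env = B x env)"
  using testf_conj[OF testf_le[of A B] testf_le[of B A]] by (simp add: eq_iff)

lemma testf_bex:
  assumes "numf A" "testf (\<lambda>x env. P x (top env) (tl env))"
  shows "testf (\<lambda>x env. \<exists>i<A x env. P x i env)"
proof -
  have "numf (\<lambda>x env. \<Sum>i<A x env. if P x i env then 1 else 0)"
    by (rule numf_sum[OF assms(1)]) (use assms(2) in \<open>simp add: testf_def\<close>)
  moreover have "(0 < (\<Sum>i<a. if Q i then 1 else 0 :: nat)) = (\<exists>i<a. Q i)" for a :: nat and Q
    by (induction a) (auto simp: less_Suc_eq)
  ultimately show ?thesis
    using testf_less[OF numf_const[of 0], of "\<lambda>x env. \<Sum>i<A x env. if P x i env then 1 else 0"] by simp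
qed

lemma testf_ball:
  assumes "numf A" "testf (\<lambda>x env. P x (top env) (tl env))"
  shows "testf (\<lambda>x env. \<forall>i<A x env. P x i env)"
  using testf_not[OF testf_bex[OF assms(1), of "\<lambda>x i env. \<not> P x i env"]] testf_not[OF assms(2)] by simp

lemma numf_minus: "numf A \<Longrightarrow> numf B \<Longrightarrow> numf (\<lambda>x env. A x env - B x env)"
proof -
  assume A: "numf A" and B: "numf B"
  have "(\<Sum>i<a. if b \<le> i then 1 else 0) = a - b" for a b :: nat
    by (induction a) auto
  moreover have "numf (\<lambda>x env. \<Sum>i<A x env. if B x env \<le> i then 1 else 0)"
    by (rule numf_sum[OF A]) (intro numf_if testf_le numf_const numf_top numf_shift[OF B])
  ultimately show ?thesis by simp
qed

text \<open>The quotient counts the positive multiples of \<open>b\<close> up to \<open>a\<close>,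
  and both sides vanish for \<open>b = 0\<close>.\<close>

lemma sum_div: "(\<Sum>i<a. if 0 < b \<and> Suc i * b \<le> a then 1 else 0) = a div (b :: nat)"
proof (cases "b = 0")
  case False
  have "{i. i < a \<and> Suc i * b \<le> a} = {..<a div b}"
  proof -
    have "(i < a \<and> Suc i * b \<le> a) = (i < a div b)" for i
      using False by (metis Suc_le_eq div_le_dividend less_eq_div_iff_mult_less_eq not_gr_zero order_less_le_trans)
    then show ?thesis by auto
  qed
  moreover have "(\<Sum>i<a. if 0 < b \<and> Suc i * b \<le> a then 1 else 0) = card {i. i < a \<and> Suc i * b \<le> a}"
    using False by (simp add: sum.If_cases Int_def)
  ultimately show ?thesis by simp
qed simp

lemma numf_div: "numf A \<Longrightarrow> numf B \<Longrightarrow> numf (\<lambda>x env. A x env div B x env)"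
proof -
  assume A: "numf A" and B: "numf B"
  have "numf (\<lambda>x env. \<Sum>i<A x env. if 0 < B x env \<and> Suc i * B x env \<le> A x env then 1 else 0)"
    unfolding Suc_eq_plus1
    by (rule numf_sum[OF A]) (intro numf_if testf_conj testf_le testf_less numf_mult numf_add numf_const
      numf_top numf_shift[OF B] numf_shift[OF A])
  then show ?thesis by (simp only: sum_div)
qed

lemma numf_mod: "numf A \<Longrightarrow> numf B \<Longrightarrow> numf (\<lambda>x env. A x env mod B x env)"
  unfolding modulo_nat_def by (intro numf_minus numf_mult numf_div)

lemma numf_poly: "numf A \<Longrightarrow> numf (\<lambda>x env. poly p (A x env))"
  by (induction p) (simp_all add: numf_const numf_add numf_mult)

lemmas numf_intros = numf_const numf_top numf_Len numf_add numf_mult numf_minus numf_div numf_mod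
  numf_if testf_const testf_less testf_le testf_eq testf_not testf_conj testf_disj
  numf_top[THEN numf_shift] numf_top[THEN numf_shift, THEN numf_shift]
  numf_top[THEN numf_shift, THEN numf_shift, THEN numf_shift]

section \<open>Tilings\<close>

text \<open>
  A word \<open>z\<close> of tiles stands for a table of width \<open>W\<close> that is read row by row; \<open>al\<close> restricts the
  tiles at a place of class \<open>cl p\<close>.
\<close>

definition gap :: "nat \<Rightarrow> nat \<Rightarrow> nat" where
  "gap W e = (if e = 0 then 1 else if e = 1 then W - 1 else if e = 2 then W else W + 1)"

definition tiling ::
    "'a set \<Rightarrow> (nat \<Rightarrow> 'a \<Rightarrow> 'a \<Rightarrow> bool) \<Rightarrow> (nat \<Rightarrow> 'a \<Rightarrow> bool) \<Rightarrow> nat \<Rightarrow> nat \<Rightarrow> (nat \<Rightarrow> nat) \<Rightarrow> (nat \<Rightarrow> 'a) \<Rightarrow> bool" where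
  "tiling X R al N W cl z \<longleftrightarrow> (\<forall>p < N. z p \<in> X \<and> al (cl p) (z p)) \<and>
     (\<forall>e < 4. \<forall>p. p + gap W e < N \<longrightarrow> R e (z p) (z (p + gap W e)))"

definition next_move :: "tm \<Rightarrow> nat \<Rightarrow> nat list \<Rightarrow> nat \<times> (nat \<times> move) list" where
  "next_move M q ss = (if q = 1 then (1, map (\<lambda>s. (s, Stay)) ss) else delta M q ss)"

definition reads :: "((int \<Rightarrow> nat) \<times> int) list \<Rightarrow> nat list" where
  "reads ts = map (\<lambda>(t, h). t h) ts"

text \<open>The state, the symbols read by all heads, for each tape the symbol and the head mark in
  this column, and a mark for the space of the certificate. The value \<open>None\<close> separates
  rows.\<close>

type_synonym tile = "(nat \<times> nat list \<times> (nat \<times> bool) list \<times> bool) option"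

definition tiles :: "tm \<Rightarrow> tile set" where
  "tiles M = insert None (Some ` ({..<states M} \<times> {ss. set ss \<subseteq> {..<symbols M} \<and> length ss = tapes M} \<times>
     {cs. set cs \<subseteq> {..<symbols M} \<times> UNIV \<and> length cs = tapes M} \<times> UNIV))"

text \<open>Gap 2 leads to the same column of the next row, gaps 1 and 3 to the columns left and
  right of it; a head mark is handed on along the gap that fits its move. Gap 0 keeps state and read
  symbols constant in a row, bars heads from both ends, and lets only blanks follow a blank within
  the certificate.\<close>

definition matching :: "tm \<Rightarrow> nat \<Rightarrow> tile \<Rightarrow> tile \<Rightarrow> bool" where
  "matching M e a b \<longleftrightarrow> (case (a, b) of
     (None, None) \<Rightarrow> True
   | (None, Some (q', ss', cs', g')) \<Rightarrow> e = 0 \<longrightarrow> (\<forall>k < tapes M. \<not> snd (cs' ! k))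
   | (Some (q, ss, cs, g), None) \<Rightarrow> e = 0 \<longrightarrow> (\<forall>k < tapes M. \<not> snd (cs ! k))
   | (Some (q, ss, cs, g), Some (q', ss', cs', g')) \<Rightarrow>
       (e = 0 \<longrightarrow> q' = q \<and> ss' = ss \<and> (g \<and> g' \<and> fst (cs ! 0) = 0 \<longrightarrow> fst (cs' ! 0) = 0)) \<and>
       (e = 1 \<longrightarrow> (\<forall>k < tapes M. snd (snd (next_move M q ss) ! k) = Move_Left \<longrightarrow> snd (cs' ! k) = snd (cs ! k))) \<and>
       (e = 2 \<longrightarrow> q' = fst (next_move M q ss) \<and> (\<forall>k < tapes M.
          fst (cs' ! k) = (if snd (cs ! k) then fst (snd (next_move M q ss) ! k) else fst (cs ! k)) \<and>
          (snd (snd (next_move M q ss) ! k) = Stay \<longrightarrow> snd (cs' ! k) = snd (cs ! k)))) \<and>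
       (e = 3 \<longrightarrow> (\<forall>k < tapes M. snd (snd (next_move M q ss) ! k) = Move_Right \<longrightarrow> snd (cs' ! k) = snd (cs ! k))))"

text \<open>
  Classes: 0 is the separator after each row; in the first row, 1 is blank, 2 and 3 are the bits of
  the input, 5 and 6 those at the origin, and 4 is the space for the certificate; 7 is the place of
  the answer in the last row.
\<close>

definition allowed :: "tm \<Rightarrow> nat \<Rightarrow> tile \<Rightarrow> bool" where
  "allowed M k a \<longleftrightarrow> (case a of None \<Rightarrow> k = 0
   | Some (q, ss, cs, g) \<Rightarrow> k \<noteq> 0 \<and> (\<forall>j < tapes M. snd (cs ! j) \<longrightarrow> fst (cs ! j) = ss ! j) \<and> (g \<longleftrightarrow> k = 4) \<and>
       (k = 7 \<longrightarrow> fst (cs ! 0) = 2) \<and>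
       (k < 7 \<longrightarrow> q = 0 \<and> (\<forall>j < tapes M. snd (cs ! j) \<longleftrightarrow> 5 \<le> k) \<and> (\<forall>j < tapes M. 0 < j \<longrightarrow> fst (cs ! j) = 0) \<and>
          (if k = 4 then fst (cs ! 0) < 3
           else fst (cs ! 0) = (if k = 1 then 0 else if k = 2 \<or> k = 5 then 1 else 2))))"

lemma finite_tiles: "finite (tiles M)"
  unfolding tiles_def
  by (intro finite.insertI finite_imageI finite_cartesian_product finite_lists_length_eq) auto

lemma enc_bits_Cons: "enc_bits (b # x) = True # b # enc_bits x"
  by (simp add: enc_bits_def enc_list_def)

lemma enc_bits_Nil: "enc_bits [] = [False]"
  by (simp add: enc_bits_def enc_list_def)

lemma length_enc_bits: "length (enc_bits x) = 2 * length x + 1"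
  by (induction x) (simp_all add: enc_bits_Cons enc_bits_Nil)

lemma nth_enc_bits:
  "i \<le> 2 * length x \<Longrightarrow> enc_bits x ! i = (i < 2 * length x \<and> (even i \<or> x ! (i div 2)))"
proof (induction x arbitrary: i)
  case (Cons b x)
  show ?case
  proof (cases "i < 2")
    case True
    then have "i = 0 \<or> i = 1" by auto
    then show ?thesis by (auto simp: enc_bits_Cons)
  next
    case False
    then obtain j where "i = j + 2" using le_Suc_ex by (metis add.commute not_less)
    then show ?thesis using Cons.IH[of j] Cons.prems by (simp add: enc_bits_Cons)
  qed
qed (simp add: enc_bits_Nil)

definition good_conf :: "tm \<Rightarrow> nat \<Rightarrow> config \<Rightarrow> bool" where
  "good_conf M t c \<longleftrightarrow> fst c < states M \<and> length (snd c) = tapes M \<and>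
     (\<forall>k < tapes M. (\<forall>i. fst (snd c ! k) i < symbols M) \<and> \<bar>snd (snd c ! k)\<bar> \<le> int t)"

lemma step_eq:
  assumes "length ts = tapes M"
  shows "tm_step M (q, ts) = (fst (next_move M q (reads ts)), map2 perform (snd (next_move M q (reads ts))) ts)"
proof (cases "q = 1")
  case True
  have "map2 perform (map (\<lambda>(t, h). (t h, Stay)) ts) ts = ts"
  proof (rule nth_equalityI)
    have "perform (fst T (snd T), Stay) T = T" for T :: "(int \<Rightarrow> nat) \<times> int" by (cases T) simp
    then show "map2 perform (map (\<lambda>(t, h). (t h, Stay)) ts) ts ! i = ts ! i"
      if "i < length (map2 perform (map (\<lambda>(t, h). (t h, Stay)) ts) ts)" for i
      using that by (simp add: case_prod_unfold)
  qed simp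
  then show ?thesis using True by (simp add: next_move_def reads_def case_prod_unfold o_def)
qed (simp add: next_move_def reads_def case_prod_unfold)

lemma step_nth:
  assumes "length ts = tapes M" "k < tapes M" "length (snd (next_move M q (reads ts))) = tapes M"
  shows "snd (tm_step M (q, ts)) ! k = perform (snd (next_move M q (reads ts)) ! k) (ts ! k)"
  using assms by (simp add: step_eq[OF assms(1)] del: tm_step.simps)

lemma next_move_ok:
  assumes "wf_tm M" "q < states M" "length ss = tapes M" "set ss \<subseteq> {..<symbols M}"
  shows "fst (next_move M q ss) < states M" "length (snd (next_move M q ss)) = tapes M"
    "k < tapes M \<Longrightarrow> fst (snd (next_move M q ss) ! k) < symbols M"
proof -
  have "case delta M q ss of (q', as) \<Rightarrow> q' < states M \<and> length as = tapes M \<and> (\<forall>(s, m) \<in> set as. s < symbols M)"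
  proof -
    have *: "\<forall>q < states M. \<forall>ss. length ss = tapes M \<and> (\<forall>s \<in> set ss. s < symbols M) \<longrightarrow>
       (case delta M q ss of (q', as) \<Rightarrow>
           q' < states M \<and> length as = tapes M \<and> (\<forall>(s, m) \<in> set as. s < symbols M))"
      using assms(1) unfolding wf_tm_def by (elim conjE)
    show ?thesis by (rule *[rule_format, OF assms(2)]) (use assms(3,4) in auto)
  qed
  moreover have "1 < states M" using assms(1) unfolding wf_tm_def by linarith
  ultimately show "fst (next_move M q ss) < states M" "length (snd (next_move M q ss)) = tapes M"
    "k < tapes M \<Longrightarrow> fst (snd (next_move M q ss) ! k) < symbols M"
    using assms(3,4) by (auto simp: next_move_def case_prod_unfold subset_eq)
qed

lemma good_confD:
  "good_conf M t c \<Longrightarrow> length (snd c) = tapes M" "good_conf M t c \<Longrightarrow> fst c < states M"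
  by (simp_all add: good_conf_def)

lemma reads_ok: "good_conf M t c \<Longrightarrow> length (reads (snd c)) = tapes M \<and> set (reads (snd c)) \<subseteq> {..<symbols M}"
  by (fastforce simp: good_conf_def reads_def in_set_conv_nth case_prod_unfold)

lemma good_step:
  assumes "wf_tm M" "good_conf M t c"
  shows "good_conf M (Suc t) (tm_step M c)"
proof -
  obtain q ts where c: "c = (q, ts)" by (cases c)
  have g: "q < states M" "length ts = tapes M" using assms(2) by (auto simp: good_conf_def c)
  have r: "length (reads ts) = tapes M" "set (reads ts) \<subseteq> {..<symbols M}" using reads_ok[OF assms(2)] c by auto
  note n = next_move_ok[OF assms(1) g(1) r]
  have "(\<forall>i. fst (snd (tm_step M c) ! k) i < symbols M) \<and> \<bar>snd (snd (tm_step M c) ! k)\<bar> \<le> int (Suc t)" if k: "k < tapes M" for k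
  proof -
    obtain s m where s: "snd (next_move M q (reads ts)) ! k = (s, m)" by fastforce
    obtain T h where T: "ts ! k = (T, h)" by fastforce
    have "\<forall>i. T i < symbols M" "\<bar>h\<bar> \<le> int t" using assms(2) k T by (auto simp: good_conf_def c)
    moreover have "s < symbols M" using n(3)[OF k] s by simp
    ultimately show ?thesis unfolding c step_nth[OF g(2) k n(2)] s T by (cases m) auto
  qed
  then show ?thesis using n(1,2) g by (simp add: good_conf_def c step_eq[OF g(2)] del: tm_step.simps)
qed

lemma good_run:
  assumes "wf_tm M"
  shows "good_conf M t ((tm_step M ^^ t) (tm_init M y))"
proof (induction t)
  case 0
  have "string_tape y i < symbols M" for i using assms by (auto simp: wf_tm_def string_tape_def)
  then show ?case using assms
    by (auto simp: good_conf_def tm_init_def wf_tm_def nth_Cons split: nat.splits)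
qed (simp add: good_step[OF assms])

locale verifier =
  fixes M :: tm and x :: "bool list" and wl Tm :: nat
  assumes wf: "wf_tm M" and Tm: "2 * length x + 1 + wl < Tm"
begin

text \<open>Columns 0 to \<open>W - 2\<close> stand for the tape cells from \<open>- Tm - 1\<close>
  to \<open>Tm + 1\<close>, one more on either side than a head reaches in \<open>Tm\<close> steps.
  Column \<open>W - 1\<close> is the separator.\<close>

definition org :: nat where "org = Tm + 1"
definition W :: nat where "W = 2 * Tm + 4"
definition N :: nat where "N = (Tm + 1) * W"

text \<open>Spells out \<open>enc_bits x\<close> from the origin on: even offsets carry continuation
  marks, odd ones the bits of \<open>x\<close>, and offset \<open>2 * length x\<close> the end
  mark.\<close>

definition cl :: "nat \<Rightarrow> nat" where
  "cl p = (if p mod W = W - 1 then 0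
     else if p div W = 0 then
       (if p mod W < org then 1
        else if p mod W - org \<le> 2 * length x then
          (if p mod W - org = 0 then if length x = 0 then 5 else 6
           else if p mod W - org = 2 * length x then 2
           else if (p mod W - org) mod 2 = 0 then 3
           else if (p mod W - org) div 2 < length x \<and> x ! ((p mod W - org) div 2) then 3 else 2)
        else if p mod W - org < 2 * length x + 1 + wl then 4 else 1)
     else if p div W = Tm \<and> p mod W = org then 7 else 8)"

definition cells :: "config \<Rightarrow> nat \<Rightarrow> (nat \<times> bool) list" where
  "cells C c = map (\<lambda>(t, h). (t (int c - int org), h = int c - int org)) (snd C)"

definition cfg :: "bool list \<Rightarrow> nat \<Rightarrow> config" where
  "cfg w t = (tm_step M ^^ t) (tm_init M (enc_bits x @ w))"

lemma W_pos: "0 < W" "2 < W" by (simp_all add: W_def)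

lemma div_mod_row: "c < W \<Longrightarrow> (t * W + c) div W = t" "c < W \<Longrightarrow> (t * W + c) mod W = c"
  by simp_all

lemma tapes_pos: "0 < tapes M" using wf by (simp add: wf_tm_def)

lemma good: "good_conf M t (cfg w t)"
  unfolding cfg_def by (rule good_run[OF wf])

lemma cells_nth: "length (snd C) = tapes M \<Longrightarrow> k < tapes M \<Longrightarrow>
    cells C c ! k = (fst (snd C ! k) (int c - int org), snd (snd C ! k) = int c - int org)"
  by (simp add: cells_def case_prod_unfold)

lemma length_cells: "length (cells C c) = length (snd C)"
  by (simp add: cells_def)

lemma reads_nth: "length (snd C) = tapes M \<Longrightarrow> k < tapes M \<Longrightarrow> reads (snd C) ! k = fst (snd C ! k) (snd (snd C ! k))"
  by (simp add: reads_def case_prod_unfold)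

lemma head_range:
  assumes "k < tapes M" "t \<le> Tm"
  shows "snd (snd (cfg w t) ! k) < int Tm + 1" "- int Tm - 1 < snd (snd (cfg w t) ! k)"
proof -
  have "\<bar>snd (snd (cfg w t) ! k)\<bar> \<le> int t" using good[of t w] assms(1) by (auto simp: good_conf_def)
  then show "snd (snd (cfg w t) ! k) < int Tm + 1" "- int Tm - 1 < snd (snd (cfg w t) ! k)"
    using assms(2) by linarith+
qed

lemma cfg_Suc:
  assumes "k < tapes M"
  shows "fst (cfg w (Suc t)) = fst (next_move M (fst (cfg w t)) (reads (snd (cfg w t))))"
    "snd (cfg w (Suc t)) ! k = perform (snd (next_move M (fst (cfg w t)) (reads (snd (cfg w t)))) ! k) (snd (cfg w t) ! k)"
proof -
  obtain q ts where c: "cfg w t = (q, ts)" by (cases "cfg w t")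
  have s: "cfg w (Suc t) = tm_step M (cfg w t)" by (simp add: cfg_def)
  have l: "length ts = tapes M" "q < states M" using good_confD[OF good[of t w]] c by simp_all
  have r: "length (reads ts) = tapes M" "set (reads ts) \<subseteq> {..<symbols M}" using reads_ok[OF good[of t w]] c by simp_all
  show "fst (cfg w (Suc t)) = fst (next_move M (fst (cfg w t)) (reads (snd (cfg w t))))"
    unfolding s c step_eq[OF l(1)] by simp
  show "snd (cfg w (Suc t)) ! k = perform (snd (next_move M (fst (cfg w t)) (reads (snd (cfg w t)))) ! k) (snd (cfg w t) ! k)"
    unfolding s c step_nth[OF l(1) assms next_move_ok(2)[OF wf l(2) r]] by simp
qed

lemma cells_Suc:
  fixes w t
  assumes k: "k < tapes M"
  defines "a \<equiv> snd (next_move M (fst (cfg w t)) (reads (snd (cfg w t)))) ! k"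
  shows "fst (cells (cfg w (Suc t)) c ! k) =
      (if snd (cells (cfg w t) c ! k) then fst a else fst (cells (cfg w t) c ! k))"
    "snd a = Stay \<Longrightarrow> snd (cells (cfg w (Suc t)) c ! k) = snd (cells (cfg w t) c ! k)"
    "snd a = Move_Right \<Longrightarrow> snd (cells (cfg w (Suc t)) (Suc c) ! k) = snd (cells (cfg w t) c ! k)"
    "snd a = Move_Left \<Longrightarrow> snd (cells (cfg w (Suc t)) c ! k) = snd (cells (cfg w t) (Suc c) ! k)"
proof -
  obtain T h where T: "snd (cfg w t) ! k = (T, h)" by fastforce
  obtain s m where a: "a = (s, m)" by fastforce
  have n: "snd (cfg w (Suc t)) ! k = (T(h := s), head_move m h)"
    using cfg_Suc(2)[OF k, of w t] unfolding a_def[symmetric] T a by simp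
  have l: "length (snd (cfg w t)) = tapes M" "length (snd (cfg w (Suc t))) = tapes M"
    by (rule good_confD(1)[OF good])+
  show "fst (cells (cfg w (Suc t)) c ! k) =
      (if snd (cells (cfg w t) c ! k) then fst a else fst (cells (cfg w t) c ! k))"
    "snd a = Stay \<Longrightarrow> snd (cells (cfg w (Suc t)) c ! k) = snd (cells (cfg w t) c ! k)"
    "snd a = Move_Right \<Longrightarrow> snd (cells (cfg w (Suc t)) (Suc c) ! k) = snd (cells (cfg w t) c ! k)"
    "snd a = Move_Left \<Longrightarrow> snd (cells (cfg w (Suc t)) c ! k) = snd (cells (cfg w t) (Suc c) ! k)"
    unfolding cells_nth[OF l(1) k] cells_nth[OF l(2) k] n T a fst_conv snd_conv by simp_all linarith+
qed

lemma no_head: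
  assumes "k < tapes M" "t \<le> Tm" "c = 0 \<or> c = W - 2"
  shows "\<not> snd (cells (cfg w t) c ! k)"
proof -
  have "length (snd (cfg w t)) = tapes M" using good_confD(1)[OF good] .
  from cells_nth[OF this assms(1)] head_range[OF assms(1,2), of w] assms(3) show ?thesis
    by (auto simp: W_def org_def)
qed

lemma cells_0:
  assumes "k < tapes M"
  shows "snd (cells (cfg w 0) c ! k) = (c = org)" "0 < k \<Longrightarrow> fst (cells (cfg w 0) c ! k) = 0"
    "fst (cells (cfg w 0) c ! 0) = string_tape (enc_bits x @ w) (int c - int org)"
  using assms by (auto simp: cells_def cfg_def tm_init_def nth_Cons split: nat.splits)

lemma symbol_enc:
  assumes "i \<le> 2 * length x"
  shows "string_tape (enc_bits x @ w) (int i) =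
    (if i = 2 * length x then 1 else if i mod 2 = 0 then 2
     else if i div 2 < length x \<and> x ! (i div 2) then 2 else 1)"
  using assms nth_enc_bits[OF assms]
  by (auto simp: string_tape_def nth_append length_enc_bits even_iff_mod_2_eq_zero)

definition tableau :: "bool list \<Rightarrow> nat \<Rightarrow> tile" where
  "tableau w p = (if p mod W = W - 1 then None
     else Some (fst (cfg w (p div W)), reads (snd (cfg w (p div W))), cells (cfg w (p div W)) (p mod W), cl p = 4))"

lemma tableau_row:
  "c < W - 1 \<Longrightarrow> tableau w (t * W + c) =
     Some (fst (cfg w t), reads (snd (cfg w t)), cells (cfg w t) c, cl (t * W + c) = 4)"
  "tableau w (t * W + (W - 1)) = None"
proof -
  have "(t * W + (W - 1)) mod W = W - 1" by (rule div_mod_row) (use W_pos in simp)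
  then show "tableau w (t * W + (W - 1)) = None" by (simp only: tableau_def if_True simp_thms)
qed (simp add: tableau_def)

lemma cl_le: "cl p = 0 \<longleftrightarrow> p mod W = W - 1"
  by (simp add: cl_def)

lemma tableau_tile: "tableau w p \<in> tiles M"
proof (cases "p mod W = W - 1")
  case False
  let ?C = "cfg w (p div W)"
  note g = good[of "p div W" w]
  have "cells ?C (p mod W) ! k \<in> {..<symbols M} \<times> UNIV" if "k < tapes M" for k
    using g that cells_nth[OF good_confD(1)[OF g] that] unfolding good_conf_def by simp
  then have "set (cells ?C (p mod W)) \<subseteq> {..<symbols M} \<times> UNIV"
    unfolding set_conv_nth length_cells good_confD(1)[OF g] by blast
  then show ?thesis using False reads_ok[OF g] good_confD[OF g] by (simp add: tiles_def tableau_def length_cells)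
qed (simp add: tableau_def tiles_def)

lemma row_induct:
  fixes p :: nat
  obtains t c where "p = t * W + c" "c < W"
  using W_pos(1) by (metis div_mult_mod_eq mod_less_divisor)

lemma N_row: "c < W \<Longrightarrow> t * W + c < N \<longleftrightarrow> t \<le> Tm"
proof -
  assume c: "c < W"
  show ?thesis
  proof (cases "t \<le> Tm")
    case True
    then have "Suc t * W \<le> (Tm + 1) * W" by (intro mult_right_mono) simp_all
    moreover have "Suc t * W = t * W + W" by simp
    ultimately show ?thesis using True c unfolding N_def by linarith
  next
    case False
    then have "(Tm + 1) * W \<le> t * W" by (intro mult_right_mono) simp_all
    then show ?thesis using False unfolding N_def by linarith
  qed
qed

text \<open>Where a gap leaves its row in an unintended way, one of the two places is a separator,
  about which only gap 0 says anything.\<close>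

lemma gap_rows:
  "c < W - 1 \<Longrightarrow> t * W + c + gap W 0 = t * W + Suc c"
  "t * W + (W - 1) + gap W 0 = Suc t * W + 0"
  "t * W + Suc c + gap W 1 = Suc t * W + c"
  "t * W + 0 + gap W 1 = t * W + (W - 1)"
  "t * W + c + gap W 2 = Suc t * W + c"
  "t * W + c + gap W 3 = Suc t * W + Suc c"
  using W_pos by (simp_all add: gap_def)

lemma certificate_symbol:
  "string_tape (enc_bits x @ w) (int (2 * length x + 1 + i)) = (if i < length w then if w ! i then 2 else 1 else 0)"
  by (simp add: string_tape_def nth_append length_enc_bits nat_add_distrib del: of_nat_add)

lemma tableau_allowed:
  assumes w: "length w \<le> wl" and acc: "fst (hd (snd (cfg w Tm))) 0 = 2" and p: "p < N"
  shows "allowed M (cl p) (tableau w p)"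
proof (cases "p mod W = W - 1")
  case True
  then show ?thesis by (simp add: allowed_def tableau_def cl_def)
next
  case False
  let ?C = "cfg w (p div W)"
  note len = good_confD(1)[OF good[of "p div W" w]]
  have "cl p \<noteq> 0" using False cl_le by simp
  moreover have "snd (cells ?C (p mod W) ! j) \<longrightarrow> fst (cells ?C (p mod W) ! j) = reads (snd ?C) ! j"
    if "j < tapes M" for j
    using cells_nth[OF len that] reads_nth[OF len that] by auto
  moreover have "fst (cells ?C (p mod W) ! 0) = 2" if "cl p = 7"
  proof -
    have "p div W = Tm" "p mod W = org" using that False by (auto simp: cl_def split: if_splits)
    then have "fst (cells ?C (p mod W) ! 0) = fst (snd (cfg w Tm) ! 0) 0"
      using cells_nth[OF len tapes_pos] by simp
    moreover have "snd (cfg w Tm) \<noteq> []" using good_confD(1)[OF good[of Tm w]] tapes_pos by auto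
    ultimately show ?thesis using acc by (simp add: hd_conv_nth)
  qed
  moreover have "fst ?C = 0 \<and> (\<forall>j < tapes M. snd (cells ?C (p mod W) ! j) \<longleftrightarrow> 5 \<le> cl p) \<and>
      (\<forall>j < tapes M. 0 < j \<longrightarrow> fst (cells ?C (p mod W) ! j) = 0) \<and>
      (if cl p = 4 then fst (cells ?C (p mod W) ! 0) < 3
       else fst (cells ?C (p mod W) ! 0) = (if cl p = 1 then 0 else if cl p = 2 \<or> cl p = 5 then 1 else 2))"
    if "cl p < 7"
  proof -
    have 0: "p div W = 0" using that False by (auto simp: cl_def split: if_splits)
    define c where "c = p mod W"
    have c: "c \<noteq> W - 1" using False by (simp add: c_def)
    have clc: "cl p = (if c < org then 1
        else if c - org \<le> 2 * length x then
          (if c - org = 0 then if length x = 0 then 5 else 6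
           else if c - org = 2 * length x then 2
           else if (c - org) mod 2 = 0 then 3
           else if (c - org) div 2 < length x \<and> x ! ((c - org) div 2) then 3 else 2)
        else if c - org < 2 * length x + 1 + wl then 4 else 1)"
      using 0 c by (simp add: cl_def c_def[symmetric])
    have "(5 \<le> cl p) = (c = org)" unfolding clc by auto
    moreover have "(if cl p = 4 then string_tape (enc_bits x @ w) (int c - int org) < 3
       else string_tape (enc_bits x @ w) (int c - int org) = (if cl p = 1 then 0 else if cl p = 2 \<or> cl p = 5 then 1 else 2))"
    proof -
      consider "c < org" | i where "c = org + i" "i \<le> 2 * length x"
        | i where "c = org + (2 * length x + 1 + i)"
      proof (cases "c < org")
        case False
        then obtain i where i: "c = org + i" by (metis le_Suc_ex not_less)
        then show ?thesis using that(2,3)[of i] that(3)[of "i - (2 * length x + 1)"] by (cases "i \<le> 2 * length x") auto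
      qed (use that in simp)
      then show ?thesis
      proof cases
        case 1
        then show ?thesis unfolding clc by (simp add: string_tape_def)
      next
        case (2 i)
        then have "int c - int org = int i" by simp
        then show ?thesis using 2 unfolding clc by (simp only: symbol_enc) auto
      next
        case (3 i)
        then have "int c - int org = int (2 * length x + 1 + i)" by simp
        then show ?thesis using 3 w unfolding clc by (simp only: certificate_symbol) auto
      qed
    qed
    ultimately show ?thesis using cells_0(1,2)[of _ w c] cells_0(3)[OF tapes_pos, of w c]
      unfolding 0 c_def[symmetric] by (auto simp: cfg_def tm_init_def)
  qed
  ultimately show ?thesis using False by (simp add: allowed_def tableau_def)
qed

lemma tableau_matching:
  assumes w: "length w \<le> wl" and e: "e < 4" and p: "p + gap W e < N"
  shows "matching M e (tableau w p) (tableau w (p + gap W e))"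
proof -
  obtain t c where tc: "p = t * W + c" "c < W" by (rule row_induct)
  have a: "tapes M = length (snd (cfg w t))" for t using good_confD(1)[OF good] by simp
  consider "e = 0" | "e = 1" | "e = 2" | "e = 3" using e by linarith
  then show ?thesis
  proof cases
    case 1
    show ?thesis
    proof (cases "c = W - 1")
      case True
      have q: "p + gap W e = Suc t * W + 0" unfolding tc True 1 by (rule gap_rows)
      then have t: "Suc t \<le> Tm" using p N_row[of 0 "Suc t"] W_pos by simp
      have "0 < W - 1" using W_pos by simp
      show ?thesis unfolding q unfolding tc True tableau_row(2) tableau_row(1)[OF \<open>0 < W - 1\<close>]
        using no_head[OF _ t, of _ 0 w] by (simp add: matching_def)
    next
      case False
      then have c: "c < W - 1" using tc by simp
      have q: "p + gap W e = t * W + Suc c" unfolding tc 1 by (rule gap_rows(1)[OF c])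
      have t: "t \<le> Tm" using p q N_row[of "Suc c" t] c by simp
      show ?thesis
      proof (cases "Suc c = W - 1")
        case True
        then have "c = W - 2" by simp
        then show ?thesis unfolding q unfolding tc True tableau_row(2) tableau_row(1)[OF c]
          using no_head[OF _ t, of _ c w] 1 by (simp add: matching_def)
      next
        case False
        then have c': "Suc c < W - 1" using c by simp
        have "fst (cells (cfg w t) (Suc c) ! 0) = 0"
          if 4: "cl (t * W + c) = 4" "cl (t * W + Suc c) = 4" "fst (cells (cfg w t) c ! 0) = 0"
        proof -
          have "t = 0" "\<not> c < org" "\<not> c - org \<le> 2 * length x"
            using 4(1) c unfolding cl_def by (auto simp: div_mod_row split: if_splits)
          then obtain i where i: "c = org + (2 * length x + 1 + i)" by (metis Suc_eq_plus1 le_Suc_ex not_less not_less_eq_eq add.commute le_add_diff_inverse)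
          have "int c - int org = int (2 * length x + 1 + i)" "int (Suc c) - int org = int (2 * length x + 1 + Suc i)"
            using i by simp_all
          then show ?thesis using 4(3) unfolding \<open>t = 0\<close> cells_0(3)[OF tapes_pos]
            by (simp only: certificate_symbol) (auto split: if_splits)
        qed
        then show ?thesis unfolding q unfolding tc tableau_row(1)[OF c] tableau_row(1)[OF c'] 1
          by (simp add: matching_def)
      qed
    qed
  next
    case 2
    show ?thesis
    proof (cases c)
      case 0
      have q: "p + gap W e = t * W + (W - 1)" unfolding tc 0 2 by (rule gap_rows)
      show ?thesis unfolding q tableau_row(2) by (simp add: matching_def 2 split: option.split)
    next
      case (Suc c')
      have q: "p + gap W e = Suc t * W + c'" unfolding tc Suc 2 by (rule gap_rows)
      show ?thesis
      proof (cases "c = W - 1")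
        case True
        then show ?thesis unfolding tc tableau_row(2) True by (simp add: matching_def 2 split: option.split)
      next
        case False
        then have c: "Suc c' < W - 1" "c' < W - 1" using tc Suc by simp_all
        show ?thesis unfolding q unfolding tc Suc tableau_row(1)[OF c(1)] tableau_row(1)[OF c(2)] 2
          using cells_Suc(4)[where w = w and t = t] by (simp add: matching_def)
      qed
    qed
  next
    case 3
    have q: "p + gap W e = Suc t * W + c" unfolding tc 3 by (rule gap_rows)
    show ?thesis
    proof (cases "c = W - 1")
      case True
      then show ?thesis unfolding q unfolding tc True tableau_row(2) by (simp add: matching_def)
    next
      case False
      then have c: "c < W - 1" using tc by simp
      show ?thesis unfolding q unfolding tc tableau_row(1)[OF c] 3
        using cells_Suc(1,2)[where w = w and t = t] cfg_Suc(1)[OF tapes_pos, of w t] by (simp add: matching_def)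
    qed
  next
    case 4
    have q: "p + gap W e = Suc t * W + Suc c" unfolding tc 4 by (rule gap_rows)
    show ?thesis
    proof (cases "c < W - 1 \<and> Suc c < W - 1")
      case False
      then have "c = W - 1 \<or> Suc c = W - 1" using tc by auto
      then show ?thesis
      proof
        assume "c = W - 1"
        then show ?thesis unfolding tc by (simp only: tableau_row(2)) (simp add: matching_def 4 split: option.split)
      next
        assume s: "Suc c = W - 1"
        show ?thesis unfolding q unfolding s tableau_row(2) by (simp add: matching_def 4 split: option.split)
      qed
    next
      case True
      then show ?thesis unfolding q unfolding tc tableau_row(1)[OF conjunct1[OF True]] tableau_row(1)[OF conjunct2[OF True]] 4
        using cells_Suc(3)[where w = w and t = t] by (simp add: matching_def)
    qed
  qed
qed

lemma tableau_tiling: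
  assumes "length w \<le> wl" "fst (hd (snd (cfg w Tm))) 0 = 2"
  shows "tiling (tiles M) (matching M) (allowed M) N W cl (tableau w)"
  unfolding tiling_def using tableau_tile tableau_allowed[OF assms] tableau_matching[OF assms(1)] by blast

end

section \<open>From a tiling to a certificate\<close>

context verifier
begin

context
  fixes z :: "nat \<Rightarrow> tile"
  assumes z: "tiling (tiles M) (matching M) (allowed M) N W cl z"
begin

definition state_at :: "nat \<Rightarrow> nat" where "state_at p = fst (the (z p))"
definition reads_at :: "nat \<Rightarrow> nat list" where "reads_at p = fst (snd (the (z p)))"
definition cells_at :: "nat \<Rightarrow> (nat \<times> bool) list" where "cells_at p = fst (snd (snd (the (z p))))"
definition flag_at :: "nat \<Rightarrow> bool" where "flag_at p = snd (snd (snd (the (z p))))"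

lemma z_None: "p < N \<Longrightarrow> p mod W = W - 1 \<Longrightarrow> z p = None"
  using z cl_le[of p] unfolding tiling_def allowed_def by (cases "z p") (auto split: prod.splits)

lemma z_Some:
  assumes "t \<le> Tm" "c < W - 1"
  shows "z (t * W + c) = Some (state_at (t * W + c), reads_at (t * W + c), cells_at (t * W + c), flag_at (t * W + c))"
proof -
  let ?p = "t * W + c"
  have p: "?p < N" using assms N_row[of c t] by simp
  have "cl ?p \<noteq> 0" using cl_le[of ?p] assms(2) by simp
  then have "z ?p \<noteq> None" using z p unfolding tiling_def allowed_def by (auto split: option.splits)
  then show ?thesis by (auto simp: state_at_def reads_at_def cells_at_def flag_at_def)
qed

lemma z_allowed:
  assumes "t \<le> Tm" "c < W - 1"
  shows "allowed M (cl (t * W + c)) (Some (state_at (t * W + c), reads_at (t * W + c), cells_at (t * W + c), flag_at (t * W + c)))"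
proof -
  have "t * W + c < N" using assms N_row[of c t] by simp
  then have "allowed M (cl (t * W + c)) (z (t * W + c))" using z by (simp add: tiling_def)
  then show ?thesis unfolding z_Some[OF assms] .
qed

lemma z_lengths:
  assumes "t \<le> Tm" "c < W - 1"
  shows "length (reads_at (t * W + c)) = tapes M" "length (cells_at (t * W + c)) = tapes M"
proof -
  have "t * W + c < N" using assms N_row[of c t] by simp
  then have "z (t * W + c) \<in> tiles M" using z by (simp add: tiling_def)
  then show "length (reads_at (t * W + c)) = tapes M" "length (cells_at (t * W + c)) = tapes M"
    unfolding z_Some[OF assms] tiles_def by auto
qed

lemma z_matching: "e < 4 \<Longrightarrow> p + gap W e = p' \<Longrightarrow> p' < N \<Longrightarrow> matching M e (z p) (z p')"
  using z by (auto simp: tiling_def)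

lemma z_next:
  assumes "t \<le> Tm" "Suc c < W - 1"
  shows "state_at (t * W + Suc c) = state_at (t * W + c)" "reads_at (t * W + Suc c) = reads_at (t * W + c)"
    "flag_at (t * W + c) \<Longrightarrow> flag_at (t * W + Suc c) \<Longrightarrow> fst (cells_at (t * W + c) ! 0) = 0 \<Longrightarrow>
      fst (cells_at (t * W + Suc c) ! 0) = 0"
proof -
  have c: "c < W - 1" using assms by simp
  have "matching M 0 (z (t * W + c)) (z (t * W + Suc c))"
    by (rule z_matching[OF _ gap_rows(1)[OF c]]) (use assms N_row[of "Suc c" t] in simp_all)
  then show "state_at (t * W + Suc c) = state_at (t * W + c)" "reads_at (t * W + Suc c) = reads_at (t * W + c)"
    "flag_at (t * W + c) \<Longrightarrow> flag_at (t * W + Suc c) \<Longrightarrow> fst (cells_at (t * W + c) ! 0) = 0 \<Longrightarrow>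
      fst (cells_at (t * W + Suc c) ! 0) = 0"
    unfolding z_Some[OF assms(1) c] z_Some[OF assms] by (simp_all add: matching_def)
qed

lemma reads_const: "t \<le> Tm \<Longrightarrow> c < W - 1 \<Longrightarrow> reads_at (t * W + c) = reads_at (t * W + 0)"
proof (induction c)
  case (Suc c)
  have "c < W - 1" using Suc.prems by linarith
  from Suc.IH[OF Suc.prems(1) this] show ?case using z_next(2)[OF Suc.prems] by argo
qed (rule refl)

text \<open>The common list of read symbols is right as every head is seen somewhere in the row.\<close>

lemma reads_right:
  assumes t: "t \<le> Tm" and cells: "\<And>c. c < W - 1 \<Longrightarrow> cells_at (t * W + c) = cells (cfg w t) c"
    and c: "c < W - 1"
  shows "reads_at (t * W + c) = reads (snd (cfg w t))"
proof (rule nth_equalityI)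
  note len = good_confD(1)[OF good[of t w]]
  show "length (reads_at (t * W + c)) = length (reads (snd (cfg w t)))"
    using z_lengths(1)[OF t c] reads_ok[OF good[of t w]] by simp
  fix k assume "k < length (reads_at (t * W + c))"
  then have k: "k < tapes M" using z_lengths(1)[OF t c] by simp
  define h where "h = snd (snd (cfg w t) ! k)"
  define d where "d = nat (h + int org)"
  have d: "int d = h + int org" "d < W - 1"
    using head_range[OF k t, of w] by (auto simp: d_def h_def W_def org_def)
  have "snd (cells (cfg w t) d ! k)" unfolding cells_nth[OF len k] using d h_def by simp
  then have "fst (cells (cfg w t) d ! k) = reads_at (t * W + d) ! k"
    using z_allowed[OF t d(2)] k unfolding cells[OF d(2)] by (simp add: allowed_def)
  then show "reads_at (t * W + c) ! k = reads (snd (cfg w t)) ! k"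
    using reads_const[OF t d(2)] reads_const[OF t c] d
    by (simp add: cells_nth[OF len k] reads_nth[OF len k] h_def)
qed

definition gsym :: "nat \<Rightarrow> nat" where "gsym i = fst (cells_at (0 * W + (org + (2 * length x + 1 + i))) ! 0)"

text \<open>The certificate may be shorter than the space for it: it ends at the first blank, after
  which the matching rules admit blanks only.\<close>

definition glen :: nat where "glen = (LEAST k. k = wl \<or> gsym k = 0)"

definition cert :: "bool list" where "cert = map (\<lambda>i. gsym i = 2) [0..<glen]"

lemma glen: "glen \<le> wl" "i < glen \<Longrightarrow> gsym i \<noteq> 0" "glen = wl \<or> gsym glen = 0"
  unfolding glen_def
proof -
  show "(LEAST k. k = wl \<or> gsym k = 0) \<le> wl" by (rule Least_le) simp
  show "i < (LEAST k. k = wl \<or> gsym k = 0) \<Longrightarrow> gsym i \<noteq> 0" using not_less_Least by blast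
  show "(LEAST k. k = wl \<or> gsym k = 0) = wl \<or> gsym (LEAST k. k = wl \<or> gsym k = 0) = 0"
    by (rule LeastI[of _ wl]) simp
qed

lemma cl_guess:
  assumes "i < wl"
  shows "cl (0 * W + (org + (2 * length x + 1 + i))) = 4" "org + (2 * length x + 1 + i) < W - 1"
  using assms Tm by (auto simp: cl_def W_def org_def)

lemma gsym_less: "i < wl \<Longrightarrow> gsym i < 3"
proof -
  assume i: "i < wl"
  show ?thesis unfolding gsym_def
    using z_allowed[OF le0 cl_guess(2)[OF i]] cl_guess(1)[OF i] by (simp add: allowed_def)
qed

lemma gsym_blank: "glen \<le> i \<Longrightarrow> i < wl \<Longrightarrow> gsym i = 0"
proof (induction i rule: dec_induct)
  case base
  then show ?case using glen(3) by simp
next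
  case (step i)
  have i: "i < wl" "Suc i < wl" using step by simp_all
  have "flag_at (0 * W + (org + (2 * length x + 1 + j)))" if "j < wl" for j
    using z_allowed[OF _ cl_guess(2)[OF that], of 0] unfolding cl_guess(1)[OF that] by (simp add: allowed_def)
  from this[OF i(1)] this[OF i(2)] show ?case
    using z_next(3)[of 0 "org + (2 * length x + 1 + i)"] cl_guess(2)[OF i(2)] step.IH[OF i(1)]
    unfolding gsym_def by simp
qed

lemma cert_symbol: "i < wl \<Longrightarrow> string_tape (enc_bits x @ cert) (int (2 * length x + 1 + i)) = gsym i"
  unfolding certificate_symbol using gsym_blank[of i] glen(2)[of i] gsym_less[of i] by (auto simp: cert_def)

lemma row_0:
  assumes c: "c < W - 1"
  shows "state_at (0 * W + c) = fst (cfg cert 0)" "cells_at (0 * W + c) = cells (cfg cert 0) c"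
proof -
  have "cl (0 * W + c) < 7" using c Tm by (simp add: cl_def)
  note a = z_allowed[OF le0 c, unfolded allowed_def option.case prod.case]
  have a': "state_at (0 * W + c) = 0" "\<And>j. j < tapes M \<Longrightarrow> snd (cells_at (0 * W + c) ! j) \<longleftrightarrow> 5 \<le> cl (0 * W + c)"
     "\<And>j. j < tapes M \<Longrightarrow> 0 < j \<Longrightarrow> fst (cells_at (0 * W + c) ! j) = 0"
     "cl (0 * W + c) \<noteq> 4 \<Longrightarrow> fst (cells_at (0 * W + c) ! 0) =
        (if cl (0 * W + c) = 1 then 0 else if cl (0 * W + c) = 2 \<or> cl (0 * W + c) = 5 then 1 else 2)"
    using a \<open>cl (0 * W + c) < 7\<close> by simp_all
  show "state_at (0 * W + c) = fst (cfg cert 0)" using a'(1) by (simp add: cfg_def tm_init_def)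
  have cl: "cl (0 * W + c) = (if c < org then 1
        else if c - org \<le> 2 * length x then
          (if c - org = 0 then if length x = 0 then 5 else 6
           else if c - org = 2 * length x then 2
           else if (c - org) mod 2 = 0 then 3
           else if (c - org) div 2 < length x \<and> x ! ((c - org) div 2) then 3 else 2)
        else if c - org < 2 * length x + 1 + wl then 4 else 1)"
    using c Tm by (simp add: cl_def)
  have sym: "fst (cells_at (0 * W + c) ! 0) = string_tape (enc_bits x @ cert) (int c - int org)"
  proof -
    consider "c < org" | i where "c = org + i" "i \<le> 2 * length x"
      | i where "c = org + (2 * length x + 1 + i)"
    proof (cases "c < org")
      case False
      then obtain i where i: "c = org + i" by (metis le_Suc_ex not_less)
      then show ?thesis using that(2,3)[of i] that(3)[of "i - (2 * length x + 1)"] by (cases "i \<le> 2 * length x") auto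
    qed (use that in simp)
    then show ?thesis
    proof cases
      case 1
      then show ?thesis using a'(4) cl by (simp add: string_tape_def)
    next
      case (2 i)
      then have e: "int c - int org = int i" by simp
      have "cl (0 * W + c) \<noteq> 4" unfolding cl using 2 by auto
      from a'(4)[OF this] show ?thesis unfolding e symbol_enc[OF 2(2)] cl using 2 by auto
    next
      case (3 i)
      then have e: "int c - int org = int (2 * length x + 1 + i)" by simp
      show ?thesis
      proof (cases "i < wl")
        case True
        show ?thesis unfolding e cert_symbol[OF True] unfolding gsym_def 3 by (rule refl)
      next
        case False
        then have "cl (0 * W + c) = 1" unfolding cl using 3 by auto
        then show ?thesis using a'(4) False glen(1) unfolding e certificate_symbol by (simp add: cert_def)
      qed
    qed
  qed
  have head: "(5 \<le> cl (0 * W + c)) = (c = org)" unfolding cl by auto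
  show "cells_at (0 * W + c) = cells (cfg cert 0) c"
  proof (rule nth_equalityI)
    show "length (cells_at (0 * W + c)) = length (cells (cfg cert 0) c)"
      using z_lengths(2)[OF le0 c] good_confD(1)[OF good[of 0 cert]] by (simp add: length_cells)
    fix k assume "k < length (cells_at (0 * W + c))"
    then have k: "k < tapes M" using z_lengths(2)[OF le0 c] by simp
    have "fst (cells_at (0 * W + c) ! k) = fst (cells (cfg cert 0) c ! k)"
    proof (cases "k = 0")
      case True
      show ?thesis unfolding True sym cells_0(3)[OF tapes_pos] ..
    next
      case False
      then show ?thesis using a'(3)[OF k] cells_0(2)[OF k] by simp
    qed
    moreover have "snd (cells_at (0 * W + c) ! k) = snd (cells (cfg cert 0) c ! k)"
      unfolding a'(2)[OF k] head cells_0(1)[OF k] ..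
    ultimately show "cells_at (0 * W + c) ! k = cells (cfg cert 0) c ! k" by (rule prod_eqI)
  qed
qed

text \<open>Induction on time. Since \<open>reads_right\<close> makes the read symbols known, the
  rules determine every symbol of the next row, and every head mark along the gap that fits the
  move.\<close>

lemma rows:
  "t \<le> Tm \<Longrightarrow> c < W - 1 \<Longrightarrow> state_at (t * W + c) = fst (cfg cert t) \<and> cells_at (t * W + c) = cells (cfg cert t) c"
proof (induction t arbitrary: c)
  case 0
  show ?case using row_0[OF 0(2)] by blast
next
  case (Suc t)
  have t: "t \<le> Tm" using Suc.prems by simp
  have IH: "state_at (t * W + c) = fst (cfg cert t)" "cells_at (t * W + c) = cells (cfg cert t) c"
      "reads_at (t * W + c) = reads (snd (cfg cert t))" if "c < W - 1" for c
    using Suc.IH[OF t that] reads_right[OF t _ that, of cert] Suc.IH[OF t] by blast+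
  let ?n = "next_move M (fst (cfg cert t)) (reads (snd (cfg cert t)))"
  have zt: "z (t * W + c) = Some (fst (cfg cert t), reads (snd (cfg cert t)), cells (cfg cert t) c, flag_at (t * W + c))"
    if "c < W - 1" for c
    using z_Some[OF t that] unfolding IH[OF that] .
  note c = Suc.prems(2) and zs = z_Some[OF Suc.prems(1)]
  have lt: "Suc t * W + c < N" using N_row[of c "Suc t"] c Suc.prems(1) by simp
  have "matching M 2 (z (t * W + c)) (z (Suc t * W + c))"
    by (rule z_matching[OF _ gap_rows(5) lt]) simp
  then have 2: "state_at (Suc t * W + c) = fst ?n"
    "\<And>k. k < tapes M \<Longrightarrow> fst (cells_at (Suc t * W + c) ! k) =
      (if snd (cells (cfg cert t) c ! k) then fst (snd ?n ! k) else fst (cells (cfg cert t) c ! k))"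
    "\<And>k. k < tapes M \<Longrightarrow> snd (snd ?n ! k) = Stay \<Longrightarrow> snd (cells_at (Suc t * W + c) ! k) = snd (cells (cfg cert t) c ! k)"
    unfolding zt[OF c] zs[OF c] by (simp_all add: matching_def)
  have 3: "snd (cells_at (Suc t * W + c) ! k) = snd (cells (cfg cert (Suc t)) c ! k)"
    if k: "k < tapes M" and r: "snd (snd ?n ! k) = Move_Right" for k
  proof (cases c)
    \<comment> \<open>There is no column to the left; the separator before the row bars heads from
      column 0 in the tiling, as \<open>no_head\<close> does in the run.\<close>
    case 0
    have "matching M 0 (z (t * W + (W - 1))) (z (Suc t * W + 0))"
      by (rule z_matching[OF _ gap_rows(2)]) (use lt 0 in simp_all)
    moreover have "z (t * W + (W - 1)) = None"
    proof (rule z_None)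
      show "t * W + (W - 1) < N" using N_row[of "W - 1" t] t W_pos by simp
      show "(t * W + (W - 1)) mod W = W - 1" by (rule div_mod_row) (use W_pos in simp)
    qed
    moreover have "0 < W - 1" using W_pos by simp
    ultimately show ?thesis using no_head[OF k Suc.prems(1), of 0] k zs[of 0] unfolding 0 by (simp add: matching_def)
  next
    case (Suc d)
    then have d: "d < W - 1" using c by simp
    have "matching M 3 (z (t * W + d)) (z (Suc t * W + Suc d))"
      by (rule z_matching[OF _ gap_rows(6)]) (use lt Suc in simp_all)
    then show ?thesis using k r cells_Suc(3)[OF k r, of d] unfolding zt[OF d] unfolding Suc[symmetric] zs[OF c] by (simp add: matching_def)
  qed
  have 1: "snd (cells_at (Suc t * W + c) ! k) = snd (cells (cfg cert (Suc t)) c ! k)"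
    if k: "k < tapes M" and r: "snd (snd ?n ! k) = Move_Left" for k
  proof (cases "Suc c = W - 1")
    case True
    have "matching M 0 (z (Suc t * W + c)) (z (Suc t * W + Suc c))"
      by (rule z_matching[OF _ gap_rows(1)[OF c]]) (use N_row[of "Suc c" "Suc t"] c Suc.prems(1) in simp_all)
    moreover have "z (Suc t * W + Suc c) = None"
    proof (rule z_None)
      show "Suc t * W + Suc c < N" using N_row[of "Suc c" "Suc t"] c Suc.prems(1) by simp
      show "(Suc t * W + Suc c) mod W = W - 1" unfolding True by (rule div_mod_row) (use W_pos in simp)
    qed
    moreover have "c = W - 2" using True by simp
    ultimately show ?thesis using no_head[OF k Suc.prems(1), of c] k zs[OF c] by (simp add: matching_def)
  next
    case False
    then have d: "Suc c < W - 1" using c by simp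
    have "matching M 1 (z (t * W + Suc c)) (z (Suc t * W + c))"
      by (rule z_matching[OF _ gap_rows(3) lt]) simp
    then show ?thesis using k r cells_Suc(4)[OF k r, of c] unfolding zt[OF d] zs[OF c] by (simp add: matching_def)
  qed
  have "cells_at (Suc t * W + c) = cells (cfg cert (Suc t)) c"
  proof (rule nth_equalityI)
    show "length (cells_at (Suc t * W + c)) = length (cells (cfg cert (Suc t)) c)"
      using z_lengths(2)[OF Suc.prems] good_confD(1)[OF good[of "Suc t" cert]] by (simp add: length_cells)
    fix k assume "k < length (cells_at (Suc t * W + c))"
    then have k: "k < tapes M" using z_lengths(2)[OF Suc.prems] by simp
    have "fst (cells_at (Suc t * W + c) ! k) = fst (cells (cfg cert (Suc t)) c ! k)"
      unfolding 2(2)[OF k] cells_Suc(1)[OF k] ..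
    moreover have "snd (cells_at (Suc t * W + c) ! k) = snd (cells (cfg cert (Suc t)) c ! k)"
      using 1[OF k] 2(3)[OF k] 3[OF k] cells_Suc(2)[OF k, of cert t c] by (cases "snd (snd ?n ! k)") simp_all
    ultimately show "cells_at (Suc t * W + c) ! k = cells (cfg cert (Suc t)) c ! k" by (rule prod_eqI)
  qed
  then show ?case using 2(1) cfg_Suc(1)[OF tapes_pos, of cert t] by simp
qed

lemma tiling_certificate: "length cert \<le> wl \<and> fst (hd (snd (cfg cert Tm))) 0 = 2"
proof -
  have c: "org < W - 1" by (simp add: W_def org_def)
  have "cl (Tm * W + org) = 7" using c Tm by (simp add: cl_def)
  with z_allowed[OF le_refl c] have "fst (cells_at (Tm * W + org) ! 0) = 2" by (simp add: allowed_def)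
  then have "fst (cells (cfg cert Tm) org ! 0) = 2" using rows[OF le_refl c] by simp
  moreover have "snd (cfg cert Tm) \<noteq> []" using good_confD(1)[OF good[of Tm cert]] tapes_pos by auto
  ultimately show ?thesis
    using cells_nth[OF good_confD(1)[OF good[of Tm cert]] tapes_pos, of org] glen(1)
    by (simp add: hd_conv_nth cert_def)
qed

end

theorem tiling_iff:
  "(\<exists>z. tiling (tiles M) (matching M) (allowed M) N W cl z) \<longleftrightarrow>
   (\<exists>w. length w \<le> wl \<and> fst (hd (snd (cfg w Tm))) 0 = 2)"
  using tableau_tiling tiling_certificate by blast

end

text \<open>With numbers for tiles the relations become tables on an initial segment, which
  expressions can test.\<close>

lemma tiling_relabel:
  fixes X :: "'a set"
  assumes "finite X"
  shows "\<exists>(s :: nat) R' al'. \<forall>N W cl.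
    (\<exists>z. tiling X R al N W cl z) \<longleftrightarrow> (\<exists>z. tiling {..<s} R' al' N W cl z)"
proof -
  obtain f where f: "bij_betw f X {..<card X}" using ex_bij_betw_finite_nat[OF assms] by (metis atLeast0LessThan)
  let ?g = "inv_into X f"
  have fg: "f a \<in> {..<card X}" "?g (f a) = a" if "a \<in> X" for a
    using f that by (auto simp: bij_betw_def)
  have gX: "?g b \<in> X" if "b \<in> {..<card X}" for b
    using f that by (metis bij_betw_imp_surj_on inv_into_into)
  let ?R = "\<lambda>e a b. R e (?g a) (?g b)" and ?al = "\<lambda>k a. al k (?g a)"
  have "(\<exists>z. tiling X R al N W cl z) \<longleftrightarrow> (\<exists>z. tiling {..<card X} ?R ?al N W cl z)" for N W cl
  proof
    assume "\<exists>z. tiling X R al N W cl z"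
    then obtain z where z: "tiling X R al N W cl z" by blast
    have "tiling {..<card X} ?R ?al N W cl (\<lambda>p. f (z p))"
      unfolding tiling_def
    proof (intro conjI allI impI)
      fix p assume "p < N"
      then have "z p \<in> X" "al (cl p) (z p)" using z by (simp_all add: tiling_def)
      then show "f (z p) \<in> {..<card X}" "al (cl p) (?g (f (z p)))" using fg by simp_all
    next
      fix e p assume e: "e < (4 :: nat)" and p: "p + gap W e < N"
      then have "z p \<in> X" "z (p + gap W e) \<in> X" "R e (z p) (z (p + gap W e))"
        using z by (simp_all add: tiling_def)
      then show "R e (?g (f (z p))) (?g (f (z (p + gap W e))))" using fg by simp
    qed
    then show "\<exists>z. tiling {..<card X} ?R ?al N W cl z" by blast
  next
    assume "\<exists>z. tiling {..<card X} ?R ?al N W cl z"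
    then obtain z where "tiling {..<card X} ?R ?al N W cl z" by blast
    then have "tiling X R al N W cl (\<lambda>p. ?g (z p))"
      unfolding tiling_def using gX by blast
    then show "\<exists>z. tiling X R al N W cl z" by blast
  qed
  then show ?thesis by blast
qed

lemma poly_nat_mono: "a \<le> b \<Longrightarrow> poly p a \<le> poly p (b :: nat)"
  by (induction p) (simp_all add: add_mono mult_mono)

text \<open>A halting configuration is a fixed point, so the answer may be read at a time common to
  all certificates.\<close>

lemma halted: "n \<le> k \<Longrightarrow> fst ((tm_step M ^^ n) c) = 1 \<Longrightarrow> (tm_step M ^^ k) c = (tm_step M ^^ n) c"
proof (induction k rule: dec_induct)
  case (step k)
  obtain q ts where "(tm_step M ^^ n) c = (q, ts)" by fastforce
  then show ?case using step by simp
qed simp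

text \<open>Tiles and relations depend on the verifier only; the input enters through the size of
  the table and the classes of its places, which are computed by loops.\<close>

theorem NP_tiling:
  assumes "A \<in> class_NP"
  shows "\<exists>(s :: nat) R al N W cl. numf (\<lambda>x env. N x) \<and> numf (\<lambda>x env. W x) \<and>
    (\<forall>F. numf F \<longrightarrow> numf (\<lambda>x env. cl x (F x env))) \<and> (\<forall>x p. 4 \<le> W x \<and> cl x p < 9) \<and>
    (\<forall>x. x \<in> A \<longleftrightarrow> (\<exists>z. tiling {..<s} R al (N x) (W x) (cl x) z))"
proof -
  obtain V pw where V: "V \<in> class_P" and A: "\<And>x. x \<in> A \<longleftrightarrow> (\<exists>w. length w \<le> poly pw (length x) \<and> enc_bits x @ w \<in> V)"
    using assms by (auto simp: class_NP_def)
  have "polytime (\<lambda>x. [x \<in> V])" using V by (simp add: class_P_def)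
  then obtain M P where wf: "wf_tm M"
    and M: "\<And>y. \<exists>n \<le> poly P (length y). halts_with ((tm_step M ^^ n) (tm_init M y)) [y \<in> V]"
    unfolding polytime_def by blast
  define wl where "wl x = poly pw (length x)" for x :: "bool list"
  define L where "L x = 2 * length x + 1 + wl x" for x
  \<comment> \<open>The first summand bounds the running time for all admissible certificates, as
    polynomials over the naturals are monotone; the rest makes the tape long enough for the encoded
    input and certificate.\<close>
  define Tm where "Tm x = poly P (L x) + L x + 1" for x
  have ver: "verifier M x (wl x) (Tm x)" for x
    by unfold_locales (simp_all add: wf Tm_def L_def)
  have acc: "fst (hd (snd (verifier.cfg M x w (Tm x)))) 0 = 2 \<longleftrightarrow> enc_bits x @ w \<in> V"
    if "length w \<le> wl x" for x w
  proof -
    let ?y = "enc_bits x @ w"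
    obtain n where n: "n \<le> poly P (length ?y)" "halts_with ((tm_step M ^^ n) (tm_init M ?y)) [?y \<in> V]"
      using M by blast
    have "length ?y \<le> L x" using that by (simp add: length_enc_bits L_def)
    then have "poly P (length ?y) \<le> poly P (L x)" by (rule poly_nat_mono)
    then have "n \<le> Tm x" using n(1) by (simp add: Tm_def)
    moreover have "fst ((tm_step M ^^ n) (tm_init M ?y)) = 1" using n(2) by (simp add: halts_with_def)
    ultimately have "verifier.cfg M x w (Tm x) = (tm_step M ^^ n) (tm_init M ?y)"
      unfolding verifier.cfg_def[OF ver] by (intro halted)
    then show ?thesis using n(2) by (auto simp: halts_with_def string_tape_def split: if_splits)
  qed
  have sol: "x \<in> A \<longleftrightarrow> (\<exists>z. tiling (tiles M) (matching M) (allowed M)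
      (verifier.N (Tm x)) (verifier.W (Tm x)) (verifier.cl x (wl x) (Tm x)) z)" for x
    unfolding verifier.tiling_iff[OF ver] A using acc[of _ x] by (auto simp: wl_def)
  obtain s R al where rel: "\<And>N W cl. (\<exists>z. tiling (tiles M) (matching M) (allowed M) N W cl z) \<longleftrightarrow>
      (\<exists>z. tiling {..<s :: nat} R al N W cl z)"
    using tiling_relabel[OF finite_tiles] by metis
  have nT: "numf (\<lambda>x env. Tm x)" unfolding Tm_def L_def wl_def
    by (intro numf_intros numf_poly)
  have nW: "numf (\<lambda>x env. verifier.W (Tm x))" unfolding verifier.W_def[OF ver]
    by (intro numf_intros nT)
  have nN: "numf (\<lambda>x env. verifier.N (Tm x))" unfolding verifier.N_def[OF ver]
    by (intro numf_intros nT nW)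
  have norg: "numf (\<lambda>x env. verifier.org (Tm x))" unfolding verifier.org_def[OF ver]
    by (intro numf_intros nT)
  have nwl: "numf (\<lambda>x env. wl x)" unfolding wl_def by (intro numf_intros numf_poly)
  have ncl: "numf (\<lambda>x env. verifier.cl x (wl x) (Tm x) (F x env))" if "numf F" for F
    unfolding verifier.cl_def[OF ver]
    by (intro numf_intros testf_bit that nT nW norg nwl)
  have less: "u < k \<Longrightarrow> v < k \<Longrightarrow> (if b then u else v) < k" for u v k :: nat and b by simp
  have W4: "4 \<le> verifier.W (Tm x)" "verifier.cl x (wl x) (Tm x) p < 9" for x p
    unfolding verifier.W_def[OF ver] verifier.cl_def[OF ver] by (simp, intro less) simp_all
  have sol': "x \<in> A \<longleftrightarrow> (\<exists>z. tiling {..<s} R al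
      (verifier.N (Tm x)) (verifier.W (Tm x)) (verifier.cl x (wl x) (Tm x)) z)" for x
    by (rule trans[OF sol rel])
  show ?thesis
    by (rule exI[of _ s], rule exI[of _ R], rule exI[of _ al], rule exI[of _ "\<lambda>x. verifier.N (Tm x)"],
      rule exI[of _ "\<lambda>x. verifier.W (Tm x)"], rule exI[of _ "\<lambda>x. verifier.cl x (wl x) (Tm x)"])
      (intro conjI allI impI nN nW ncl W4 sol')
qed

section \<open>From tilings to triple systems\<close>

text \<open>
  For each place and tile there is a chain of rows which are all selected if the tile is used, one
  for every conflict with a neighbour. An unselected row serves its conflict slot, so of two
  conflicting rows at least one is unselected.
\<close>

locale tile_system =
  fixes s :: nat and R :: "nat \<Rightarrow> nat \<Rightarrow> nat \<Rightarrow> bool" and ok :: "nat \<Rightarrow> nat \<Rightarrow> bool"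
    and N W :: nat and cl :: "nat \<Rightarrow> nat"
begin

text \<open>One port for each of four gaps, two roles in a conflict and \<open>s\<close> partner
  tiles. The additional row in \<open>P\<close> ends the chain and serves the place.\<close>

definition K :: nat where "K = 8 * s"
definition P :: nat where "P = K + 1"
definition Q :: nat where "Q = N * 4 * s * s"

definition conflict :: "nat \<Rightarrow> nat \<Rightarrow> nat \<Rightarrow> nat \<Rightarrow> nat" where
  "conflict p e a b = 3 + (((p * 4 + e) * s + a) * s + b)"

text \<open>The slots in increasing order: fillers 1 and 2, conflicts, filler \<open>3 + Q\<close>,
  copies, places, filler \<open>slots\<close>. With this order each row satisfies
  \<open>d2 < d1 < da\<close>.\<close>

definition copy :: "nat \<Rightarrow> nat \<Rightarrow> nat" where "copy q k = 4 + Q + (q * K + k)"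
definition place :: "nat \<Rightarrow> nat" where "place p = 4 + Q + N * s * K + p"
definition slots :: nat where "slots = 4 + Q + N * s * K + N"
definition rows :: nat where "rows = N * s * P + Q + 3"

text \<open>The digits of \<open>k\<close> are the gap, the role and the partner tile. A place with
  no predecessor at this gap gets the filler 1.\<close>

definition port :: "nat \<Rightarrow> nat \<Rightarrow> nat \<Rightarrow> nat" where
  "port p a k = (if k div s mod 2 = 0 then conflict p (k div (2 * s)) a (k mod s)
     else if gap W (k div (2 * s)) \<le> p then conflict (p - gap W (k div (2 * s))) (k div (2 * s)) (k mod s) a
     else 1)"

definition d2 :: "nat \<Rightarrow> nat" where
  "d2 r = (if r < N * s * P \<and> r mod P < K then port (r div P div s) (r div P mod s) (r mod P) else 1)"

text \<open>\<open>copy q k\<close> is served by row \<open>k\<close> of the chain if selected and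
  by row \<open>k + 1\<close> if unselected. Hence selection passes from the last row of a chain
  down to all its rows.\<close>

definition d1 :: "nat \<Rightarrow> nat" where
  "d1 r = (if r < N * s * P then if r mod P = 0 then 3 + Q else copy (r div P) (r mod P - 1)
     else if r = N * s * P + Q + 2 then 3 + Q else 2)"

text \<open>Pairs that are permitted or reach beyond the table; a row outside the chains serves
  their slots.\<close>

definition free :: "nat \<Rightarrow> bool" where
  "free f \<longleftrightarrow> R (f div (s * s) mod 4) (f div s mod s) (f mod s) \<or>
     N \<le> f div (4 * (s * s)) + gap W (f div (s * s) mod 4)"

definition da :: "nat \<Rightarrow> nat" where
  "da r = (if r < N * s * P then if r mod P < K then copy (r div P) (r mod P)
       else if ok (cl (r div P div s)) (r div P mod s) then place (r div P div s) else slots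
     else if r < N * s * P + Q \<and> free (r - N * s * P) then 3 + (r - N * s * P) else slots)"

lemma digit_less: "x < a \<Longrightarrow> y < b \<Longrightarrow> x * b + y < a * (b :: nat)"
proof -
  assume "x < a" "y < b"
  then have "Suc x * b \<le> a * b" by (intro mult_right_mono) simp_all
  then show ?thesis using \<open>y < b\<close> by simp
qed

lemma digits: "y < b \<Longrightarrow> (x * b + y) div b = x" "y < b \<Longrightarrow> (x * b + y) mod b = (y :: nat)"
  by simp_all

lemma digits_eq: "y < b \<Longrightarrow> y' < b \<Longrightarrow> x * b + y = x' * b + y' \<longleftrightarrow> x = x' \<and> y = (y' :: nat)"
  using digits by metis

lemma conflict_bounds:
  assumes "p < N" "e < 4" "a < s" "b < s"
  shows "3 \<le> conflict p e a b" "conflict p e a b < 3 + Q"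
proof -
  have "((p * 4 + e) * s + a) * s + b < N * 4 * s * s"
    by (intro digit_less assms)
  then show "3 \<le> conflict p e a b" "conflict p e a b < 3 + Q" by (simp_all add: conflict_def Q_def)
qed

lemma conflict_eq:
  "e < 4 \<Longrightarrow> a < s \<Longrightarrow> b < s \<Longrightarrow> e' < 4 \<Longrightarrow> a' < s \<Longrightarrow> b' < s \<Longrightarrow>
    conflict p e a b = conflict p' e' a' b' \<longleftrightarrow> p = p' \<and> e = e' \<and> a = a' \<and> b = b'"
  unfolding conflict_def by (simp add: digits_eq)

lemma conflict_cases:
  assumes "f < Q"
  obtains p e a b where "p < N" "e < 4" "a < s" "b < s" "3 + f = conflict p e a b"
    "free f \<longleftrightarrow> R e a b \<or> N \<le> p + gap W e"
proof -
  have s: "0 < s"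
  proof (rule ccontr)
    assume "\<not> 0 < s"
    then show False using assms unfolding Q_def by simp
  qed
  let ?p = "f div (4 * (s * s))" and ?e = "f div (s * s) mod 4" and ?a = "f div s mod s" and ?b = "f mod s"
  have p: "f div (4 * (s * s)) = f div s div s div 4" "f div (s * s) = f div s div s"
    by (simp_all add: div_mult2_eq mult.commute)
  have "f < N * (4 * (s * s))" using assms by (simp add: Q_def mult.assoc)
  then have "?p < N" using s by (simp add: div_less_iff_less_mult)
  moreover have "3 + f = conflict ?p ?e ?a ?b"
    unfolding conflict_def p by (simp add: div_mult_mod_eq)
  ultimately show ?thesis using that[of ?p ?e ?a ?b] s by (simp add: free_def)
qed

lemma free_conflict:
  assumes "e < 4" "a < s" "b < s"
  shows "free (((p * 4 + e) * s + a) * s + b) \<longleftrightarrow> R e a b \<or> N \<le> p + gap W e"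
proof -
  have "f div (4 * (s * s)) = f div s div s div 4" "f div (s * s) = f div s div s" for f
    by (simp_all add: div_mult2_eq mult.commute)
  then show ?thesis using assms by (simp add: free_def digits)
qed

lemma port_digits:
  assumes "e < 4" "d < 2" "b < s"
  shows "((e * 2 + d) * s + b) < K" "((e * 2 + d) * s + b) div (2 * s) = e"
    "((e * 2 + d) * s + b) div s mod 2 = d" "((e * 2 + d) * s + b) mod s = b"
proof -
  have "(e * 2 + d) * s + b < 4 * 2 * s" by (intro digit_less assms)
  then show "((e * 2 + d) * s + b) < K" by (simp add: K_def)
  have "k div (2 * s) = k div s div 2" for k by (simp add: div_mult2_eq mult.commute)
  then show "((e * 2 + d) * s + b) div (2 * s) = e" using assms by simp
  show "((e * 2 + d) * s + b) div s mod 2 = d" "((e * 2 + d) * s + b) mod s = b" using assms by simp_all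
qed

lemma port_cases:
  assumes "k < K" "a < s" "p < N"
  obtains b e where "e < 4" "b < s" "port p a k = conflict p e a b" "k = (e * 2 + 0) * s + b"
  | b e where "e < 4" "b < s" "gap W e \<le> p" "port p a k = conflict (p - gap W e) e b a" "k = (e * 2 + 1) * s + b"
  | "port p a k = 1"
proof -
  have s: "0 < s" using assms by (cases s) simp_all
  let ?e = "k div (2 * s)" and ?d = "k div s mod 2" and ?b = "k mod s"
  have e: "?e < 4" using assms(1) s by (simp add: K_def div_less_iff_less_mult)
  have k: "k = (?e * 2 + ?d) * s + ?b"
    by (simp add: div_mult2_eq mult.commute[of 2 s] div_mult_mod_eq)
  have b: "?b < s" using s by simp
  consider "?d = 0" | "?d = 1" "gap W ?e \<le> p" | "?d = 1" "\<not> gap W ?e \<le> p" by linarith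
  then show ?thesis
  proof cases
    case 1
    then have "port p a k = conflict p ?e a ?b" by (simp add: port_def)
    moreover have "k = (?e * 2 + 0) * s + ?b" using k unfolding 1 .
    ultimately show ?thesis by (rule that(1)[OF e b])
  next
    case 2
    then have "port p a k = conflict (p - gap W ?e) ?e ?b a" by (simp add: port_def)
    moreover have "k = (?e * 2 + 1) * s + ?b" using k unfolding 2(1) .
    ultimately show ?thesis by (rule that(2)[OF e b 2(2)])
  next
    case 3
    then show ?thesis by (intro that(3)) (simp add: port_def)
  qed
qed

lemma port_eq:
  assumes "e < 4" "b < s"
  shows "port p a ((e * 2 + 0) * s + b) = conflict p e a b"
    "port (p + gap W e) a ((e * 2 + 1) * s + b) = conflict p e b a"
  unfolding port_def using port_digits[of e 0 b] port_digits[of e 1 b] assms by simp_all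

lemma port_bounds:
  assumes "k < K" "a < s" "p < N"
  shows "1 \<le> port p a k" "port p a k < 3 + Q"
proof -
  have "1 \<le> port p a k \<and> port p a k < 3 + Q"
    using assms
  proof (cases rule: port_cases)
    case (1 b e)
    then show ?thesis using conflict_bounds[of p e a b] assms by simp
  next
    case (2 b e)
    then show ?thesis using conflict_bounds[of "p - gap W e" e b a] assms less_imp_diff_less[of p N] by simp
  qed simp
  then show "1 \<le> port p a k" "port p a k < 3 + Q" by simp_all
qed

lemma row_digits:
  assumes "q < N * s" "k < P"
  shows "q * P + k < N * s * P" "(q * P + k) div P = q" "(q * P + k) mod P = k"
  using digit_less[OF assms] assms(2) by simp_all

lemma q_bounds:
  assumes "q < N * s"
  shows "q div s < N" "q mod s < s"
proof -
  have "0 < s" using assms by (cases s) simp_all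
  then show "q div s < N" "q mod s < s" using assms by (simp_all add: div_less_iff_less_mult)
qed

lemma copy_bounds: "q < N * s \<Longrightarrow> k < K \<Longrightarrow> copy q k < 4 + Q + N * s * K"
  using digit_less[of q "N * s" k K] by (simp add: copy_def)

lemma row_cases:
  assumes "r < rows"
  obtains q k where "q < N * s" "k < P" "r = q * P + k"
  | f where "f < Q" "r = N * s * P + f"
  | "r = N * s * P + Q" | "r = N * s * P + Q + 1" | "r = N * s * P + Q + 2"
proof -
  have "0 < P" by (simp add: P_def)
  consider "r < N * s * P" | "N * s * P \<le> r" "r < N * s * P + Q" | "N * s * P + Q \<le> r" by linarith
  then show ?thesis
  proof cases
    case 1
    then have "r div P < N * s" using \<open>0 < P\<close> by (simp add: div_less_iff_less_mult)
    then show ?thesis using that(1)[of "r div P" "r mod P"] \<open>0 < P\<close> by simp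
  next
    case 2
    then show ?thesis using that(2)[of "r - N * s * P"] by simp
  next
    case 3
    then have "r = N * s * P + Q \<or> r = N * s * P + Q + 1 \<or> r = N * s * P + Q + 2"
      using assms unfolding rows_def by linarith
    then show ?thesis using that(3-5) by blast
  qed
qed

lemma chain_row:
  assumes "q < N * s" "k < P"
  shows "d2 (q * P + k) = (if k < K then port (q div s) (q mod s) k else 1)"
    "d1 (q * P + k) = (if k = 0 then 3 + Q else copy q (k - 1))"
    "da (q * P + k) = (if k < K then copy q k else if ok (cl (q div s)) (q mod s) then place (q div s) else slots)"
  using row_digits[OF assms] by (simp_all add: d2_def d1_def da_def)

lemma filler_row:
  assumes "f < Q"
  shows "d2 (N * s * P + f) = 1" "d1 (N * s * P + f) = 2"
    "da (N * s * P + f) = (if free f then 3 + f else slots)"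
  using assms by (simp_all add: d2_def d1_def da_def)

text \<open>These rows take care of the fillers: the first one serves 1 and 2 when unselected, the
  second one \<open>slots\<close> when selected, the third one \<open>3 + Q\<close> when
  unselected.\<close>

lemma last_rows:
  "d2 (N * s * P + Q) = 1" "d1 (N * s * P + Q) = 2" "da (N * s * P + Q) = slots"
  "d2 (N * s * P + Q + 1) = 1" "d1 (N * s * P + Q + 1) = 2" "da (N * s * P + Q + 1) = slots"
  "d2 (N * s * P + Q + 2) = 1" "d1 (N * s * P + Q + 2) = 3 + Q" "da (N * s * P + Q + 2) = slots"
  by (simp_all add: d2_def d1_def da_def)

lemma triples_ordered:
  assumes "r < rows"
  shows "1 \<le> d2 r \<and> d2 r < d1 r \<and> d1 r < da r \<and> da r \<le> slots"
  using assms
proof (cases rule: row_cases)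
  case (1 q k)
  note q = q_bounds[OF 1(1)]
  have "1 \<le> d2 r \<and> d2 r < 3 + Q"
    using chain_row(1)[OF 1(1,2)] port_bounds[OF _ q(2,1), of k] 1(3) by simp
  moreover have "3 + Q \<le> d1 r" using chain_row(2)[OF 1(1,2)] 1(3) by (simp add: copy_def)
  moreover have "d1 r < da r \<and> da r \<le> slots"
  proof (cases "k < K")
    case True
    then have "copy q k < 4 + Q + N * s * K" using copy_bounds[OF 1(1)] by simp
    moreover have "k \<noteq> 0 \<Longrightarrow> copy q (k - 1) < copy q k" by (simp add: copy_def)
    moreover have "3 + Q < copy q k" by (simp add: copy_def)
    ultimately show ?thesis using chain_row(2,3)[OF 1(1,2)] 1(3) True by (cases "k = 0") (simp_all add: slots_def)
  next
    case False
    then have k: "k = K" using 1(2) by (simp add: P_def)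
    have "d1 r < 4 + Q + N * s * K"
    proof (cases "k = 0")
      case True
      then show ?thesis using chain_row(2)[OF 1(1,2)] 1(3) by simp
    next
      case False
      then show ?thesis using chain_row(2)[OF 1(1,2)] 1(3) copy_bounds[OF 1(1), of "k - 1"] k by simp
    qed
    then show ?thesis using chain_row(3)[OF 1(1,2)] 1(3) False q(1) by (simp add: slots_def place_def)
  qed
  ultimately show ?thesis by linarith
next
  case (2 f)
  then show ?thesis using filler_row[OF 2(1)] by (simp add: slots_def)
next
  case 3
  then show ?thesis using last_rows(1-3) by (simp add: slots_def)
next
  case 4
  then show ?thesis using last_rows(4-6) by (simp add: slots_def)
next
  case 5
  then show ?thesis using last_rows(7-9) by (simp add: slots_def)
qed

definition serves :: "(nat \<Rightarrow> bool) \<Rightarrow> nat \<Rightarrow> nat \<Rightarrow> bool" where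
  "serves X r j \<longleftrightarrow> da r = j \<and> X r \<or> d1 r = j \<and> \<not> X r \<or> d2 r = j \<and> \<not> X r"

definition chosen :: "(nat \<Rightarrow> nat) \<Rightarrow> nat \<Rightarrow> bool" where
  "chosen z r \<longleftrightarrow> (if r < N * s * P then z (r div P div s) = r div P mod s
     else r < N * s * P + Q \<or> r = N * s * P + Q + 1)"

lemma chosen_chain: "q < N * s \<Longrightarrow> k < P \<Longrightarrow> chosen z (q * P + k) \<longleftrightarrow> z (q div s) = q mod s"
  using row_digits[of q k] by (simp add: chosen_def)

lemma chain_row_less: "q < N * s \<Longrightarrow> k < P \<Longrightarrow> q * P + k < rows"
  using row_digits(1)[of q k] by (simp add: rows_def)

lemma tiling_serves:
  assumes z: "tiling {..<s} R ok N W cl z" and j: "1 \<le> j" "j \<le> slots"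
  shows "\<exists>r < rows. serves (chosen z) r j"
proof -
  have zs: "z p < s" "ok (cl p) (z p)" if "p < N" for p using z that by (simp_all add: tiling_def)
  have zq: "p * s + a < N * s \<and> (p * s + a) div s = p \<and> (p * s + a) mod s = a" if "p < N" "a < s" for p a
    using that digit_less[OF that] by simp
  consider "j = 1" | "j = 2" | f where "f < Q" "j = 3 + f" | "j = 3 + Q"
    | v where "v < N * s * K" "j = 4 + Q + v" | p where "p < N" "j = place p" | "j = slots"
  proof -
    assume a: "j = 1 \<Longrightarrow> thesis" "j = 2 \<Longrightarrow> thesis" "\<And>f. f < Q \<Longrightarrow> j = 3 + f \<Longrightarrow> thesis" "j = 3 + Q \<Longrightarrow> thesis"
      "\<And>v. v < N * s * K \<Longrightarrow> j = 4 + Q + v \<Longrightarrow> thesis" "\<And>p. p < N \<Longrightarrow> j = place p \<Longrightarrow> thesis" "j = slots \<Longrightarrow> thesis"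
    have "j = 1 \<or> j = 2 \<or> 3 \<le> j \<and> j < 3 + Q \<or> j = 3 + Q \<or> 4 + Q \<le> j \<and> j < 4 + Q + N * s * K \<or>
      4 + Q + N * s * K \<le> j \<and> j < slots \<or> j = slots" using j by linarith
    then show thesis
      using a(1,2,4,7) a(3)[of "j - 3"] a(5)[of "j - (4 + Q)"] a(6)[of "j - (4 + Q + N * s * K)"]
      unfolding slots_def place_def by (elim disjE conjE) simp_all
  qed
  then show ?thesis
  proof cases
    case 1
    then show ?thesis using last_rows(1)
      by (intro exI[of _ "N * s * P + Q"]) (simp add: serves_def chosen_def rows_def)
  next
    case 2
    then show ?thesis using last_rows(2)
      by (intro exI[of _ "N * s * P + Q"]) (simp add: serves_def chosen_def rows_def)
  next
    case (3 f)
    from 3(1) obtain p e a b where f: "p < N" "e < 4" "a < s" "b < s" "3 + f = conflict p e a b"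
      "free f \<longleftrightarrow> R e a b \<or> N \<le> p + gap W e" by (rule conflict_cases)
    show ?thesis
    proof (cases "free f")
      case True
      then show ?thesis using filler_row(3)[OF 3(1)] 3
        by (intro exI[of _ "N * s * P + f"]) (simp add: serves_def chosen_def rows_def)
    next
      case False
      then have nR: "\<not> R e a b" "p + gap W e < N" using f(6) by simp_all
      have "R e (z p) (z (p + gap W e))" using z f(2) nR(2) by (simp add: tiling_def)
      then consider "z p \<noteq> a" | "z (p + gap W e) \<noteq> b" using nR(1) by metis
      then show ?thesis
      proof cases
        case 1
        let ?k = "(e * 2 + 0) * s + b" and ?q = "p * s + a"
        have k: "?k < K" using port_digits(1)[OF f(2) _ f(4), of 0] by simp
        then have kP: "?k < P" by (simp add: P_def)
        have q: "?q < N * s" "?q div s = p" "?q mod s = a" using zq[OF f(1,3)] by simp_all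
        have "d2 (?q * P + ?k) = j"
          using chain_row(1)[OF q(1) kP] k port_eq(1)[OF f(2,4), of p a] unfolding q(2,3) 3(2) f(5) by simp
        moreover have "\<not> chosen z (?q * P + ?k)" unfolding chosen_chain[OF q(1) kP] q(2,3) by (rule 1)
        ultimately show ?thesis using chain_row_less[OF q(1) kP] unfolding serves_def by blast
      next
        case 2
        let ?k = "(e * 2 + 1) * s + a" and ?q = "(p + gap W e) * s + b"
        have k: "?k < K" using port_digits(1)[OF f(2) _ f(3), of 1] by simp
        then have kP: "?k < P" by (simp add: P_def)
        have q: "?q < N * s" "?q div s = p + gap W e" "?q mod s = b" using zq[OF nR(2) f(4)] by blast+
        have "d2 (?q * P + ?k) = j"
          using chain_row(1)[OF q(1) kP] k port_eq(2)[OF f(2,3), of p b] unfolding q(2,3) 3(2) f(5) by simp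
        moreover have "\<not> chosen z (?q * P + ?k)" unfolding chosen_chain[OF q(1) kP] q(2,3) by (rule 2)
        ultimately show ?thesis using chain_row_less[OF q(1) kP] unfolding serves_def by blast
      qed
    qed
  next
    case 4
    then show ?thesis using last_rows(8)
      by (intro exI[of _ "N * s * P + Q + 2"]) (simp add: serves_def chosen_def rows_def)
  next
    case (5 v)
    have K: "0 < K" using 5(1) by (cases K) simp_all
    define q k where "q = v div K" and "k = v mod K"
    have q: "q < N * s" using 5(1) K by (simp add: q_def div_less_iff_less_mult)
    have k: "k < K" using K by (simp add: k_def)
    then have kP: "k < P" "Suc k < P" by (simp_all add: P_def)
    have j: "j = copy q k" using 5(2) by (simp add: copy_def q_def k_def)
    show ?thesis
    proof (cases "z (q div s) = q mod s")
      case True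
      have "da (q * P + k) = j" using chain_row(3)[OF q kP(1)] k j by simp
      moreover have "chosen z (q * P + k)" unfolding chosen_chain[OF q kP(1)] by (rule True)
      ultimately show ?thesis using chain_row_less[OF q kP(1)] unfolding serves_def by blast
    next
      case False
      have "d1 (q * P + Suc k) = j" using chain_row(2)[OF q kP(2)] j by simp
      moreover have "\<not> chosen z (q * P + Suc k)" unfolding chosen_chain[OF q kP(2)] by (rule False)
      ultimately show ?thesis using chain_row_less[OF q kP(2)] unfolding serves_def by blast
    qed
  next
    case (6 p)
    let ?q = "p * s + z p"
    have q: "?q < N * s" "?q div s = p" "?q mod s = z p" using zq[OF 6(1) zs(1)[OF 6(1)]] by blast+
    have K: "K < P" by (simp add: P_def)
    have "da (?q * P + K) = j" using chain_row(3)[OF q(1) K] zs(2)[OF 6(1)] unfolding q(2,3) 6(2) by simp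
    moreover have "chosen z (?q * P + K)" unfolding chosen_chain[OF q(1) K] q(2,3) ..
    ultimately show ?thesis using chain_row_less[OF q(1) K] unfolding serves_def by blast
  next
    case 7
    then show ?thesis using last_rows(6)
      by (intro exI[of _ "N * s * P + Q + 1"]) (simp add: serves_def chosen_def rows_def)
  qed
qed

text \<open>A place lies above all slots \<open>d1\<close> and \<open>d2\<close>, so a selected last
  row of one of its chains serves it, and then that whole chain is selected. If two tiles chosen in
  this way violated \<open>R\<close>, all chain rows at their conflict would be selected and no
  other row would serve it.\<close>

lemma serves_tiling:
  assumes X: "\<And>j. 1 \<le> j \<Longrightarrow> j \<le> slots \<Longrightarrow> \<exists>r < rows. serves X r j"
  shows "\<exists>z. tiling {..<s} R ok N W cl z"
proof -
  have low: "d1 r < place p" "d2 r < place p" if "r < rows" for r p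
  proof -
    have "d1 r < place p"
      using that
    proof (cases rule: row_cases)
      case (1 q k)
      have "k \<noteq> 0 \<Longrightarrow> k - 1 < K" using 1(2) by (simp add: P_def)
      then show ?thesis using chain_row(2)[OF 1(1,2)] copy_bounds[OF 1(1), of "k - 1"] 1(3)
        by (cases "k = 0") (simp_all add: place_def)
    next
      case (2 f)
      then show ?thesis using filler_row(2)[OF 2(1)] by (simp add: place_def)
    next
      case 3
      then show ?thesis using last_rows(2) by (simp add: place_def)
    next
      case 4
      then show ?thesis using last_rows(5) by (simp add: place_def)
    next
      case 5
      then show ?thesis using last_rows(8) by (simp add: place_def)
    qed
    then show "d1 r < place p" "d2 r < place p" using triples_ordered[OF that] by linarith+
  qed
  have copy_place: "copy q k < place p" if "q < N * s" "k < K" for q k p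
    using copy_bounds[OF that] by (simp add: place_def)
  have "\<exists>a < s. X ((p * s + a) * P + K) \<and> ok (cl p) a" if p: "p < N" for p
  proof -
    have "1 \<le> place p" "place p \<le> slots" using p by (simp_all add: place_def slots_def)
    from X[OF this] obtain r where r: "r < rows" "serves X r (place p)" by blast
    then have r2: "da r = place p" "X r" using low[OF r(1), of p] by (auto simp: serves_def)
    from r(1) show ?thesis
    proof (cases rule: row_cases)
      case (1 q k)
      have "\<not> k < K" using r2(1) chain_row(3)[OF 1(1,2)] copy_place[OF 1(1), of k p] 1(3) by (cases "k < K") auto
      then have k: "k = K" using 1(2) by (simp add: P_def)
      have "place p \<noteq> slots" using p by (simp add: place_def slots_def)
      then have "ok (cl (q div s)) (q mod s)" "place (q div s) = place p"
        using r2(1) chain_row(3)[OF 1(1,2)] \<open>\<not> k < K\<close> 1(3) by (auto split: if_splits)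
      then have o: "ok (cl p) (q mod s)" and d: "q div s = p" by (simp_all add: place_def)
      have "q = p * s + q mod s" unfolding d[symmetric] by (simp add: div_mult_mod_eq)
      then have "X ((p * s + q mod s) * P + K)" using r2(2) 1(3) k by simp
      then show ?thesis using o q_bounds(2)[OF 1(1)] by blast
    next
      case (2 f)
      then have "da r < place p \<or> da r = slots" using filler_row(3)[OF 2(1)] by (simp add: place_def)
      then show ?thesis using r2(1) p by (simp add: place_def slots_def)
    next
      case 3
      then show ?thesis using last_rows(3) r2(1) p by (simp add: place_def slots_def)
    next
      case 4
      then show ?thesis using last_rows(6) r2(1) p by (simp add: place_def slots_def)
    next
      case 5
      then show ?thesis using last_rows(9) r2(1) p by (simp add: place_def slots_def)
    qed
  qed
  then obtain z where z: "\<And>p. p < N \<Longrightarrow> z p < s \<and> X ((p * s + z p) * P + K) \<and> ok (cl p) (z p)" by metis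
  have chain: "X (q * P + k)" if q: "q < N * s" and k: "k < K" and x: "X (q * P + Suc k)" for q k
  proof -
    have c: "1 \<le> copy q k" "copy q k \<le> slots" using copy_bounds[OF q k] by (simp_all add: copy_def slots_def)
    from X[OF c] obtain r where r: "r < rows" "serves X r (copy q k)" by blast
    have c3: "3 + Q < copy q k" by (simp add: copy_def)
    have copy_inj: "q' = q \<and> k' = k" if "copy q' k' = copy q k" "k' < K" for q' k'
      using that k by (simp add: copy_def digits_eq)
    from r(1) show ?thesis
    proof (cases rule: row_cases)
      case (1 q' k')
      have "d2 r < 3 + Q"
        using chain_row(1)[OF 1(1,2)] port_bounds(2)[OF _ q_bounds(2,1)[OF 1(1)], of k'] 1(3) by (auto split: if_splits)
      then consider "da r = copy q k" "X r" | "d1 r = copy q k" "\<not> X r"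
        using r(2) c3 by (auto simp: serves_def)
      then show ?thesis
      proof cases
        case up: 1
        have "k' < K"
        proof (rule ccontr)
          assume "\<not> k' < K"
          then show False using up(1) chain_row(3)[OF 1(1,2)] 1(3) copy_bounds[OF q k]
            by (auto simp: slots_def place_def split: if_splits)
        qed
        then have "copy q' k' = copy q k" using up(1) chain_row(3)[OF 1(1,2)] 1(3) by simp
        from copy_inj[OF this \<open>k' < K\<close>] show ?thesis using up(2) 1(3) by simp
      next
        case 2
        then have "k' \<noteq> 0" using chain_row(2)[OF 1(1,2)] 1(3) c3 by (cases "k' = 0") auto
        then have "copy q' (k' - 1) = copy q k" "k' - 1 < K" using 2(1) chain_row(2)[OF 1(1,2)] 1(2,3) by (simp_all add: P_def)
        then have "q' = q" "k' = Suc k" using copy_inj[of q' "k' - 1"] \<open>k' \<noteq> 0\<close> by auto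
        then show ?thesis using 2(2) x 1(3) by simp
      qed
    next
      case (2 f)
      then show ?thesis using filler_row[OF 2(1)] r(2) c3 copy_bounds[OF q k] by (auto simp: serves_def slots_def split: if_splits)
    next
      case 3
      then show ?thesis using last_rows(1-3) r(2) c3 copy_bounds[OF q k] by (auto simp: serves_def slots_def)
    next
      case 4
      then show ?thesis using last_rows(4-6) r(2) c3 copy_bounds[OF q k] by (auto simp: serves_def slots_def)
    next
      case 5
      then show ?thesis using last_rows(7-9) r(2) c3 copy_bounds[OF q k] by (auto simp: serves_def slots_def)
    qed
  qed
  have all: "X ((p * s + z p) * P + k)" if p: "p < N" and k: "k \<le> K" for p k
    using k
  proof (induction k rule: inc_induct)
    case base
    show ?case using z[OF p] by blast
  next
    case (step k)
    have "p * s + z p < N * s" using digit_less[OF p] z[OF p] by blast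
    then show ?case by (rule chain[OF _ step.hyps(2) step.IH])
  qed
  have "R e (z p) (z (p + gap W e))" if e: "e < 4" and pN: "p + gap W e < N" for e p
  proof (rule ccontr)
    assume nR: "\<not> R e (z p) (z (p + gap W e))"
    have p: "p < N" using pN by simp
    let ?f = "((p * 4 + e) * s + z p) * s + z (p + gap W e)"
    note zp = z[OF p, THEN conjunct1] and zp' = z[OF pN, THEN conjunct1]
    have nf: "\<not> free ?f" using free_conflict[OF e zp zp'] nR pN by simp
    let ?j = "conflict p e (z p) (z (p + gap W e))"
    have j: "?j = 3 + ?f" by (simp add: conflict_def)
    note b = conflict_bounds[OF p e zp zp']
    have "1 \<le> ?j" "?j \<le> slots" using b by (simp_all add: slots_def)
    from X[OF this] obtain r where r: "r < rows" "serves X r ?j" by blast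
    from r(1) show False
    proof (cases rule: row_cases)
      case (1 q k)
      note qb = q_bounds[OF 1(1)]
      have "3 + Q \<le> d1 r" using chain_row(2)[OF 1(1,2)] 1(3) by (simp add: copy_def)
      moreover have "d1 r < da r" using triples_ordered[OF r(1)] by blast
      ultimately have d: "d2 r = ?j" "\<not> X r" using r(2) b by (auto simp: serves_def)
      then have k: "k < K" "port (q div s) (q mod s) k = ?j"
        using chain_row(1)[OF 1(1,2)] 1(3) b(1) by (auto split: if_splits)
      have qq: "q = q div s * s + q mod s" by (simp add: div_mult_mod_eq)
      from k(1) qb(2,1) show False
      proof (cases rule: port_cases)
        case (1 b' e')
        have "conflict (q div s) e' (q mod s) b' = ?j" using 1(3) k(2) by simp
        then have "q div s = p" "q mod s = z p" using conflict_eq[OF 1(1) qb(2) 1(2) e zp zp'] by blast+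
        then have "X r" using all[OF p, of k] k(1) \<open>r = q * P + k\<close> qq by simp
        then show False using d(2) by blast
      next
        case (2 b' e')
        have "conflict (q div s - gap W e') e' b' (q mod s) = ?j" using 2(4) k(2) by simp
        then have "q div s - gap W e' = p" "e' = e" "q mod s = z (p + gap W e)"
          using conflict_eq[OF 2(1,2) qb(2) e zp zp'] by blast+
        then have "q div s = p + gap W e" "q mod s = z (p + gap W e)" using 2(3) by auto
        then have "X r" using all[OF pN, of k] k(1) \<open>r = q * P + k\<close> qq by simp
        then show False using d(2) by blast
      next
        case 3
        then show False using k(2) b(1) by simp
      qed
    next
      case (2 f)
      have "f = ?f \<or> False" using filler_row[OF 2(1)] r(2) b 2(2) j by (auto simp: serves_def slots_def split: if_splits)
      then have "f = ?f" by simp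
      then have "\<not> free f" using nf by simp
      then show False using filler_row[OF 2(1)] r(2) b 2(2) by (auto simp: serves_def slots_def)
    next
      case 3
      then show False using last_rows(1-3) r(2) b by (auto simp: serves_def slots_def)
    next
      case 4
      then show False using last_rows(4-6) r(2) b by (auto simp: serves_def slots_def)
    next
      case 5
      then show False using last_rows(7-9) r(2) b by (auto simp: serves_def slots_def)
    qed
  qed
  then have "tiling {..<s} R ok N W cl z" using z by (simp add: tiling_def)
  then show ?thesis by blast
qed

theorem serves_iff:
  "(\<exists>S. \<forall>j\<in>{1..slots}. \<exists>i\<in>{1..rows}. da (i - 1) = j \<and> i \<in> S \<or> d1 (i - 1) = j \<and> i \<notin> S \<or> d2 (i - 1) = j \<and> i \<notin> S) \<longleftrightarrow>
   (\<exists>z. tiling {..<s} R ok N W cl z)"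
proof
  assume "\<exists>z. tiling {..<s} R ok N W cl z"
  then obtain z where z: "tiling {..<s} R ok N W cl z" by blast
  have "\<forall>j\<in>{1..slots}. \<exists>i\<in>{1..rows}. da (i - 1) = j \<and> i \<in> {i. chosen z (i - 1)} \<or>
      d1 (i - 1) = j \<and> i \<notin> {i. chosen z (i - 1)} \<or> d2 (i - 1) = j \<and> i \<notin> {i. chosen z (i - 1)}"
  proof
    fix j assume "j \<in> {1..slots}"
    then obtain r where "r < rows" "serves (chosen z) r j" using tiling_serves[OF z, of j] by auto
    then show "\<exists>i\<in>{1..rows}. da (i - 1) = j \<and> i \<in> {i. chosen z (i - 1)} \<or>
      d1 (i - 1) = j \<and> i \<notin> {i. chosen z (i - 1)} \<or> d2 (i - 1) = j \<and> i \<notin> {i. chosen z (i - 1)}"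
      by (intro bexI[of _ "Suc r"]) (simp_all add: serves_def)
  qed
  then show "\<exists>S. \<forall>j\<in>{1..slots}. \<exists>i\<in>{1..rows}. da (i - 1) = j \<and> i \<in> S \<or> d1 (i - 1) = j \<and> i \<notin> S \<or> d2 (i - 1) = j \<and> i \<notin> S"
    by (rule exI)
next
  assume "\<exists>S. \<forall>j\<in>{1..slots}. \<exists>i\<in>{1..rows}. da (i - 1) = j \<and> i \<in> S \<or> d1 (i - 1) = j \<and> i \<notin> S \<or> d2 (i - 1) = j \<and> i \<notin> S"
  then obtain S where S: "\<forall>j\<in>{1..slots}. \<exists>i\<in>{1..rows}. da (i - 1) = j \<and> i \<in> S \<or> d1 (i - 1) = j \<and> i \<notin> S \<or> d2 (i - 1) = j \<and> i \<notin> S" ..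
  show "\<exists>z. tiling {..<s} R ok N W cl z"
  proof (rule serves_tiling[of "\<lambda>r. Suc r \<in> S"])
    fix j assume "1 \<le> j" "j \<le> slots"
    then have "j \<in> {1..slots}" by simp
    from S[rule_format, OF this] obtain i where i: "i \<in> {1..rows}"
      "da (i - 1) = j \<and> i \<in> S \<or> d1 (i - 1) = j \<and> i \<notin> S \<or> d2 (i - 1) = j \<and> i \<notin> S" ..
    then obtain r where "i = Suc r" by (cases i) auto
    then show "\<exists>r<rows. serves (\<lambda>r. Suc r \<in> S) r j" using i by (intro exI[of _ r]) (simp add: serves_def)
  qed
qed

end

section \<open>Emitting numbers and layouts\<close>

lemma numf_Suc: "numf A \<Longrightarrow> numf (\<lambda>x env. Suc (A x env))"
  using numf_add[of A "\<lambda>x env. 1"] numf_const by simp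

lemma testf_imp: "testf P \<Longrightarrow> testf Q \<Longrightarrow> testf (\<lambda>x env. P x env \<longrightarrow> Q x env)"
  using testf_disj[OF testf_not, of P Q] by simp

text \<open>Index \<open>e\<close> will stand for the divisor \<open>Suc e\<close>. Odd divisors
  other than 1 drop out and even ones are halved, which is the recursion of binary notation.\<close>

lemma concat_odd_even:
  assumes "\<And>e. 0 < e \<Longrightarrow> even e \<Longrightarrow> F e = []" "0 < v"
  shows "concat (map F [0..<v]) = F 0 @ concat (map (\<lambda>e. F (2 * e + 1)) [0..<v div 2])"
  using assms(2)
proof (induction v rule: nat_induct_non_zero)
  case (Suc v)
  show ?case
  proof (cases "even v")
    case True
    then show ?thesis using Suc assms(1)[of v] by simp
  next
    case False
    then obtain e where "v = 2 * e + 1" by (elim oddE)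
    then show ?thesis using Suc.IH by simp
  qed
qed simp

text \<open>For positive arguments, the powers of two, expressed by remainders and a bounded
  quantifier as \<open>testf_ball\<close> requires.\<close>

definition no_odd_divisor :: "nat \<Rightarrow> bool" where
  "no_odd_divisor e \<longleftrightarrow> (\<forall>d<e. Suc d mod 2 = 1 \<and> e mod Suc d = 0 \<longrightarrow> d = 0)"

lemma no_odd_divisor_iff: "no_odd_divisor (Suc e) \<longleftrightarrow> (\<forall>d. odd d \<longrightarrow> d dvd Suc e \<longrightarrow> d = 1)"
proof
  assume *: "no_odd_divisor (Suc e)"
  show "\<forall>d. odd d \<longrightarrow> d dvd Suc e \<longrightarrow> d = 1"
  proof (intro allI impI)
    fix d assume d: "odd d" "d dvd Suc e"
    then obtain d' where d': "d = Suc d'" by (cases d) auto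
    have "d \<le> Suc e" using d(2) by (rule dvd_imp_le) simp
    then have a: "d' < Suc e" using d' by simp
    have b: "Suc d' mod 2 = 1" using d(1) unfolding d' odd_iff_mod_2_eq_one .
    have c: "Suc e mod Suc d' = 0" using d(2) unfolding d' dvd_eq_mod_eq_0 .
    have "d' = 0"
      by (rule *[unfolded no_odd_divisor_def, THEN spec, THEN mp, THEN mp, OF a conjI[OF b c]])
    then show "d = 1" using d' by simp
  qed
next
  assume *: "\<forall>d. odd d \<longrightarrow> d dvd Suc e \<longrightarrow> d = 1"
  show "no_odd_divisor (Suc e)" unfolding no_odd_divisor_def
  proof (intro allI impI, elim conjE)
    fix d assume d: "Suc d mod 2 = 1" "Suc e mod Suc d = 0"
    have "odd (Suc d)" by (rule odd_iff_mod_2_eq_one[THEN iffD2, OF d(1)])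
    moreover have "Suc d dvd Suc e" by (rule dvd_eq_mod_eq_0[THEN iffD2, OF d(2)])
    ultimately have "Suc d = 1" using * by blast
    then show "d = 0" by simp
  qed
qed

lemma no_odd_divisor_double: "no_odd_divisor (Suc (2 * e + 1)) \<longleftrightarrow> no_odd_divisor (Suc e)"
proof -
  have "Suc (2 * e + 1) = 2 * Suc e" by simp
  moreover have "d dvd 2 * Suc e \<longleftrightarrow> d dvd Suc e" if "odd d" for d
    using that by (simp add: coprime_dvd_mult_right_iff del: mult_Suc_right)
  ultimately show ?thesis unfolding no_odd_divisor_iff by metis
qed

text \<open>The bit of weight \<open>w\<close> is the parity of \<open>v div w\<close>. Running
  through all numbers up to \<open>v\<close> and keeping the powers of two avoids exponentiation in
  the loops.\<close>

lemma bits_of_nat_concat: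
  "bits_of_nat v = concat (map (\<lambda>e. if no_odd_divisor (Suc e) then [v div Suc e mod 2 = 1] else []) [0..<v])"
proof (induction v rule: less_induct)
  case (less v)
  show ?case
  proof (cases "v = 0")
    case True
    then show ?thesis by (simp add: bits_of_nat.simps)
  next
    case False
    let ?F = "\<lambda>v e. if no_odd_divisor (Suc e) then [v div Suc e mod 2 = 1] else []"
    have "?F v e = []" if "0 < e" "even e" for e
    proof -
      have "odd (Suc e)" "Suc e \<noteq> 1" using that by simp_all
      then have "\<not> no_odd_divisor (Suc e)" unfolding no_odd_divisor_iff using dvd_refl by blast
      then show ?thesis by simp
    qed
    then have "concat (map (?F v) [0..<v]) = ?F v 0 @ concat (map (\<lambda>e. ?F v (2 * e + 1)) [0..<v div 2])"
      using False by (intro concat_odd_even) simp_all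
    moreover have "?F v 0 = [odd v]" by (simp add: no_odd_divisor_def odd_iff_mod_2_eq_one)
    moreover have "?F v (2 * e + 1) = ?F (v div 2) e" for e
    proof -
      have "v div Suc (2 * e + 1) = v div 2 div Suc e"
        by (simp add: div_mult2_eq[symmetric])
      then show ?thesis unfolding no_odd_divisor_double by simp
    qed
    moreover have "bits_of_nat (v div 2) = concat (map (?F (v div 2)) [0..<v div 2])"
      using False by (intro less) simp
    ultimately show ?thesis using False by (simp add: bits_of_nat.simps[of v])
  qed
qed

lemma enc_bits_concat: "enc_bits bs = concat (map (\<lambda>b. [True, b]) bs) @ [False]"
  by (simp add: enc_bits_def enc_list_def)

lemma emits_bit: "testf P \<Longrightarrow> emits (\<lambda>x env. [P x env])"
  by (rule back_subst[of emits, OF emits_if[of P "\<lambda>x env. [True]" "\<lambda>x env. [False]"]])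
    (auto intro: emits_Cons emits_Nil simp: fun_eq_iff)

lemma emits_enc_nat:
  assumes "numf A"
  shows "emits (\<lambda>x env. enc_nat (A x env))"
proof -
  have "enc_nat v = concat (map (\<lambda>e. if no_odd_divisor (Suc e) then [True] @ [v div Suc e mod 2 = 1] else []) [0..<v]) @ [False]" for v
  proof -
    have "concat (map (\<lambda>b. [True, b]) (concat (map (\<lambda>e. if Q e then [B e] else []) es))) =
      concat (map (\<lambda>e. if Q e then [True] @ [B e] else []) es)" for Q B and es :: "nat list"
      by (induction es) simp_all
    then show ?thesis unfolding enc_nat_def enc_bits_concat by (subst bits_of_nat_concat) simp
  qed
  moreover have "testf (\<lambda>x env. no_odd_divisor (Suc (top env)))"
    unfolding no_odd_divisor_def by (intro testf_ball testf_imp numf_Suc numf_intros)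
  then have "emits (\<lambda>x env. concat (map (\<lambda>e. if no_odd_divisor (Suc e) then [True] @ [A x env div Suc e mod 2 = 1] else [])
      [0..<A x env]) @ [False])"
    by (intro emits_append emits_concat emits_if emits_bit emits_Cons emits_Nil numf_Suc numf_intros
      assms assms[THEN numf_shift])
  ultimately show ?thesis by simp
qed

lemma bits_of_nat_power2: "bits_of_nat (2 ^ e) = replicate e False @ [True]"
  by (induction e) (simp_all add: bits_of_nat.simps[of "Suc 0"] bits_of_nat.simps[of 0] bits_of_nat.simps[of "2 * 2 ^ _"])

lemma enc_rat_power2:
  "enc_rat (2 ^ e) = False # concat (map (\<lambda>i. [True, False]) [0..<e]) @ [True, True, False, False, True, True, False]"
proof -
  have "quotient_of (of_int (2 ^ e)) = (2 ^ e, 1)" using quotient_of_int[of "2 ^ e"] unfolding Rat.of_int_def .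
  then have q: "quotient_of (2 ^ e) = (2 ^ e, 1)" by simp
  have "nat \<bar>2 ^ e\<bar> = 2 ^ e" by (simp add: nat_power_eq)
  then have "enc_int (2 ^ e) = False # concat (map (\<lambda>b. [True, b]) (replicate e False)) @ [True, True, False]"
    by (simp add: enc_int_def enc_nat_def bits_of_nat_power2 enc_bits_concat nat_power_eq)
  moreover have "enc_int 1 = [False, True, True, False]"
    using bits_of_nat_power2[of 0] by (simp add: enc_int_def enc_nat_def enc_bits_concat)
  moreover have "concat (map (\<lambda>b. [True, b]) (replicate e False)) = concat (map (\<lambda>i. [True, False]) [0..<e])"
    by (simp add: map_replicate_const)
  ultimately show ?thesis by (simp add: enc_rat_def q)
qed

lemma emits_enc_rat: "numf A \<Longrightarrow> emits (\<lambda>x env. enc_rat (2 ^ A x env))"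
  unfolding enc_rat_power2 by (intro emits_append emits_concat emits_Cons emits_Nil)

lemma enc_list_concat: "enc_list f xs = concat (map (\<lambda>x. True # f x) xs) @ [False]"
  by (simp add: enc_list_def)

lemma concat_map_upt: "concat (map f [a..<b]) = concat (map (\<lambda>i. f (a + i)) [0..<b - a])"
proof -
  have "[a..<b] = map (\<lambda>i. a + i) [0..<b - a]"
    by (rule nth_equalityI) simp_all
  then show ?thesis by (simp add: o_def)
qed

lemma emits_upt:
  assumes "numf A" "numf B" "emits (\<lambda>x env. G x (A x (tl env) + top env) (tl env))"
  shows "emits (\<lambda>x env. concat (map (\<lambda>i. G x i env) [A x env..<B x env]))"
  unfolding concat_map_upt[of _ "A _ _"] by (intro emits_concat numf_minus assms)

section \<open>Emitting the instance of a triple system\<close>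

locale emitted_triples =
  fixes m n :: "bool list \<Rightarrow> nat" and c2 c1 al :: "bool list \<Rightarrow> nat \<Rightarrow> nat"
  assumes m: "numf (\<lambda>x env. m x)" and n: "numf (\<lambda>x env. n x)"
    and c2: "\<And>A. numf A \<Longrightarrow> numf (\<lambda>x env. c2 x (A x env))"
    and c1: "\<And>A. numf A \<Longrightarrow> numf (\<lambda>x env. c1 x (A x env))"
    and al: "\<And>A. numf A \<Longrightarrow> numf (\<lambda>x env. al x (A x env))"
begin

lemmas num = numf_intros numf_Suc m n c2 c1 al

lemma numf_xe:
  assumes "testf H" "numf A" "numf B"
  shows "numf (\<lambda>x env. triples.xe (m x) (n x) (c1 x) (\<lambda>j r. H x env) (A x env) (B x env))"
  unfolding triples.xe_def triples.extra_def triples.D_def row_def lev_def odd_iff_mod_2_eq_one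
  by (intro num assms)

lemma numf_ye:
  assumes "numf A" "numf B"
  shows "numf (\<lambda>x env. triples.ye (m x) (n x) (c2 x) (c1 x) (al x) (\<lambda>_. False) (\<lambda>_ _ _. False) (A x env) (B x env))"
  unfolding triples.ye_def triples.band_def triples.del_def triples.bord_def triples.act_def triples.F_def triples.G_def
    row_def lev_def slot_def of_bool_def odd_iff_mod_2_eq_one even_iff_mod_2_eq_zero
  by (intro num assms)

lemma emits_rcell:
  assumes "numf A" "numf B"
  shows "emits (\<lambda>x env. enc_rect (triples.rcell (m x) (n x) (c2 x) (c1 x) (al x) (A x env, B x env)))"
  unfolding triples.rcell_def prod.case enc_rect.simps
  by (intro emits_append emits_enc_rat numf_xe numf_ye num assms)

lemma emits_rbox:
  assumes "numf A" "numf B" "numf C" "numf E"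
  shows "emits (\<lambda>x env. enc_rect (triples.rbox (m x) (n x) (c2 x) (c1 x) (al x) (A x env, C x env, B x env, E x env)))"
proof -
  \<comment> \<open>\<open>xe\<close> consults its first argument at level \<open>r\<close> only, so
    the test can be made constant and \<open>numf_xe\<close> applies.\<close>
  have hi: "triples.xe (m x) (n x) (c1 x) (\<lambda>j r. r \<noteq> 0) g r = triples.xe (m x) (n x) (c1 x) (\<lambda>j r'. r \<noteq> 0) g r" for x g r
    by (simp add: triples.xe_def)
  show ?thesis
    unfolding triples.rbox.simps enc_rect.simps hi
    by (intro emits_append emits_enc_rat numf_xe numf_ye num assms)
qed

lemma concat_concat: "concat (concat xss) = concat (map concat xss)"
  by (induction xss) simp_all

lemma concat_product: "concat (map f (List.product xs ys)) = concat (map (\<lambda>a. concat (map (\<lambda>b. f (a, b)) ys)) xs)"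
  by (induction xs) (simp_all add: o_def)

lemma emits_block:
  assumes "numf A" "numf B" "numf C" "numf E"
  shows "emits (\<lambda>x env. enc_list enc_rect (map (triples.rcell (m x) (n x) (c2 x) (c1 x) (al x))
    (block_cells (A x env, C x env, B x env, E x env))))"
  unfolding enc_list_concat map_map o_def block_cells.simps concat_product
  by (intro emits_append emits_upt emits_Cons emits_Nil emits_rcell num assms assms[THEN numf_shift]
      assms[THEN numf_shift, THEN numf_shift])

lemma emits_blocks:
  assumes G: "\<And>A B C E. numf A \<Longrightarrow> numf B \<Longrightarrow> numf C \<Longrightarrow> numf E \<Longrightarrow>
    emits (\<lambda>x env. G x (A x env, C x env, B x env, E x env))"
  shows "emits (\<lambda>x env. concat (map (G x) (triples.bs (m x) (n x) (c1 x))))"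
proof -
  have blk: "emits (\<lambda>x env. concat (map (G x) (triples.blk (c1 x) (A x env) (B x env))))" if "numf A" "numf B" for A B
  proof -
    have "concat (map f (triples.blk (c1 x) i j)) =
      (if j < c1 x i then f (2 * j - 1, 2, 3 * i - 2, 1) @ f (2 * j - 1, 2, 3 * i - 1, 2)
       else if j = c1 x i then f (2 * j - 1, 2, 3 * i - 2, 3)
       else f (2 * j - 1, 2, 3 * i - 2, 2) @ f (2 * j - 1, 2, 3 * i, 1))" for f :: "block \<Rightarrow> bool list" and x i j
      by (simp add: triples.blk_def)
    then show ?thesis by (simp only:) (intro emits_if emits_append G num that)
  qed
  have row: "concat (map f (triples.rowblocks (n x) (c1 x) i)) =
      concat (map (\<lambda>k. f (0, 1, 3 * i - 2 + k, 1)) [0..<3]) @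
      concat (map (\<lambda>j. concat (map f (triples.blk (c1 x) i j))) [1..<Suc (n x)]) @
      concat (map (\<lambda>k. f (2 * n x + 1, 1, 3 * i - 2 + k, 1)) [0..<3])" for f :: "block \<Rightarrow> bool list" and x i
    by (simp add: triples.rowblocks_def map_concat concat_concat o_def del: upt_Suc)
  have "concat (map f (triples.bs (m x) (n x) (c1 x))) =
      concat (map (\<lambda>c. f (c, 1, 0, 1)) [0..<2 * n x + 2]) @
      concat (map (\<lambda>i. concat (map f (triples.rowblocks (n x) (c1 x) i))) [1..<Suc (m x)]) @
      concat (map (\<lambda>c. f (c, 1, 3 * m x + 1, 1)) [0..<2 * n x + 2])" for f :: "block \<Rightarrow> bool list" and x
    by (simp add: triples.bs_def map_concat concat_concat o_def del: upt_Suc)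
  then show ?thesis unfolding row by (simp only:) (intro emits_append emits_upt blk G num)
qed

lemma emits_instance:
  "emits (\<lambda>x env. enc_inst (triples.instance_of (m x) (n x) (c2 x) (c1 x) (al x)) @
     enc_nat (triples.limit (m x) (n x)))"
  unfolding triples.instance_of_def enc_inst.simps enc_list_concat[of "enc_list enc_rect"]
    enc_list_concat[of enc_rect "map (triples.rbox _ _ _ _ _) _"] map_map o_def triples.limit_def
  by (intro emits_append emits_blocks emits_Cons emits_Nil emits_block emits_rbox emits_enc_nat num)

end

text \<open>Comparing a bounded number with every constant builds a finite table into an expression,
  so \<open>P\<close> may depend on the number in an arbitrary way.\<close>

lemma testf_cases:
  assumes "numf A" "\<And>a. testf (P a)"
  shows "testf (\<lambda>x env. A x env < N \<and> P (A x env) x env)"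
proof (induction N)
  case (Suc N)
  have "testf (\<lambda>x env. A x env < N \<and> P (A x env) x env \<or> A x env = N \<and> P N x env)"
    by (intro testf_disj testf_conj testf_eq numf_const assms Suc)
  then show ?case by (rule back_subst[of testf]) (auto simp: fun_eq_iff less_Suc_eq)
qed (simp add: testf_const)

text \<open>Only arguments in a fixed finite range occur, so the relations can be cut down to tables
  as \<open>testf_cases\<close> needs them.\<close>

lemma tiling_bounded:
  assumes "\<And>p. cl p < k"
  shows "tiling {..<s} R al N W cl z \<longleftrightarrow>
    tiling {..<s} (\<lambda>e a b. e < 4 \<and> a < s \<and> b < s \<and> R e a b) (\<lambda>c a. c < k \<and> a < s \<and> al c a) N W cl z"
  using assms unfolding tiling_def by (auto dest: add_lessD1)

theorem theorem4: "NP_hard_maximisation enc_inst instances solutions objective"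
  unfolding NP_hard_maximisation_def NP_hard_def
proof
  fix A assume "A \<in> class_NP"
  from NP_tiling[OF this] obtain s :: nat and R al and N W :: "bool list \<Rightarrow> nat" and cl where
    nN: "numf (\<lambda>x env. N x)" and nW: "numf (\<lambda>x env. W x)" and ncl: "\<forall>F. numf F \<longrightarrow> numf (\<lambda>x env. cl x (F x env))"
    and bd: "\<forall>x p. 4 \<le> W x \<and> cl x p < 9"
    and til: "\<forall>x. x \<in> A \<longleftrightarrow> (\<exists>z. tiling {..<s} R al (N x) (W x) (cl x) z)" by blast
  define R' where "R' e a b \<longleftrightarrow> e < 4 \<and> a < s \<and> b < s \<and> R e a b" for e a b
  define ok where "ok c a \<longleftrightarrow> c < 9 \<and> a < s \<and> al c a" for c a
  have til': "x \<in> A \<longleftrightarrow> (\<exists>z. tiling {..<s} R' ok (N x) (W x) (cl x) z)" for x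
  proof -
    have "cl x p < 9" for p using bd by blast
    from tiling_bounded[of "cl x", OF this] show ?thesis using til unfolding R'_def[abs_def] ok_def[abs_def] by blast
  qed
  have nR: "testf (\<lambda>x env. R' (E x env) (F x env) (G x env))" if "numf E" "numf F" "numf G" for E F G
    unfolding R'_def by (intro testf_cases testf_const that)
  have nok: "testf (\<lambda>x env. ok (E x env) (F x env))" if "numf E" "numf F" for E F
    unfolding ok_def by (intro testf_cases testf_const that)
  note defs = tile_system.K_def tile_system.P_def tile_system.Q_def tile_system.conflict_def tile_system.copy_def
    tile_system.place_def tile_system.slots_def tile_system.rows_def tile_system.port_def tile_system.d2_def
    tile_system.d1_def tile_system.free_def tile_system.da_def gap_def
  define m n where "m x = tile_system.rows s (N x)" and "n x = tile_system.slots s (N x)" for x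
  \<comment> \<open>Rows of a triple system count from 1, those of a tile system from 0.\<close>
  define c2 where "c2 x i = tile_system.d2 s (N x) (W x) (i - 1)" for x i
  define c1 where "c1 x i = tile_system.d1 s (N x) (i - 1)" for x i
  define aa where "aa x i = tile_system.da s R' ok (N x) (W x) (cl x) (i - 1)" for x i
  interpret emitted_triples m n c2 c1 aa
  proof
    show "numf (\<lambda>x env. m x)" unfolding m_def defs by (intro numf_intros nN)
    show "numf (\<lambda>x env. n x)" unfolding n_def defs by (intro numf_intros nN)
    show "numf (\<lambda>x env. c2 x (F x env))" if "numf F" for F
      unfolding c2_def defs by (intro numf_intros nN nW that)
    show "numf (\<lambda>x env. c1 x (F x env))" if "numf F" for F
      unfolding c1_def defs by (intro numf_intros nN nW that)
    show "numf (\<lambda>x env. aa x (F x env))" if "numf F" for F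
      unfolding aa_def defs by (intro numf_intros nN nW nR nok ncl[rule_format] that)
  qed
  have good: "good_triples (m x) (n x) (c2 x) (c1 x) (aa x)" for x
  proof
    show "0 < m x" by (simp add: m_def tile_system.rows_def)
    fix i assume "1 \<le> i" "i \<le> m x"
    then have "i - 1 < tile_system.rows s (N x)" by (simp add: m_def)
    from tile_system.triples_ordered[OF this]
    show "1 \<le> c2 x i \<and> c2 x i < c1 x i \<and> c1 x i < aa x i \<and> aa x i \<le> n x"
      unfolding c2_def c1_def aa_def n_def .
  qed
  let ?i = "\<lambda>x. triples.instance_of (m x) (n x) (c2 x) (c1 x) (aa x)" and ?k = "\<lambda>x. triples.limit (m x) (n x)"
  have "x \<in> A \<longleftrightarrow> (\<exists>S. triples.solves (m x) (n x) (c2 x) (c1 x) (aa x) S)" for x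
    unfolding til' tile_system.serves_iff[symmetric] triples.solves_def m_def n_def c2_def c1_def aa_def ..
  then have "x \<in> A \<longleftrightarrow> (\<exists>M \<in> solutions (?i x). ?k x \<le> objective (?i x) M)" for x
    unfolding good_triples.instance_of_iff[OF good] .
  then have "\<exists>i \<in> instances \<times> UNIV. enc_inst (?i x) @ enc_nat (?k x) = (case i of (i, k) \<Rightarrow> enc_inst i @ enc_nat k) \<and>
      (x \<in> A \<longleftrightarrow> i \<in> {(i, k). \<exists>M \<in> solutions i. k \<le> objective i M})" for x
    using good_triples.instance_of_valid[OF good, of x] by (intro bexI[of _ "(?i x, ?k x)"]) simp_all
  moreover have "polytime (\<lambda>x. enc_inst (?i x) @ enc_nat (?k x))"
    using polytime_emits[OF emits_instance] .
  ultimately show "\<exists>f. polytime f \<and> (\<forall>x. \<exists>i \<in> instances \<times> UNIV. f x = (case i of (i, k) \<Rightarrow> enc_inst i @ enc_nat k) \<and>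
      (x \<in> A \<longleftrightarrow> i \<in> {(i, k). \<exists>M \<in> solutions i. k \<le> objective i M}))" by blast
qed

end
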